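(* There are computable linear orderings with Scott sentence complexities $\Pi^{\mathrm{in}}_{\omega_1^{CK}}$, $\Pi^{\mathrm{in}}_{\omega_1^{CK}+1}$, and $\Pi^{\mathrm{in}}_{\omega_1^{CK}+2}$, respectively.
   Context: $\omega_1^{CK}$ is the least non-computable ordinal. A computable linear ordering is one whose domain is $\omega$ (or a computable set) and whose order relation is computable. Infinitary formulas: $\Sigma^{\mathrm{in}}_0=\Pi^{\mathrm{in}}_0$ are the finitary quantifier-free formulas; for $\alpha\ge1$, a $\Sigma^{\mathrm{in}}_\alpha$ formula is a countable disjunction of formulas $\exists\bar x\,\varphi$ with $\varphi\in\Pi^{\mathrm{in}}_\beta$, $\beta<\alpha$, and $\Pi^{\mathrm{in}}_\alpha$ is dual; $d\text{-}\Sigma^{\mathrm{in}}_\alpha$ formulas are conjunctions of a $\Sigma^{\mathrm{in}}_\alpha$ and a $\Pi^{\mathrm{in}}_\alpha$ formula. A Scott sentence of a countable structure is an $L_{\omega_1\omega}$ sentence whose countable models are exactly its isomorphic copies. The Scott sentence complexity of a structure is the least class among $\Pi^{\mathrm{in}}_\alpha,\Sigma^{\mathrm{in}}_\alpha,d\text{-}\Sigma^{\mathrm{in}}_\alpha$ ($\alpha\ge1$) in which it has a Scott sentence, classes ordered by inclusion up to equivalence ($\Pi_\alpha,\Sigma_\alpha\subseteq d\text{-}\Sigma_\alpha\subseteq \Sigma_{\alpha+1}\cap\Pi_{\alpha+1}$). *)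

theory Defs
  imports "HOL-Library.Countable_Set_Type"
begin

section \<open>Computable sets and relations of natural numbers\<close>

text \<open>Programs for the partial \<open>\<mu>\<close>-recursive functions. In \<open>Prec f g\<close> and \<open>Mu f\<close> the recursion
  variable, respectively the search variable, is the first argument.\<close>

datatype recf =
  Zero
| Succ
| Proj nat
| Comp recf "recf list"
| Prec recf recf
| Mu recf

text \<open>\<open>computes f xs y\<close>: the partial function of \<open>f\<close> is defined at \<open>xs\<close> with value \<open>y\<close>.\<close>

inductive computes :: "recf \<Rightarrow> nat list \<Rightarrow> nat \<Rightarrow> bool" where
  zero: "computes Zero xs 0"
| succ: "computes Succ [x] (Suc x)"
| proj: "i < length xs \<Longrightarrow> computes (Proj i) xs (xs ! i)"
| comp: "list_all2 (\<lambda>g y. computes g xs y) gs ys \<Longrightarrow> computes f ys z \<Longrightarrow> computes (Comp f gs) xs z"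
| prec_0: "computes f xs y \<Longrightarrow> computes (Prec f g) (0 # xs) y"
| prec_Suc: "computes (Prec f g) (n # xs) y \<Longrightarrow> computes g (n # y # xs) z \<Longrightarrow>
    computes (Prec f g) (Suc n # xs) z"
| mu: "computes f (n # xs) 0 \<Longrightarrow> (\<forall>m<n. \<exists>y. computes f (m # xs) (Suc y)) \<Longrightarrow>
    computes (Mu f) xs n"

definition computable_set :: "nat set \<Rightarrow> bool" where
  "computable_set A \<longleftrightarrow> (\<exists>f. \<forall>x. computes f [x] (if x \<in> A then 1 else 0))"

definition computable_rel :: "nat rel \<Rightarrow> bool" where
  "computable_rel r \<longleftrightarrow> (\<exists>f. \<forall>x y. computes f [x, y] (if (x, y) \<in> r then 1 else 0))"

definition computable_linear_order :: "nat set \<Rightarrow> nat rel \<Rightarrow> bool" where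
  "computable_linear_order A r \<longleftrightarrow> linear_order_on A r \<and> computable_set A \<and> computable_rel r"


section \<open>Countable ordinals\<close>

text \<open>A countable ordinal is the isomorphism type of a (reflexive) well-order on some set of
  natural numbers, finite or infinite; \<open>ordIso\<close> relates only well-orders.\<close>

quotient_type cord = "nat rel" / partial: "\<lambda>r s. (r, s) \<in> ordIso"
proof (rule part_equivpI)
  show "\<exists>r::nat rel. (r, r) \<in> ordIso"
    by (rule exI[of _ "{}"]) (simp add: ordIso_reflexive)
qed (auto intro!: sympI transpI intro: ordIso_symmetric ordIso_transitive)

instantiation cord :: "{zero, wellorder}"
begin

lift_definition zero_cord :: cord is "{}"
  by (simp add: ordIso_reflexive)

lift_definition less_eq_cord :: "cord \<Rightarrow> cord \<Rightarrow> bool" is "\<lambda>r s. (r, s) \<in> ordLeq"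
  by (meson ordIso_ordLeq_trans ordIso_symmetric ordLeq_ordIso_trans)

lift_definition less_cord :: "cord \<Rightarrow> cord \<Rightarrow> bool" is "\<lambda>r s. (r, s) \<in> ordLess"
  by (meson ordIso_ordLess_trans ordIso_symmetric ordLess_ordIso_trans)

instance
proof
  have WO: "Well_order r" if "(r, r) \<in> ordIso" for r :: "nat rel"
    using that by (simp add: ordIso_def)
  fix a b c :: cord
  show "(a < b) = (a \<le> b \<and> \<not> b \<le> a)"
    by transfer (meson WO not_ordLess_ordLeq ordLess_imp_ordLeq ordLess_or_ordLeq)
  show "a \<le> a"
    by transfer (meson ordIso_iff_ordLeq)
  show "a \<le> b \<Longrightarrow> b \<le> c \<Longrightarrow> a \<le> c"
    by transfer (rule ordLeq_transitive)
  show "a \<le> b \<Longrightarrow> b \<le> a \<Longrightarrow> a = b"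
    by transfer (simp add: ordIso_iff_ordLeq)
  show "a \<le> b \<or> b \<le> a"
    by transfer (meson WO ordLeq_total)
next
  fix P :: "cord \<Rightarrow> bool" and a :: cord
  assume step: "\<And>x. (\<And>y. y < x \<Longrightarrow> P y) \<Longrightarrow> P x"
  have "wf {(x, y). x < (y::cord)}"
  proof (rule wf_subset[OF wf_inv_image[OF wf_ordLess, of rep_cord]])
    show "{(x, y). x < (y::cord)} \<subseteq> inv_image ordLess rep_cord"
      by (auto simp: less_cord_def)
  qed
  then show "P a"
    by (rule wf_induct_rule) (use step in auto)
qed

end

definition osuc :: "cord \<Rightarrow> cord" where
  "osuc \<alpha> = (LEAST \<beta>. \<alpha> < \<beta>)"

definition computable_ordinal :: "cord \<Rightarrow> bool" where
  "computable_ordinal \<alpha> \<longleftrightarrow>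
    (\<exists>r. computable_linear_order (Field r) r \<and> Well_order r \<and> abs_cord r = \<alpha>)"

definition omega1CK :: cord where
  "omega1CK = (LEAST \<alpha>. \<not> computable_ordinal \<alpha>)"


section \<open>The infinitary logic of one binary relation symbol\<close>

datatype fm =
  Eq nat nat
| Le nat nat
| Neg fm
| And "fm cset"
| Or "fm cset"
| Ex nat fm
| All nat fm

primrec fv :: "fm \<Rightarrow> nat set" where
  "fv (Eq x y) = {x, y}"
| "fv (Le x y) = {x, y}"
| "fv (Neg \<phi>) = fv \<phi>"
| "fv (And F) = \<Union> (rcset (cimage fv F))"
| "fv (Or F) = \<Union> (rcset (cimage fv F))"
| "fv (Ex x \<phi>) = fv \<phi> - {x}"
| "fv (All x \<phi>) = fv \<phi> - {x}"

definition sentence :: "fm \<Rightarrow> bool" where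
  "sentence \<phi> \<longleftrightarrow> fv \<phi> = {}"

text \<open>Satisfaction in the structure with domain \<open>A\<close> and relation \<open>r\<close>, under an assignment of the
  variables.\<close>

primrec sat :: "nat set \<Rightarrow> nat rel \<Rightarrow> fm \<Rightarrow> (nat \<Rightarrow> nat) \<Rightarrow> bool" where
  "sat A r (Eq x y) = (\<lambda>e. e x = e y)"
| "sat A r (Le x y) = (\<lambda>e. (e x, e y) \<in> r)"
| "sat A r (Neg \<phi>) = (\<lambda>e. \<not> sat A r \<phi> e)"
| "sat A r (And F) = (\<lambda>e. \<forall>p \<in> rcset (cimage (sat A r) F). p e)"
| "sat A r (Or F) = (\<lambda>e. \<exists>p \<in> rcset (cimage (sat A r) F). p e)"
| "sat A r (Ex x \<phi>) = (\<lambda>e. \<exists>a\<in>A. sat A r \<phi> (e(x := a)))"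
| "sat A r (All x \<phi>) = (\<lambda>e. \<forall>a\<in>A. sat A r \<phi> (e(x := a)))"

lemma sat_And [simp]: "sat A r (And F) e \<longleftrightarrow> (\<forall>\<phi> \<in> rcset F. sat A r \<phi> e)"
  by (simp add: cimage.rep_eq)

lemma sat_Or [simp]: "sat A r (Or F) e \<longleftrightarrow> (\<exists>\<phi> \<in> rcset F. sat A r \<phi> e)"
  by (simp add: cimage.rep_eq)

text \<open>Every countable structure is isomorphic to one whose domain is a set of natural numbers.\<close>

definition structure_on :: "nat set \<Rightarrow> nat rel \<Rightarrow> bool" where
  "structure_on A r \<longleftrightarrow> A \<noteq> {} \<and> r \<subseteq> A \<times> A"

definition isomorphic :: "nat set \<Rightarrow> nat rel \<Rightarrow> nat set \<Rightarrow> nat rel \<Rightarrow> bool" where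
  "isomorphic A r B s \<longleftrightarrow>
    (\<exists>f. bij_betw f A B \<and> (\<forall>x\<in>A. \<forall>y\<in>A. (x, y) \<in> r \<longleftrightarrow> (f x, f y) \<in> s))"

definition models :: "nat set \<Rightarrow> nat rel \<Rightarrow> fm \<Rightarrow> bool" where
  "models A r \<phi> \<longleftrightarrow> (\<forall>e. range e \<subseteq> A \<longrightarrow> sat A r \<phi> e)"

definition scott_sentence :: "nat set \<Rightarrow> nat rel \<Rightarrow> fm \<Rightarrow> bool" where
  "scott_sentence A r \<phi> \<longleftrightarrow> sentence \<phi> \<and>
    (\<forall>B s. structure_on B s \<longrightarrow> (models B s \<phi> \<longleftrightarrow> isomorphic A r B s))"


section \<open>Infinitary complexity classes\<close>

inductive finitary_qf :: "fm \<Rightarrow> bool" where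
  "finitary_qf (Eq x y)"
| "finitary_qf (Le x y)"
| "finitary_qf \<phi> \<Longrightarrow> finitary_qf (Neg \<phi>)"
| "finite (rcset F) \<Longrightarrow> (\<forall>\<phi> \<in> rcset F. finitary_qf \<phi>) \<Longrightarrow> finitary_qf (And F)"
| "finite (rcset F) \<Longrightarrow> (\<forall>\<phi> \<in> rcset F. finitary_qf \<phi>) \<Longrightarrow> finitary_qf (Or F)"

inductive Sigma_in :: "cord \<Rightarrow> fm \<Rightarrow> bool" and Pi_in :: "cord \<Rightarrow> fm \<Rightarrow> bool" where
  Sigma_0: "finitary_qf \<phi> \<Longrightarrow> Sigma_in 0 \<phi>"
| Pi_0: "finitary_qf \<phi> \<Longrightarrow> Pi_in 0 \<phi>"
| Sigma_step: "0 < \<alpha> \<Longrightarrow>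
    (\<forall>\<phi> \<in> rcset F. \<exists>xs \<psi> \<beta>. \<phi> = foldr Ex xs \<psi> \<and> \<beta> < \<alpha> \<and> Pi_in \<beta> \<psi>) \<Longrightarrow>
    Sigma_in \<alpha> (Or F)"
| Pi_step: "0 < \<alpha> \<Longrightarrow>
    (\<forall>\<phi> \<in> rcset F. \<exists>xs \<psi> \<beta>. \<phi> = foldr All xs \<psi> \<and> \<beta> < \<alpha> \<and> Sigma_in \<beta> \<psi>) \<Longrightarrow>
    Pi_in \<alpha> (And F)"

definition d_Sigma_in :: "cord \<Rightarrow> fm \<Rightarrow> bool" where
  "d_Sigma_in \<alpha> \<phi> \<longleftrightarrow>
    (\<exists>\<sigma> \<pi>. Sigma_in \<alpha> \<sigma> \<and> Pi_in \<alpha> \<pi> \<and> \<phi> = And (cinsert \<sigma> (csingle \<pi>)))"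

datatype complexity = PiC cord | SigmaC cord | DSigmaC cord

primrec level :: "complexity \<Rightarrow> cord" where
  "level (PiC \<alpha>) = \<alpha>"
| "level (SigmaC \<alpha>) = \<alpha>"
| "level (DSigmaC \<alpha>) = \<alpha>"

primrec in_class :: "complexity \<Rightarrow> fm \<Rightarrow> bool" where
  "in_class (PiC \<alpha>) = Pi_in \<alpha>"
| "in_class (SigmaC \<alpha>) = Sigma_in \<alpha>"
| "in_class (DSigmaC \<alpha>) = d_Sigma_in \<alpha>"

text \<open>Equivalence on countable structures is the same as equivalence on all structures, by the
  downward Loewenheim-Skolem theorem for countable fragments.\<close>

definition equivalent :: "fm \<Rightarrow> fm \<Rightarrow> bool" where
  "equivalent \<phi> \<psi> \<longleftrightarrow> (\<forall>A r. structure_on A r \<longrightarrow> (models A r \<phi> \<longleftrightarrow> models A r \<psi>))"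

definition class_le :: "complexity \<Rightarrow> complexity \<Rightarrow> bool" where
  "class_le \<Gamma> \<Delta> \<longleftrightarrow> (\<forall>\<phi>. sentence \<phi> \<longrightarrow> in_class \<Gamma> \<phi> \<longrightarrow>
    (\<exists>\<psi>. sentence \<psi> \<and> in_class \<Delta> \<psi> \<and> equivalent \<phi> \<psi>))"

definition has_scott_sentence_in :: "nat set \<Rightarrow> nat rel \<Rightarrow> complexity \<Rightarrow> bool" where
  "has_scott_sentence_in A r \<Gamma> \<longleftrightarrow> (\<exists>\<phi>. in_class \<Gamma> \<phi> \<and> scott_sentence A r \<phi>)"

definition scott_sentence_complexity :: "nat set \<Rightarrow> nat rel \<Rightarrow> complexity \<Rightarrow> bool" where
  "scott_sentence_complexity A r \<Gamma> \<longleftrightarrow>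
    structure_on A r \<and> 0 < level \<Gamma> \<and> has_scott_sentence_in A r \<Gamma> \<and>
    (\<forall>\<Delta>. 0 < level \<Delta> \<longrightarrow> has_scott_sentence_in A r \<Delta> \<longrightarrow> class_le \<Gamma> \<Delta>)"

end

theory Submission
  imports Defs
begin

text \<open>Let \<open>\<lambda>\<close> be \<open>\<omega>\<^sub>1\<^sup>C\<^sup>K\<close>. Overspill for Kleene--Brouwer orders gives a computable linear order \<open>K\<close> that
  is not well-founded and whose well-founded part has exactly the ordinals below \<open>\<lambda>\<close> as ranks. Labels
  are the elements of \<open>K \<times> \<omega>\<close> and a greatest element; a label is standard if it is in the
  well-founded part. Trees in which the labels decrease along branches are coded by linear orders:
  the children of a node are shuffled densely, and a node becomes a finite block that
  tells its level and its colour. All non-standard labels at a node are in the same orbit, while a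
  standard label is recognised by back-and-forth games of about its rank.

  If all labels are admitted, then tuples with the same back-and-forth type of rank \<open>\<lambda>\<close> are
  automorphic, and no smaller rank is enough; this gives \<open>\<Pi>\<close> at \<open>\<lambda> + 2\<close>. If level \<open>n\<close> admits only
  the labels in a decidable set \<open>R n\<close> whose standard members are bounded by a standard label, then the orbit
  of a tuple is described at a rank below \<open>\<lambda>\<close>. When this rank depends only on the levels of the entries,
  the Scott sentence is \<open>\<Pi>\<close> at \<open>\<lambda>\<close>; when the tree begins with the choice of an eventually constant
  sequence of labels, it is \<open>\<Pi>\<close> at \<open>\<lambda> + 1\<close>. For the lower bounds, the order is compared with a tree that
  has a root which behaves like a non-standard label down to a late level only, with one that
  has also a cofinal sequence of standard labels, and with one that has a node
  whose children have exactly the standard labels, respectively.\<close>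


section \<open>Computable functions\<close>

text \<open>Well-foundedness is not decidable, so \<open>K\<close> comes from diagonalisation.
  Comparability with every computable order is witnessed by a function subject to a decidable
  condition, and all well-founded \<open>L e\<close> have such a witness. If no other
  \<open>L e\<close> had one, the Kleene--Brouwer order of the tree of witnesses with descending
  sequences would be a computable well-order longer than itself.

  The factor omega in the labels serves the games: one move may name nodes at any finite depth, so
  each rank \<gamma> below \<open>lam\<close> comes with labels \<open>t \<gamma> n\<close> for all
  \<open>n\<close>, one lost per step down the tree.

  Thin families meet two opposing demands. At the next level they are cofinal below each of their
  labels, so that non-standard labels cannot be told apart; yet their standard members are bounded
  at each level, so that standard labels are recognised at a rank depending on the level only.
  Counting \<open>up\<close> steps along the numbers achieves both.

  Levels and colours are put into finite blocks because these are read off at a rank that does not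
  depend on the labels; \<open>c2\<close> and \<open>c3\<close> pay for reading blocks and
  prefixes.\<close>

definition computableN :: "nat \<Rightarrow> (nat list \<Rightarrow> nat) \<Rightarrow> bool" where
  "computableN k F \<longleftrightarrow> (\<exists>p. \<forall>xs. length xs = k \<longrightarrow> computes p xs (F xs))"

lemma computableN_cong:
  assumes "computableN k F" "\<And>xs. length xs = k \<Longrightarrow> F xs = G xs"
  shows "computableN k G"
  using assms unfolding computableN_def by metis

lemma computableN_proj: "i < k \<Longrightarrow> computableN k (\<lambda>xs. xs ! i)"
  unfolding computableN_def using computes.proj by blast

lemma computableN_zero: "computableN k (\<lambda>_. 0)"
  unfolding computableN_def using computes.zero by blast

lemma computableN_Suc1: "computableN 1 (\<lambda>xs. Suc (xs ! 0))"
  unfolding computableN_def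
  by (rule exI[of _ Succ]) (auto simp: length_Suc_conv intro: computes.succ)

lemma computableN_comp1:
  assumes "computableN 1 F" "computableN k g"
  shows "computableN k (\<lambda>xs. F [g xs])"
proof -
  obtain p where p: "length xs = 1 \<Longrightarrow> computes p xs (F xs)" for xs
    using assms(1) unfolding computableN_def by blast
  obtain q where q: "length xs = k \<Longrightarrow> computes q xs (g xs)" for xs
    using assms(2) unfolding computableN_def by blast
  have "computes (Comp p [q]) xs (F [g xs])" if "length xs = k" for xs
    by (rule computes.comp[where ys = "[g xs]"]) (use p q that in auto)
  then show ?thesis unfolding computableN_def by blast
qed

lemma computableN_comp2:
  assumes "computableN 2 F" "computableN k g" "computableN k h"
  shows "computableN k (\<lambda>xs. F [g xs, h xs])"
proof -
  obtain p where p: "length xs = 2 \<Longrightarrow> computes p xs (F xs)" for xs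
    using assms(1) unfolding computableN_def by blast
  obtain q where q: "length xs = k \<Longrightarrow> computes q xs (g xs)" for xs
    using assms(2) unfolding computableN_def by blast
  obtain r where r: "length xs = k \<Longrightarrow> computes r xs (h xs)" for xs
    using assms(3) unfolding computableN_def by blast
  have "computes (Comp p [q, r]) xs (F [g xs, h xs])" if "length xs = k" for xs
    by (rule computes.comp[where ys = "[g xs, h xs]"]) (use p q r that in auto)
  then show ?thesis unfolding computableN_def by blast
qed

lemma computableN_Suc: "computableN k g \<Longrightarrow> computableN k (\<lambda>xs. Suc (g xs))"
  using computableN_comp1[OF computableN_Suc1] by simp

lemma computableN_const: "computableN k (\<lambda>_. c)"
  by (induction c) (auto intro: computableN_zero computableN_Suc)

lemma computableN_prec:
  assumes "computableN k F" "computableN (Suc (Suc k)) G"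
  shows "computableN (Suc k) (\<lambda>xs. rec_nat (F (tl xs)) (\<lambda>n y. G (n # y # tl xs)) (hd xs))"
proof -
  obtain p where p: "length xs = k \<Longrightarrow> computes p xs (F xs)" for xs
    using assms(1) unfolding computableN_def by blast
  obtain q where q: "length xs = Suc (Suc k) \<Longrightarrow> computes q xs (G xs)" for xs
    using assms(2) unfolding computableN_def by blast
  have *: "computes (Prec p q) (n # xs) (rec_nat (F xs) (\<lambda>n y. G (n # y # xs)) n)"
    if "length xs = k" for n xs
  proof (induction n)
    case 0
    then show ?case using p that by (auto intro: computes.prec_0)
  next
    case (Suc n)
    then show ?case
      using computes.prec_Suc[OF Suc q] that by simp
  qed
  have "computes (Prec p q) xs (rec_nat (F (tl xs)) (\<lambda>n y. G (n # y # tl xs)) (hd xs))"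
    if "length xs = Suc k" for xs
    using *[of "tl xs" "hd xs"] that by (cases xs) auto
  then show ?thesis unfolding computableN_def by blast
qed

section \<open>Arithmetic, Cantor pairing and its projections\<close>

lemma computableN_add2: "computableN 2 (\<lambda>xs. xs ! 0 + xs ! 1)"
proof -
  have "computableN (Suc 1) (\<lambda>xs. rec_nat (tl xs ! 0) (\<lambda>n y. Suc ((n # y # tl xs) ! 1)) (hd xs))"
    by (rule computableN_prec[where G = "\<lambda>xs. Suc (xs ! 1)"]) (auto intro: computableN_proj computableN_Suc)
  moreover have "rec_nat (tl xs ! 0) (\<lambda>n y. Suc ((n # y # tl xs) ! 1)) (hd xs) = xs ! 0 + xs ! 1"
    if len: "length xs = Suc 1" for xs
  proof -
    obtain a b where xs: "xs = [a, b]" using len by (auto simp: length_Suc_conv)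
    have "rec_nat b (\<lambda>n y. Suc y) a = a + b" by (induction a) auto
    then show ?thesis using xs by simp
  qed
  ultimately show ?thesis using computableN_cong by (simp add: numeral_2_eq_2)
qed

lemma computableN_add:
  "computableN k g \<Longrightarrow> computableN k h \<Longrightarrow> computableN k (\<lambda>xs. g xs + h xs)"
  using computableN_comp2[OF computableN_add2] by simp

lemma computableN_pred: "computableN k g \<Longrightarrow> computableN k (\<lambda>xs. g xs - 1)"
proof -
  assume g: "computableN k g"
  have "computableN (Suc 0) (\<lambda>xs. rec_nat 0 (\<lambda>n y. ((n # y # tl xs) ! 0)) (hd xs))"
    by (rule computableN_prec[where G = "\<lambda>xs. xs ! 0" and F = "\<lambda>_. 0"])
      (auto intro: computableN_proj computableN_zero)
  moreover have "rec_nat 0 (\<lambda>n y. ((n # y # tl xs) ! 0)) (hd xs) = xs ! 0 - 1"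
    if len: "length xs = Suc 0" for xs :: "nat list"
  proof -
    obtain a where xs: "xs = [a]" using len by (auto simp: length_Suc_conv)
    have "rec_nat 0 (\<lambda>n y. n) a = a - 1" by (cases a) auto
    then show ?thesis using xs by simp
  qed
  ultimately have "computableN 1 (\<lambda>xs. xs ! 0 - 1)" using computableN_cong by auto
  from computableN_comp1[OF this g] show ?thesis by simp
qed

lemma computableN_diff2: "computableN 2 (\<lambda>xs. xs ! 1 - xs ! 0)"
proof -
  have "computableN (Suc 1) (\<lambda>xs. rec_nat (tl xs ! 0) (\<lambda>n y. (n # y # tl xs) ! 1 - 1) (hd xs))"
    by (rule computableN_prec[where G = "\<lambda>xs. xs ! 1 - 1"]) (rule computableN_proj computableN_pred | simp)+
  moreover have "rec_nat (tl xs ! 0) (\<lambda>n y. (n # y # tl xs) ! 1 - 1) (hd xs) = xs ! 1 - xs ! 0"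
    if len: "length xs = Suc 1" for xs
  proof -
    obtain a b where xs: "xs = [a, b]" using len by (auto simp: length_Suc_conv)
    have "rec_nat b (\<lambda>n y. y - 1) a = b - a" by (induction a) auto
    then show ?thesis using xs by simp
  qed
  ultimately show ?thesis using computableN_cong by (simp add: numeral_2_eq_2)
qed

lemma computableN_diff:
  "computableN k g \<Longrightarrow> computableN k h \<Longrightarrow> computableN k (\<lambda>xs. g xs - h xs)"
  using computableN_comp2[OF computableN_diff2] by simp

lemma computableN_triangle: "computableN k g \<Longrightarrow> computableN k (\<lambda>xs. triangle (g xs))"
proof -
  assume g: "computableN k g"
  have "computableN (Suc 0) (\<lambda>xs. rec_nat 0 (\<lambda>n y. (n # y # tl xs) ! 1 + Suc ((n # y # tl xs) ! 0)) (hd xs))"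
    by (rule computableN_prec[where G = "\<lambda>xs. xs ! 1 + Suc (xs ! 0)" and F = "\<lambda>_. 0"])
      (rule computableN_proj computableN_zero computableN_add computableN_Suc | simp)+
  moreover have "rec_nat 0 (\<lambda>n y. (n # y # tl xs) ! 1 + Suc ((n # y # tl xs) ! 0)) (hd xs) = triangle (xs ! 0)"
    if len: "length xs = Suc 0" for xs :: "nat list"
  proof -
    obtain a where xs: "xs = [a]" using len by (auto simp: length_Suc_conv)
    have "rec_nat 0 (\<lambda>n y. Suc (y + n)) a = triangle a" by (induction a) auto
    then show ?thesis using xs by simp
  qed
  ultimately have "computableN 1 (\<lambda>xs. triangle (xs ! 0))" using computableN_cong by auto
  from computableN_comp1[OF this g] show ?thesis by simp
qed

abbreviation pair :: "nat \<Rightarrow> nat \<Rightarrow> nat" where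
  "pair a b \<equiv> prod_encode (a, b)"

definition p1 :: "nat \<Rightarrow> nat" where "p1 n = fst (prod_decode n)"
definition p2 :: "nat \<Rightarrow> nat" where "p2 n = snd (prod_decode n)"

lemma p1_pair [simp]: "p1 (pair a b) = a" and p2_pair [simp]: "p2 (pair a b) = b"
  by (simp_all add: p1_def p2_def)

lemma pair_p1_p2 [simp]: "pair (p1 n) (p2 n) = n"
  by (simp add: p1_def p2_def)

lemma p1_le: "p1 n \<le> n" and p2_le: "p2 n \<le> n"
  using le_prod_encode_1[of "p1 n" "p2 n"] le_prod_encode_2[of "p2 n" "p1 n"] by auto

lemma pair_cases: obtains a b where "n = pair a b"
  using pair_p1_p2 by metis

text \<open>The step adds 1 exactly when \<open>Suc n\<close> reaches the next triangular number.
  This inverts \<open>triangle\<close> by primitive recursion and makes the projections of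
  \<open>pair\<close> recursive.\<close>

definition tri_root :: "nat \<Rightarrow> nat" where
  "tri_root n = rec_nat 0 (\<lambda>n y. y + (1 - (triangle (Suc y) - Suc n))) n"

lemma tri_root: "tri_root n = p1 n + p2 n"
proof -
  have *: "triangle (tri_root n) \<le> n \<and> n < triangle (Suc (tri_root n))"
  proof (induction n)
    case (Suc n)
    have "tri_root (Suc n) = tri_root n + (1 - (triangle (Suc (tri_root n)) - Suc n))"
      by (simp add: tri_root_def)
    then show ?case using Suc by (cases "triangle (Suc (tri_root n)) = Suc n") auto
  qed (simp add: tri_root_def)
  have n: "n = triangle (p1 n + p2 n) + p1 n"
    using pair_p1_p2[of n] unfolding prod_encode_def by simp
  have mono: "a \<le> b \<Longrightarrow> triangle a \<le> triangle b" for a b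
    by (induction b) (auto simp: le_Suc_eq)
  have "n < triangle (Suc (p1 n + p2 n))" "triangle (p1 n + p2 n) \<le> n" using n by auto
  with * mono show ?thesis
    by (metis le_less_trans not_less_eq_eq order.antisym not_le)
qed

lemma computableN_tri_root: "computableN k g \<Longrightarrow> computableN k (\<lambda>xs. tri_root (g xs))"
proof -
  assume g: "computableN k g"
  have "computableN (Suc 0) (\<lambda>xs. rec_nat 0 (\<lambda>n y. (n # y # tl xs) ! 1 + (1 - (triangle (Suc ((n # y # tl xs) ! 1)) - Suc ((n # y # tl xs) ! 0)))) (hd xs))"
    by (rule computableN_prec[where G = "\<lambda>xs. xs ! 1 + (1 - (triangle (Suc (xs ! 1)) - Suc (xs ! 0)))" and F = "\<lambda>_. 0"])
      (rule computableN_proj computableN_zero computableN_add computableN_Suc computableN_diff computableN_triangle computableN_const | simp)+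
  moreover have "rec_nat 0 (\<lambda>n y. (n # y # tl xs) ! 1 + (1 - (triangle (Suc ((n # y # tl xs) ! 1)) - Suc ((n # y # tl xs) ! 0)))) (hd xs) = tri_root (xs ! 0)"
    if "length xs = Suc 0" for xs :: "nat list"
    using that by (auto simp: length_Suc_conv tri_root_def)
  ultimately have "computableN 1 (\<lambda>xs. tri_root (xs ! 0))" using computableN_cong by auto
  from computableN_comp1[OF this g] show ?thesis by simp
qed

lemma computableN_p1: "computableN k g \<Longrightarrow> computableN k (\<lambda>xs. p1 (g xs))"
  and computableN_p2: "computableN k g \<Longrightarrow> computableN k (\<lambda>xs. p2 (g xs))"
proof -
  assume g: "computableN k g"
  have 1: "p1 n = n - triangle (tri_root n)" for n
  proof -
    have "n = triangle (p1 n + p2 n) + p1 n"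
      using pair_p1_p2[of n] unfolding prod_encode_def by simp
    then show ?thesis unfolding tri_root by linarith
  qed
  have 2: "p2 n = tri_root n - (n - triangle (tri_root n))" for n
    using 1[of n] tri_root[of n] by simp
  show "computableN k (\<lambda>xs. p1 (g xs))"
    unfolding 1 by (intro computableN_diff computableN_triangle computableN_tri_root g)
  show "computableN k (\<lambda>xs. p2 (g xs))"
    unfolding 2 by (intro computableN_diff computableN_triangle computableN_tri_root g)
qed

lemma computableN_pair: "computableN k g \<Longrightarrow> computableN k h \<Longrightarrow> computableN k (\<lambda>xs. pair (g xs) (h xs))"
  unfolding prod_encode_def by (simp add: computableN_add computableN_triangle)

text \<open>Functions of several arguments are handled as unary functions of a tuple code.\<close>

definition cmp :: "(nat \<Rightarrow> nat) \<Rightarrow> bool" where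
  "cmp f \<longleftrightarrow> computableN 1 (\<lambda>xs. f (xs ! 0))"

definition dec :: "(nat \<Rightarrow> bool) \<Rightarrow> bool" where
  "dec P \<longleftrightarrow> cmp (\<lambda>x. if P x then 1 else 0)"

named_theorems cmp_intro

lemma computableN_cmp: "cmp f \<Longrightarrow> computableN k g \<Longrightarrow> computableN k (\<lambda>xs. f (g xs))"
  unfolding cmp_def by (drule computableN_comp1) auto

lemma cmp_comp: "cmp f \<Longrightarrow> cmp g \<Longrightarrow> cmp (\<lambda>x. f (g x))"
  using computableN_cmp[of f 1 "\<lambda>xs. g (xs ! 0)"] by (simp add: cmp_def)

lemma cmp_id [cmp_intro]: "cmp (\<lambda>x. x)"
  unfolding cmp_def by (rule computableN_proj) simp

lemma cmp_const [cmp_intro]: "cmp (\<lambda>_. c)"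
  unfolding cmp_def by (rule computableN_const)

lemma cmp_Suc [cmp_intro]: "cmp f \<Longrightarrow> cmp (\<lambda>x. Suc (f x))"
  unfolding cmp_def by (rule computableN_Suc)

lemma cmp_add [cmp_intro]: "cmp f \<Longrightarrow> cmp g \<Longrightarrow> cmp (\<lambda>x. f x + g x)"
  unfolding cmp_def by (rule computableN_add)

lemma cmp_diff [cmp_intro]: "cmp f \<Longrightarrow> cmp g \<Longrightarrow> cmp (\<lambda>x. f x - g x)"
  unfolding cmp_def by (rule computableN_diff)

lemma cmp_p1 [cmp_intro]: "cmp f \<Longrightarrow> cmp (\<lambda>x. p1 (f x))"
  unfolding cmp_def by (rule computableN_p1)

lemma cmp_p2 [cmp_intro]: "cmp f \<Longrightarrow> cmp (\<lambda>x. p2 (f x))"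
  unfolding cmp_def by (rule computableN_p2)

lemma cmp_pair [cmp_intro]: "cmp f \<Longrightarrow> cmp g \<Longrightarrow> cmp (\<lambda>x. pair (f x) (g x))"
  unfolding cmp_def by (rule computableN_pair)

text \<open>Step number, previous value and parameter reach \<open>g\<close> as one coded triple.
  Bounded quantifiers and operations on coded lists are all obtained from this rule.\<close>

lemma cmp_rec [cmp_intro]:
  assumes "cmp k" "cmp a" and g: "cmp (\<lambda>z. g (p1 z) (p1 (p2 z)) (p2 (p2 z)))"
  shows "cmp (\<lambda>x. rec_nat (a x) (\<lambda>n y. g n y x) (k x))"
proof -
  let ?G = "\<lambda>z. g (p1 z) (p1 (p2 z)) (p2 (p2 z))"
  have "computableN (Suc 1) (\<lambda>xs. rec_nat (a (tl xs ! 0))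
      (\<lambda>n y. ?G (pair ((n # y # tl xs) ! 0) (pair ((n # y # tl xs) ! 1) ((n # y # tl xs) ! 2)))) (hd xs))"
    by (rule computableN_prec[where F = "\<lambda>xs. a (xs ! 0)" and
          G = "\<lambda>xs. ?G (pair (xs ! 0) (pair (xs ! 1) (xs ! 2)))"])
      ((rule computableN_cmp[OF g] computableN_cmp[OF assms(2)] computableN_pair computableN_proj | simp)+)
  then have "computableN 2 (\<lambda>xs. rec_nat (a (tl xs ! 0)) (\<lambda>n y. g n y (tl xs ! 0)) (hd xs))"
    by (simp add: numeral_2_eq_2)
  from computableN_comp2[OF this, of 1 "\<lambda>xs. k (xs ! 0)" "\<lambda>xs. xs ! 0"] show ?thesis
    using assms(1) computableN_proj[of 0 1] by (simp add: cmp_def)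
qed

lemma cmp_if [cmp_intro]:
  assumes "dec P" "cmp f" "cmp g"
  shows "cmp (\<lambda>x. if P x then f x else g x)"
proof -
  have "cmp (\<lambda>x. rec_nat (g x) (\<lambda>n y. f x) (if P x then 1 else 0))"
    using assms by (intro cmp_rec cmp_comp[OF assms(2)] cmp_p2 cmp_id) (simp_all add: dec_def)
  moreover have "(\<lambda>x. rec_nat (g x) (\<lambda>n y. f x) (if P x then 1 else 0 :: nat)) = (\<lambda>x. if P x then f x else g x)"
    by auto
  ultimately show ?thesis by simp
qed

lemma dec_comp: "dec P \<Longrightarrow> cmp g \<Longrightarrow> dec (\<lambda>x. P (g x))"
  unfolding dec_def by (drule cmp_comp)

lemma dec_comp2:
  assumes "dec (\<lambda>z. P (p1 z) (p2 z))" "cmp f" "cmp g"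
  shows "dec (\<lambda>x. P (f x) (g x))"
  using dec_comp[OF assms(1) cmp_pair[OF assms(2,3)]] by simp

lemma dec_not [cmp_intro]: "dec P \<Longrightarrow> dec (\<lambda>x. \<not> P x)"
proof -
  assume "dec P"
  then have "cmp (\<lambda>x. if P x then 0 else 1)" by (intro cmp_intro)
  moreover have "(\<lambda>x. if P x then 0 else 1 :: nat) = (\<lambda>x. if \<not> P x then 1 else 0)" by auto
  ultimately show ?thesis unfolding dec_def by simp
qed

lemma dec_if_intro: "cmp f \<Longrightarrow> (\<And>x. f x = (if P x then 1 else 0)) \<Longrightarrow> dec P"
  unfolding dec_def by (subgoal_tac "f = (\<lambda>x. if P x then 1 else 0)") auto

lemma cmp_eqI: "cmp f \<Longrightarrow> (\<And>x. f x = g x) \<Longrightarrow> cmp g"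
  by (subgoal_tac "f = g") auto

lemma dec_eqI: "dec f \<Longrightarrow> (\<And>x. f x = g x) \<Longrightarrow> dec g"
  by (subgoal_tac "f = g") auto

lemma dec_const [cmp_intro]: "dec (\<lambda>_. b)"
  unfolding dec_def by (cases b) (simp_all add: cmp_const)

lemma dec_zero: "cmp f \<Longrightarrow> dec (\<lambda>x. f x = 0)"
proof -
  assume "cmp f"
  then have "cmp (\<lambda>x. 1 - f x)" by (intro cmp_intro)
  then show ?thesis by (rule dec_if_intro) auto
qed

lemma dec_and [cmp_intro]: "dec P \<Longrightarrow> dec Q \<Longrightarrow> dec (\<lambda>x. P x \<and> Q x)"
proof -
  assume "dec P" "dec Q"
  then have "cmp (\<lambda>x. if P x then if Q x then 1 else 0 else 0)" by (intro cmp_intro)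
  then show ?thesis by (rule dec_if_intro) auto
qed

lemma dec_or [cmp_intro]: "dec P \<Longrightarrow> dec Q \<Longrightarrow> dec (\<lambda>x. P x \<or> Q x)"
proof -
  assume "dec P" "dec Q"
  then have "cmp (\<lambda>x. if P x then 1 else if Q x then 1 else 0)" by (intro cmp_intro)
  then show ?thesis by (rule dec_if_intro) auto
qed

lemma dec_imp [cmp_intro]: "dec P \<Longrightarrow> dec Q \<Longrightarrow> dec (\<lambda>x. P x \<longrightarrow> Q x)"
  unfolding imp_conv_disj by (intro cmp_intro)

lemma dec_le [cmp_intro]: "cmp f \<Longrightarrow> cmp g \<Longrightarrow> dec (\<lambda>x. f x \<le> g x)"
proof -
  assume "cmp f" "cmp g"
  then have "dec (\<lambda>x. f x - g x = 0)" by (intro dec_zero cmp_intro)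
  then show ?thesis by simp
qed

lemma dec_less [cmp_intro]: "cmp f \<Longrightarrow> cmp g \<Longrightarrow> dec (\<lambda>x. f x < g x)"
  using dec_le[OF cmp_Suc, of f g] by (simp add: Suc_le_eq)

lemma dec_eq [cmp_intro]: "cmp f \<Longrightarrow> cmp g \<Longrightarrow> dec (\<lambda>x. f x = g x)"
  using dec_and[OF dec_le[of f g] dec_le[of g f]] by (simp add: eq_iff)

lemma dec_iff [cmp_intro]: "dec P \<Longrightarrow> dec Q \<Longrightarrow> dec (\<lambda>x. P x \<longleftrightarrow> Q x)"
  unfolding iff_conv_conj_imp by (intro cmp_intro)

lemma dec_ex [cmp_intro]:
  assumes "cmp b" "dec (\<lambda>z. P (p1 z) (p2 z))"
  shows "dec (\<lambda>x. \<exists>n<b x. P n x)"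
proof -
  have "dec (\<lambda>z. P (p1 z) (p2 (p2 z)))"
    by (rule dec_comp2[OF assms(2)]) (intro cmp_intro)+
  then have "cmp (\<lambda>x. rec_nat 0 (\<lambda>n y. if P n x then 1 else y) (b x))"
    by (intro cmp_intro assms(1))
  moreover have "rec_nat 0 (\<lambda>n y. if P n x then 1 else y) k = (if \<exists>n<k. P n x then 1 else 0)" for k x
    by (induction k) (auto simp: less_Suc_eq)
  ultimately show ?thesis by (intro dec_if_intro)
qed

lemma dec_all [cmp_intro]:
  assumes "cmp b" "dec (\<lambda>z. P (p1 z) (p2 z))"
  shows "dec (\<lambda>x. \<forall>n<b x. P n x)"
proof -
  have "dec (\<lambda>x. \<not> (\<exists>n<b x. \<not> P n x))"
    by (intro cmp_intro assms)
  then show ?thesis by simp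
qed

lemma cmp_mult [cmp_intro]: "cmp f \<Longrightarrow> cmp g \<Longrightarrow> cmp (\<lambda>x. f x * g x)"
proof -
  assume f: "cmp f" and g: "cmp g"
  have "cmp (\<lambda>x. rec_nat 0 (\<lambda>n y. y + g x) (f x))"
    by (intro cmp_intro f cmp_comp[OF g])
  moreover have "rec_nat 0 (\<lambda>n y. y + g x) k = k * g x" for k x
    by (induction k) auto
  ultimately show ?thesis by (elim cmp_eqI) auto
qed

lemma cmp_power2 [cmp_intro]: "cmp f \<Longrightarrow> cmp (\<lambda>x. (2::nat) ^ f x)"
proof -
  assume f: "cmp f"
  have "cmp (\<lambda>x. rec_nat 1 (\<lambda>n y. y + y) (f x))"
    by (intro cmp_intro f)
  moreover have "rec_nat 1 (\<lambda>n y. y + y) k = (2::nat) ^ k" for k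
    by (induction k) auto
  ultimately show ?thesis by (elim cmp_eqI) auto
qed

subsection \<open>Codes of finite sequences\<close>

text \<open>\<open>sel n i\<close> is entry \<open>i\<close> of the list coded by \<open>n\<close>; it is used only for \<open>i < len n\<close>.\<close>

definition dropc :: "nat \<Rightarrow> nat \<Rightarrow> nat" where
  "dropc n k = list_encode (drop k (list_decode n))"

definition len :: "nat \<Rightarrow> nat" where "len n = length (list_decode n)"
definition sel :: "nat \<Rightarrow> nat \<Rightarrow> nat" where "sel n i = p1 (dropc n i - 1)"
definition cons :: "nat \<Rightarrow> nat \<Rightarrow> nat" where "cons a n = Suc (pair a n)"

lemma len_encode [simp]: "len (list_encode xs) = length xs"
  by (simp add: len_def)

lemma list_decode_eq: "n > 0 \<Longrightarrow> list_decode n = p1 (n - 1) # list_decode (p2 (n - 1))"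
  by (cases n) (auto simp: p1_def p2_def split: prod.splits)

lemma sel_decode: "i < length (list_decode n) \<Longrightarrow> sel n i = list_decode n ! i"
  by (simp add: sel_def dropc_def Cons_nth_drop_Suc[symmetric])

lemma sel_encode [simp]: "i < length xs \<Longrightarrow> sel (list_encode xs) i = xs ! i"
  by (simp add: sel_decode)

lemma decode_cons [simp]: "list_decode (cons a n) = a # list_decode n"
  by (simp add: cons_def)

lemma encode_cons [simp]: "list_encode (a # xs) = cons a (list_encode xs)"
  by (simp add: cons_def)

declare list_encode.simps(2) [simp del]

lemma length_decode_le: "length (list_decode n) \<le> n"
proof (induction n rule: less_induct)
  case (less n)
  show ?case
  proof (cases "n = 0")
    case False
    then have "length (list_decode (p2 (n - 1))) \<le> p2 (n - 1)"
      using p2_le[of "n - 1"] by (intro less) auto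
    then show ?thesis
      using p2_le[of "n - 1"] False by (simp add: list_decode_eq)
  qed simp
qed

lemma encode_eq_0 [simp]: "list_encode xs = 0 \<longleftrightarrow> xs = []"
  by (cases xs) (auto simp: cons_def)

lemma cmp_dropc [cmp_intro]: "cmp f \<Longrightarrow> cmp g \<Longrightarrow> cmp (\<lambda>x. dropc (f x) (g x))"
proof -
  assume f: "cmp f" and g: "cmp g"
  have "cmp (\<lambda>x. rec_nat (f x) (\<lambda>n y. if y = 0 then 0 else p2 (y - 1)) (g x))"
    by (intro cmp_intro f g)
  moreover have "rec_nat m (\<lambda>n y. if y = 0 then 0 else p2 (y - 1)) k = dropc m k" for m k
  proof (induction k)
    case (Suc k)
    let ?d = "dropc m k"
    have "dropc m (Suc k) = list_encode (tl (list_decode ?d))"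
      by (simp add: dropc_def tl_drop drop_Suc)
    also have "\<dots> = (if ?d = 0 then 0 else p2 (?d - 1))"
      by (simp add: list_decode_eq)
    finally show ?case using Suc by simp
  qed (simp add: dropc_def)
  ultimately show ?thesis by (elim cmp_eqI) auto
qed

lemma cmp_len [cmp_intro]: "cmp f \<Longrightarrow> cmp (\<lambda>x. len (f x))"
proof -
  assume f: "cmp f"
  have "cmp (\<lambda>x. rec_nat 0 (\<lambda>n y. if dropc (f x) n = 0 then y else Suc y) (f x))"
    by (intro cmp_intro f cmp_comp[OF f])
  moreover have "rec_nat 0 (\<lambda>n y. if dropc m n = 0 then y else Suc y) k = min k (len m)" for m k
    by (induction k) (auto simp: dropc_def len_def)
  moreover have "min m (len m) = len m" for m
    using length_decode_le[of m] by (simp add: len_def)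
  ultimately show ?thesis by simp
qed

lemma cmp_sel [cmp_intro]: "cmp f \<Longrightarrow> cmp g \<Longrightarrow> cmp (\<lambda>x. sel (f x) (g x))"
  unfolding sel_def by (intro cmp_intro)

lemma cmp_cons [cmp_intro]: "cmp f \<Longrightarrow> cmp g \<Longrightarrow> cmp (\<lambda>x. cons (f x) (g x))"
  unfolding cons_def by (intro cmp_intro)

subsection \<open>Checkable computations\<close>

inductive_cases computes_ZeroE: "computes Zero xs y"
inductive_cases computes_SuccE: "computes Succ xs y"
inductive_cases computes_ProjE: "computes (Proj i) xs y"
inductive_cases computes_CompE: "computes (Comp f gs) xs y"
inductive_cases computes_Prec0E: "computes (Prec f g) (0 # xs) y"
inductive_cases computes_PrecSucE: "computes (Prec f g) (Suc n # xs) y"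
inductive_cases computes_MuE: "computes (Mu f) xs y"

lemma computes_deterministic: "computes f xs y \<Longrightarrow> computes f xs z \<Longrightarrow> y = z"
proof (induction arbitrary: z rule: computes.induct)
  case (zero xs)
  then show ?case by (auto elim: computes_ZeroE)
next
  case (succ x)
  then show ?case by (rule computes_SuccE) simp
next
  case (proj i xs)
  from proj(2) show ?case by (rule computes_ProjE) simp
next
  case (comp xs gs ys f w)
  obtain ys' where ys': "list_all2 (\<lambda>g y. computes g xs y) gs ys'" "computes f ys' z"
    using comp.prems by (rule computes_CompE)
  have "ys = ys'"
    using comp(1) ys'(1) by (auto simp: list_all2_conv_all_nth intro!: nth_equalityI)
  then show ?case using comp.IH ys'(2) by blast
next
  case (prec_0 f xs y g)
  from prec_0.prems prec_0.IH show ?case by (blast elim: computes_Prec0E)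
next
  case (prec_Suc f g n xs y w)
  from prec_Suc.prems obtain y' where "computes (Prec f g) (n # xs) y'" "computes g (n # y' # xs) z"
    by (rule computes_PrecSucE)
  with prec_Suc.IH show ?case by blast
next
  case (mu f n xs)
  from mu.prems have z: "computes f (z # xs) 0" "\<forall>m<z. \<exists>y. computes f (m # xs) (Suc y)"
    by (auto elim: computes_MuE)
  have "\<not> z < n"
    using mu.IH z(1) by blast
  moreover have "\<not> n < z"
    using mu.IH z(2) by blast
  ultimately show ?case by simp
qed

fun code :: "recf \<Rightarrow> nat" where
  "code Zero = pair 0 0"
| "code Succ = pair 1 0"
| "code (Proj i) = pair 2 i"
| "code (Comp f gs) = pair 3 (pair (code f) (list_encode (map code gs)))"
| "code (Prec f g) = pair 4 (pair (code f) (code g))"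
| "code (Mu f) = pair 5 (code f)"

text \<open>A fact \<open>fact c xs y\<close> records that the program with code \<open>c\<close> maps \<open>xs\<close> to \<open>y\<close>.\<close>

definition fact :: "nat \<Rightarrow> nat \<Rightarrow> nat \<Rightarrow> nat" where
  "fact c xs y = pair c (pair xs y)"

definition exm :: "nat \<Rightarrow> (nat \<Rightarrow> bool) \<Rightarrow> bool" where
  "exm l Q \<longleftrightarrow> (\<exists>j<len l. Q (sel l j))"

definition mem :: "nat \<Rightarrow> nat \<Rightarrow> bool" where
  "mem a l \<longleftrightarrow> exm l (\<lambda>b. b = a)"

text \<open>Local correctness of one evaluation: the seven disjuncts follow the clauses of
  \<open>computes\<close>, with every premise looked up in \<open>l\<close>. All quantifiers are
  bounded, so the predicate is decidable.\<close>

definition just :: "nat \<Rightarrow> nat \<Rightarrow> nat \<Rightarrow> nat \<Rightarrow> bool" where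
  "just l c xs y \<longleftrightarrow>
    c = pair 0 0 \<and> y = 0 \<or>
    c = pair 1 0 \<and> len xs = 1 \<and> y = Suc (sel xs 0) \<or>
    p1 c = 2 \<and> p2 c < len xs \<and> y = sel xs (p2 c) \<or>
    p1 c = 3 \<and> exm l (\<lambda>a. p1 a = p1 (p2 c) \<and> p2 (p2 a) = y \<and>
      len (p1 (p2 a)) = len (p2 (p2 c)) \<and>
      (\<forall>i<len (p2 (p2 c)). mem (fact (sel (p2 (p2 c)) i) xs (sel (p1 (p2 a)) i)) l)) \<or>
    p1 c = 4 \<and> 0 < len xs \<and> sel xs 0 = 0 \<and> mem (fact (p1 (p2 c)) (dropc xs 1) y) l \<or>
    p1 c = 4 \<and> 0 < len xs \<and> 0 < sel xs 0 \<and> exm l (\<lambda>a. p1 a = c \<and>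
      p1 (p2 a) = cons (sel xs 0 - 1) (dropc xs 1) \<and>
      mem (fact (p2 (p2 c)) (cons (sel xs 0 - 1) (cons (p2 (p2 a)) (dropc xs 1))) y) l) \<or>
    p1 c = 5 \<and> mem (fact (p2 c) (cons y xs) 0) l \<and>
      (\<forall>m<y. exm l (\<lambda>a. p1 a = p2 c \<and> p1 (p2 a) = cons m xs \<and> 0 < p2 (p2 a)))"

text \<open>An entry may appeal only to entries further down the list, so induction over the list is
  induction over the computation.\<close>

definition valid :: "nat \<Rightarrow> bool" where
  "valid l \<longleftrightarrow> (\<forall>i<len l. just (dropc l (Suc i)) (p1 (sel l i)) (p1 (p2 (sel l i))) (p2 (p2 (sel l i))))"

lemma exm_iff: "exm l Q \<longleftrightarrow> (\<exists>a\<in>set (list_decode l). Q a)"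
  unfolding exm_def by (metis in_set_conv_nth len_def sel_decode)

lemma mem_iff: "mem a l \<longleftrightarrow> a \<in> set (list_decode l)"
  by (auto simp: mem_def exm_iff)

lemma dec_exm [cmp_intro]:
  assumes "cmp f" "dec (\<lambda>z. Q (p1 z) (p2 z))"
  shows "dec (\<lambda>x. exm (f x) (\<lambda>a. Q a x))"
  unfolding exm_def
  by (intro cmp_intro assms(1) dec_comp2[where P = Q, OF assms(2)] cmp_comp[OF assms(1)])

lemma dec_mem [cmp_intro]: "cmp f \<Longrightarrow> cmp g \<Longrightarrow> dec (\<lambda>x. mem (f x) (g x))"
  by (rule dec_comp2[where P = mem]) (unfold mem_def, intro cmp_intro)

lemma dec_just [cmp_intro]:
  assumes "cmp f" "cmp g" "cmp h" "cmp k"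
  shows "dec (\<lambda>x. just (f x) (g x) (h x) (k x))"
proof -
  have "dec (\<lambda>z. just (p1 (p1 z)) (p2 (p1 z)) (p1 (p2 z)) (p2 (p2 z)))"
    unfolding just_def fact_def by (intro cmp_intro)
  from dec_comp2[where P = "\<lambda>u v. just (p1 u) (p2 u) (p1 v) (p2 v)", OF this
      cmp_pair[OF assms(1,2)] cmp_pair[OF assms(3,4)]]
  show ?thesis by simp
qed

lemma dec_valid [cmp_intro]: "cmp f \<Longrightarrow> dec (\<lambda>x. valid (f x))"
  by (rule dec_comp[where P = valid]) (unfold valid_def, intro cmp_intro)


lemma len_0 [simp]: "len 0 = 0" and len_cons [simp]: "len (cons a l) = Suc (len l)"
  by (simp_all add: len_def)

lemma dropc_cons [simp]: "dropc (cons a l) (Suc i) = dropc l i" and dropc_0 [simp]: "dropc l 0 = l"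
  by (simp_all add: dropc_def)

lemma sel_cons_0 [simp]: "sel (cons a l) 0 = a" and sel_cons_Suc [simp]: "sel (cons a l) (Suc i) = sel l i"
  by (simp_all add: sel_def cons_def) (simp add: dropc_def)

lemma valid_0 [simp]: "valid 0"
  by (simp add: valid_def)

lemma valid_cons: "valid (cons a l) \<longleftrightarrow> just l (p1 a) (p1 (p2 a)) (p2 (p2 a)) \<and> valid l"
  by (auto simp: valid_def less_Suc_eq_0_disj)

lemma just_mono:
  assumes "just l c xs y" "set (list_decode l) \<subseteq> set (list_decode l')"
  shows "just l' c xs y"
proof -
  have m: "mem a l \<Longrightarrow> mem a l'" for a using assms(2) by (auto simp: mem_iff)
  have e: "exm l Q \<Longrightarrow> (\<And>a. Q a \<Longrightarrow> Q' a) \<Longrightarrow> exm l' Q'" for Q Q'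
    unfolding exm_iff using assms(2) by blast
  have "just l c xs y \<longrightarrow> just l' c xs y"
    unfolding just_def
    by (intro disj_mono conj_mono imp_refl) (auto intro: m elim!: e)
  then show ?thesis using assms(1) ..
qed

text \<open>Justification is monotone in the set of available facts, so certificates of several
  premises can be concatenated.\<close>

lemma valid_append:
  "valid (list_encode L1) \<Longrightarrow> valid (list_encode L2) \<Longrightarrow> valid (list_encode (L1 @ L2))"
  by (induction L1) (auto simp: valid_cons elim!: just_mono)

lemma fact_simps [simp]: "p1 (fact c xs y) = c" "p1 (p2 (fact c xs y)) = xs" "p2 (p2 (fact c xs y)) = y"
  by (simp_all add: fact_def)

lemma fact_eq: "a = fact (p1 a) (p1 (p2 a)) (p2 (p2 a))"
  by (simp add: fact_def)

lemma dropc_1_Cons [simp]: "dropc (list_encode (x # xs)) (Suc 0) = list_encode xs"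
  by simp

text \<open>A certificate proves a single value, and \<open>p\<close> may diverge elsewhere. This is
  why trees of certified facts make sense for every code.\<close>

lemma certificate_sound:
  "valid (list_encode L) \<Longrightarrow> fact (code p) (list_encode xs) y \<in> set L \<Longrightarrow> computes p xs y"
proof (induction L arbitrary: p xs y)
  case (Cons a L)
  have IH: "computes q us v" if "fact (code q) (list_encode us) v \<in> set L" for q us v
    using Cons.IH Cons.prems(1) that by (simp add: valid_cons)
  show ?case
  proof (cases "a = fact (code p) (list_encode xs) y")
    case False
    then show ?thesis using IH Cons.prems(2) by auto
  next
    case True
    then have j: "just (list_encode L) (code p) (list_encode xs) y"
      using Cons.prems(1) by (simp add: valid_cons)
    show ?thesis
    proof (cases p)
      case Zero
      with j show ?thesis by (auto simp: just_def intro: computes.zero)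
    next
      case Succ
      with j obtain x where "xs = [x]" "y = Suc x"
        by (auto simp: just_def length_Suc_conv)
      with Succ show ?thesis by (auto intro: computes.succ)
    next
      case (Proj i)
      with j show ?thesis by (auto simp: just_def intro: computes.proj)
    next
      case (Comp f gs)
      with j obtain b where b: "b \<in> set L" "p1 b = code f" "p2 (p2 b) = y" "len (p1 (p2 b)) = length gs"
        "\<And>i. i < length gs \<Longrightarrow> fact (code (gs ! i)) (list_encode xs) (sel (p1 (p2 b)) i) \<in> set L"
        by (auto simp: just_def exm_iff mem_iff)
      define ys where "ys = list_decode (p1 (p2 b))"
      have "computes f ys y"
        using b(1-3) by (intro IH) (simp add: ys_def fact_eq[of b, symmetric] flip: b(2,3))
      moreover have "list_all2 (\<lambda>g y. computes g xs y) gs ys"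
        unfolding list_all2_conv_all_nth using b(4,5) IH by (auto simp: ys_def len_def sel_decode)
      ultimately show ?thesis using Comp by (auto intro: computes.comp)
    next
      case (Prec f g)
      then have "xs \<noteq> []" using j by (auto simp: just_def)
      then obtain n us where xs: "xs = n # us" by (cases xs) auto
      show ?thesis
      proof (cases n)
        case 0
        with j Prec xs have "fact (code f) (list_encode us) y \<in> set L"
          by (simp add: just_def mem_iff)
        with IH Prec xs 0 show ?thesis by (auto intro: computes.prec_0)
      next
        case (Suc m)
        with j Prec xs obtain b where b: "b \<in> set L" "p1 b = code p" "p1 (p2 b) = list_encode (m # us)"
          "fact (code g) (list_encode (m # p2 (p2 b) # us)) y \<in> set L"
          by (auto simp: just_def exm_iff mem_iff)
        have "computes p (m # us) (p2 (p2 b))"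
          using b(1) by (intro IH) (simp add: fact_eq[of b, symmetric] flip: b(2,3) encode_cons)
        with IH[OF b(4)] Prec xs Suc show ?thesis by (auto intro: computes.prec_Suc)
      qed
    next
      case (Mu f)
      with j have b: "fact (code f) (list_encode (y # xs)) 0 \<in> set L"
        "\<And>m. m < y \<Longrightarrow> \<exists>a\<in>set L. p1 a = code f \<and> p1 (p2 a) = list_encode (m # xs) \<and> 0 < p2 (p2 a)"
        by (simp_all add: just_def mem_iff exm_iff)
      have "\<exists>z. computes f (m # xs) (Suc z)" if m: "m < y" for m
      proof -
        obtain b where b: "b \<in> set L" "p1 b = code f" "p1 (p2 b) = list_encode (m # xs)" "0 < p2 (p2 b)"
          using b(2)[OF m] by blast
        have "computes f (m # xs) (p2 (p2 b))"
          using b(1) by (intro IH) (simp add: fact_eq[of b, symmetric] flip: b(2,3) encode_cons)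
        with b(4) show ?thesis by (metis Suc_pred)
      qed
      with IH[OF b(1)] Mu show ?thesis by (auto intro: computes.mu)
    qed
  qed
qed simp

definition certified :: "nat \<Rightarrow> nat list \<Rightarrow> nat \<Rightarrow> bool" where
  "certified c xs y \<longleftrightarrow> (\<exists>L. valid (list_encode L) \<and> fact c (list_encode xs) y \<in> set L)"

lemma certifiedI:
  assumes "valid (list_encode L)" "just (list_encode L) c (list_encode xs) y"
  shows "certified c xs y"
  unfolding certified_def
  by (rule exI[of _ "fact c (list_encode xs) y # L"]) (use assms in \<open>auto simp: valid_cons\<close>)

lemma certified_all:
  assumes "\<And>i. i < (k::nat) \<Longrightarrow> certified (c i) (xs i) (y i)"
  shows "\<exists>L. valid (list_encode L) \<and> (\<forall>i<k. fact (c i) (list_encode (xs i)) (y i) \<in> set L)"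
  using assms
proof (induction k)
  case 0
  show ?case by (rule exI[of _ "[]"]) simp
next
  case (Suc k)
  then obtain L where L: "valid (list_encode L)" "\<forall>i<k. fact (c i) (list_encode (xs i)) (y i) \<in> set L"
    by auto
  obtain L' where L': "valid (list_encode L')" "fact (c k) (list_encode (xs k)) (y k) \<in> set L'"
    using Suc.prems[of k] by (auto simp: certified_def)
  show ?case
    by (rule exI[of _ "L @ L'"]) (use L L' valid_append in \<open>auto simp: less_Suc_eq\<close>)
qed

lemma certificate_complete: "computes p xs y \<Longrightarrow> certified (code p) xs y"
proof (induction rule: computes.induct)
  case (zero xs)
  show ?case by (rule certifiedI[of "[]"]) (auto simp: just_def)
next
  case (succ x)
  show ?case by (rule certifiedI[of "[]"]) (auto simp: just_def simp del: encode_cons)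
next
  case (proj i xs)
  then show ?case by (intro certifiedI[of "[]"]) (auto simp: just_def)
next
  case (comp xs gs ys f z)
  then have l: "length ys = length gs" and c: "\<And>i. i < length gs \<Longrightarrow> certified (code (gs ! i)) xs (ys ! i)"
    by (auto simp: list_all2_conv_all_nth)
  obtain L where L: "valid (list_encode L)"
    "\<forall>i<length gs. fact (code (gs ! i)) (list_encode xs) (ys ! i) \<in> set L"
    using certified_all[of "length gs" "\<lambda>i. code (gs ! i)" "\<lambda>_. xs" "\<lambda>i. ys ! i"] c by auto
  obtain L' where L': "valid (list_encode L')" "fact (code f) (list_encode ys) z \<in> set L'"
    using comp.IH by (auto simp: certified_def)
  have "just (list_encode (L @ L')) (code (Comp f gs)) (list_encode xs) z"
    unfolding just_def exm_iff
    by (intro disjI2 disjI1 conjI bexI[of _ "fact (code f) (list_encode ys) z"])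
      (use L(2) L' l in \<open>auto simp: mem_iff\<close>)
  with valid_append[OF L(1) L'(1)] show ?case by (rule certifiedI)
next
  case (prec_0 f xs y g)
  then obtain L where "valid (list_encode L)" "fact (code f) (list_encode xs) y \<in> set L"
    by (auto simp: certified_def)
  then show ?case by (intro certifiedI[of L]) (auto simp: just_def mem_iff)
next
  case (prec_Suc f g n xs y z)
  then obtain L L' where L: "valid (list_encode L)" "fact (code (Prec f g)) (list_encode (n # xs)) y \<in> set L"
    "valid (list_encode L')" "fact (code g) (list_encode (n # y # xs)) z \<in> set L'"
    by (auto simp: certified_def simp del: encode_cons)
  have "just (list_encode (L @ L')) (code (Prec f g)) (list_encode (Suc n # xs)) z"
    unfolding just_def exm_iff
    by (intro disjI2 disjI1 conjI bexI[of _ "fact (code (Prec f g)) (list_encode (n # xs)) y"])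
      (use L(2,4) in \<open>auto simp: mem_iff\<close>)
  with valid_append[OF L(1,3)] show ?case by (rule certifiedI)
next
  case (mu f n xs)
  then have "\<forall>m. \<exists>y. m < n \<longrightarrow> certified (code f) (m # xs) (Suc y)" by blast
  then obtain y where y: "\<And>m. m < n \<Longrightarrow> certified (code f) (m # xs) (Suc (y m))" by metis
  obtain L where L: "valid (list_encode L)"
    "\<forall>m<n. fact (code f) (list_encode (m # xs)) (Suc (y m)) \<in> set L"
    using certified_all[of n "\<lambda>_. code f" "\<lambda>m. m # xs" "\<lambda>m. Suc (y m)"] y by auto
  obtain L' where L': "valid (list_encode L')" "fact (code f) (list_encode (n # xs)) 0 \<in> set L'"
    using mu.IH by (auto simp: certified_def)
  have "just (list_encode (L @ L')) (code (Mu f)) (list_encode xs) n"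
  proof -
    have "\<exists>a\<in>set (L @ L'). p1 a = code f \<and> p1 (p2 a) = cons m (list_encode xs) \<and> 0 < p2 (p2 a)"
      if "m < n" for m
      using L(2) that by (intro bexI[of _ "fact (code f) (list_encode (m # xs)) (Suc (y m))"]) auto
    then show ?thesis
      using L'(2) unfolding just_def exm_iff mem_iff by simp
  qed
  with valid_append[OF L(1) L'(1)] show ?case by (rule certifiedI)
qed

lemma computable_setI: "dec (\<lambda>x. x \<in> A) \<Longrightarrow> computable_set A"
proof -
  assume "dec (\<lambda>x. x \<in> A)"
  then obtain p where p: "length xs = 1 \<Longrightarrow> computes p xs (if xs ! 0 \<in> A then 1 else 0)" for xs
    unfolding dec_def cmp_def computableN_def by auto
  have "computes p [x] (if x \<in> A then 1 else 0)" for x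
    using p[of "[x]"] by simp
  then show ?thesis unfolding computable_set_def by blast
qed

lemma computable_relI: "dec (\<lambda>z. (p1 z, p2 z) \<in> r) \<Longrightarrow> computable_rel r"
proof -
  assume "dec (\<lambda>z. (p1 z, p2 z) \<in> r)"
  then have c: "cmp (\<lambda>z. if (p1 z, p2 z) \<in> r then 1 else 0)"
    unfolding dec_def .
  have "computableN 2 (\<lambda>xs. pair (xs ! 0) (xs ! 1))"
    by (intro computableN_pair computableN_proj) simp_all
  from computableN_cmp[OF c this]
  have "computableN 2 (\<lambda>xs. if (xs ! 0, xs ! 1) \<in> r then 1 else 0)" by simp
  then obtain p where p: "length xs = 2 \<Longrightarrow> computes p xs (if (xs ! 0, xs ! 1) \<in> r then 1 else 0)" for xs
    unfolding computableN_def by auto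
  have "computes p [x, y] (if (x, y) \<in> r then 1 else 0)" for x y
    using p[of "[x, y]"] by simp
  then show ?thesis unfolding computable_rel_def by blast
qed

section \<open>Ranks in linear orders of the natural numbers\<close>

definition slo :: "(nat \<Rightarrow> nat \<Rightarrow> bool) \<Rightarrow> bool" where
  "slo lt \<longleftrightarrow> (\<forall>x. \<not> lt x x) \<and> (\<forall>x y z. lt x y \<longrightarrow> lt y z \<longrightarrow> lt x z) \<and> (\<forall>x y. x = y \<or> lt x y \<or> lt y x)"

lemma slo_irrefl: "slo lt \<Longrightarrow> \<not> lt x x"
  and slo_trans: "slo lt \<Longrightarrow> lt x y \<Longrightarrow> lt y z \<Longrightarrow> lt x z"
  and slo_total: "slo lt \<Longrightarrow> x = y \<or> lt x y \<or> lt y x"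
  unfolding slo_def by blast+

lemma slo_asym: "slo lt \<Longrightarrow> lt x y \<Longrightarrow> \<not> lt y x"
  using slo_irrefl slo_trans by metis

abbreviation std :: "(nat \<Rightarrow> nat \<Rightarrow> bool) \<Rightarrow> nat \<Rightarrow> bool" where
  "std lt x \<equiv> Wellfounded.accp lt x"

definition rel :: "(nat \<Rightarrow> nat \<Rightarrow> bool) \<Rightarrow> nat set \<Rightarrow> nat rel" where
  "rel lt S = {(y, z). y \<in> S \<and> z \<in> S \<and> (y = z \<or> lt y z)}"

lemma Field_rel [simp]: "Field (rel lt S) = S"
  by (auto simp: rel_def Field_def)

lemma linear_order_rel: "slo lt \<Longrightarrow> linear_order_on S (rel lt S)"
  unfolding order_on_defs
  by (auto simp: rel_def refl_on_def trans_def antisym_def total_on_def slo_def)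

lemma well_order_rel:
  assumes "slo lt" "\<And>x. x \<in> S \<Longrightarrow> std lt x"
  shows "Well_order (rel lt S)"
proof -
  have "wf (rel lt S - Id)"
  proof (rule wfUNIVI)
    fix P :: "nat \<Rightarrow> bool" and x
    assume step: "\<forall>x. (\<forall>y. (y, x) \<in> rel lt S - Id \<longrightarrow> P y) \<longrightarrow> P x"
    have "P x" if "std lt x" for x
      using that
    proof (induction rule: accp.induct)
      case IH: (accI x)
      have "P y" if "(y, x) \<in> rel lt S - Id" for y
        using that IH by (auto simp: rel_def)
      with step show ?case by blast
    qed
    then show "P x" using step assms(2) by (cases "x \<in> S") (auto simp: rel_def)
  qed
  with linear_order_rel[OF assms(1), of S] show ?thesis by (simp add: well_order_on_def)
qed

section \<open>Order types of initial segments as ordinals\<close>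

lemma abs_cord_less: "Well_order r \<Longrightarrow> Well_order s \<Longrightarrow> abs_cord r < abs_cord s \<longleftrightarrow> (r, s) \<in> ordLess"
  using less_cord.abs_eq ordIso_reflexive by blast

lemma abs_cord_eq: "Well_order r \<Longrightarrow> Well_order s \<Longrightarrow> abs_cord r = abs_cord s \<longleftrightarrow> (r, s) \<in> ordIso"
  using Quotient3_rel[OF Quotient3_cord, of r s] by (simp add: ordIso_reflexive)

lemma cord_cases: obtains r where "Well_order r" "c = abs_cord r"
proof -
  have "(rep_cord c, rep_cord c) \<in> ordIso" "abs_cord (rep_cord c) = c"
    using Quotient3_rep_reflp[OF Quotient3_cord] Quotient3_abs_rep[OF Quotient3_cord] by auto
  moreover have "Well_order (rep_cord c)"
    using calculation(1) by (simp add: ordIso_def)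
  ultimately show thesis using that by metis
qed

lemma less_abs_cord_iff:
  assumes "Well_order r"
  shows "\<beta> < abs_cord r \<longleftrightarrow> (\<exists>a\<in>Field r. \<beta> = abs_cord (Restr r (underS r a)))"
proof -
  obtain s where s: "Well_order s" "\<beta> = abs_cord s" by (rule cord_cases)
  show ?thesis
    using s assms Well_order_Restr[OF assms] by (simp add: abs_cord_less abs_cord_eq ordLess_iff_ordIso_Restr)
qed

text \<open>A genuine ordinal when \<open>x\<close> is standard, which the lemmas about it assume;
  the value is then the usual rank, the type of the set of predecessors.\<close>

definition rk :: "(nat \<Rightarrow> nat \<Rightarrow> bool) \<Rightarrow> nat \<Rightarrow> cord" where
  "rk lt x = abs_cord (rel lt {y. lt y x})"

lemma Restr_rel: "Restr (rel lt S) (underS (rel lt S) a) = rel lt {y \<in> S. lt y a}" if "slo lt" "a \<in> S"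
  using that slo_irrefl[OF that(1)] by (auto simp: rel_def underS_def)

lemma less_rel_iff:
  assumes "slo lt" "\<And>x. x \<in> S \<Longrightarrow> std lt x" "\<And>x y. x \<in> S \<Longrightarrow> lt y x \<Longrightarrow> y \<in> S"
  shows "\<beta> < abs_cord (rel lt S) \<longleftrightarrow> (\<exists>y\<in>S. rk lt y = \<beta>)"
proof -
  have "{y \<in> S. lt y a} = {y. lt y a}" if "a \<in> S" for a using that assms(3) by blast
  then show ?thesis
    using less_abs_cord_iff[OF well_order_rel, of lt S \<beta>] assms(1,2) by (auto simp: rk_def Restr_rel)
qed

lemma less_rk_iff:
  assumes "slo lt" "std lt x"
  shows "\<beta> < rk lt x \<longleftrightarrow> (\<exists>y. lt y x \<and> rk lt y = \<beta>)"
  using less_rel_iff[OF assms(1), of "{y. lt y x}" \<beta>] assms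
  by (auto simp: rk_def[of lt x] dest: accp_downward slo_trans[OF assms(1)])

lemma rk_mono: "slo lt \<Longrightarrow> std lt x \<Longrightarrow> lt y x \<Longrightarrow> rk lt y < rk lt x"
  using less_rk_iff by blast

lemma rk_less_iff: "slo lt \<Longrightarrow> std lt x \<Longrightarrow> std lt y \<Longrightarrow> rk lt y < rk lt x \<longleftrightarrow> lt y x"
  by (metis less_asym less_irrefl rk_mono slo_total)

lemma rk_inj: "slo lt \<Longrightarrow> std lt x \<Longrightarrow> std lt y \<Longrightarrow> rk lt y = rk lt x \<longleftrightarrow> x = y"
  by (metis less_irrefl rk_mono slo_total)

definition rel_rk :: "nat rel \<Rightarrow> nat \<Rightarrow> cord" where
  "rel_rk r a = abs_cord (Restr r (underS r a))"

lemma less_rel_rk_iff: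
  assumes "Well_order r"
  shows "\<beta> < rel_rk r a \<longleftrightarrow> (\<exists>b\<in>underS r a. \<beta> = rel_rk r b)"
proof -
  have tr: "trans r" and an: "antisym r" and re: "refl_on (Field r) r"
    using assms by (auto simp: order_on_defs)
  let ?s = "Restr r (underS r a)"
  have F: "Field ?s = underS r a"
    using re by (auto simp: Field_def underS_def refl_on_def)
  have "Restr ?s (underS ?s b) = Restr r (underS r b)" if "b \<in> underS r a" for b
    using that tr an by (auto simp: underS_def dest: transD antisymD)
  then show ?thesis
    using less_abs_cord_iff[OF Well_order_Restr[OF assms], of \<beta> "underS r a"]
    by (simp add: rel_rk_def F)
qed

lemma computable_restriction:
  assumes "slo lt" "dec (\<lambda>z. lt (p1 z) (p2 z))" "dec (\<lambda>x. x \<in> S)" "\<And>x. x \<in> S \<Longrightarrow> std lt x"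
  shows "computable_ordinal (abs_cord (rel lt S))"
proof -
  have "dec (\<lambda>z. (p1 z, p2 z) \<in> rel lt S)"
    unfolding rel_def using assms(2,3)
    by (auto intro!: cmp_intro dec_comp[OF assms(3)])
  then have "computable_linear_order (Field (rel lt S)) (rel lt S)"
    unfolding computable_linear_order_def
    by (simp add: linear_order_rel assms(1) computable_setI assms(3) computable_relI)
  with well_order_rel[OF assms(1,4)] show ?thesis
    unfolding computable_ordinal_def by blast
qed

lemma computable_rk:
  assumes "slo lt" "dec (\<lambda>z. lt (p1 z) (p2 z))" "std lt x"
  shows "computable_ordinal (rk lt x)"
  unfolding rk_def
  by (rule computable_restriction[OF assms(1,2)])
    (auto intro!: dec_comp2[where P = lt, OF assms(2)] cmp_intro dest: accp_downward[OF assms(3)])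

lemma not_accp_descending:
  assumes "\<not> std lt (x :: nat)"
  shows "\<exists>d. \<forall>n. lt (d (Suc n)) (d n)"
proof -
  have "\<exists>y. \<not> std lt y \<and> lt y x" if "\<not> std lt x" for x using that accp.accI[of lt x] by blast
  then obtain g where g: "\<And>x. \<not> std lt x \<Longrightarrow> \<not> std lt (g x) \<and> lt (g x) x" by metis
  have "\<not> std lt ((g ^^ n) x)" for n using g assms by (induction n) auto
  then show ?thesis by (intro exI[of _ "\<lambda>n. (g ^^ n) x"]) (auto simp: g)
qed

lemma accp_no_descending:
  assumes "std lt x" "lt (d 0) x" "\<And>n. lt (d (Suc n)) (d n)"
  shows False
proof -
  have "\<forall>d. d 0 = y \<longrightarrow> \<not> (\<forall>n. lt (d (Suc n)) (d n))" if "std lt y" for y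
    using that
  proof (induction rule: accp.induct)
    case IH: (accI y)
    show ?case
    proof (intro allI impI notI)
      fix d assume d: "d 0 = y" "\<forall>n. lt (d (Suc n)) (d n)"
      then have "lt (d 1) y" by (metis One_nat_def)
      with IH(2)[of "d 1"] d(2) show False by (auto dest: spec[of _ "\<lambda>n. d (Suc n)"])
    qed
  qed
  then show False using assms accp_downward by metis
qed

section \<open>Kleene--Brouwer orders\<close>

text \<open>Reversing the entries and swapping the arguments of \<open>lexord\<close> gives the
  Kleene--Brouwer order: \<open>s\<close> precedes \<open>t\<close> if it properly extends
  \<open>t\<close> or is smaller at the first difference.\<close>

definition kb :: "nat list \<Rightarrow> nat list \<Rightarrow> bool" where
  "kb s t \<longleftrightarrow> (t, s) \<in> lexord {(a, b). b < a}"

text \<open>The codes outside the tree \<open>T\<close> are put on top of those in \<open>T\<close>, so that the order lives on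
  all natural numbers.\<close>

definition KB :: "(nat \<Rightarrow> bool) \<Rightarrow> nat \<Rightarrow> nat \<Rightarrow> bool" where
  "KB T a b \<longleftrightarrow> T a \<and> T b \<and> kb (list_decode a) (list_decode b) \<or> T a \<and> \<not> T b \<or> \<not> T a \<and> \<not> T b \<and> a < b"

lemma kb_irrefl: "\<not> kb s s"
  unfolding kb_def by (rule lexord_irreflexive) simp

lemma kb_trans: "kb s t \<Longrightarrow> kb t u \<Longrightarrow> kb s u"
  unfolding kb_def by (rule lexord_trans) (auto simp: trans_def)

lemma kb_total: "s = t \<or> kb s t \<or> kb t s"
proof -
  have "total (lexord {(a::nat, b). b < a})" by (rule total_lexord) (auto simp: total_on_def)
  then show ?thesis unfolding kb_def total_on_def by blast
qed

lemma kb_extension: "u \<noteq> [] \<Longrightarrow> kb (s @ u) s"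
  unfolding kb_def by (rule lexord_append_rightI) (cases u; simp)

lemma slo_KB: "slo (KB T)"
proof -
  have inj: "list_decode a = list_decode b \<Longrightarrow> a = b" for a b
    by (metis list_decode_inverse)
  show ?thesis
    unfolding slo_def
  proof (intro conjI allI impI)
    show "\<not> KB T x x" for x by (simp add: KB_def kb_irrefl)
    show "KB T x z" if "KB T x y" "KB T y z" for x y z
      using that by (auto simp: KB_def intro: kb_trans)
    show "x = y \<or> KB T x y \<or> KB T y x" for x y
      using kb_total[of "list_decode x" "list_decode y"] inj by (auto simp: KB_def)
  qed
qed

lemma kb_index:
  "kb (list_decode a) (list_decode b) \<longleftrightarrow> len b < len a \<and> (\<forall>i<len b. sel a i = sel b i) \<or>
    (\<exists>i<len a. i < len b \<and> (\<forall>j<i. sel a j = sel b j) \<and> sel a i < sel b i)"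
proof -
  let ?a = "list_decode a" and ?b = "list_decode b"
  have 1: "take (length ?b) ?a = ?b \<longleftrightarrow> (\<forall>i<length ?b. ?a ! i = ?b ! i)" if "length ?b < length ?a"
    using that by (auto simp: list_eq_iff_nth_eq)
  have 2: "take i ?a = take i ?b \<longleftrightarrow> (\<forall>j<i. ?a ! j = ?b ! j)" if "i < length ?a" "i < length ?b" for i
    using that by (auto simp: list_eq_iff_nth_eq)
  have A: "length ?b < length ?a \<and> take (length ?b) ?a = ?b \<longleftrightarrow> len b < len a \<and> (\<forall>i<len b. sel a i = sel b i)"
    using 1 by (auto simp: len_def sel_decode)
  have "(i < min (length ?b) (length ?a) \<and> take i ?b = take i ?a \<and> (?b ! i, ?a ! i) \<in> {(a, b). b < a}) \<longleftrightarrow>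
      i < len a \<and> i < len b \<and> (\<forall>j<i. sel a j = sel b j) \<and> sel a i < sel b i" for i
    using 2[of i] by (auto simp: len_def sel_decode)
  then show ?thesis
    unfolding kb_def lexord_take_index_conv A by blast
qed

lemma dec_KB:
  assumes T: "dec (\<lambda>z. T (p1 z) (p2 z))" and fgh: "cmp f" "cmp g" "cmp h"
  shows "dec (\<lambda>x. KB (T (f x)) (g x) (h x))"
proof -
  have "dec (\<lambda>z. KB (T (p1 z)) (p1 (p2 z)) (p2 (p2 z)))"
    unfolding KB_def kb_index by (intro cmp_intro dec_comp2[where P = T, OF T])
  from dec_comp[OF this cmp_pair[OF fgh(1) cmp_pair[OF fgh(2,3)]]] show ?thesis by simp
qed

text \<open>Without infinite paths the child relation is well-founded. Accessibility is then proved
  by two nested inductions: over nodes, from children to parents, and over the children of a node,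
  from left to right.\<close>

lemma KB_std:
  fixes T :: "nat \<Rightarrow> bool"
  assumes closed: "\<And>s n. T (list_encode (s @ [n])) \<Longrightarrow> T (list_encode s)"
    and no_path: "\<And>f. \<exists>n. \<not> T (list_encode (map f [0..<n]))"
  shows "std (KB T) a"
proof -
  define P where "P s = T (list_encode s)" for s
  have closed': "P (s @ u) \<Longrightarrow> P s" for s u
    by (induction u rule: rev_induct) (auto simp: P_def simp flip: append_assoc dest: closed)
  define L where "L s t \<longleftrightarrow> P s \<and> P t \<and> kb s t" for s t
  have wf_child: "wf {(s @ [n], s) | s n. P (s @ [n])}"
  proof (rule ccontr)
    assume "\<not> wf {(s @ [n], s) | s n. P (s @ [n])}"
    then obtain c where c: "\<And>i. (c (Suc i), c i) \<in> {(s @ [n], s) | s n. P (s @ [n])}"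
      unfolding wf_iff_no_infinite_down_chain by blast
    then have "\<forall>i. \<exists>n. c (Suc i) = c i @ [n] \<and> P (c (Suc i))" by (auto, metis)
    then obtain g where g: "\<And>i. c (Suc i) = c i @ [g i]" "\<And>i. P (c (Suc i))" by metis
    have ci: "c i = c 0 @ map g [0..<i]" for i by (induction i) (auto simp: g)
    define f where "f i = (if i < length (c 0) then c 0 ! i else g (i - length (c 0)))" for i
    have "map f [0..<length (c 0) + i] = c i" for i
      unfolding ci[of i] by (rule nth_equalityI) (auto simp: f_def nth_append)
    moreover have "P (map f [0..<i])" for i
    proof -
      have "map f [0..<length (c 0) + Suc i] = map f [0..<i] @ map f [i..<length (c 0) + Suc i]"
        using upt_add_eq_append[of 0 i "Suc (length (c 0))"] by (simp add: add.commute)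
      then show ?thesis using g(2)[of i] calculation[of "Suc i"] closed' by metis
    qed
    ultimately show False using no_path[of f] P_def by blast
  qed
  define left where "left s t \<longleftrightarrow> kb t s \<and> \<not> (\<exists>u. t = s @ u)" for s t
  \<comment> \<open>Whatever precedes an extension of \<open>s\<close> lies left of \<open>s\<close>
    or extends \<open>s\<close> itself. So the accessibility of the left side is the only outside
    information, and at the root it is vacuous.\<close>
  have C: "(\<forall>t. left s t \<longrightarrow> Wellfounded.accp L t) \<longrightarrow> (\<forall>u. Wellfounded.accp L (s @ u))" for s
    using wf_child
  proof (induction s rule: wf_induct_rule)
    case outer: (less s)
    show ?case
    proof (intro impI)
      assume left: "\<forall>t. left s t \<longrightarrow> Wellfounded.accp L t"
      have child: "Wellfounded.accp L (s @ n # u)" for n u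
      proof (induction n arbitrary: u rule: less_induct)
        case (less n)
        show ?case
        proof (cases "P (s @ [n])")
          case True
          have l: "Wellfounded.accp L t" if t: "left (s @ [n]) t" for t
          proof (cases "left s t")
            case False
            have "kb t s" using t kb_extension[of "[n]" s] kb_trans by (auto simp: left_def)
            then obtain u where u: "t = s @ u"
              using False by (auto simp: left_def)
            moreover have "u \<noteq> []" using \<open>kb t s\<close> kb_irrefl u by auto
            ultimately
            obtain m v where m: "u = m # v" by (cases u) auto
            have "m < n"
            proof (rule ccontr)
              assume "\<not> m < n"
              moreover have "m \<noteq> n" using t m u by (auto simp: left_def)
              ultimately have "(t, s @ [n]) \<in> lexord {(a, b). b < a}"
                unfolding u m by (intro lexord_append_leftI) simp
              then have "kb (s @ [n]) t" by (simp add: kb_def)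
              with t show False using kb_irrefl kb_trans left_def by blast
            qed
            with less.IH u m show ?thesis by simp
          qed (use left in blast)
          have "(s @ [n], s) \<in> {(s @ [n], s) | s n. P (s @ [n])}"
            by (rule CollectI, intro exI conjI, rule refl, rule True)
          then have "(\<forall>t. left (s @ [n]) t \<longrightarrow> Wellfounded.accp L t) \<longrightarrow> (\<forall>u. Wellfounded.accp L ((s @ [n]) @ u))"
            by (rule outer)
          then have "\<forall>u. Wellfounded.accp L ((s @ [n]) @ u)"
            by (rule mp) (intro allI impI l)
          then show ?thesis by simp
        next
          case False
          then have nP: "\<not> P (s @ n # u)" using closed'[of "s @ [n]" u] by auto
          show ?thesis by (rule accpI) (use nP in \<open>simp add: L_def\<close>)
        qed
      qed
      have "Wellfounded.accp L s"
      proof (rule accpI)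
        fix t assume "L t s"
        then have k: "kb t s" by (simp add: L_def)
        show "Wellfounded.accp L t"
        proof (cases "left s t")
          case False
          then obtain u where "t = s @ u" using k by (auto simp: left_def)
          with child k kb_irrefl show ?thesis by (cases u) auto
        qed (use left in blast)
      qed
      with child show "\<forall>u. Wellfounded.accp L (s @ u)"
 by (metis append_Nil2 list.exhaust)
    qed
  qed
  have nil: "\<not> left [] t" for t by (simp add: left_def)
  have all: "Wellfounded.accp L t" for t using C[of "[]"] nil by auto
  have T: "std (KB T) a" if "T a" for a
  proof -
    have "std (KB T) (list_encode t)" if "P t" for t
      using all[of t] that
    proof (induction rule: accp.induct)
      case (accI t)
      show ?case
      proof (rule accpI)
        fix b assume "KB T b (list_encode t)"
        then have b: "T b" "kb (list_decode b) t" using accI.prems by (auto simp: KB_def P_def)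
        then have "L (list_decode b) t" using accI.prems by (simp add: L_def P_def)
        from accI.IH[OF this] b show "std (KB T) b" by (simp add: P_def)
      qed
    qed
    from this[of "list_decode a"] that show ?thesis by (simp add: P_def)
  qed
  show ?thesis
  proof (induction a rule: less_induct)
    case (less a)
    show ?case
    proof (cases "T a")
      case False
      show ?thesis
      proof (rule accpI)
        fix b assume "KB T b a"
        with False have "T b \<or> b < a" by (auto simp: KB_def)
        with less T show "std (KB T) b" by blast
      qed
    qed (rule T)
  qed
qed


lemma initial_embedding_rk:
  assumes A: "slo A" and B: "slo B" and v: "\<And>x x'. A x x' \<Longrightarrow> B (v x) (v x')"
    and initial: "\<And>x y. B y (v x) \<Longrightarrow> \<exists>x'. v x' = y"
    and x: "std A x"
  shows "std B (v x) \<and> rk B (v x) = rk A x"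
  using x
proof (induction rule: accp.induct)
  case (accI x)
  have below: "B y (v x) \<longleftrightarrow> (\<exists>x'. A x' x \<and> y = v x')" for y
    using initial v slo_total[OF A] slo_asym[OF B] slo_irrefl[OF B] by metis
  have s: "std B (v x)"
    by (rule accpI) (use below accI.IH in auto)
  have "std A x" using accI.hyps by (rule accpI)
  then have "\<beta> < rk B (v x) \<longleftrightarrow> \<beta> < rk A x" for \<beta>
    unfolding less_rk_iff[OF B s] less_rk_iff[OF A \<open>std A x\<close>] below using accI.IH by metis
  then have "rk B (v x) = rk A x"
    by (metis less_irrefl linorder_neqE)
  with s show ?case by simp
qed

text \<open>If all ranks of \<open>A\<close> occur in \<open>B\<close>, matching equal ranks embeds
  \<open>A\<close> onto an initial segment. Otherwise a rank of \<open>A\<close> that is missing in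
  \<open>B\<close> exceeds all ranks of \<open>B\<close>.\<close>

lemma well_orders_comparable:
  assumes A: "slo A" "\<And>x. std A x" and B: "slo B" "\<And>x. std B x"
  shows "(\<exists>v. (\<forall>x x'. A x x' \<longrightarrow> B (v x) (v x')) \<and> (\<forall>x y. B y (v x) \<longrightarrow> (\<exists>x'. v x' = y))) \<or>
    (\<exists>v. \<forall>x x'. B x x' \<longrightarrow> A (v x) (v x'))"
proof (cases "\<forall>x. \<exists>y. rk B y = rk A x")
  case True
  then obtain v where v: "\<And>x. rk B (v x) = rk A x" by metis
  have "B (v x) (v x')" if "A x x'" for x x'
    using that v rk_less_iff[OF A(1)] rk_less_iff[OF B(1)] A B by metis
  moreover have "\<exists>x'. v x' = y" if y: "B y (v x)" for x y
  proof -
    have "rk B y < rk A x" using rk_mono[OF B(1) B(2) y] v by simp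
    then obtain x' where "rk A x' = rk B y" using less_rk_iff[OF A(1) A(2)] by metis
    then have "v x' = y" using v rk_inj[OF B(1) B(2) B(2)] by metis
    then show ?thesis ..
  qed
  ultimately show ?thesis by blast
next
  case False
  then obtain x where x: "\<And>y. rk B y \<noteq> rk A x" by blast
  have "rk B y < rk A x" for y
  proof (rule ccontr)
    assume "\<not> rk B y < rk A x"
    then have "rk A x < rk B y" using x[of y] by (metis linorder_neqE)
    then show False using less_rk_iff[OF B(1) B(2)] x by metis
  qed
  then have "\<forall>y. \<exists>x'. rk A x' = rk B y" using less_rk_iff[OF A(1) A(2)] by metis
  then obtain v where v: "\<And>y. rk A (v y) = rk B y" by metis
  have "A (v x) (v x')" if "B x x'" for x x'
    using that v rk_less_iff[OF A(1)] rk_less_iff[OF B(1)] A B by metis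
  then show ?thesis by blast
qed

section \<open>A computable linear order whose well-founded part is maximal\<close>

text \<open>\<open>descent_tree e\<close> consists of the certified descending sequences of the relation computed by
  the program with code \<open>e\<close>; it is decidable also when \<open>e\<close> does not compute a total relation.\<close>

definition dstep :: "nat \<Rightarrow> nat \<Rightarrow> nat \<Rightarrow> bool" where
  "dstep e v v' \<longleftrightarrow> p1 v' \<noteq> p1 v \<and> valid (p2 v') \<and> mem (fact e (cons (p1 v') (cons (p1 v) 0)) 1) (p2 v')"

definition descent_tree :: "nat \<Rightarrow> nat \<Rightarrow> bool" where
  "descent_tree e a \<longleftrightarrow> (\<forall>i<len a - 1. dstep e (sel a i) (sel a (Suc i)))"

text \<open>A linear order of all numbers for every \<open>e\<close>, decidable uniformly in
  \<open>e\<close>; if \<open>e\<close> computes a well-order, then \<open>L e\<close> is a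
  well-order that is at least as long.\<close>

definition L :: "nat \<Rightarrow> nat \<Rightarrow> nat \<Rightarrow> bool" where
  "L e = KB (descent_tree e)"

lemma slo_L: "slo (L e)"
  by (simp add: L_def slo_KB)

lemma dec_L [cmp_intro]: "cmp f \<Longrightarrow> cmp g \<Longrightarrow> cmp h \<Longrightarrow> dec (\<lambda>x. L (f x) (g x) (h x))"
  unfolding L_def
  by (rule dec_KB) (unfold descent_tree_def dstep_def fact_def, intro cmp_intro)

lemma descent_tree_encode:
  "descent_tree e (list_encode s) \<longleftrightarrow> (\<forall>i. Suc i < length s \<longrightarrow> dstep e (s ! i) (s ! Suc i))"
  by (auto simp: descent_tree_def less_diff_conv)

lemma L_child: "descent_tree e (list_encode (s @ [v])) \<Longrightarrow> L e (list_encode (s @ [v])) (list_encode s)"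
  using kb_extension[of "[v]" s] by (auto simp: L_def KB_def descent_tree_encode nth_append)

lemma descent_tree_snoc:
  "s \<noteq> [] \<Longrightarrow> descent_tree e (list_encode s) \<Longrightarrow> dstep e (last s) v \<Longrightarrow> descent_tree e (list_encode (s @ [v]))"
  by (auto simp: descent_tree_encode nth_append last_conv_nth less_Suc_eq)
    (metis Suc_lessI diff_Suc_Suc diff_zero)

text \<open>Determinism excludes false certificates, so an infinite path would descend in
  \<open>r\<close>. Conversely every \<open>r\<close>-predecessor of the last entry can be appended
  together with a certificate, so ranks in \<open>r\<close> are bounded by ranks in the tree. The
  number \<open>0\<close> codes the empty sequence, the greatest node.\<close>

lemma well_order_descent_tree:
  assumes p: "\<And>x y. computes p [x, y] (if (x, y) \<in> r then 1 else 0)" and r: "Well_order r"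
  shows "std (L (code p)) a" and "abs_cord r \<le> rk (L (code p)) 0"
proof -
  let ?e = "code p"
  have step: "(p1 v', p1 v) \<in> r - Id" if "dstep ?e v v'" for v v'
  proof -
    have "computes p [p1 v', p1 v] 1"
      using certificate_sound[of "list_decode (p2 v')" p "[p1 v', p1 v]" 1] that
      by (simp add: dstep_def mem_iff)
    from computes_deterministic[OF this p] have "(p1 v', p1 v) \<in> r"
      by (auto split: if_splits)
    with that show ?thesis by (simp add: dstep_def)
  qed
  have ex_step: "\<exists>c. dstep ?e v (pair x c)" if "(x, p1 v) \<in> r" "x \<noteq> p1 v" for v x
  proof -
    have "certified ?e [x, p1 v] 1"
      using p[of x "p1 v"] that certificate_complete by auto
    then obtain c where "valid (list_encode c)" "fact ?e (list_encode [x, p1 v]) 1 \<in> set c"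
      by (auto simp: certified_def)
    then show ?thesis
      using that by (intro exI[of _ "list_encode c"]) (auto simp: dstep_def mem_iff)
  qed
  have wf: "wf (r - Id)" using r by (simp add: well_order_on_def)
  show std: "std (L ?e) a" for a
    unfolding L_def
  proof (rule KB_std)
    show "descent_tree ?e (list_encode s)" if "descent_tree ?e (list_encode (s @ [n]))" for s n
      unfolding descent_tree_encode
    proof (intro allI impI)
      fix i assume i: "Suc i < length s"
      then have "dstep ?e ((s @ [n]) ! i) ((s @ [n]) ! Suc i)"
        using that unfolding descent_tree_encode by auto
      with i show "dstep ?e (s ! i) (s ! Suc i)" by (simp add: nth_append)
    qed
  next
    fix f :: "nat \<Rightarrow> nat"
    show "\<exists>n. \<not> descent_tree ?e (list_encode (map f [0..<n]))"
    proof (rule ccontr)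
      assume *: "\<not> ?thesis"
      have "dstep ?e (f i) (f (Suc i))" for i
      proof -
        have "descent_tree ?e (list_encode (map f [0..<Suc (Suc i)]))" using * by blast
        then have "dstep ?e (map f [0..<Suc (Suc i)] ! i) (map f [0..<Suc (Suc i)] ! Suc i)"
          unfolding descent_tree_encode by (rule allE[of _ i]) simp
        then show ?thesis by (simp del: upt_Suc)
      qed
      then have "(p1 (f (Suc i)), p1 (f i)) \<in> r - Id" for i by (rule step)
      then have "\<exists>g. \<forall>i. (g (Suc i), g i) \<in> r - Id" by (intro exI[of _ "\<lambda>i. p1 (f i)"]) blast
      with wf show False unfolding wf_iff_no_infinite_down_chain by blast
    qed
  qed
  have node: "rel_rk r x \<le> rk (L ?e) (list_encode s)"
    if "s \<noteq> []" "p1 (last s) = x" "descent_tree ?e (list_encode s)" for s x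
    using wf that
  proof (induction x arbitrary: s rule: wf_induct_rule)
    case (less x)
    show ?case
    proof (rule ccontr)
      assume "\<not> ?thesis"
      then have "rk (L ?e) (list_encode s) < rel_rk r x" by simp
      then obtain y where y: "y \<in> underS r x" "rk (L ?e) (list_encode s) = rel_rk r y"
        using less_rel_rk_iff[OF r] by blast
      then obtain c where c: "dstep ?e (last s) (pair y c)"
        using ex_step[of y "last s"] less.prems by (auto simp: underS_def)
      let ?t = "s @ [pair y c]"
      have t: "descent_tree ?e (list_encode ?t)"
        using less.prems c by (intro descent_tree_snoc)
      have "rel_rk r y \<le> rk (L ?e) (list_encode ?t)"
        by (rule less.IH) (use y t in \<open>auto simp: underS_def\<close>)
      also have "\<dots> < rk (L ?e) (list_encode s)"
        by (rule rk_mono[OF slo_L std L_child[OF t]])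
      finally show False using y by simp
    qed
  qed
  show "abs_cord r \<le> rk (L ?e) 0"
  proof (rule ccontr)
    assume "\<not> ?thesis"
    then have "rk (L ?e) 0 < abs_cord r" by simp
    then obtain a where a: "rk (L ?e) 0 = rel_rk r a"
      using less_abs_cord_iff[OF r] by (auto simp: rel_rk_def)
    have t: "descent_tree ?e (list_encode ([] @ [pair a 0]))" by (simp add: descent_tree_def)
    have "rel_rk r a \<le> rk (L ?e) (list_encode ([] @ [pair a 0]))"
      by (rule node) (use t in auto)
    also have "\<dots> < rk (L ?e) (list_encode [])"
      by (rule rk_mono[OF slo_L std L_child[OF t]])
    finally show False using a by simp
  qed
qed

text \<open>\<open>compat e n m a b\<close> is the condition on two values \<open>a = w n\<close>, \<open>b = w m\<close> of a witness \<open>w\<close> for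
  the following property of \<open>L e\<close>: for every \<open>i\<close>, either \<open>L i\<close> has a descending sequence (kind 0),
  or \<open>L i\<close> is isomorphic to an initial segment of \<open>L e\<close> (kind 1), or \<open>L e\<close> embeds into \<open>L i\<close>
  (kind 2). Arguments of \<open>w\<close> have the form \<open>pair i (pair x y)\<close>, its values have the form
  \<open>pair kind (pair v h)\<close>, where \<open>v\<close> is the value of the sequence or embedding at \<open>x\<close>, and \<open>h\<close> is a
  preimage of \<open>y\<close> if \<open>y\<close> lies below \<open>v\<close>.\<close>

definition compat :: "nat \<Rightarrow> nat \<Rightarrow> nat \<Rightarrow> nat \<Rightarrow> nat \<Rightarrow> bool" where
  "compat e n m a b \<longleftrightarrow> (p1 n = p1 m \<longrightarrow>
    p1 a = p1 b \<and> (p1 (p2 n) = p1 (p2 m) \<longrightarrow> p1 (p2 a) = p1 (p2 b)) \<and>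
    (p1 a = 0 \<and> (p1 (p2 m) = Suc (p1 (p2 n)) \<longrightarrow> L (p1 n) (p1 (p2 b)) (p1 (p2 a))) \<or>
     p1 a = 1 \<and> (L (p1 n) (p1 (p2 n)) (p1 (p2 m)) \<longrightarrow> L e (p1 (p2 a)) (p1 (p2 b))) \<and>
       (L e (p2 (p2 n)) (p1 (p2 a)) \<and> p1 (p2 m) = p2 (p2 a) \<longrightarrow> p1 (p2 b) = p2 (p2 n)) \<or>
     p1 a = 2 \<and> (L e (p1 (p2 n)) (p1 (p2 m)) \<longrightarrow> L (p1 n) (p1 (p2 a)) (p1 (p2 b)))))"

definition pseudo_wo :: "nat \<Rightarrow> bool" where
  "pseudo_wo e \<longleftrightarrow> (\<exists>w. \<forall>n m. compat e n m (w n) (w m))"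

text \<open>Either \<open>L i\<close> has a descending sequence or it is a well-order comparable
  with \<open>L e\<close>. The inverse \<open>h\<close> is stored in the witness because "onto an
  initial segment" would otherwise put an unbounded quantifier into the decidable condition.\<close>

lemma pseudo_woI:
  assumes e: "\<And>x. std (L e) x"
  shows "pseudo_wo e"
proof -
  define Q where "Q i k v h \<longleftrightarrow> k = 0 \<and> (\<forall>x. L i (v (Suc x)) (v x)) \<or>
      k = 1 \<and> (\<forall>x x'. L i x x' \<longrightarrow> L e (v x) (v x')) \<and> (\<forall>x y. L e y (v x) \<longrightarrow> v (h x y) = y) \<or>
      k = (2::nat) \<and> (\<forall>x x'. L e x x' \<longrightarrow> L i (v x) (v x'))" for i k v and h :: "nat \<Rightarrow> nat \<Rightarrow> nat"
  have "\<exists>k v h. Q i k v h" for i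
  proof (cases "\<forall>x. std (L i) x")
    case False
    then obtain d where "\<forall>n. L i (d (Suc n)) (d n)" using not_accp_descending by blast
    then have "Q i 0 d (\<lambda>_ _. 0)" by (simp add: Q_def)
    then show ?thesis by blast
  next
    case True
    then consider v where "\<And>x x'. L i x x' \<Longrightarrow> L e (v x) (v x')" "\<And>x y. L e y (v x) \<Longrightarrow> \<exists>x'. v x' = y"
      | v where "\<And>x x'. L e x x' \<Longrightarrow> L i (v x) (v x')"
      using well_orders_comparable[OF slo_L _ slo_L e, of i] by blast
    then show ?thesis
    proof cases
      case (1 v)
      then have "\<forall>x y. \<exists>x'. L e y (v x) \<longrightarrow> v x' = y" by blast
      then obtain h where "\<And>x y. L e y (v x) \<Longrightarrow> v (h x y) = y" by metis
      with 1(1) have "Q i 1 v h" by (simp add: Q_def)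
      then show ?thesis by blast
    next
      case (2 v)
      then have "Q i 2 v (\<lambda>_ _. 0)" by (simp add: Q_def)
      then show ?thesis by blast
    qed
  qed
  then obtain k v h where w: "\<And>i. Q i (k i) (v i) (h i)" by metis
  define f where "f n = pair (k (p1 n)) (pair (v (p1 n) (p1 (p2 n))) (h (p1 n) (p1 (p2 n)) (p2 (p2 n))))" for n
  have "compat e n m (f n) (f m)" for n m
  proof (cases "p1 n = p1 m")
    case True
    from w[of "p1 n", unfolded Q_def] show ?thesis
      by (elim disjE) (simp_all add: compat_def f_def True)
  qed (simp add: compat_def)
  then show ?thesis unfolding pseudo_wo_def by blast
qed

text \<open>A well-order \<open>L i\<close> rules out kind 0, and kind 2 would carry a descending
  sequence of \<open>L e\<close> into it. Hence an ill-founded pseudo-well-order has all computable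
  well-orders as initial segments.\<close>

lemma pseudo_woD:
  assumes "pseudo_wo e" and e: "\<not> std (L e) z" and i: "\<And>x. std (L i) x"
  obtains v where "\<And>x x'. L i x x' \<Longrightarrow> L e (v x) (v x')" "\<And>x y. L e y (v x) \<Longrightarrow> \<exists>x'. v x' = y"
proof -
  obtain w where w: "\<And>n m. compat e n m (w n) (w m)"
    using assms(1) by (auto simp: pseudo_wo_def)
  define k where "k = p1 (w (pair i (pair 0 0)))"
  define v where "v x = p1 (p2 (w (pair i (pair x 0))))" for x
  define h where "h x y = p2 (p2 (w (pair i (pair x y))))" for x y
  have k: "p1 (w (pair i a)) = k" for a
    using w[of "pair i a" "pair i (pair 0 0)"] by (simp add: compat_def k_def)
  have v: "p1 (p2 (w (pair i (pair x y)))) = v x" for x y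
    using w[of "pair i (pair x y)" "pair i (pair x 0)"] by (simp add: compat_def v_def)
  have no_desc: False if "\<And>n. L i (d (Suc n)) (d n)" for d
    using accp_no_descending[OF i, of "\<lambda>n. d (Suc n)" "d 0"] that by simp
  have c: "k = 0 \<and> (x' = Suc x \<longrightarrow> L i (v x') (v x)) \<or>
     k = 1 \<and> (L i x x' \<longrightarrow> L e (v x) (v x')) \<and> (L e y (v x) \<and> x' = h x y \<longrightarrow> v x' = y) \<or>
     k = 2 \<and> (L e x x' \<longrightarrow> L i (v x) (v x'))" for x x' y
    using w[of "pair i (pair x y)" "pair i (pair x' 0)"] by (simp add: compat_def k v h_def)
  obtain d where d: "\<And>n. L e (d (Suc n)) (d n)" using not_accp_descending[OF e] by blast
  have "k \<noteq> 0"
  proof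
    assume "k = 0"
    then have "L i (v (Suc n)) (v n)" for n using c[of "Suc n" n] by simp
    then show False by (rule no_desc)
  qed
  moreover have "k \<noteq> 2"
  proof
    assume "k = 2"
    then have "L i (v (d (Suc n))) (v (d n))" for n using c[of "d n" "d (Suc n)"] d by simp
    then show False by (rule no_desc)
  qed
  ultimately have "k = 1" using c by blast
  then have "L i x x' \<Longrightarrow> L e (v x) (v x')" "L e y (v x) \<Longrightarrow> v (h x y) = y" for x x' y
    using c[of x' x] c[of "h x y" x y] by simp_all
  then show thesis using that by blast
qed

text \<open>A path \<open>e, (w 0, d 0), (w 1, d 1), \<dots>\<close> of the following tree consists of a witness \<open>w\<close> for
  \<open>pseudo_wo e\<close> and a descending sequence \<open>d\<close> in \<open>L e\<close>.\<close>

definition pseudo_tree :: "nat \<Rightarrow> bool" where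
  "pseudo_tree a \<longleftrightarrow>
    (\<forall>n<len a - 1. \<forall>m<len a - 1. compat (sel a 0) n m (p1 (sel a (Suc n))) (p1 (sel a (Suc m)))) \<and>
    (\<forall>n<len a - 2. L (sel a 0) (p2 (sel a (Suc (Suc n)))) (p2 (sel a (Suc n))))"

definition V :: "nat \<Rightarrow> nat \<Rightarrow> bool" where
  "V = KB pseudo_tree"

lemma pseudo_tree_encode:
  "pseudo_tree (list_encode s) \<longleftrightarrow>
    (\<forall>n m. Suc n < length s \<longrightarrow> Suc m < length s \<longrightarrow> compat (s ! 0) n m (p1 (s ! Suc n)) (p1 (s ! Suc m))) \<and>
    (\<forall>n. Suc (Suc n) < length s \<longrightarrow> L (s ! 0) (p2 (s ! Suc (Suc n))) (p2 (s ! Suc n)))"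
proof -
  have "n < length s - 1 \<longleftrightarrow> Suc n < length s" "n < length s - 2 \<longleftrightarrow> Suc (Suc n) < length s" for n
    by auto
  moreover have "Suc n < length s \<Longrightarrow> sel (list_encode s) 0 = s ! 0" for n
    by (subst sel_encode) auto
  ultimately show ?thesis unfolding pseudo_tree_def len_encode by auto
qed

lemma dec_V: "dec (\<lambda>z. V (p1 z) (p2 z))"
  unfolding V_def
  by (rule dec_KB[where T = "\<lambda>_. pseudo_tree" and f = "\<lambda>_. 0"])
    (unfold pseudo_tree_def compat_def, (intro cmp_intro)+)

lemma pseudo_tree_prefix: "pseudo_tree (list_encode (s @ [n])) \<Longrightarrow> pseudo_tree (list_encode s)"
  unfolding pseudo_tree_encode
proof (elim conjE, intro conjI allI impI)
  fix i j
  assume 1: "\<forall>i j. Suc i < length (s @ [n]) \<longrightarrow> Suc j < length (s @ [n]) \<longrightarrow>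
      compat ((s @ [n]) ! 0) i j (p1 ((s @ [n]) ! Suc i)) (p1 ((s @ [n]) ! Suc j))"
    and "Suc i < length s" "Suc j < length s"
  then show "compat (s ! 0) i j (p1 (s ! Suc i)) (p1 (s ! Suc j))"
    using 1[rule_format, of i j] by (cases "s = []") (auto simp: nth_append)
next
  fix i
  assume 1: "\<forall>i. Suc (Suc i) < length (s @ [n]) \<longrightarrow>
      L ((s @ [n]) ! 0) (p2 ((s @ [n]) ! Suc (Suc i))) (p2 ((s @ [n]) ! Suc i))"
    and "Suc (Suc i) < length s"
  then show "L (s ! 0) (p2 (s ! Suc (Suc i))) (p2 (s ! Suc i))"
    using 1[rule_format, of i] by (cases "s = []") (auto simp: nth_append)
qed

text \<open>Otherwise \<open>pseudo_tree\<close> has no path and \<open>V\<close> is a computable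
  well-order, computed by some \<open>e\<close>. Then \<open>L e\<close> is at least as long as
  \<open>V\<close>; but with a witness for \<open>e\<close> fixed, its descending sequences fit
  below one node of \<open>pseudo_tree\<close>, so \<open>L e\<close> is shorter than
  \<open>V\<close>.\<close>

lemma ex_illfounded_pseudo_wo: "\<exists>e z. pseudo_wo e \<and> \<not> std (L e) z"
proof (rule ccontr)
  assume neg: "\<not> ?thesis"
  have V: "slo V" by (simp add: V_def slo_KB)
  have std_V: "std V a" for a
    unfolding V_def
  proof (rule KB_std[where T = pseudo_tree, OF pseudo_tree_prefix])
    fix f :: "nat \<Rightarrow> nat"
    show "\<exists>n. \<not> pseudo_tree (list_encode (map f [0..<n]))"
    proof (rule ccontr)
      assume *: "\<not> ?thesis"
      then have t: "pseudo_tree (list_encode (map f [0..<n]))" for n by blast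
      have "compat (f 0) n m (p1 (f (Suc n))) (p1 (f (Suc m)))" for n m
        using t[of "Suc (Suc (max n m))"] unfolding pseudo_tree_encode
        by (auto simp del: upt_Suc dest!: spec2[of _ n m])
      then have "pseudo_wo (f 0)"
        unfolding pseudo_wo_def by (intro exI[of _ "\<lambda>n. p1 (f (Suc n))"]) blast
      moreover have d: "L (f 0) (p2 (f (Suc (Suc n)))) (p2 (f (Suc n)))" for n
        using t[of "Suc (Suc (Suc n))"] unfolding pseudo_tree_encode
        by (auto simp del: upt_Suc dest!: spec[of _ n])
      have "\<not> std (L (f 0)) (p2 (f (Suc 0)))"
        using accp_no_descending[of "L (f 0)" "p2 (f (Suc 0))" "\<lambda>n. p2 (f (Suc (Suc n)))"] d by blast
      ultimately show False using neg by blast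
    qed
  qed
  let ?r = "rel V UNIV"
  have r: "Well_order ?r" by (rule well_order_rel[OF V std_V])
  have "computable_rel ?r"
    by (rule computable_relI) (unfold rel_def, simp, intro cmp_intro dec_V)
  then obtain p where p: "\<And>x y. computes p [x, y] (if (x, y) \<in> ?r then 1 else 0)"
    unfolding computable_rel_def by blast
  define e where "e = code p"
  have e: "std (L e) a" "abs_cord ?r \<le> rk (L e) 0" for a
    using well_order_descent_tree[OF p r] by (simp_all add: e_def)
  obtain w where w: "\<And>n m. compat e n m (w n) (w m)"
    using pseudo_woI[OF e(1)] by (auto simp: pseudo_wo_def)
  \<comment> \<open>The witness \<open>w\<close> is the same along all branches, so such a node is
    in the tree as soon as \<open>ds\<close> descends in \<open>L e\<close>.\<close>
  define node where "node ds = list_encode (e # map (\<lambda>i. pair (w i) (ds ! i)) [0..<length ds])" for ds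
  have tree: "pseudo_tree (node ds) \<longleftrightarrow> (\<forall>n. Suc n < length ds \<longrightarrow> L e (ds ! Suc n) (ds ! n))" for ds
    unfolding node_def pseudo_tree_encode by (auto simp: w)
  have lower: "rk (L e) x \<le> rk V (node ds)"
    if "ds \<noteq> []" "last ds = x" "pseudo_tree (node ds)" for ds x
    using e(1)[of x] that
  proof (induction x arbitrary: ds rule: accp.induct)
    case (accI x)
    show ?case
    proof (rule ccontr)
      assume "\<not> ?thesis"
      then have "rk V (node ds) < rk (L e) x" by simp
      then obtain y where y: "L e y x" "rk (L e) y = rk V (node ds)"
        using less_rk_iff[OF slo_L e(1)] by blast
      let ?t = "ds @ [y]"
      have last: "last ds = ds ! (length ds - 1)" using accI.prems(1) by (simp add: last_conv_nth)
      have t: "pseudo_tree (node ?t)"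
        unfolding tree
      proof (intro allI impI)
        fix n assume n: "Suc n < length ?t"
        show "L e (?t ! Suc n) (?t ! n)"
        proof (cases "Suc n < length ds")
          case True
          then show ?thesis using accI.prems(3) unfolding tree by (simp add: nth_append)
        next
          case False
          with n have m: "length ds = Suc n" by simp
          then have "x = ds ! n" using accI.prems(2) last by simp
          then show ?thesis using y(1) m by (simp add: nth_append)
        qed
      qed
      have "rk (L e) y \<le> rk V (node ?t)"
        by (rule accI.IH[OF y(1)]) (use t in auto)
      also have "\<dots> < rk V (node ds)"
      proof (rule rk_mono[OF V std_V])
        have "list_decode (node ?t) = list_decode (node ds) @ [pair (w (length ds)) y]"
          by (simp add: node_def nth_append)
        then have "kb (list_decode (node ?t)) (list_decode (node ds))"
          by (simp add: kb_extension)
        with t accI.prems show "V (node ?t) (node ds)" by (simp add: V_def KB_def)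
      qed
      finally show False using y(2) by simp
    qed
  qed
  have "abs_cord ?r \<le> rk V (node [0])"
    using e(2) lower[of "[0]" 0] by (auto simp: tree)
  moreover have "rk V (node [0]) < abs_cord ?r"
    using less_rel_iff[OF V std_V, of UNIV] by auto
  ultimately show False by simp
qed

theorem ex_order_with_maximal_std_part:
  obtains K where "slo K" "dec (\<lambda>z. K (p1 z) (p2 z))" "\<exists>z. \<not> std K z"
    "\<And>\<beta>. computable_ordinal \<beta> \<Longrightarrow> \<exists>x. std K x \<and> rk K x = \<beta>"
proof -
  obtain e z where e: "pseudo_wo e" "\<not> std (L e) z" using ex_illfounded_pseudo_wo by blast
  have "\<exists>x. std (L e) x \<and> rk (L e) x = \<beta>" if \<beta>: "computable_ordinal \<beta>" for \<beta>
  proof -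
    obtain r where r: "computable_linear_order (Field r) r" "Well_order r" "abs_cord r = \<beta>"
      using \<beta> unfolding computable_ordinal_def by blast
    then obtain p where p: "\<And>x y. computes p [x, y] (if (x, y) \<in> r then 1 else 0)"
      unfolding computable_linear_order_def computable_rel_def by blast
    define i where "i = code p"
    have i: "std (L i) a" "\<beta> \<le> rk (L i) 0" for a
      using well_order_descent_tree[OF p r(2)] r(3) by (simp_all add: i_def)
    \<comment> \<open>The ranks of a well-order are closed downwards, so \<beta> itself is attained,
      not only bounded.\<close>
    obtain x where x: "rk (L i) x = \<beta>"
      using i less_rk_iff[OF slo_L i(1)[of 0], of \<beta>] by (cases "\<beta> = rk (L i) 0") (auto simp: le_less)
    obtain v where v: "\<And>x x'. L i x x' \<Longrightarrow> L e (v x) (v x')" "\<And>x y. L e y (v x) \<Longrightarrow> \<exists>x'. v x' = y"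
      using pseudo_woD[OF e i(1)] by blast
    have "std (L e) (v x) \<and> rk (L e) (v x) = rk (L i) x"
      by (rule initial_embedding_rk[OF slo_L slo_L _ _ i(1)]) (use v in blast)+
    with x show ?thesis by metis
  qed
  moreover have "dec (\<lambda>z. L e (p1 z) (p2 z))" by (intro cmp_intro)
  ultimately show thesis using that slo_L e(2) by blast
qed

section \<open>Computable ordinals and labels\<close>

text \<open>The successor type: shifting the field by \<open>Suc\<close> frees \<open>0\<close> for
  a new greatest element.\<close>

lemma ex_greater_cord: "\<exists>\<beta>::cord. \<alpha> < \<beta>"
proof -
  obtain r where r: "Well_order r" "\<alpha> = abs_cord r" by (rule cord_cases)
  let ?F = "insert 0 (Suc ` Field r)"
  define s where "s = {(Suc x, Suc y) | x y. (x, y) \<in> r} \<union> {(z, 0) | z. z \<in> ?F}"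
  have F: "Field s = ?F" by (force simp: s_def Field_def)
  have lin: "linear_order_on (Field r) r" and wf: "wf (r - Id)"
    using r(1) by (simp_all add: well_order_on_def)
  have mem: "(a, b) \<in> s \<longleftrightarrow> a \<in> ?F \<and> b = 0 \<or> (\<exists>x y. a = Suc x \<and> b = Suc y \<and> (x, y) \<in> r)" for a b
    by (auto simp: s_def)
  have "linear_order_on ?F s"
    unfolding order_on_defs
  proof (intro conjI)
    show "s \<subseteq> ?F \<times> ?F" by (auto simp: s_def Field_def)
    show "refl_on ?F s" using lin by (auto simp: refl_on_def mem order_on_defs)
    show "trans s"
    proof (rule transI)
      fix a b c assume "(a, b) \<in> s" "(b, c) \<in> s"
      then show "(a, c) \<in> s"
        using lin unfolding mem order_on_defs by (auto simp: Field_def dest: transD)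
    qed
    show "antisym s" using lin by (auto intro!: antisymI simp: mem order_on_defs dest: antisymD)
    show "total_on ?F s" using lin by (auto simp: total_on_def mem order_on_defs)
  qed
  moreover have "wf (s - Id)"
  proof (rule wfUNIVI)
    fix P :: "nat \<Rightarrow> bool" and x
    assume step: "\<forall>x. (\<forall>y. (y, x) \<in> s - Id \<longrightarrow> P y) \<longrightarrow> P x"
    have S: "P (Suc y)" for y
      using wf
    proof (induction y rule: wf_induct_rule)
      case (less y)
      have "P z" if "(z, Suc y) \<in> s - Id" for z
        using that less by (auto simp: s_def)
      with step show ?case by blast
    qed
    moreover have "P 0"
    proof -
      have "P y" if "(y, 0) \<in> s - Id" for y
        using that S by (cases y) (auto simp: s_def)
      with step show ?thesis by blast
    qed
    ultimately show "P x" by (cases x) auto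
  qed
  ultimately have s: "Well_order s" by (simp add: F well_order_on_def)
  have "Restr s (underS s 0) = dir_image r Suc"
    by (auto simp: s_def underS_def dir_image_def Field_def)
  moreover have "(r, dir_image r Suc) \<in> ordIso"
    using r(1) by (intro dir_image_ordIso) (auto simp: inj_on_def)
  ultimately have "(r, Restr s (underS s 0)) \<in> ordIso" by simp
  then have "\<alpha> = abs_cord (Restr s (underS s 0))"
    unfolding r(2) by (simp only: abs_cord_eq[OF r(1) Well_order_Restr[OF s]])
  then have "\<alpha> < abs_cord s"
    using less_abs_cord_iff[OF s] F by blast
  then show ?thesis ..
qed

lemma less_osuc: "\<alpha> < osuc \<alpha>"
  unfolding osuc_def by (rule LeastI_ex[OF ex_greater_cord])

lemma osuc_le: "\<alpha> < \<beta> \<Longrightarrow> osuc \<alpha> \<le> \<beta>"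
  unfolding osuc_def by (rule Least_le)

lemma less_osuc_iff: "\<beta> < osuc \<alpha> \<longleftrightarrow> \<beta> \<le> \<alpha>"
  using less_osuc[of \<alpha>] osuc_le[of \<alpha> \<beta>] by (metis le_less_trans not_le)

lemma cord_0_le: "(0::cord) \<le> \<alpha>"
proof -
  have "Well_order ({}::nat rel)" by simp
  have "\<not> \<alpha> < abs_cord {}"
    unfolding less_abs_cord_iff[OF \<open>Well_order {}\<close>] by simp
  then show ?thesis by (simp add: zero_cord_def not_less)
qed

section \<open>The least non-computable ordinal and the labels\<close>

locale maximal_order =
  fixes K :: "nat \<Rightarrow> nat \<Rightarrow> bool"
  assumes slo_K: "slo K" and dec_K: "dec (\<lambda>z. K (p1 z) (p2 z))" and nonstd_K: "\<exists>z. \<not> std K z"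
    and maximal_K: "\<And>\<beta>. computable_ordinal \<beta> \<Longrightarrow> \<exists>x. std K x \<and> rk K x = \<beta>"
begin

abbreviation lam :: cord where "lam \<equiv> omega1CK"

lemma computable_ordinal_iff: "computable_ordinal \<beta> \<longleftrightarrow> \<beta> < lam"
proof
  \<comment> \<open>Otherwise the order type of the standard part would be a rank within the
    standard part.\<close>
  have "\<exists>\<beta>. \<not> computable_ordinal \<beta>"
  proof (rule ccontr)
    assume "\<not> ?thesis"
    then obtain x where x: "std K x" "rk K x = abs_cord (rel K {x. std K x})"
      using maximal_K by blast
    have "rk K x < abs_cord (rel K {x. std K x})"
      using x(1) by (subst less_rel_iff[OF slo_K]) (auto intro: accp_downward)
    with x(2) show False by simp
  qed
  then have nc: "\<not> computable_ordinal lam"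
    unfolding omega1CK_def by (rule LeastI_ex)
  assume \<beta>: "computable_ordinal \<beta>"
  show "\<beta> < lam"
  proof (rule ccontr)
    assume "\<not> \<beta> < lam"
    then consider "\<beta> = lam" | "lam < \<beta>" by fastforce
    then show False
    proof cases
      case 2
      obtain x where x: "std K x" "rk K x = \<beta>" using maximal_K[OF \<beta>] by blast
      \<comment> \<open>A computable ordinal above \<open>lam\<close> would make \<open>lam\<close>
        the rank of a standard element, and such ranks are computable.\<close>
      then obtain y where "std K y" "rk K y = lam"
        using 2 less_rk_iff[OF slo_K x(1)] accp_downward[OF x(1)] by blast
      then show False using computable_rk[OF slo_K dec_K] nc by metis
    qed (use \<beta> nc in simp)
  qed
next
  assume "\<beta> < lam"
  then show "computable_ordinal \<beta>"
    unfolding omega1CK_def using not_less_Least by blast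
qed

lemma lam_pos: "0 < lam"
proof -
  have "computable_ordinal (abs_cord (rel K {}))"
    by (rule computable_restriction[OF slo_K dec_K]) (auto intro: cmp_intro)
  then show ?thesis by (simp add: computable_ordinal_iff rel_def zero_cord_def)
qed

definition kk :: "cord \<Rightarrow> nat" where
  "kk \<gamma> = (SOME x. std K x \<and> rk K x = \<gamma>)"

lemma kk: "\<gamma> < lam \<Longrightarrow> std K (kk \<gamma>) \<and> rk K (kk \<gamma>) = \<gamma>"
  unfolding kk_def by (rule someI_ex) (use maximal_K computable_ordinal_iff in blast)

text \<open>Labels: the order \<open>K \<times> \<omega>\<close> with an additional greatest element \<open>0\<close>.\<close>

definition lb :: "nat \<Rightarrow> nat \<Rightarrow> nat" where "lb k j = Suc (pair k j)"

definition lt :: "nat \<Rightarrow> nat \<Rightarrow> bool" (infix "\<prec>" 50) where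
  "a \<prec> b \<longleftrightarrow> a \<noteq> 0 \<and> (b = 0 \<or> K (p1 (a - 1)) (p1 (b - 1)) \<or>
    p1 (a - 1) = p1 (b - 1) \<and> p2 (a - 1) < p2 (b - 1))"

abbreviation le :: "nat \<Rightarrow> nat \<Rightarrow> bool" (infix "\<preceq>" 50) where
  "a \<preceq> b \<equiv> a = b \<or> a \<prec> b"

abbreviation stdL :: "nat \<Rightarrow> bool" where "stdL x \<equiv> std lt x"

lemma label_cases: obtains "a = 0" | k j where "a = lb k j"
proof (cases a)
  case (Suc n)
  then have "a = lb (p1 n) (p2 n)" by (simp add: lb_def)
  then show thesis using that(2) by blast
qed (use that(1) in simp)

lemma lt_lb [simp]: "lb k j \<prec> lb k' j' \<longleftrightarrow> K k k' \<or> k = k' \<and> j < j'" "lb k j \<prec> 0" "\<not> 0 \<prec> a"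
  by (simp_all add: lt_def lb_def)

lemma lb_neq_0 [simp]: "lb k j \<noteq> 0" "0 \<noteq> lb k j"
  by (simp_all add: lb_def)

lemma lb_eq [simp]: "lb k j = lb k' j' \<longleftrightarrow> k = k' \<and> j = j'"
  by (simp add: lb_def)

lemma slo_lt: "slo lt"
  unfolding slo_def
proof (intro conjI allI impI)
  show "\<not> x \<prec> x" for x
    by (cases x rule: label_cases) (auto simp: slo_irrefl[OF slo_K])
  show "x \<prec> z" if "x \<prec> y" "y \<prec> z" for x y z
    using that by (cases x rule: label_cases; cases y rule: label_cases; cases z rule: label_cases)
      (auto intro: slo_trans[OF slo_K])
  show "x = y \<or> x \<prec> y \<or> y \<prec> x" for x y
  proof (cases x rule: label_cases)
    case 1
    then show ?thesis by (cases y rule: label_cases) auto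
  next
    case x: (2 k j)
    show ?thesis
    proof (cases y rule: label_cases)
      case (2 k' j')
      then show ?thesis using slo_total[OF slo_K, of k k'] x by auto
    qed (use x in auto)
  qed
qed

lemmas lt_irrefl [simp] = slo_irrefl[OF slo_lt]
lemmas lt_trans = slo_trans[OF slo_lt]
lemmas lt_total = slo_total[OF slo_lt]
lemmas lt_asym = slo_asym[OF slo_lt]

lemma not_lt: "\<not> a \<prec> b \<longleftrightarrow> b \<preceq> a"
  using lt_total[of a b] lt_asym[of a b] by auto

lemma le_lt_trans: "a \<preceq> b \<Longrightarrow> b \<prec> c \<Longrightarrow> a \<prec> c"
  and lt_le_trans: "a \<prec> b \<Longrightarrow> b \<preceq> c \<Longrightarrow> a \<prec> c"
  and le_trans': "a \<preceq> b \<Longrightarrow> b \<preceq> c \<Longrightarrow> a \<preceq> c"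
  using lt_trans by blast+

lemma dec_lt [cmp_intro]: "cmp f \<Longrightarrow> cmp g \<Longrightarrow> dec (\<lambda>x. f x \<prec> g x)"
  unfolding lt_def by (intro cmp_intro dec_comp2[where P = K, OF dec_K])

lemma std_lb: "stdL (lb k j) \<longleftrightarrow> std K k"
proof
  assume "stdL (lb k j)"
  then have "\<forall>k j. lb k j = x \<longrightarrow> std K k" if "x = lb k j" for x
    unfolding that
  proof (induction rule: accp.induct)
    case (accI x)
    show ?case
    proof (intro allI impI)
      fix k j assume x: "lb k j = x"
      show "std K k"
      proof (rule accpI)
        fix k' assume "K k' k"
        then have "lb k' 0 \<prec> x" using x by auto
        with accI.IH show "std K k'" by blast
      qed
    qed
  qed
  then show "std K k" by blast
next
  assume "std K k"
  then have "\<forall>j. stdL (lb k j)"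
  proof (induction rule: accp.induct)
    case (accI k)
    show ?case
    proof
      show "stdL (lb k j)" for j
      proof (induction j rule: less_induct)
        case (less j)
        show ?case
        proof (rule accpI)
          fix y assume "y \<prec> lb k j"
          with accI.IH less show "stdL y" by (cases y rule: label_cases) auto
        qed
      qed
    qed
  qed
  then show "stdL (lb k j)" ..
qed

lemma std_down: "stdL x \<Longrightarrow> y \<prec> x \<Longrightarrow> stdL y"
  by (rule accp_downward)

lemma nonstd_0 [simp]: "\<not> stdL 0"
  using nonstd_K std_lb std_down lt_lb(2) by metis

lemma std_lt_nonstd: "stdL x \<Longrightarrow> \<not> stdL y \<Longrightarrow> x \<prec> y"
  using lt_total std_down by metis

lemma nonstd_below: "\<not> stdL x \<Longrightarrow> \<exists>y. y \<prec> x \<and> \<not> stdL y"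
  using accpI[of lt x] by blast

lemma rk_std_less: "stdL x \<Longrightarrow> rk lt x < lam"
  using computable_rk[OF slo_lt] computable_ordinal_iff by (simp add: cmp_intro)

lemma rk_lb: "std K k \<Longrightarrow> rk K k \<le> rk lt (lb k j)"
proof (induction k arbitrary: j rule: accp.induct)
  case (accI k)
  have s: "std K k" using accI.hyps by (rule accpI)
  show ?case
  proof (rule ccontr)
    assume "\<not> ?thesis"
    then have "rk lt (lb k j) < rk K k" by simp
    then obtain k' where k': "K k' k" "rk K k' = rk lt (lb k j)"
      using less_rk_iff[OF slo_K s] by blast
    then have "rk K k' \<le> rk lt (lb k' 0)" using accI.IH by blast
    also have "\<dots> < rk lt (lb k j)" by (rule rk_mono[OF slo_lt]) (use s k' std_lb in auto)
    finally show False using k' by simp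
  qed
qed

section \<open>Scales of standard labels indexed by ordinals\<close>

definition t :: "cord \<Rightarrow> nat \<Rightarrow> nat" where "t \<gamma> n = lb (kk \<gamma>) n"

lemma std_t: "\<gamma> < lam \<Longrightarrow> stdL (t \<gamma> n)"
  by (simp add: t_def std_lb kk)

lemma t_mono: "\<delta> < \<gamma> \<Longrightarrow> \<gamma> < lam \<Longrightarrow> t \<delta> m \<prec> t \<gamma> n"
  using kk[of \<gamma>] kk[of \<delta>] less_trans[of \<delta> \<gamma> lam] rk_less_iff[OF slo_K, of "kk \<gamma>" "kk \<delta>"]
  by (auto simp: t_def)

lemma t_mono2: "m < n \<Longrightarrow> t \<gamma> m \<prec> t \<gamma> n"
  by (simp add: t_def)

lemma le_rk_t: "\<gamma> < lam \<Longrightarrow> \<gamma> \<le> rk lt (t \<gamma> n)"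
  using rk_lb kk by (metis t_def)

lemma t_cofinal: "stdL x \<Longrightarrow> \<exists>\<gamma><lam. x \<prec> t \<gamma> 0"
proof (cases x rule: label_cases)
  case (2 k j)
  assume "stdL x"
  then have k: "std K k" using 2 std_lb by simp
  let ?\<gamma> = "rk lt (lb k 1)"
  have "rk K k \<le> rk lt (lb k 0)" by (rule rk_lb[OF k])
  also have "\<dots> < ?\<gamma>" by (rule rk_mono[OF slo_lt]) (auto simp: std_lb k)
  finally have "rk K k < ?\<gamma>" .
  moreover have \<gamma>: "?\<gamma> < lam" using rk_std_less std_lb k by blast
  ultimately have "K k (kk ?\<gamma>)" using kk[OF \<gamma>] rk_less_iff[OF slo_K] k by metis
  then show ?thesis using \<gamma> 2 by (intro exI[of _ ?\<gamma>]) (auto simp: t_def)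
qed simp

lemma lam_limit: "\<gamma> < lam \<Longrightarrow> osuc \<gamma> < lam"
proof -
  assume \<gamma>: "\<gamma> < lam"
  have "\<gamma> \<le> rk lt (t \<gamma> 0)" by (rule le_rk_t[OF \<gamma>])
  also have "\<dots> < rk lt (t \<gamma> 1)" by (rule rk_mono[OF slo_lt std_t[OF \<gamma>] t_mono2]) simp
  finally have "osuc \<gamma> \<le> rk lt (t \<gamma> 1)" by (rule osuc_le)
  also have "\<dots> < lam" by (rule rk_std_less[OF std_t[OF \<gamma>]])
  finally show ?thesis .
qed

text \<open>The formula level reserved for back-and-forth rank \<beta>. A larger rank must have room
  for one more successor, and the factor omega in the labels supplies it while staying below
  \<open>lam\<close>.\<close>

definition hh :: "cord \<Rightarrow> cord" where "hh \<beta> = rk lt (t \<beta> 3)"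

lemma hh_less: "\<beta> < lam \<Longrightarrow> hh \<beta> < lam"
  unfolding hh_def by (rule rk_std_less[OF std_t])

lemma hh_pos: "\<beta> < lam \<Longrightarrow> 0 < hh \<beta>"
proof -
  assume "\<beta> < lam"
  then have "rk lt (t \<beta> 2) < hh \<beta>"
    unfolding hh_def by (intro rk_mono[OF slo_lt std_t] t_mono2) auto
  then show ?thesis using cord_0_le le_less_trans by blast
qed

lemma hh_mono: "\<gamma> < \<beta> \<Longrightarrow> \<beta> < lam \<Longrightarrow> osuc (hh \<gamma>) < hh \<beta>"
proof -
  assume *: "\<gamma> < \<beta>" "\<beta> < lam"
  then have "\<gamma> < lam" by (rule less_trans)
  then have "hh \<gamma> < rk lt (t \<gamma> 4)"
    unfolding hh_def by (intro rk_mono[OF slo_lt std_t] t_mono2) auto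
  then have "osuc (hh \<gamma>) \<le> rk lt (t \<gamma> 4)" by (rule osuc_le)
  also have "\<dots> < hh \<beta>"
    unfolding hh_def using * by (intro rk_mono[OF slo_lt std_t] t_mono)
  finally show ?thesis .
qed

text \<open>The rank spent on recognising the label \<open>x\<close>. The shift by 3 puts it at or
  above \<open>c3\<close>, so that it exceeds \<open>c2\<close>, the rank above which the tree can
  be recovered from the order.\<close>

definition rho :: "nat \<Rightarrow> cord" where
  "rho x = rk lt (lb (p1 (x - 1)) (p2 (x - 1) + 3))"

abbreviation c3 :: cord where "c3 \<equiv> osuc (osuc (osuc 0))"

lemma rho_lb: "rho (lb k j) = rk lt (lb k (j + 3))"
  by (simp add: rho_def lb_def)

lemma rho_mono: "stdL x \<Longrightarrow> y \<prec> x \<Longrightarrow> rho y < rho x"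
  by (cases x rule: label_cases; cases y rule: label_cases)
    (auto simp: rho_lb std_lb intro!: rk_mono[OF slo_lt])

lemma rho_less: "stdL x \<Longrightarrow> rho x < lam"
  by (cases x rule: label_cases) (auto simp: rho_lb std_lb intro!: rk_std_less)

lemma rho_ge: "stdL x \<Longrightarrow> c3 \<le> rho x"
proof (cases x rule: label_cases)
  case (2 k j)
  assume "stdL x"
  then have k: "stdL (lb k i)" for i using 2 by (simp add: std_lb)
  have l: "rk lt (lb k (j + i)) < rk lt (lb k (j + Suc i))" for i
    by (rule rk_mono[OF slo_lt k]) simp
  have "osuc 0 \<le> rk lt (lb k (j + 1))" using l[of 0] cord_0_le le_less_trans osuc_le by fastforce
  then have "osuc (osuc 0) \<le> rk lt (lb k (j + 2))" using l[of 1] le_less_trans osuc_le by fastforce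
  then have "c3 \<le> rk lt (lb k (j + 3))" using l[of 2] le_less_trans osuc_le by fastforce
  then show ?thesis by (simp add: 2 rho_lb)
qed simp

lemma ex_std: "\<exists>x. stdL x"
  using std_t[OF lam_pos] by blast

text \<open>The order type of the sum of the initial segments below the members of \<open>Y\<close> is computable, so
  it is less than \<open>lam\<close>.\<close>

lemma computable_std_bounded:
  assumes Y: "dec (\<lambda>y. y \<in> Y)" and std_Y: "\<And>y. y \<in> Y \<Longrightarrow> stdL y"
  shows "\<exists>\<delta>. stdL \<delta> \<and> (\<forall>y\<in>Y. y \<prec> \<delta>)"
proof (rule ccontr)
  assume unb: "\<not> ?thesis"
  define good where "good a \<longleftrightarrow> p1 a \<in> Y \<and> p2 a \<prec> p1 a" for a
  \<comment> \<open>Codes outside the sum are put on top in their natural order, so that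
    \<open>W\<close> is a linear order of all numbers.\<close>
  define W where "W a b \<longleftrightarrow> good a \<and> good b \<and> (p1 a \<prec> p1 b \<or> p1 a = p1 b \<and> p2 a \<prec> p2 b) \<or>
    good a \<and> \<not> good b \<or> \<not> good a \<and> \<not> good b \<and> a < b" for a b
  have slo_W: "slo W"
    unfolding slo_def
  proof (intro conjI allI impI)
    show "\<not> W x x" for x by (simp add: W_def)
    show "W x z" if "W x y" "W y z" for x y z
      using that by (auto simp: W_def intro: lt_trans)
    show "x = y \<or> W x y \<or> W y x" for x y
      using lt_total[of "p1 x" "p1 y"] lt_total[of "p2 x" "p2 y"] pair_p1_p2[of x] pair_p1_p2[of y]
      unfolding W_def by (metis linorder_neqE_nat)
  qed
  have dec_W: "dec (\<lambda>z. W (p1 z) (p2 z))"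
    unfolding W_def good_def by (intro cmp_intro dec_comp[OF Y])
  have W_below: "W b (pair y x) \<longleftrightarrow> good b \<and> (p1 b \<prec> y \<or> p1 b = y \<and> p2 b \<prec> x)" if "good (pair y x)" for b y x
    using that by (auto simp: W_def)
  have std_good: "\<forall>x. good (pair y x) \<longrightarrow> std W (pair y x)" if "stdL y" for y
    using that
  proof (induction rule: accp.induct)
    case y: (accI y)
    have "std W (pair y x)" if "stdL x" "good (pair y x)" for x
      using that
    proof (induction rule: accp.induct)
      case x: (accI x)
      show ?case
      proof (rule accpI)
        fix b assume "W b (pair y x)"
        then have b: "good b" "p1 b \<prec> y \<or> p1 b = y \<and> p2 b \<prec> x" using W_below x.prems by auto
        obtain u v where "b = pair u v" by (rule pair_cases)
        with b y.IH x.IH show "std W b" by auto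
      qed
    qed
    then show ?case using y.hyps std_down by (auto simp: good_def)
  qed
  have good_std: "std W a" if "good a" for a
    using std_good[of "p1 a"] that std_Y by (auto simp: good_def)
  have std_W: "std W a" for a
  proof (induction a rule: less_induct)
    case (less a)
    show ?case
    proof (cases "good a")
      case False
      show ?thesis
      proof (rule accpI)
        fix b assume "W b a"
        with False have "good b \<or> b < a" by (auto simp: W_def)
        with less good_std show "std W b" by blast
      qed
    qed (rule good_std)
  qed
  have lower: "rk lt x \<le> rk W (pair y x)" if "stdL x" "good (pair y x)" for x y
    using that
  proof (induction rule: accp.induct)
    case (accI x)
    have s: "stdL x" using accI.hyps by (rule accpI)
    show ?case
    proof (rule ccontr)
      assume "\<not> ?thesis"
      then have "rk W (pair y x) < rk lt x" by simp
      then obtain z where z: "z \<prec> x" "rk lt z = rk W (pair y x)"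
        using less_rk_iff[OF slo_lt s] by blast
      then have g: "good (pair y z)" using accI.prems by (auto simp: good_def intro: lt_trans)
      have "rk lt z \<le> rk W (pair y z)" using accI.IH z g by blast
      also have "\<dots> < rk W (pair y x)"
        by (rule rk_mono[OF slo_W std_W]) (use W_below accI.prems g z in auto)
      finally show False using z by simp
    qed
  qed
  define \<theta> where "\<theta> = abs_cord (rel W UNIV)"
  have "computable_ordinal \<theta>"
    unfolding \<theta>_def by (rule computable_restriction[OF slo_W dec_W]) (auto simp: std_W intro: cmp_intro)
  then have \<theta>: "\<theta> < lam" by (simp add: computable_ordinal_iff)
  \<comment> \<open>A member of \<open>Y\<close> beyond \<open>t \<theta> 1\<close> has
    \<open>t \<theta> 0\<close> below it; so its summand alone contains an element of rank at least
    \<theta>, the type of the whole sum.\<close>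
  have "\<not> (\<forall>y\<in>Y. y \<prec> t \<theta> 1)" using unb std_t[OF \<theta>] by blast
  then obtain y where y: "y \<in> Y" "t \<theta> 1 \<preceq> y" using not_lt by blast
  have "t \<theta> 0 \<prec> t \<theta> 1" by (rule t_mono2) simp
  then have "good (pair y (t \<theta> 0))" using y by (auto simp: good_def intro: lt_trans)
  then have "rk lt (t \<theta> 0) \<le> rk W (pair y (t \<theta> 0))" by (rule lower[OF std_t[OF \<theta>]])
  moreover have "rk W (pair y (t \<theta> 0)) < \<theta>"
    unfolding \<theta>_def using less_rel_iff[OF slo_W std_W, of UNIV] by blast
  ultimately show False using le_rk_t[OF \<theta>, of 0] by simp
qed

end

section \<open>Thin sets of labels\<close>

context maximal_order
begin

text \<open>\<open>up x\<close> is the next larger label among the labels with a smaller number. The set \<open>R n\<close> consists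
  of the labels from which at most \<open>n\<close> such steps lead to the top. The sets \<open>R n\<close> exhaust all
  labels, but the standard members of each \<open>R n\<close> are bounded by a standard label.\<close>

definition up :: "nat \<Rightarrow> nat" where
  "up x = rec_nat 0 (\<lambda>j y. if x \<prec> j \<and> j \<prec> y then j else y) x"

definition R :: "nat \<Rightarrow> nat \<Rightarrow> bool" where
  "R n x \<longleftrightarrow> (up ^^ n) x = 0"

definition next_up :: "nat \<Rightarrow> nat \<Rightarrow> nat \<Rightarrow> bool" where
  "next_up l x u \<longleftrightarrow> u < l \<and> x \<prec> u \<and> (\<forall>j<l. x \<prec> j \<longrightarrow> u \<preceq> j)"

lemma up_0 [simp]: "up 0 = 0"
  by (simp add: up_def)

lemma lt_0: "x \<noteq> 0 \<Longrightarrow> x \<prec> 0"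
  by (simp add: lt_def)

lemma up: "x \<noteq> 0 \<Longrightarrow> next_up x x (up x)"
proof -
  assume x: "x \<noteq> 0"
  let ?f = "\<lambda>l. rec_nat 0 (\<lambda>j y. if x \<prec> j \<and> j \<prec> y then j else y) l"
  have "next_up l x (?f l)" if "0 < l" for l
    using that
  proof (induction l)
    case (Suc l)
    show ?case
    proof (cases "l = 0")
      case True
      then show ?thesis using lt_0[OF x] by (auto simp: next_up_def)
    next
      case False
      with Suc have IH: "next_up l x (?f l)" by simp
      show ?thesis
      proof (cases "x \<prec> l \<and> l \<prec> ?f l")
        case True
        then have "?f (Suc l) = l" by simp
        then show ?thesis using True IH by (auto simp: next_up_def less_Suc_eq intro: lt_trans)
      next
        case False
        then have "?f (Suc l) = ?f l" by (subst old.nat.rec(2)) (rule if_not_P)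
        moreover have "?f l \<preceq> l" if "x \<prec> l" using that False not_lt[of l "?f l"] by simp
        ultimately show ?thesis using IH by (auto simp: next_up_def less_Suc_eq)
      qed
    qed
  qed simp
  then show ?thesis using x by (simp add: up_def)
qed

lemma next_up_unique: "next_up l x u \<Longrightarrow> next_up l x v \<Longrightarrow> u = v"
  unfolding next_up_def using lt_asym by blast

lemma up_less: "x \<noteq> 0 \<Longrightarrow> up x < x" and lt_up: "x \<noteq> 0 \<Longrightarrow> x \<prec> up x"
  and up_le: "x \<noteq> 0 \<Longrightarrow> j < x \<Longrightarrow> x \<prec> j \<Longrightarrow> up x \<preceq> j"
  using up by (auto simp: next_up_def)

lemma dec_R [cmp_intro]: "cmp f \<Longrightarrow> cmp g \<Longrightarrow> dec (\<lambda>x. R (f x) (g x))"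
proof -
  assume fg: "cmp f" "cmp g"
  have up: "cmp (\<lambda>x. up (g x))" if "cmp g" for g
    unfolding up_def by (intro cmp_intro that cmp_comp[OF that])
  have "cmp (\<lambda>x. rec_nat (g x) (\<lambda>n y. up y) (f x))"
    by (intro cmp_intro fg up)
  moreover have "rec_nat x (\<lambda>n y. up y) n = (up ^^ n) x" for n x
    by (induction n) auto
  ultimately have "cmp (\<lambda>x. (up ^^ f x) (g x))" by simp
  then show ?thesis unfolding R_def by (rule dec_zero)
qed

lemma R_0: "R 0 x \<longleftrightarrow> x = 0"
  by (simp add: R_def)

lemma R_Suc: "R (Suc n) x \<longleftrightarrow> R n (up x)"
  by (simp add: R_def funpow_swap1)

lemma R_mono: "R n x \<Longrightarrow> n \<le> m \<Longrightarrow> R m x"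
proof -
  assume "R n x" "n \<le> m"
  moreover have "R k x \<Longrightarrow> R (Suc k) x" for k by (simp add: R_def)
  ultimately show ?thesis by (induction rule: dec_induct[OF \<open>n \<le> m\<close>]) auto
qed

lemma R_top [simp]: "R n 0"
  using R_mono[of 0 0 n] by (simp add: R_0)

lemma ex_R: "\<exists>n. R n x"
proof (induction x rule: less_induct)
  case (less x)
  show ?case
  proof (cases "x = 0")
    case False
    then show ?thesis using less[OF up_less] R_Suc by blast
  qed (use R_top in blast)
qed

text \<open>Restricting the competitors to numbers below \<open>y\<close> can only raise the next
  larger label, and it rises along the iterates of \<open>up\<close>.\<close>

lemma up_iterate: "0 < y \<Longrightarrow> y \<le> x \<Longrightarrow> \<exists>m. next_up y x ((up ^^ m) x)"
proof (induction x rule: less_induct)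
  case (less x)
  then have x: "x \<noteq> 0" by simp
  show ?case
  proof (cases "up x < y")
    case True
    then have "next_up y x ((up ^^ 1) x)"
      using up[OF x] less.prems by (auto simp: next_up_def)
    then show ?thesis ..
  next
    case False
    then obtain m where m: "next_up y (up x) ((up ^^ m) (up x))"
      using less up_less[OF x] by (metis not_less)
    have "x \<prec> j \<longleftrightarrow> up x \<prec> j" if "j < y" for j
    proof
      assume j: "x \<prec> j"
      then have "up x \<preceq> j" using up_le[OF x] that less.prems by simp
      then show "up x \<prec> j" using False that by auto
    qed (rule lt_trans[OF lt_up[OF x]])
    then have "next_up y x ((up ^^ Suc m) x)"
      using m by (auto simp: next_up_def funpow_swap1)
    then show ?thesis ..
  qed
qed

text \<open>Take the label with the least number in the interval from \<open>z\<close> to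
  \<open>x\<close>. All smaller numbers above it lie at or above \<open>x\<close>, so its next step
  leads to \<open>x\<close> or to a label on the way from \<open>x\<close> to the top.\<close>

lemma R_cofinal:
  assumes x: "R n x" and z: "z \<prec> x"
  shows "\<exists>y. R (Suc n) y \<and> z \<preceq> y \<and> y \<prec> x"
proof -
  define y where "y = (LEAST y. z \<preceq> y \<and> y \<prec> x)"
  have y: "z \<preceq> y" "y \<prec> x"
    using LeastI[of "\<lambda>y. z \<preceq> y \<and> y \<prec> x" z] z unfolding y_def by auto
  have min: "\<not> (z \<preceq> j \<and> j \<prec> x)" if "j < y" for j
    using not_less_Least[of j "\<lambda>y. z \<preceq> y \<and> y \<prec> x"] that unfolding y_def by blast
  have y0: "y \<noteq> 0" using y(2) by (metis lt_lb(3))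
  have above: "x \<preceq> j" if "j < y" "y \<prec> j" for j
    using min[OF that(1)] y(1) that(2) not_lt[of j x] le_lt_trans by blast
  have "R n (up y)"
  proof (cases "x < y")
    case True
    then have "next_up y y x" using y(2) above by (auto simp: next_up_def)
    with x next_up_unique up[OF y0] show ?thesis by metis
  next
    case False
    have "x \<noteq> y" using y(2) by auto
    then obtain m where m: "next_up y x ((up ^^ m) x)" using up_iterate[of y x] False y0 by auto
    have "y \<prec> j \<longleftrightarrow> x \<prec> j" if "j < y" for j
      using above[OF that] y(2) False that lt_trans by auto
    then have "next_up y y ((up ^^ m) x)" using m by (auto simp: next_up_def)
    then have u: "up y = (up ^^ m) x" using next_up_unique up[OF y0] by blast
    have "R m' ((up ^^ m) x)" if "m' = n - m" for m'
    proof (cases "m \<le> n")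
      case True
      then have "(up ^^ (m' + m)) x = 0" using x that by (simp add: R_def)
      then show ?thesis by (simp add: R_def funpow_add)
    next
      case False
      then have "(up ^^ ((m - n) + n)) x = (up ^^ m) x" by simp
      then have "(up ^^ m) x = (up ^^ (m - n)) 0" using x by (simp add: R_def funpow_add)
      moreover have "(up ^^ k) 0 = 0" for k by (induction k) auto
      ultimately show ?thesis by simp
    qed
    then show ?thesis using u R_mono by (metis diff_le_self)
  qed
  then show ?thesis using y R_Suc by blast
qed

lemma finite_min: "finite S \<Longrightarrow> S \<noteq> {} \<Longrightarrow> \<exists>m\<in>S. \<forall>x\<in>S. m \<preceq> x"
proof (induction S rule: finite_ne_induct)
  case (insert a S)
  then obtain m where "m \<in> S" "\<forall>x\<in>S. m \<preceq> x" by blast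
  then show ?case
    using lt_total[of a m] lt_trans by (metis insert_iff)
qed auto

lemma finite_std_bounded: "finite S \<Longrightarrow> \<exists>\<delta>. stdL \<delta> \<and> (\<forall>x\<in>S. stdL x \<longrightarrow> x \<prec> \<delta>)"
proof (induction S rule: finite_induct)
  case (insert a S)
  then obtain \<delta> where \<delta>: "stdL \<delta>" "\<forall>x\<in>S. stdL x \<longrightarrow> x \<prec> \<delta>" by blast
  show ?case
  proof (cases "stdL a")
    case True
    then obtain \<gamma> where "\<gamma> < lam" "a \<prec> t \<gamma> 0" using t_cofinal by blast
    then have "stdL (t \<gamma> 0)" "a \<prec> t \<gamma> 0" using std_t by auto
    with \<delta> show ?thesis using lt_total[of \<delta> "t \<gamma> 0"] lt_trans by (metis insert_iff)
  qed (use \<delta> in auto)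
qed (use ex_std in auto)

text \<open>The second conjunct strengthens the induction: below \<open>p\<close>, a step from
  \<open>R (Suc n)\<close> to a non-standard label lands exactly at \<open>p\<close>, up to finitely
  many exceptions. Only the labels stepping to \<open>p\<close> then have to be bounded.\<close>

lemma R_thin_aux:
  "(\<exists>\<delta>. stdL \<delta> \<and> (\<forall>x. R n x \<and> stdL x \<longrightarrow> x \<prec> \<delta>)) \<and>
   (\<exists>p. R n p \<and> \<not> stdL p \<and> (\<forall>x. R n x \<and> \<not> stdL x \<longrightarrow> p \<preceq> x))"
proof (induction n)
  case 0
  then show ?case using ex_std by (auto simp: R_0)
next
  case (Suc n)
  then obtain \<delta> p where \<delta>: "stdL \<delta>" "\<And>x. R n x \<Longrightarrow> stdL x \<Longrightarrow> x \<prec> \<delta>"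
    and p: "R n p" "\<not> stdL p" "\<And>x. R n x \<Longrightarrow> \<not> stdL x \<Longrightarrow> p \<preceq> x" by blast
  define Y where "Y = {x. up x = p \<and> x \<noteq> 0}"
  \<comment> \<open>Among labels with the same next step, number order and label order agree: a
    larger label with a smaller number would be an earlier candidate for the step.\<close>
  have Y_incr: "x \<prec> x'" if "x \<in> Y" "x' \<in> Y" "x < x'" for x x'
  proof (rule ccontr)
    assume "\<not> x \<prec> x'"
    then have "x' \<prec> x" using not_lt[of x x'] that(3) by auto
    then have "p \<preceq> x" using that up_le[of x' x] by (auto simp: Y_def)
    moreover have "x \<prec> p" using that(1) lt_up[of x] by (auto simp: Y_def)
    ultimately show False using lt_asym by auto
  qed
  have cases: "x \<in> Y \<or> x \<le> p" if x: "R (Suc n) x" "x \<prec> p" "\<not> stdL (up x)" for x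
  proof -
    have x0: "x \<noteq> 0" using x(2) by (metis lt_lb(3))
    have "p \<preceq> up x" using p(3) x R_Suc by blast
    then show ?thesis
    proof
      assume "p \<prec> up x"
      \<comment> \<open>With a smaller number than \<open>x\<close>, the label \<open>p\<close>
        would beat \<open>up x\<close> as the next step. So only labels with numbers up to
        \<open>p\<close> step past it.\<close>
      then have "\<not> p < x" using up_le[OF x0 _ x(2)] lt_asym by auto
      then show ?thesis by simp
    qed (auto simp: Y_def x0)
  qed
  obtain \<delta>1 where \<delta>1: "stdL \<delta>1" "\<And>x. x \<le> p \<Longrightarrow> stdL x \<Longrightarrow> x \<prec> \<delta>1"
    using finite_std_bounded[of "{..p}"] by auto
  obtain \<delta>2 where \<delta>2: "stdL \<delta>2" "\<And>x. x \<in> Y \<Longrightarrow> stdL x \<Longrightarrow> x \<prec> \<delta>2"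
  \<comment> \<open>If all of \<open>Y\<close> is standard, boundedness follows from decidability.
    If not, a single non-standard member bounds the numbers of the standard ones by
    \<open>Y_incr\<close>, leaving finitely many.\<close>
  proof (cases "\<forall>y\<in>Y. stdL y")
    case True
    have up: "cmp (\<lambda>x. up x)"
      unfolding up_def by (intro cmp_intro)
    have "dec (\<lambda>y. y \<in> Y)" unfolding Y_def mem_Collect_eq by (intro cmp_intro up)
    from computable_std_bounded[OF this] True that show ?thesis by blast
  next
    case False
    then obtain y0 where y0: "y0 \<in> Y" "\<not> stdL y0" by blast
    have "x \<le> y0" if "x \<in> Y" "stdL x" for x
      using Y_incr[OF y0(1) that(1)] that y0 std_down not_less by blast
    moreover obtain \<delta>' where "stdL \<delta>'" "\<And>x. x \<le> y0 \<Longrightarrow> stdL x \<Longrightarrow> x \<prec> \<delta>'"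
      using finite_std_bounded[of "{..y0}"] by auto
    ultimately show ?thesis using that by blast
  qed
  have bound: "x \<prec> \<delta> \<or> x \<prec> \<delta>1 \<or> x \<prec> \<delta>2" if "R (Suc n) x" "stdL x" for x
  proof (cases "stdL (up x)")
    case True
    have "x \<noteq> 0" using that nonstd_0 by metis
    then show ?thesis using \<delta>(2)[of "up x"] True that(1) lt_up[of x] lt_trans R_Suc by blast
  next
    case False
    then show ?thesis using cases[OF that(1) std_lt_nonstd[OF that(2) p(2)]] \<delta>1 \<delta>2 that(2) by blast
  qed
  obtain \<delta>' where "stdL \<delta>'" "\<delta> \<prec> \<delta>'" "\<delta>1 \<prec> \<delta>'" "\<delta>2 \<prec> \<delta>'"
    using finite_std_bounded[of "{\<delta>, \<delta>1, \<delta>2}"] \<delta> \<delta>1 \<delta>2 by auto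
  then have 1: "\<exists>\<delta>. stdL \<delta> \<and> (\<forall>x. R (Suc n) x \<and> stdL x \<longrightarrow> x \<prec> \<delta>)"
    using bound lt_trans by blast
  define N where "N = {x. R (Suc n) x \<and> \<not> stdL x \<and> x \<prec> p}"
  have p': "R (Suc n) p" by (rule R_mono[OF p(1)]) simp
  have 2: "\<exists>p. R (Suc n) p \<and> \<not> stdL p \<and> (\<forall>x. R (Suc n) x \<and> \<not> stdL x \<longrightarrow> p \<preceq> x)"
  proof (cases "N = {}")
    case True
    then show ?thesis using p' p(2) not_lt[of _ p] by (auto simp: N_def)
  next
    case False
    \<comment> \<open>By \<open>Y_incr\<close> the least number in \<open>N \<inter> Y\<close> is
      also its least label.\<close>
    define y where "y = (LEAST y. y \<in> N \<inter> Y)"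
    define S where "S = N \<inter> ({..p} \<union> {y})"
    have N_cases: "x \<in> Y \<or> x \<le> p" if "x \<in> N" for x
    proof -
      have "x \<prec> p" using that by (simp add: N_def)
      then have "x \<noteq> 0" by (metis lt_lb(3))
      then have "\<not> stdL (up x)" using that std_down lt_up by (auto simp: N_def)
      with that cases show ?thesis by (auto simp: N_def)
    qed
    have y_least: "y \<in> S \<and> y \<preceq> x" if "x \<in> N \<inter> Y" for x
    proof -
      have "y \<in> N \<inter> Y" unfolding y_def by (rule LeastI[where P = "\<lambda>y. y \<in> N \<inter> Y", OF that])
      moreover have "y \<le> x" unfolding y_def by (rule Least_le[where P = "\<lambda>y. y \<in> N \<inter> Y", OF that])
      ultimately show ?thesis using that Y_incr[of y x] by (auto simp: S_def le_less)
    qed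
    have "S \<noteq> {}" using False N_cases y_least by (fastforce simp: S_def)
    moreover have "finite S" by (simp add: S_def)
    ultimately obtain m where m: "m \<in> S" "\<forall>x\<in>S. m \<preceq> x" using finite_min by blast
    have "m \<preceq> x" if "x \<in> N" for x
      using N_cases[OF that] that m(2) y_least le_trans' by (auto simp: S_def) blast+
    moreover have "m \<in> N" using m by (simp add: S_def)
    ultimately show ?thesis
      using not_lt[of _ p] lt_le_trans by (auto simp: N_def) metis
  qed
  from 1 2 show ?case by blast
qed

lemma R_thin: "\<exists>\<delta>. stdL \<delta> \<and> (\<forall>x. R n x \<and> stdL x \<longrightarrow> x \<prec> \<delta>)"
  using R_thin_aux by blast

end

section \<open>Back-and-forth relations\<close>

definition patom :: "nat rel \<Rightarrow> nat rel \<Rightarrow> nat list \<Rightarrow> nat list \<Rightarrow> bool" where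
  "patom r s a b \<longleftrightarrow> length a = length b \<and> (\<forall>i<length a. \<forall>j<length a.
    (a ! i = a ! j \<longleftrightarrow> b ! i = b ! j) \<and> ((a ! i, a ! j) \<in> r \<longleftrightarrow> (b ! i, b ! j) \<in> s))"

text \<open>The symmetric variant with moves by tuples of any finite length; rank \<beta> preserves
  both the \<Sigma> and the \<Pi> formulas of level \<beta>.\<close>

inductive bf :: "nat set \<Rightarrow> nat rel \<Rightarrow> nat set \<Rightarrow> nat rel \<Rightarrow> cord \<Rightarrow> nat list \<Rightarrow> nat list \<Rightarrow> bool"
  for A r B s where
  bfI: "patom r s a b \<Longrightarrow>
    (\<forall>\<gamma><\<beta>. \<forall>c. set c \<subseteq> A \<longrightarrow> (\<exists>d. set d \<subseteq> B \<and> length d = length c \<and> bf A r B s \<gamma> (a @ c) (b @ d))) \<Longrightarrow>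
    (\<forall>\<gamma><\<beta>. \<forall>d. set d \<subseteq> B \<longrightarrow> (\<exists>c. set c \<subseteq> A \<and> length d = length c \<and> bf A r B s \<gamma> (a @ c) (b @ d))) \<Longrightarrow>
    bf A r B s \<beta> a b"

lemma bf_patom: "bf A r B s \<beta> a b \<Longrightarrow> patom r s a b"
  by (erule bf.cases) simp

lemma bf_length: "bf A r B s \<beta> a b \<Longrightarrow> length a = length b"
  using bf_patom patom_def by blast

lemma bf_forth:
  "bf A r B s \<beta> a b \<Longrightarrow> \<gamma> < \<beta> \<Longrightarrow> set c \<subseteq> A \<Longrightarrow> \<exists>d. set d \<subseteq> B \<and> length d = length c \<and> bf A r B s \<gamma> (a @ c) (b @ d)"
  by (erule bf.cases) blast

lemma bf_back:
  "bf A r B s \<beta> a b \<Longrightarrow> \<gamma> < \<beta> \<Longrightarrow> set d \<subseteq> B \<Longrightarrow> \<exists>c. set c \<subseteq> A \<and> length c = length d \<and> bf A r B s \<gamma> (a @ c) (b @ d)"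
  by (erule bf.cases) metis

lemma bf_iff: "bf A r B s \<beta> a b \<longleftrightarrow> patom r s a b \<and>
    (\<forall>\<gamma><\<beta>. \<forall>c. set c \<subseteq> A \<longrightarrow> (\<exists>d. set d \<subseteq> B \<and> length d = length c \<and> bf A r B s \<gamma> (a @ c) (b @ d))) \<and>
    (\<forall>\<gamma><\<beta>. \<forall>d. set d \<subseteq> B \<longrightarrow> (\<exists>c. set c \<subseteq> A \<and> length d = length c \<and> bf A r B s \<gamma> (a @ c) (b @ d)))"
  by (subst bf.simps) blast

lemma bf_mono: "bf A r B s \<beta> a b \<Longrightarrow> \<gamma> \<le> \<beta> \<Longrightarrow> bf A r B s \<gamma> a b"
  unfolding bf_iff[of _ _ _ _ \<beta>] bf_iff[of _ _ _ _ \<gamma>] by (meson less_le_trans)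

lemma patom_sym: "patom r s a b \<Longrightarrow> patom s r b a"
  unfolding patom_def by metis

lemma bf_sym: "bf A r B s \<beta> a b \<Longrightarrow> bf B s A r \<beta> b a"
proof (induction \<beta> arbitrary: a b rule: less_induct)
  case (less \<beta>)
  show ?case
  proof (rule bfI)
    show "patom s r b a" using less.prems bf_patom patom_sym by blast
  qed (use bf_forth[OF less.prems] bf_back[OF less.prems] less.IH in \<open>metis\<close>)+
qed

section \<open>Preservation of infinitary formulas along back-and-forth relations\<close>

lemma finitary_qf_patom:
  assumes "finitary_qf \<phi>" "patom r s a b" "\<forall>v\<in>fv \<phi>. \<exists>i<length a. e v = a ! i \<and> e' v = b ! i"
  shows "sat A r \<phi> e \<longleftrightarrow> sat B s \<phi> e'"
  using assms
proof (induction rule: finitary_qf.induct)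
  case (1 x y)
  then obtain i j where "i < length a" "e x = a ! i" "e' x = b ! i" "j < length a" "e y = a ! j" "e' y = b ! j"
    by auto
  with 1 show ?case by (simp add: patom_def)
next
  case (2 x y)
  then obtain i j where "i < length a" "e x = a ! i" "e' x = b ! i" "j < length a" "e y = a ! j" "e' y = b ! j"
    by auto
  with 2 show ?case by (simp add: patom_def)
next
  case (4 F)
  have "sat A r \<phi> e = sat B s \<phi> e'" if "\<phi> \<in> rcset F" for \<phi>
    using 4 that by (force simp: cimage.rep_eq)
  then show ?case unfolding sat_And by blast
next
  case (5 F)
  have "sat A r \<phi> e = sat B s \<phi> e'" if "\<phi> \<in> rcset F" for \<phi>
    using 5 that by (force simp: cimage.rep_eq)
  then show ?case unfolding sat_Or by blast
qed auto

lemma fv_foldr_Ex: "fv (foldr Ex xs \<phi>) = fv \<phi> - set xs"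
  by (induction xs) auto

lemma fv_foldr_All: "fv (foldr All xs \<phi>) = fv \<phi> - set xs"
  by (induction xs) auto

lemma sat_foldr_Ex:
  "sat A r (foldr Ex xs \<phi>) e \<longleftrightarrow>
    (\<exists>e2. (\<forall>v. v \<notin> set xs \<longrightarrow> e2 v = e v) \<and> (\<forall>v\<in>set xs. e2 v \<in> A) \<and> sat A r \<phi> e2)"
proof (induction xs arbitrary: e)
  case Nil
  have "e2 = e" if "\<forall>v. e2 v = e v" for e2 using that by auto
  then show ?case by auto
next
  case (Cons x xs)
  show ?case
  proof
    assume "sat A r (foldr Ex (x # xs) \<phi>) e"
    then obtain a e2 where "a \<in> A" "\<forall>v. v \<notin> set xs \<longrightarrow> e2 v = (e(x := a)) v" "\<forall>v\<in>set xs. e2 v \<in> A" "sat A r \<phi> e2"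
      unfolding foldr.simps o_apply sat.simps Cons by blast
    then show "\<exists>e2. (\<forall>v. v \<notin> set (x # xs) \<longrightarrow> e2 v = e v) \<and> (\<forall>v\<in>set (x # xs). e2 v \<in> A) \<and> sat A r \<phi> e2"
      by (intro exI[of _ e2]) (cases "x \<in> set xs", auto)
  next
    assume "\<exists>e2. (\<forall>v. v \<notin> set (x # xs) \<longrightarrow> e2 v = e v) \<and> (\<forall>v\<in>set (x # xs). e2 v \<in> A) \<and> sat A r \<phi> e2"
    then obtain e2 where "\<forall>v. v \<notin> set (x # xs) \<longrightarrow> e2 v = e v" "\<forall>v\<in>set (x # xs). e2 v \<in> A" "sat A r \<phi> e2"
      by blast
    then have "e2 x \<in> A" "sat A r (foldr Ex xs \<phi>) (e(x := e2 x))"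
      unfolding Cons by (auto intro!: exI[of _ e2])
    then show "sat A r (foldr Ex (x # xs) \<phi>) e" by auto
  qed
qed

lemma sat_foldr_neg: "sat A r (foldr All xs \<phi>) e \<longleftrightarrow> \<not> sat A r (foldr Ex xs (Neg \<phi>)) e"
  by (induction xs arbitrary: e) auto

lemma sat_foldr_All:
  "sat A r (foldr All xs \<phi>) e \<longleftrightarrow>
    (\<forall>e2. (\<forall>v. v \<notin> set xs \<longrightarrow> e2 v = e v) \<and> (\<forall>v\<in>set xs. e2 v \<in> A) \<longrightarrow> sat A r \<phi> e2)"
  unfolding sat_foldr_neg sat_foldr_Ex by auto

abbreviation along :: "nat set \<Rightarrow> nat list \<Rightarrow> nat list \<Rightarrow> (nat \<Rightarrow> nat) \<Rightarrow> (nat \<Rightarrow> nat) \<Rightarrow> bool" where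
  "along X a b e e' \<equiv> \<forall>v\<in>X. \<exists>i<length a. e v = a ! i \<and> e' v = b ! i"

lemma along_extend:
  assumes e: "along (X - set xs) a b e e'" and e2: "\<forall>v. v \<notin> set xs \<longrightarrow> e2 v = e v"
    and d: "length d = length xs" "length a = length b" "set d \<subseteq> B"
  shows "\<exists>e2'. (\<forall>v. v \<notin> set xs \<longrightarrow> e2' v = e' v) \<and> (\<forall>v\<in>set xs. e2' v \<in> B) \<and> along X (a @ map e2 xs) (b @ d) e2 e2'"
proof -
  \<comment> \<open>A variable may occur several times in the quantifier block \<open>xs\<close>;
    one position is chosen, and both tuples are read there.\<close>
  define ix where "ix v = (SOME i. i < length xs \<and> xs ! i = v)" for v
  have ix: "ix v < length xs \<and> xs ! ix v = v" if "v \<in> set xs" for v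
    unfolding ix_def by (rule someI_ex) (use that in \<open>simp add: in_set_conv_nth\<close>)
  define e2' where "e2' v = (if v \<in> set xs then d ! ix v else e' v)" for v
  have "e2' v \<in> B" if "v \<in> set xs" for v
    using that ix[OF that] d by (auto simp: e2'_def)
  moreover have "\<exists>i<length (a @ map e2 xs). e2 v = (a @ map e2 xs) ! i \<and> e2' v = (b @ d) ! i" if "v \<in> X" for v
  proof (cases "v \<in> set xs")
    case True
    then show ?thesis
      using ix[OF True] d by (intro exI[of _ "length a + ix v"]) (auto simp: e2'_def nth_append)
  next
    case False
    then obtain i where "i < length a" "e v = a ! i" "e' v = b ! i" using e \<open>v \<in> X\<close> by blast
    then show ?thesis
      using False e2 d by (intro exI[of _ i]) (auto simp: e2'_def nth_append)
  qed
  ultimately show ?thesis by (intro exI[of _ e2']) (auto simp: e2'_def)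
qed

lemma along_swap: "along X a b e e' \<Longrightarrow> length a = length b \<Longrightarrow> along X b a e' e"
  by metis

lemma bf_preserves:
  "Sigma_in \<beta> \<phi> \<Longrightarrow> bf A r B s \<beta> a b \<Longrightarrow> along (fv \<phi>) a b e e' \<Longrightarrow> sat A r \<phi> e \<Longrightarrow> sat B s \<phi> e'"
  "Pi_in \<beta> \<phi> \<Longrightarrow> bf A r B s \<beta> a b \<Longrightarrow> along (fv \<phi>) a b e e' \<Longrightarrow> sat A r \<phi> e \<Longrightarrow> sat B s \<phi> e'"
proof (induction arbitrary: a b e e' and a b e e' rule: Sigma_in_Pi_in.inducts)
  case (Sigma_0 \<phi>)
  then show ?case using finitary_qf_patom bf_patom by blast
next
  case (Pi_0 \<phi>)
  then show ?case using finitary_qf_patom bf_patom by blast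
next
  case (Sigma_step \<alpha> F)
  from Sigma_step.prems(3) obtain \<phi> where \<phi>: "\<phi> \<in> rcset F" "sat A r \<phi> e" unfolding sat_Or by blast
  obtain xs \<psi> \<beta> where x: "\<phi> = foldr Ex xs \<psi>" "\<beta> < \<alpha>"
    and IH: "\<forall>a b. bf A r B s \<beta> a b \<longrightarrow> (\<forall>e e'. along (fv \<psi>) a b e e' \<longrightarrow> sat A r \<psi> e \<longrightarrow> sat B s \<psi> e')"
    using bspec[OF Sigma_step(2) \<phi>(1)] by (elim exE conjE) (rule that)
  obtain e2 where e2: "\<forall>v. v \<notin> set xs \<longrightarrow> e2 v = e v" "\<forall>v\<in>set xs. e2 v \<in> A" "sat A r \<psi> e2"
    using \<phi>(2) unfolding x(1) sat_foldr_Ex by blast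
  obtain d where d: "set d \<subseteq> B" "length d = length (map e2 xs)" "bf A r B s \<beta> (a @ map e2 xs) (b @ d)"
    using bf_forth[OF Sigma_step.prems(1) x(2), of "map e2 xs"] e2(2) by auto
  have al: "along (fv \<psi> - set xs) a b e e'"
    using Sigma_step.prems(2) \<phi>(1) x(1) by (force simp: fv_foldr_Ex cimage.rep_eq)
  obtain e2' where e2': "\<forall>v. v \<notin> set xs \<longrightarrow> e2' v = e' v" "\<forall>v\<in>set xs. e2' v \<in> B"
    "along (fv \<psi>) (a @ map e2 xs) (b @ d) e2 e2'"
    using along_extend[OF al e2(1) d(2)[unfolded length_map] bf_length[OF Sigma_step.prems(1)] d(1)] by (elim exE conjE) (rule that)
  from IH[THEN spec, THEN spec, THEN mp, OF d(3), THEN spec, THEN spec, THEN mp, OF e2'(3), THEN mp, OF e2(3)] e2' have "sat B s \<phi> e'"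
    unfolding x(1) sat_foldr_Ex by blast
  with \<phi>(1) show ?case unfolding sat_Or by blast
next
  case (Pi_step \<alpha> F)
  have "sat B s \<phi> e'" if \<phi>: "\<phi> \<in> rcset F" for \<phi>
  proof -
    obtain xs \<psi> \<beta> where x: "\<phi> = foldr All xs \<psi>" "\<beta> < \<alpha>"
      and IH: "\<forall>a b. bf A r B s \<beta> a b \<longrightarrow> (\<forall>e e'. along (fv \<psi>) a b e e' \<longrightarrow> sat A r \<psi> e \<longrightarrow> sat B s \<psi> e')"
      using bspec[OF Pi_step(2) \<phi>] by (elim exE conjE) (rule that)
    have len: "length b = length a" using bf_length[OF Pi_step.prems(1)] by simp
    have al: "along (fv \<psi> - set xs) b a e' e"
      using Pi_step.prems(2) \<phi> x(1) len by (force simp: fv_foldr_All cimage.rep_eq)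
    show ?thesis
      unfolding x(1) sat_foldr_All
    proof (intro allI impI)
      fix e2' assume e2': "(\<forall>v. v \<notin> set xs \<longrightarrow> e2' v = e' v) \<and> (\<forall>v\<in>set xs. e2' v \<in> B)"
      obtain c where c: "set c \<subseteq> A" "length c = length (map e2' xs)" "bf A r B s \<beta> (a @ c) (b @ map e2' xs)"
        using bf_back[OF Pi_step.prems(1) x(2), of "map e2' xs"] e2' by auto
      obtain e2 where e2: "\<forall>v. v \<notin> set xs \<longrightarrow> e2 v = e v" "\<forall>v\<in>set xs. e2 v \<in> A"
        "along (fv \<psi>) (b @ map e2' xs) (a @ c) e2' e2"
        using along_extend[OF al conjunct1[OF e2'] c(2)[unfolded length_map] len c(1)] by (elim exE conjE) (rule that)
      have "sat A r \<psi> e2"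
        using bspec[OF Pi_step.prems(3)[unfolded sat_And] \<phi>] e2(1,2) unfolding x(1) sat_foldr_All by blast
      moreover have "length (b @ map e2' xs) = length (a @ c)" using len c(2) by simp
      ultimately show "sat B s \<psi> e2'"
        using IH[THEN spec, THEN spec, THEN mp, OF c(3), THEN spec, THEN spec, THEN mp, OF along_swap[OF e2(3)]] by blast
    qed
  qed
  then show ?case unfolding sat_And by blast
qed

text \<open>A \<Pi> formula starts with a universal block, so only tuples chosen in \<open>B\<close>
  have to be answered, at ranks below \<alpha>. This gains one level over the symmetric relation
  that holds after the first move.\<close>

lemma Pi_transfer:
  assumes "Pi_in \<alpha> \<phi>" "patom r s a b"
    and "\<And>\<beta> d. \<beta> < \<alpha> \<Longrightarrow> set d \<subseteq> B \<Longrightarrow> \<exists>c. set c \<subseteq> A \<and> length c = length d \<and> bf A r B s \<beta> (a @ c) (b @ d)"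
    and al: "along (fv \<phi>) a b e e'" and sat: "sat A r \<phi> e"
  shows "sat B s \<phi> e'"
  using assms(1)
proof cases
  case Pi_0
  then show ?thesis using finitary_qf_patom assms by blast
next
  case (Pi_step F)
  have "sat B s \<phi> e'" if \<phi>: "\<phi> \<in> rcset F" for \<phi>
  proof -
    from \<phi> Pi_step(3) obtain xs \<psi> \<beta> where x: "\<phi> = foldr All xs \<psi>" "\<beta> < \<alpha>" "Sigma_in \<beta> \<psi>" by blast
    have len: "length b = length a" using assms(2) by (simp add: patom_def)
    have al: "along (fv \<psi> - set xs) b a e' e"
      using al \<phi> x(1) len Pi_step(1) by (force simp: fv_foldr_All cimage.rep_eq)
    show ?thesis
      unfolding x(1) sat_foldr_All
    proof (intro allI impI)
      fix e2' assume e2': "(\<forall>v. v \<notin> set xs \<longrightarrow> e2' v = e' v) \<and> (\<forall>v\<in>set xs. e2' v \<in> B)"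
      obtain c where c: "set c \<subseteq> A" "length c = length (map e2' xs)" "bf A r B s \<beta> (a @ c) (b @ map e2' xs)"
        using assms(3)[OF x(2), of "map e2' xs"] e2' by auto
      obtain e2 where e2: "\<forall>v. v \<notin> set xs \<longrightarrow> e2 v = e v" "\<forall>v\<in>set xs. e2 v \<in> A"
        "along (fv \<psi>) (b @ map e2' xs) (a @ c) e2' e2"
        using along_extend[OF al conjunct1[OF e2'] c(2)[unfolded length_map] len c(1)] by (elim exE conjE) (rule that)
      have "sat A r \<psi> e2"
        using bspec[OF sat[unfolded Pi_step(1) sat_And] \<phi>] e2(1,2) unfolding x(1) sat_foldr_All by blast
      moreover have "length (b @ map e2' xs) = length (a @ c)" using len c(2) by simp
      ultimately show "sat B s \<psi> e2'"
        using bf_preserves(1)[OF x(3) c(3) along_swap[OF e2(3)]] by blast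
    qed
  qed
  then show ?thesis unfolding Pi_step(1) sat_And by blast
qed

section \<open>Isomorphisms and back-and-forth systems\<close>

lemma iso_bf:
  assumes f: "bij_betw f A B" "\<forall>x\<in>A. \<forall>y\<in>A. (x, y) \<in> r \<longleftrightarrow> (f x, f y) \<in> s"
  shows "set a \<subseteq> A \<Longrightarrow> bf A r B s \<beta> a (map f a)"
proof (induction \<beta> arbitrary: a rule: less_induct)
  case (less \<beta>)
  have inj: "inj_on f A" and im: "f ` A = B" using f(1) by (auto simp: bij_betw_def)
  show ?case
  proof (rule bfI)
    have "a ! i \<in> A" if "i < length a" for i using that less.prems nth_mem by blast
    then show "patom r s a (map f a)"
      using f(2) inj by (auto simp: patom_def inj_on_eq_iff)
    show "\<forall>\<gamma><\<beta>. \<forall>c. set c \<subseteq> A \<longrightarrow> (\<exists>d. set d \<subseteq> B \<and> length d = length c \<and> bf A r B s \<gamma> (a @ c) (map f a @ d))"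
    proof (intro allI impI)
      fix \<gamma> c assume "\<gamma> < \<beta>" "set c \<subseteq> A"
      then show "\<exists>d. set d \<subseteq> B \<and> length d = length c \<and> bf A r B s \<gamma> (a @ c) (map f a @ d)"
        using less.IH[of \<gamma> "a @ c"] less.prems im by (intro exI[of _ "map f c"]) auto
    qed
    show "\<forall>\<gamma><\<beta>. \<forall>d. set d \<subseteq> B \<longrightarrow> (\<exists>c. set c \<subseteq> A \<and> length d = length c \<and> bf A r B s \<gamma> (a @ c) (map f a @ d))"
    proof (intro allI impI)
      fix \<gamma> d assume "\<gamma> < \<beta>" "set d \<subseteq> B"
      then have "\<forall>y\<in>set d. \<exists>x\<in>A. f x = y" using im by blast
      then obtain g where g: "\<And>y. y \<in> set d \<Longrightarrow> g y \<in> A \<and> f (g y) = y" by metis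
      then have "map f (map g d) = d" by (simp add: map_idI)
      then show "\<exists>c. set c \<subseteq> A \<and> length d = length c \<and> bf A r B s \<gamma> (a @ c) (map f a @ d)"
        using less.IH[of \<gamma> "a @ map g d"] less.prems g \<open>\<gamma> < \<beta>\<close>
        by (intro exI[of _ "map g d"]) auto
    qed
  qed
qed

lemma isomorphic_bf: "isomorphic A r B s \<Longrightarrow> bf A r B s \<beta> [] []"
  unfolding isomorphic_def using iso_bf[of _ A B r s "[]"] by auto

lemma isomorphicI:
  assumes nil: "I [] []" and I: "\<And>a b. I a b \<Longrightarrow> patom r s a b \<and> set a \<subseteq> A \<and> set b \<subseteq> B"
    and forth: "\<And>a b c. I a b \<Longrightarrow> c \<in> A \<Longrightarrow> \<exists>d\<in>B. I (a @ [c]) (b @ [d])"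
    and backw: "\<And>a b d. I a b \<Longrightarrow> d \<in> B \<Longrightarrow> \<exists>c\<in>A. I (a @ [c]) (b @ [d])"
  shows "isomorphic A r B s"
proof -
  \<comment> \<open>Stage \<open>n\<close> puts the number \<open>n\<close> itself into the domain
    and into the range, if it belongs there; this enumerates both structures at once.\<close>
  define Q where "Q n p q \<longleftrightarrow> (\<exists>u v. q = (fst p @ u, snd p @ v)) \<and>
    (n \<in> A \<longrightarrow> n \<in> set (fst q)) \<and> (n \<in> B \<longrightarrow> n \<in> set (snd q))" for n :: nat and p q :: "nat list \<times> nat list"
  have step: "\<exists>q. I (fst q) (snd q) \<and> Q n p q" if p: "I (fst p) (snd p)" for n p
  proof -
    obtain a b where ab: "I (fst p @ a) (snd p @ b)" "n \<in> A \<longrightarrow> n \<in> set (fst p @ a)"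
    proof (cases "n \<in> A")
      case True
      then obtain d where "I (fst p @ [n]) (snd p @ [d])" using forth[OF p] by blast
      then show thesis using that[of "[n]" "[d]"] by auto
    qed (use that[of "[]" "[]"] p in auto)
    show ?thesis
    proof (cases "n \<in> B")
      case True
      then obtain c where "I (fst p @ a @ [c]) (snd p @ b @ [n])" using backw[OF ab(1)] by auto
      then show ?thesis using ab(2)
        by (intro exI[of _ "(fst p @ a @ [c], snd p @ b @ [n])"]) (auto simp: Q_def)
    next
      case False
      with ab show ?thesis
        by (intro exI[of _ "(fst p @ a, snd p @ b)"]) (auto simp: Q_def)
    qed
  qed
  have "\<exists>F. \<forall>n. I (fst (F n)) (snd (F n)) \<and> Q n (F n) (F (Suc n))"
    using dependent_nat_choice[of "\<lambda>_ p. I (fst p) (snd p)" Q] nil step by fastforce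
  then obtain F where F: "\<And>n. I (fst (F n)) (snd (F n))" "\<And>n. Q n (F n) (F (Suc n))" by blast
  define a where "a n = fst (F n)" for n
  define b where "b n = snd (F n)" for n
  have pat: "patom r s (a n) (b n)" "set (a n) \<subseteq> A" "set (b n) \<subseteq> B" for n
    using I[OF F(1)[of n]] by (simp_all add: a_def b_def)
  have len: "length (a n) = length (b n)" for n using pat(1)[of n] by (simp add: patom_def)
  have ext: "\<exists>u v. a (n + k) = a n @ u \<and> b (n + k) = b n @ v" for n k
  proof (induction k)
    case (Suc k)
    moreover have "\<exists>u v. a (Suc (n + k)) = a (n + k) @ u \<and> b (Suc (n + k)) = b (n + k) @ v"
      using F(2)[of "n + k"] by (auto simp: Q_def a_def b_def)
    ultimately show ?case by (metis add_Suc_right append.assoc)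
  qed simp
  have nth_ext: "a (max n m) ! i = a n ! i \<and> b (max n m) ! i = b n ! i \<and> i < length (a (max n m))" if "i < length (a n)" for n m i
  proof -
    obtain u v where "a (n + (max n m - n)) = a n @ u" "b (n + (max n m - n)) = b n @ v" using ext by blast
    then show ?thesis using that len[of n] by (simp add: nth_append)
  qed
  define G where "G x y \<longleftrightarrow> (\<exists>n i. i < length (a n) \<and> a n ! i = x \<and> b n ! i = y)" for x y
  have G2: "(x = x' \<longleftrightarrow> y = y') \<and> ((x, x') \<in> r \<longleftrightarrow> (y, y') \<in> s)" if G: "G x y" "G x' y'" for x y x' y'
  proof -
    obtain n i where 1: "i < length (a n)" "a n ! i = x" "b n ! i = y" using G(1) by (auto simp: G_def)
    obtain m j where 2: "j < length (a m)" "a m ! j = x'" "b m ! j = y'" using G(2) by (auto simp: G_def)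
    show ?thesis
      using pat(1)[of "max n m"] nth_ext[OF 1(1), of m] nth_ext[OF 2(1), of n] 1 2
      unfolding patom_def max.commute[of m n] by metis
  qed
  have GA: "\<exists>y. G x y" if "x \<in> A" for x
  proof -
    have "x \<in> set (a (Suc x))" using F(2)[of x] that by (simp add: Q_def a_def)
    then show ?thesis unfolding in_set_conv_nth G_def by blast
  qed
  have GB: "\<exists>x. G x y" if "y \<in> B" for y
  proof -
    have "y \<in> set (b (Suc y))" using F(2)[of y] that by (simp add: Q_def b_def)
    then show ?thesis unfolding in_set_conv_nth G_def len[symmetric] by blast
  qed
  have GAB: "x \<in> A \<and> y \<in> B" if "G x y" for x y
    using that pat(2,3) len unfolding G_def by (metis nth_mem subsetD)
  obtain f where f: "\<And>x. x \<in> A \<Longrightarrow> G x (f x)" using GA by metis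
  have "inj_on f A" using f G2 by (auto intro!: inj_onI) blast
  moreover have "f ` A = B"
  proof
    show "B \<subseteq> f ` A"
    proof
      fix y assume "y \<in> B"
      then obtain x where "G x y" using GB by blast
      with f GAB G2 show "y \<in> f ` A" by (metis imageI)
    qed
  qed (use f GAB in blast)
  ultimately have "bij_betw f A B" by (simp add: bij_betw_def)
  then show ?thesis unfolding isomorphic_def using f G2 by (intro exI[of _ f]) blast
qed

section \<open>Definability\<close>

text \<open>\<open>PiD \<alpha> n \<Phi>\<close>: on tuples of length \<open>n\<close> of countable structures, \<open>\<Phi>\<close> is given by a \<open>\<Pi>\<close> formula of
  level \<open>\<alpha>\<close> in the variables \<open>0, \<dots>, n - 1\<close>.\<close>

definition fm_defines :: "nat \<Rightarrow> fm \<Rightarrow> (nat set \<Rightarrow> nat rel \<Rightarrow> nat list \<Rightarrow> bool) \<Rightarrow> bool" where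
  "fm_defines n \<phi> \<Phi> \<longleftrightarrow> fv \<phi> \<subseteq> {..<n} \<and> (\<forall>B s e. structure_on B s \<longrightarrow> range e \<subseteq> B \<longrightarrow>
    (sat B s \<phi> e \<longleftrightarrow> \<Phi> B s (map e [0..<n])))"

definition PiD :: "cord \<Rightarrow> nat \<Rightarrow> (nat set \<Rightarrow> nat rel \<Rightarrow> nat list \<Rightarrow> bool) \<Rightarrow> bool" where
  "PiD \<alpha> n \<Phi> \<longleftrightarrow> (\<exists>\<phi>. Pi_in \<alpha> \<phi> \<and> fm_defines n \<phi> \<Phi>)"

definition SigD :: "cord \<Rightarrow> nat \<Rightarrow> (nat set \<Rightarrow> nat rel \<Rightarrow> nat list \<Rightarrow> bool) \<Rightarrow> bool" where
  "SigD \<alpha> n \<Phi> \<longleftrightarrow> (\<exists>\<phi>. Sigma_in \<alpha> \<phi> \<and> fm_defines n \<phi> \<Phi>)"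

text \<open>The classes admit \<open>Neg\<close> only in quantifier-free formulas, so a negation is
  pushed through the hierarchy.\<close>

lemma ex_dual:
  "Sigma_in \<alpha> \<phi> \<Longrightarrow> \<exists>\<psi>. Pi_in \<alpha> \<psi> \<and> fv \<psi> = fv \<phi> \<and> (\<forall>A r e. sat A r \<psi> e \<longleftrightarrow> \<not> sat A r \<phi> e)"
  "Pi_in \<alpha> \<phi> \<Longrightarrow> \<exists>\<psi>. Sigma_in \<alpha> \<psi> \<and> fv \<psi> = fv \<phi> \<and> (\<forall>A r e. sat A r \<psi> e \<longleftrightarrow> \<not> sat A r \<phi> e)"
proof (induction rule: Sigma_in_Pi_in.inducts)
  case (Sigma_0 \<phi>)
  then show ?case by (intro exI[of _ "Neg \<phi>"]) (auto intro: Sigma_in_Pi_in.Pi_0 finitary_qf.intros)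
next
  case (Pi_0 \<phi>)
  then show ?case by (intro exI[of _ "Neg \<phi>"]) (auto intro: Sigma_in_Pi_in.Sigma_0 finitary_qf.intros)
next
  case (Sigma_step \<alpha> F)
  have "\<exists>\<chi>. (\<exists>xs \<psi> \<beta>. \<chi> = foldr All xs \<psi> \<and> \<beta> < \<alpha> \<and> Sigma_in \<beta> \<psi>) \<and> fv \<chi> = fv \<phi> \<and>
      (\<forall>A r e. sat A r \<chi> e \<longleftrightarrow> \<not> sat A r \<phi> e)" if \<phi>: "\<phi> \<in> rcset F" for \<phi>
  proof -
    obtain xs \<psi> \<beta> \<psi>' where x: "\<phi> = foldr Ex xs \<psi>" "\<beta> < \<alpha>" "Sigma_in \<beta> \<psi>'" "fv \<psi>' = fv \<psi>"
      "\<forall>A r e. sat A r \<psi>' e \<longleftrightarrow> \<not> sat A r \<psi> e"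
      using bspec[OF Sigma_step(2) \<phi>] by blast
    then show ?thesis
      by (intro exI[of _ "foldr All xs \<psi>'"] conjI exI[of _ xs] exI[of _ \<psi>'] exI[of _ \<beta>])
        (auto simp: fv_foldr_All fv_foldr_Ex sat_foldr_All sat_foldr_Ex)
  qed
  then obtain g where g: "\<And>\<phi>. \<phi> \<in> rcset F \<Longrightarrow> (\<exists>xs \<psi> \<beta>. g \<phi> = foldr All xs \<psi> \<and> \<beta> < \<alpha> \<and> Sigma_in \<beta> \<psi>) \<and>
      fv (g \<phi>) = fv \<phi> \<and> (\<forall>A r e. sat A r (g \<phi>) e \<longleftrightarrow> \<not> sat A r \<phi> e)"
    by metis
  have "Pi_in \<alpha> (And (cimage g F))"
    using Sigma_step(1) g by (intro Sigma_in_Pi_in.Pi_step) (auto simp: cimage.rep_eq)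
  moreover have "fv (And (cimage g F)) = fv (Or F)"
    using g by (auto simp: cimage.rep_eq)
  moreover have "sat A r (And (cimage g F)) e \<longleftrightarrow> \<not> sat A r (Or F) e" for A r e
    unfolding sat_And sat_Or using g by (auto simp: cimage.rep_eq)
  ultimately show ?case by blast
next
  case (Pi_step \<alpha> F)
  have "\<exists>\<chi>. (\<exists>xs \<psi> \<beta>. \<chi> = foldr Ex xs \<psi> \<and> \<beta> < \<alpha> \<and> Pi_in \<beta> \<psi>) \<and> fv \<chi> = fv \<phi> \<and>
      (\<forall>A r e. sat A r \<chi> e \<longleftrightarrow> \<not> sat A r \<phi> e)" if \<phi>: "\<phi> \<in> rcset F" for \<phi>
  proof -
    obtain xs \<psi> \<beta> \<psi>' where x: "\<phi> = foldr All xs \<psi>" "\<beta> < \<alpha>" "Pi_in \<beta> \<psi>'" "fv \<psi>' = fv \<psi>"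
      "\<forall>A r e. sat A r \<psi>' e \<longleftrightarrow> \<not> sat A r \<psi> e"
      using bspec[OF Pi_step(2) \<phi>] by blast
    then show ?thesis
      by (intro exI[of _ "foldr Ex xs \<psi>'"] conjI exI[of _ xs] exI[of _ \<psi>'] exI[of _ \<beta>])
        (auto simp: fv_foldr_All fv_foldr_Ex sat_foldr_All sat_foldr_Ex)
  qed
  then obtain g where g: "\<And>\<phi>. \<phi> \<in> rcset F \<Longrightarrow> (\<exists>xs \<psi> \<beta>. g \<phi> = foldr Ex xs \<psi> \<and> \<beta> < \<alpha> \<and> Pi_in \<beta> \<psi>) \<and>
      fv (g \<phi>) = fv \<phi> \<and> (\<forall>A r e. sat A r (g \<phi>) e \<longleftrightarrow> \<not> sat A r \<phi> e)"
    by metis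
  have "Sigma_in \<alpha> (Or (cimage g F))"
    using Pi_step(1) g by (intro Sigma_in_Pi_in.Sigma_step) (auto simp: cimage.rep_eq)
  moreover have "fv (Or (cimage g F)) = fv (And F)"
    using g by (auto simp: cimage.rep_eq)
  moreover have "sat A r (Or (cimage g F)) e \<longleftrightarrow> \<not> sat A r (And F) e" for A r e
    unfolding sat_And sat_Or using g by (auto simp: cimage.rep_eq)
  ultimately show ?case by blast
qed

lemma SigD_iff: "SigD \<alpha> n \<Phi> \<longleftrightarrow> PiD \<alpha> n (\<lambda>B s b. \<not> \<Phi> B s b)"
  unfolding SigD_def PiD_def fm_defines_def
proof (safe, goal_cases)
  case (1 \<phi>)
  obtain \<psi> where "Pi_in \<alpha> \<psi>" "fv \<psi> = fv \<phi>" "\<forall>A r e. sat A r \<psi> e \<longleftrightarrow> \<not> sat A r \<phi> e"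
    using ex_dual(1)[OF 1(1)] by blast
  with 1 show ?case by (intro exI[of _ \<psi>]) auto
next
  case (2 \<phi>)
  obtain \<psi> where "Sigma_in \<alpha> \<psi>" "fv \<psi> = fv \<phi>" "\<forall>A r e. sat A r \<psi> e \<longleftrightarrow> \<not> sat A r \<phi> e"
    using ex_dual(2)[OF 2(1)] by blast
  with 2 show ?case by (intro exI[of _ \<psi>]) auto
qed

lemma PiD_iff: "PiD \<alpha> n \<Phi> \<longleftrightarrow> SigD \<alpha> n (\<lambda>B s b. \<not> \<Phi> B s b)"
  by (simp add: SigD_iff)

lemma PiD_cong:
  assumes "PiD \<alpha> n \<Phi>" "\<And>B s b. structure_on B s \<Longrightarrow> length b = n \<Longrightarrow> set b \<subseteq> B \<Longrightarrow> \<Phi> B s b \<longleftrightarrow> \<Psi> B s b"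
  shows "PiD \<alpha> n \<Psi>"
proof -
  obtain \<phi> where \<phi>: "Pi_in \<alpha> \<phi>" "fm_defines n \<phi> \<Phi>" using assms(1) by (auto simp: PiD_def)
  have "\<Phi> B s (map e [0..<n]) \<longleftrightarrow> \<Psi> B s (map e [0..<n])" if "structure_on B s" "range e \<subseteq> B" for B s e
    using that by (intro assms(2)) auto
  then have "fm_defines n \<phi> \<Psi>" using \<phi>(2) by (simp add: fm_defines_def)
  with \<phi>(1) show ?thesis by (auto simp: PiD_def)
qed

lemma SigD_cong:
  assumes "SigD \<alpha> n \<Phi>" "\<And>B s b. structure_on B s \<Longrightarrow> length b = n \<Longrightarrow> set b \<subseteq> B \<Longrightarrow> \<Phi> B s b \<longleftrightarrow> \<Psi> B s b"
  shows "SigD \<alpha> n \<Psi>"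
  using assms(1) unfolding SigD_iff by (rule PiD_cong) (simp add: assms(2))

lemma PiD_All:
  assumes "0 < \<alpha>" "countable I" "\<And>i. i \<in> I \<Longrightarrow> \<exists>\<beta><\<alpha>. SigD \<beta> (n + m i) (\<Psi> i)"
  shows "PiD \<alpha> n (\<lambda>B s b. \<forall>i\<in>I. \<forall>d. set d \<subseteq> B \<and> length d = m i \<longrightarrow> \<Psi> i B s (b @ d))"
proof -
  have "\<forall>i. \<exists>\<phi>. i \<in> I \<longrightarrow> (\<exists>\<beta><\<alpha>. Sigma_in \<beta> \<phi>) \<and> fm_defines (n + m i) \<phi> (\<Psi> i)"
    using assms(3) unfolding SigD_def by metis
  then obtain \<phi> where \<phi>: "\<And>i. i \<in> I \<Longrightarrow> (\<exists>\<beta><\<alpha>. Sigma_in \<beta> (\<phi> i)) \<and> fm_defines (n + m i) (\<phi> i) (\<Psi> i)"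
    by metis
  define F where "F = acset ((\<lambda>i. foldr All [n..<n + m i] (\<phi> i)) ` I)"
  have F: "rcset F = (\<lambda>i. foldr All [n..<n + m i] (\<phi> i)) ` I"
    unfolding F_def using assms(2) by (simp add: acset_inverse)
  have "Pi_in \<alpha> (And F)"
    by (rule Sigma_in_Pi_in.Pi_step[OF assms(1)]) (use \<phi> F in blast)
  moreover have "fv (And F) \<subseteq> {..<n}"
    using \<phi> by (auto simp: cimage.rep_eq F fv_foldr_All fm_defines_def dest!: subsetD) (metis lessThan_iff subset_eq)
  moreover have "sat B s (And F) e \<longleftrightarrow>
      (\<forall>i\<in>I. \<forall>d. set d \<subseteq> B \<and> length d = m i \<longrightarrow> \<Psi> i B s (map e [0..<n] @ d))"
    if B: "structure_on B s" "range e \<subseteq> B" for B s e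
  proof -
    have "sat B s (foldr All [n..<n + m i] (\<phi> i)) e \<longleftrightarrow>
        (\<forall>d. set d \<subseteq> B \<and> length d = m i \<longrightarrow> \<Psi> i B s (map e [0..<n] @ d))" if i: "i \<in> I" for i
      unfolding sat_foldr_All
    proof (intro iffI allI impI)
      fix d
      assume all: "\<forall>e2. (\<forall>v. v \<notin> set [n..<n + m i] \<longrightarrow> e2 v = e v) \<and> (\<forall>v\<in>set [n..<n + m i]. e2 v \<in> B) \<longrightarrow> sat B s (\<phi> i) e2"
        and d: "set d \<subseteq> B \<and> length d = m i"
      define e2 where "e2 v = (if n \<le> v \<and> v < n + m i then d ! (v - n) else e v)" for v
      have in_d: "d ! (v - n) \<in> B" if "n \<le> v" "v < n + m i" for v
        using d that by (intro subsetD[OF conjunct1[OF d]] nth_mem) simp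
      then have "sat B s (\<phi> i) e2" using all by (auto simp: e2_def)
      moreover have "range e2 \<subseteq> B" using in_d B(2) by (auto simp: e2_def)
      ultimately have "\<Psi> i B s (map e2 [0..<n + m i])" using \<phi>[OF i] B(1) by (simp add: fm_defines_def)
      moreover have "map e2 [0..<n + m i] = map e [0..<n] @ d"
        by (rule nth_equalityI) (use d in \<open>auto simp: e2_def nth_append\<close>)
      ultimately show "\<Psi> i B s (map e [0..<n] @ d)" by simp
    next
      fix e2
      assume all: "\<forall>d. set d \<subseteq> B \<and> length d = m i \<longrightarrow> \<Psi> i B s (map e [0..<n] @ d)"
        and e2: "(\<forall>v. v \<notin> set [n..<n + m i] \<longrightarrow> e2 v = e v) \<and> (\<forall>v\<in>set [n..<n + m i]. e2 v \<in> B)"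
      have "\<Psi> i B s (map e [0..<n] @ map e2 [n..<n + m i])"
        by (rule all[rule_format]) (use e2 in auto)
      moreover have "map e [0..<n] @ map e2 [n..<n + m i] = map e2 [0..<n + m i]"
        by (rule nth_equalityI) (use e2 in \<open>auto simp: nth_append\<close>)
      moreover have "range e2 \<subseteq> B"
      proof
        fix y assume "y \<in> range e2"
        then obtain v where "y = e2 v" by blast
        then show "y \<in> B" using e2 B(2) by (cases "v \<in> set [n..<n + m i]") auto
      qed
      ultimately show "sat B s (\<phi> i) e2" using \<phi>[OF i] B(1) by (simp add: fm_defines_def)
    qed
    then show ?thesis unfolding sat_And F by auto
  qed
  ultimately show ?thesis unfolding PiD_def fm_defines_def by blast
qed

lemma SigD_Ex:
  assumes "0 < \<alpha>" "countable I" "\<And>i. i \<in> I \<Longrightarrow> \<exists>\<beta><\<alpha>. PiD \<beta> (n + m i) (\<Psi> i)"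
  shows "SigD \<alpha> n (\<lambda>B s b. \<exists>i\<in>I. \<exists>d. set d \<subseteq> B \<and> length d = m i \<and> \<Psi> i B s (b @ d))"
proof -
  have "PiD \<alpha> n (\<lambda>B s b. \<forall>i\<in>I. \<forall>d. set d \<subseteq> B \<and> length d = m i \<longrightarrow> \<not> \<Psi> i B s (b @ d))"
    using assms by (intro PiD_All) (auto simp: PiD_iff)
  then show ?thesis unfolding SigD_iff by (rule PiD_cong) auto
qed

lemma Pi_in_pos: "0 < \<alpha> \<Longrightarrow> Pi_in \<alpha> \<phi> \<Longrightarrow> \<exists>F. \<phi> = And F \<and>
    (\<forall>\<phi> \<in> rcset F. \<exists>xs \<psi> \<beta>. \<phi> = foldr All xs \<psi> \<and> \<beta> < \<alpha> \<and> Sigma_in \<beta> \<psi>)"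
  by (erule Pi_in.cases) auto

lemma Sigma_in_pos: "0 < \<alpha> \<Longrightarrow> Sigma_in \<alpha> \<phi> \<Longrightarrow> \<exists>F. \<phi> = Or F \<and>
    (\<forall>\<phi> \<in> rcset F. \<exists>xs \<psi> \<beta>. \<phi> = foldr Ex xs \<psi> \<and> \<beta> < \<alpha> \<and> Pi_in \<beta> \<psi>)"
  by (erule Sigma_in.cases) auto

lemma PiD_Inter:
  assumes "0 < \<alpha>" "countable I" "\<And>i. i \<in> I \<Longrightarrow> PiD \<alpha> n (\<Phi> i)"
  shows "PiD \<alpha> n (\<lambda>B s b. \<forall>i\<in>I. \<Phi> i B s b)"
proof -
  have "\<forall>i. \<exists>F. i \<in> I \<longrightarrow> (\<forall>\<phi> \<in> rcset F. \<exists>xs \<psi> \<beta>. \<phi> = foldr All xs \<psi> \<and> \<beta> < \<alpha> \<and> Sigma_in \<beta> \<psi>) \<and>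
      fm_defines n (And F) (\<Phi> i)"
    using assms(3) Pi_in_pos[OF assms(1)] unfolding PiD_def by metis
  then obtain F where F: "\<And>i. i \<in> I \<Longrightarrow> (\<forall>\<phi> \<in> rcset (F i). \<exists>xs \<psi> \<beta>. \<phi> = foldr All xs \<psi> \<and> \<beta> < \<alpha> \<and> Sigma_in \<beta> \<psi>)"
    "\<And>i. i \<in> I \<Longrightarrow> fm_defines n (And (F i)) (\<Phi> i)"
    by metis
  define G where "G = acset (\<Union>i\<in>I. rcset (F i))"
  have G: "rcset G = (\<Union>i\<in>I. rcset (F i))"
    unfolding G_def using assms(2) rcset by (intro acset_inverse) auto
  have "Pi_in \<alpha> (And G)"
    by (rule Sigma_in_Pi_in.Pi_step[OF assms(1)]) (use F(1) in \<open>unfold G, blast\<close>)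
  moreover have "fm_defines n (And G) (\<lambda>B s b. \<forall>i\<in>I. \<Phi> i B s b)"
    unfolding fm_defines_def
  proof (intro conjI allI impI)
    show "fv (And G) \<subseteq> {..<n}" using F(2) by (auto simp: fm_defines_def cimage.rep_eq G)
    fix B s and e :: "nat \<Rightarrow> nat" assume B: "structure_on B s" "range e \<subseteq> B"
    have "sat B s (And (F i)) e \<longleftrightarrow> \<Phi> i B s (map e [0..<n])" if "i \<in> I" for i
      using F(2)[OF that] B by (simp only: fm_defines_def)
    then show "sat B s (And G) e \<longleftrightarrow> (\<forall>i\<in>I. \<Phi> i B s (map e [0..<n]))"
      unfolding sat_And G by blast
  qed
  ultimately show ?thesis by (auto simp: PiD_def)
qed

lemma SigD_Union:
  assumes "0 < \<alpha>" "countable I" "\<And>i. i \<in> I \<Longrightarrow> SigD \<alpha> n (\<Phi> i)"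
  shows "SigD \<alpha> n (\<lambda>B s b. \<exists>i\<in>I. \<Phi> i B s b)"
  using PiD_Inter[OF assms(1,2), of n "\<lambda>i B s b. \<not> \<Phi> i B s b"] assms(3) by (simp add: SigD_iff)

lemma PiD_and: "0 < \<alpha> \<Longrightarrow> PiD \<alpha> n \<Phi> \<Longrightarrow> PiD \<alpha> n \<Psi> \<Longrightarrow> PiD \<alpha> n (\<lambda>B s b. \<Phi> B s b \<and> \<Psi> B s b)"
proof -
  assume "0 < \<alpha>" "PiD \<alpha> n \<Phi>" "PiD \<alpha> n \<Psi>"
  then have "PiD \<alpha> n (\<lambda>B s b. \<forall>i\<in>{False, True}. (if i then \<Phi> else \<Psi>) B s b)"
    by (intro PiD_Inter) auto
  then show ?thesis by (rule PiD_cong) auto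
qed

lemma SigD_or: "0 < \<alpha> \<Longrightarrow> SigD \<alpha> n \<Phi> \<Longrightarrow> SigD \<alpha> n \<Psi> \<Longrightarrow> SigD \<alpha> n (\<lambda>B s b. \<Phi> B s b \<or> \<Psi> B s b)"
  using PiD_and[of \<alpha> n "\<lambda>B s b. \<not> \<Phi> B s b" "\<lambda>B s b. \<not> \<Psi> B s b"] by (simp add: SigD_iff)

lemma PiD_of_SigD:
  assumes "\<beta> < \<alpha>" "SigD \<beta> n \<Phi>"
  shows "PiD \<alpha> n \<Phi>"
proof -
  have "0 < \<alpha>" using assms(1) cord_0_le le_less_trans by blast
  from PiD_All[OF this, of "{()}" n "\<lambda>_. 0" "\<lambda>_. \<Phi>"] assms show ?thesis by auto
qed

lemma SigD_of_PiD: "\<beta> < \<alpha> \<Longrightarrow> PiD \<beta> n \<Phi> \<Longrightarrow> SigD \<alpha> n \<Phi>"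
  using PiD_of_SigD[of \<beta> \<alpha> n "\<lambda>B s b. \<not> \<Phi> B s b"] by (simp add: SigD_iff)

lemma Pi_in_mono: "0 < \<alpha> \<Longrightarrow> \<alpha> \<le> \<beta> \<Longrightarrow> Pi_in \<alpha> \<phi> \<Longrightarrow> Pi_in \<beta> \<phi>"
  using Pi_in_pos[of \<alpha> \<phi>] Sigma_in_Pi_in.Pi_step[of \<beta>] by (metis less_le_trans)

lemma Sigma_in_mono: "0 < \<alpha> \<Longrightarrow> \<alpha> \<le> \<beta> \<Longrightarrow> Sigma_in \<alpha> \<phi> \<Longrightarrow> Sigma_in \<beta> \<phi>"
  using Sigma_in_pos[of \<alpha> \<phi>] Sigma_in_Pi_in.Sigma_step[of \<beta>] by (metis less_le_trans)

lemma zero_or_pos: "(\<alpha>::cord) = 0 \<or> 0 < \<alpha>"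
  using cord_0_le[of \<alpha>] by (auto simp: le_less)

lemma SigD_0_iff: "SigD 0 n \<Phi> \<longleftrightarrow> PiD 0 n \<Phi>"
proof -
  have "Sigma_in 0 \<phi> \<longleftrightarrow> Pi_in 0 \<phi>" for \<phi>
    by (subst Sigma_in.simps, subst Pi_in.simps) auto
  then show ?thesis by (simp add: SigD_def PiD_def)
qed

lemma SigD_mono: "\<alpha> \<le> \<beta> \<Longrightarrow> SigD \<alpha> n \<Phi> \<Longrightarrow> SigD \<beta> n \<Phi>"
proof (cases "\<alpha> = \<beta>")
  case False
  assume "\<alpha> \<le> \<beta>" and S: "SigD \<alpha> n \<Phi>"
  then have "\<alpha> < \<beta>" using False by simp
  show ?thesis
    using zero_or_pos[of \<alpha>]
  proof
    assume "\<alpha> = 0"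
    then show ?thesis using S SigD_0_iff SigD_of_PiD[OF \<open>\<alpha> < \<beta>\<close>] by simp
  next
    assume "0 < \<alpha>"
    then show ?thesis using S Sigma_in_mono[OF _ \<open>\<alpha> \<le> \<beta>\<close>] unfolding SigD_def by blast
  qed
qed simp

lemma PiD_mono: "\<alpha> \<le> \<beta> \<Longrightarrow> PiD \<alpha> n \<Phi> \<Longrightarrow> PiD \<beta> n \<Phi>"
  unfolding PiD_iff by (rule SigD_mono)

lemma PiD_patom: "PiD 0 (length a) (\<lambda>B s b. patom r s a b)"
proof -
  let ?n = "length a"
  define lit where "lit i j = [if a ! i = a ! j then Eq i j else Neg (Eq i j),
    if (a ! i, a ! j) \<in> r then Le i j else Neg (Le i j)]" for i j
  define S where "S = (\<Union>i<?n. \<Union>j<?n. set (lit i j))"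
  have fin: "finite S" by (simp add: S_def)
  define F where "F = acset S"
  have F: "rcset F = S" unfolding F_def using fin by (intro acset_inverse) (simp add: countable_finite)
  have "finitary_qf (And F)"
    by (rule finitary_qf.intros) (auto simp: F fin, auto simp: S_def lit_def intro: finitary_qf.intros split: if_splits)
  then have "Pi_in 0 (And F)" by (rule Sigma_in_Pi_in.Pi_0)
  moreover have "fv (And F) \<subseteq> {..<?n}"
    by (auto simp: cimage.rep_eq F S_def lit_def split: if_splits)
  moreover have "sat B s (And F) e \<longleftrightarrow> patom r s a (map e [0..<?n])" for B s e
  proof -
    have "(\<forall>\<phi>\<in>set (lit i j). sat B s \<phi> e) \<longleftrightarrow> (a ! i = a ! j \<longleftrightarrow> e i = e j) \<and> ((a ! i, a ! j) \<in> r \<longleftrightarrow> (e i, e j) \<in> s)" for i j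
      by (auto simp: lit_def)
    then show ?thesis unfolding sat_And F S_def patom_def by auto
  qed
  ultimately show ?thesis unfolding PiD_def fm_defines_def by blast
qed

lemma countable_below: "countable {\<gamma>::cord. \<gamma> < \<beta>}"
proof -
  obtain r where r: "Well_order r" "\<beta> = abs_cord r" by (rule cord_cases)
  have "{\<gamma>. \<gamma> < \<beta>} \<subseteq> (\<lambda>a. abs_cord (Restr r (underS r a))) ` Field r"
    unfolding r(2) using less_abs_cord_iff[OF r(1)] by auto
  then show ?thesis by (rule countable_subset) simp
qed

text \<open>For each \<gamma> and \<open>c\<close> the forth clause is \<Sigma> at
  \<open>osuc (g \<gamma>)\<close>. The back clause quantifies universally over \<open>d\<close>,
  and inside it the countable disjunction over \<open>c\<close> is again \<Sigma> at that level. A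
  \<delta> above all these levels suffices.\<close>

lemma PiD_bf_step:
  assumes "0 < \<delta>" and g: "\<And>\<gamma> c. \<gamma> < \<beta> \<Longrightarrow> set c \<subseteq> A \<Longrightarrow> PiD (g \<gamma>) (length a + length c) (\<lambda>B s b. bf A r B s \<gamma> (a @ c) b)"
    and \<delta>: "\<And>\<gamma>. \<gamma> < \<beta> \<Longrightarrow> osuc (g \<gamma>) < \<delta>"
  shows "PiD \<delta> (length a) (\<lambda>B s b. bf A r B s \<beta> a b)"
proof -
  let ?n = "length a"
  have pos: "0 < osuc \<gamma>" for \<gamma> using cord_0_le less_osuc le_less_trans by blast
  have 1: "PiD \<delta> ?n (\<lambda>B s b. patom r s a b)"
    by (rule PiD_mono[OF _ PiD_patom]) (rule cord_0_le)
  have E: "SigD (osuc (g \<gamma>)) ?n (\<lambda>B s b. \<exists>d. set d \<subseteq> B \<and> length d = length c \<and> bf A r B s \<gamma> (a @ c) (b @ d))"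
    if "\<gamma> < \<beta>" "set c \<subseteq> A" for \<gamma> c
    using SigD_Ex[OF pos, of "{()}" "g \<gamma>" ?n "\<lambda>_. length c" "\<lambda>_ B s b. bf A r B s \<gamma> (a @ c) b"]
      g[OF that] less_osuc by auto
  have 2: "PiD \<delta> ?n (\<lambda>B s b. \<forall>i\<in>{\<gamma>. \<gamma> < \<beta>} \<times> {c. set c \<subseteq> A}.
      \<exists>d. set d \<subseteq> B \<and> length d = length (snd i) \<and> bf A r B s (fst i) (a @ snd i) (b @ d))"
  proof (rule PiD_Inter[OF assms(1)])
    show "countable ({\<gamma>. \<gamma> < \<beta>} \<times> {c. set c \<subseteq> A})"
      using countable_below by (rule countable_SIGMA) simp
    fix i assume "i \<in> {\<gamma>. \<gamma> < \<beta>} \<times> {c. set c \<subseteq> A}"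
    then show "PiD \<delta> ?n (\<lambda>B s b. \<exists>d. set d \<subseteq> B \<and> length d = length (snd i) \<and> bf A r B s (fst i) (a @ snd i) (b @ d))"
      by (intro PiD_of_SigD[OF \<delta> E]) auto
  qed
  have U: "SigD (osuc (g \<gamma>)) (?n + m) (\<lambda>B s b. \<exists>c\<in>{c. set c \<subseteq> A \<and> length c = m}. bf A r B s \<gamma> (a @ c) b)"
    if "\<gamma> < \<beta>" for \<gamma> m
  proof (rule SigD_Union[OF pos])
    fix c assume "c \<in> {c. set c \<subseteq> A \<and> length c = m}"
    then show "SigD (osuc (g \<gamma>)) (?n + m) (\<lambda>B s b. bf A r B s \<gamma> (a @ c) b)"
      using SigD_of_PiD[OF less_osuc g[OF that, of c]] by auto
  qed simp
  have 3: "PiD \<delta> ?n (\<lambda>B s b. \<forall>i\<in>{\<gamma>. \<gamma> < \<beta>} \<times> UNIV. \<forall>d. set d \<subseteq> B \<and> length d = snd i \<longrightarrow>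
      (\<exists>c\<in>{c. set c \<subseteq> A \<and> length c = snd i}. bf A r B s (fst i) (a @ c) (b @ d)))"
  proof (rule PiD_All[OF assms(1)])
    show "countable ({\<gamma>. \<gamma> < \<beta>} \<times> (UNIV :: nat set))"
      using countable_below by (rule countable_SIGMA) simp
  qed (use U \<delta> in fastforce)
  show ?thesis
    by (rule PiD_cong[OF PiD_and[OF assms(1) 1 PiD_and[OF assms(1) 2 3]]])
      (subst bf_iff[of _ _ _ _ \<beta>], (auto; metis))
qed

section \<open>Scott sentences\<close>

lemma bf_trans:
  "bf A r B s \<beta> a b \<Longrightarrow> bf B s C u \<beta> b c \<Longrightarrow> bf A r C u \<beta> a c"
proof (induction \<beta> arbitrary: a b c rule: less_induct)
  case (less \<beta>)
  show ?case
  proof (rule bfI)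
    show "patom r u a c"
      using bf_patom[OF less.prems(1)] bf_patom[OF less.prems(2)] unfolding patom_def by metis
    show "\<forall>\<gamma><\<beta>. \<forall>x. set x \<subseteq> A \<longrightarrow> (\<exists>z. set z \<subseteq> C \<and> length z = length x \<and> bf A r C u \<gamma> (a @ x) (c @ z))"
    proof (intro allI impI)
      fix \<gamma> x assume x: "\<gamma> < \<beta>" "set x \<subseteq> A"
      obtain y where y: "set y \<subseteq> B" "length y = length x" "bf A r B s \<gamma> (a @ x) (b @ y)"
        using bf_forth[OF less.prems(1) x] by blast
      obtain z where z: "set z \<subseteq> C" "length z = length y" "bf B s C u \<gamma> (b @ y) (c @ z)"
        using bf_forth[OF less.prems(2) x(1) y(1)] by blast
      show "\<exists>z. set z \<subseteq> C \<and> length z = length x \<and> bf A r C u \<gamma> (a @ x) (c @ z)"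
        using z y less.IH[OF x(1) y(3) z(3)] by metis
    qed
    show "\<forall>\<gamma><\<beta>. \<forall>z. set z \<subseteq> C \<longrightarrow> (\<exists>x. set x \<subseteq> A \<and> length z = length x \<and> bf A r C u \<gamma> (a @ x) (c @ z))"
    proof (intro allI impI)
      fix \<gamma> z assume z: "\<gamma> < \<beta>" "set z \<subseteq> C"
      obtain y where y: "set y \<subseteq> B" "length y = length z" "bf B s C u \<gamma> (b @ y) (c @ z)"
        using bf_back[OF less.prems(2) z] by blast
      obtain x where x: "set x \<subseteq> A" "length x = length y" "bf A r B s \<gamma> (a @ x) (b @ y)"
        using bf_back[OF less.prems(1) z(1) y(1)] by blast
      show "\<exists>x. set x \<subseteq> A \<and> length z = length x \<and> bf A r C u \<gamma> (a @ x) (c @ z)"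
        using x y less.IH[OF z(1) x(3) y(3)] by metis
    qed
  qed
qed

lemma bf_refl: "set a \<subseteq> A \<Longrightarrow> bf A r A r \<beta> a a"
  using iso_bf[of id A A r r a \<beta>] by simp

lemma PiD_weaken: "PiD \<alpha> n \<Phi> \<Longrightarrow> PiD \<alpha> (n + k) (\<lambda>B s b. \<Phi> B s (take n b))"
proof -
  assume "PiD \<alpha> n \<Phi>"
  then obtain \<phi> where \<phi>: "Pi_in \<alpha> \<phi>" "fm_defines n \<phi> \<Phi>" by (auto simp: PiD_def)
  have "take n (map e [0..<n + k]) = map e [0..<n]" for e :: "nat \<Rightarrow> nat"
    by (rule nth_equalityI) auto
  then have "fm_defines (n + k) \<phi> (\<lambda>B s b. \<Phi> B s (take n b))"
    using \<phi>(2) by (auto simp: fm_defines_def)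
  with \<phi>(1) show ?thesis by (auto simp: PiD_def)
qed

lemma SigD_Ex1:
  assumes "PiD \<beta> (Suc n) \<Psi>" "\<beta> < \<alpha>"
  shows "SigD \<alpha> n (\<lambda>B s b. \<exists>d\<in>B. \<Psi> B s (b @ [d]))"
proof -
  have "0 < \<alpha>" using assms(2) cord_0_le le_less_trans by blast
  then have "SigD \<alpha> n (\<lambda>B s b. \<exists>i\<in>{()}. \<exists>d. set d \<subseteq> B \<and> length d = 1 \<and> \<Psi> B s (b @ d))"
    by (rule SigD_Ex) (use assms in auto)
  then show ?thesis by (rule SigD_cong) (force simp: length_Suc_conv)
qed

text \<open>Isomorphic copies of \<open>A\<close> satisfy \<open>T\<close> because \<open>T\<close>
  is given by a formula; only the converse has to be supplied.\<close>

lemma Scott_sentenceI: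
  assumes T: "PiD \<alpha> 0 (\<lambda>B s b. T B s)" and A: "structure_on A r" "T A r"
    and iso: "\<And>B s. structure_on B s \<Longrightarrow> T B s \<Longrightarrow> isomorphic A r B s"
  shows "has_scott_sentence_in A r (PiC \<alpha>)"
proof -
  obtain \<phi> where \<phi>: "Pi_in \<alpha> \<phi>" "fm_defines 0 \<phi> (\<lambda>B s b. T B s)" using T by (auto simp: PiD_def)
  have fv: "fv \<phi> = {}" using \<phi>(2) by (simp add: fm_defines_def)
  have sat: "sat B s \<phi> e \<longleftrightarrow> T B s" if "structure_on B s" "range e \<subseteq> B" for B s e
    using \<phi>(2) that by (simp add: fm_defines_def)
  have m: "models B s \<phi> \<longleftrightarrow> T B s" if B: "structure_on B s" for B s
  proof
    obtain x where "x \<in> B" using B by (auto simp: structure_on_def)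
    then have "range (\<lambda>_. x) \<subseteq> B" by auto
    then show "T B s" if "models B s \<phi>"
      using that sat[OF B, of "\<lambda>_. x"] by (simp add: models_def)
    show "models B s \<phi>" if "T B s" using that sat[OF B] by (simp add: models_def)
  qed
  have "models B s \<phi>" if B: "structure_on B s" and i: "isomorphic A r B s" for B s
    unfolding models_def
  proof (intro allI impI)
    fix e' :: "nat \<Rightarrow> nat" assume "range e' \<subseteq> B"
    obtain x where "x \<in> A" using A(1) by (auto simp: structure_on_def)
    then have "sat A r \<phi> (\<lambda>_. x)" using sat[OF A(1), of "\<lambda>_. x"] A(2) by auto
    then show "sat B s \<phi> e'"
      using bf_preserves(2)[OF \<phi>(1) isomorphic_bf[OF i]] fv by blast
  qed
  then have "scott_sentence A r \<phi>"
    unfolding scott_sentence_def sentence_def using fv m iso by blast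
  with \<phi>(1) show ?thesis by (auto simp: has_scott_sentence_in_def)
qed

text \<open>The assignment \<open>\<beta>\<close> of back-and-forth ranks to tuples of \<open>A\<close> describes \<open>A\<close> if \<open>A\<close> and \<open>B\<close> are
  related by the back-and-forth system of the pairs \<open>(a, b)\<close> with \<open>bf (\<beta> a) a b\<close>.\<close>

definition bf_extends where
  "bf_extends A r \<beta> B s a b \<longleftrightarrow>
    (\<forall>c\<in>A. \<exists>d\<in>B. bf A r B s (\<beta> (a @ [c])) (a @ [c]) (b @ [d])) \<and>
    (\<forall>d\<in>B. \<exists>c\<in>A. bf A r B s (\<beta> (a @ [c])) (a @ [c]) (b @ [d]))"

definition bf_described where
  "bf_described A r \<beta> B s \<longleftrightarrow> bf A r B s (\<beta> []) [] [] \<and> (\<forall>a. set a \<subseteq> A \<longrightarrow>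
    (\<forall>b. set b \<subseteq> B \<and> length b = length a \<longrightarrow> bf A r B s (\<beta> a) a b \<longrightarrow> bf_extends A r \<beta> B s a b))"

lemma bf_described_isomorphic: "bf_described A r \<beta> B s \<Longrightarrow> isomorphic A r B s"
proof (rule isomorphicI[of "\<lambda>a b. set a \<subseteq> A \<and> set b \<subseteq> B \<and> bf A r B s (\<beta> a) a b"])
  assume d: "bf_described A r \<beta> B s"
  then show "set [] \<subseteq> A \<and> set [] \<subseteq> B \<and> bf A r B s (\<beta> []) [] []" by (simp add: bf_described_def)
  fix a b assume ab: "set a \<subseteq> A \<and> set b \<subseteq> B \<and> bf A r B s (\<beta> a) a b"
  then show "patom r s a b \<and> set a \<subseteq> A \<and> set b \<subseteq> B" using bf_patom by blast
  have "bf_extends A r \<beta> B s a b"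
    using d ab bf_length[of A r B s "\<beta> a" a b] by (simp add: bf_described_def)
  then show "\<And>c. c \<in> A \<Longrightarrow> \<exists>d\<in>B. set (a @ [c]) \<subseteq> A \<and> set (b @ [d]) \<subseteq> B \<and> bf A r B s (\<beta> (a @ [c])) (a @ [c]) (b @ [d])"
    and "\<And>d. d \<in> B \<Longrightarrow> \<exists>c\<in>A. set (a @ [c]) \<subseteq> A \<and> set (b @ [d]) \<subseteq> B \<and> bf A r B s (\<beta> (a @ [c])) (a @ [c]) (b @ [d])"
    using ab unfolding bf_extends_def by auto
qed

lemma SigD_forth:
  assumes "PiD p (length a) (\<lambda>B s b. bf A r B s \<gamma> a b)" "PiD q (Suc (length a)) (\<lambda>B s b. bf A r B s \<delta> (a @ [c]) b)"
    and "p \<le> \<alpha>" "q < \<alpha>"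
  shows "SigD \<alpha> (length a) (\<lambda>B s b. \<not> bf A r B s \<gamma> a b \<or> (\<exists>d\<in>B. bf A r B s \<delta> (a @ [c]) (b @ [d])))"
proof (rule SigD_or)
  show "0 < \<alpha>" using assms(4) cord_0_le le_less_trans by blast
  show "SigD \<alpha> (length a) (\<lambda>B s b. \<not> bf A r B s \<gamma> a b)"
    by (rule SigD_mono[OF assms(3)]) (use assms(1) in \<open>simp add: PiD_iff\<close>)
qed (rule SigD_Ex1[OF assms(2,4)])

lemma PiD_forth:
  assumes \<alpha>: "0 < \<alpha>" and S: "\<And>a c. set a \<subseteq> A \<Longrightarrow> c \<in> A \<Longrightarrow> \<exists>\<delta><\<alpha>. SigD \<delta> (length a)
    (\<lambda>B s b. \<not> bf A r B s (\<beta> a) a b \<or> (\<exists>d\<in>B. bf A r B s (\<beta> (a @ [c])) (a @ [c]) (b @ [d])))"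
  shows "PiD \<alpha> 0 (\<lambda>B s b. \<forall>a. set a \<subseteq> A \<longrightarrow> (\<forall>b. set b \<subseteq> B \<and> length b = length a \<longrightarrow> bf A r B s (\<beta> a) a b \<longrightarrow>
    (\<forall>c\<in>A. \<exists>d\<in>B. bf A r B s (\<beta> (a @ [c])) (a @ [c]) (b @ [d]))))"
proof -
  have "PiD \<alpha> 0 (\<lambda>B s b. \<forall>i\<in>{a. set a \<subseteq> A} \<times> A. \<forall>d. set d \<subseteq> B \<and> length d = length (fst i) \<longrightarrow>
      (\<lambda>B s b. \<not> bf A r B s (\<beta> (fst i)) (fst i) b \<or>
        (\<exists>d\<in>B. bf A r B s (\<beta> (fst i @ [snd i])) (fst i @ [snd i]) (b @ [d]))) B s (b @ d))"
    by (rule PiD_All[OF \<alpha>]) (use S in auto)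
  then show ?thesis by (rule PiD_cong) auto
qed

lemma PiD_back:
  assumes \<alpha>: "0 < \<alpha>" and "countable I" and I: "\<And>i. i \<in> I \<Longrightarrow> set (f i) \<subseteq> A"
    and S: "\<And>i. i \<in> I \<Longrightarrow> \<exists>\<delta><\<alpha>. SigD \<delta> (length (f i) + 1)
      (\<lambda>B s b. \<not> bf A r B s (\<beta> (f i)) (f i) (take (length (f i)) b) \<or> \<Psi> i B s b)"
  shows "PiD \<alpha> 0 (\<lambda>B s b. \<forall>i\<in>I. \<forall>b. set b \<subseteq> B \<and> length b = length (f i) \<longrightarrow> bf A r B s (\<beta> (f i)) (f i) b \<longrightarrow>
    (\<forall>d\<in>B. \<Psi> i B s (b @ [d])))"
proof -
  have "PiD \<alpha> 0 (\<lambda>B s b. \<forall>i\<in>I. \<forall>d. set d \<subseteq> B \<and> length d = length (f i) + 1 \<longrightarrow>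
      (\<lambda>B s b. \<not> bf A r B s (\<beta> (f i)) (f i) (take (length (f i)) b) \<or> \<Psi> i B s b) B s (b @ d))"
    by (rule PiD_All[OF \<alpha> assms(2)]) (use S in auto)
  then show ?thesis
  proof (rule PiD_cong)
    fix B :: "nat set" and s and b :: "nat list" assume "length b = 0"
    then have [simp]: "b = []" by simp
    have "(\<forall>d. set d \<subseteq> B \<and> length d = length (f i) + 1 \<longrightarrow> Q d) \<longleftrightarrow>
        (\<forall>b d. set b \<subseteq> B \<and> length b = length (f i) \<and> d \<in> B \<longrightarrow> Q (b @ [d]))" for Q i
    proof safe
      fix d :: "nat list"
      assume "\<forall>b d. set b \<subseteq> B \<and> length b = length (f i) \<and> d \<in> B \<longrightarrow> Q (b @ [d])"
        "set d \<subseteq> B" "length d = length (f i) + 1"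
      then show "Q d" by (cases d rule: rev_cases) auto
    qed auto
    then show "(\<forall>i\<in>I. \<forall>d. set d \<subseteq> B \<and> length d = length (f i) + 1 \<longrightarrow>
        (\<not> bf A r B s (\<beta> (f i)) (f i) (take (length (f i)) (b @ d)) \<or> \<Psi> i B s (b @ d))) \<longleftrightarrow>
      (\<forall>i\<in>I. \<forall>b. set b \<subseteq> B \<and> length b = length (f i) \<longrightarrow> bf A r B s (\<beta> (f i)) (f i) b \<longrightarrow> (\<forall>d\<in>B. \<Psi> i B s (b @ [d])))"
      by auto
  qed
qed

text \<open>The negation of a \<Pi> condition of level below \<open>q\<close> is \<Sigma> at
  \<open>q\<close>, and so is a countable disjunction of such conditions or an existential statement
  over one. Both halves of \<open>bf_described\<close> are thus \<Pi> at
  \<open>osuc q\<close>.\<close>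

lemma scott_sentence_Pi_Suc:
  assumes A: "structure_on A r" and q: "0 < q"
    and p: "\<And>a. set a \<subseteq> A \<Longrightarrow> \<exists>p<q. PiD p (length a) (\<lambda>B s b. bf A r B s (\<beta> a) a b)"
    and ext: "\<And>a b. set a \<subseteq> A \<Longrightarrow> set b \<subseteq> A \<Longrightarrow> bf A r A r (\<beta> a) a b \<Longrightarrow> bf_extends A r \<beta> A r a b"
  shows "has_scott_sentence_in A r (PiC (osuc q))"
proof (rule Scott_sentenceI[where T = "bf_described A r \<beta>", OF _ A _ bf_described_isomorphic])
  show "bf_described A r \<beta> A r"
    unfolding bf_described_def using ext bf_refl[of "[]" A r] by simp
  have pos: "0 < osuc q" using q less_osuc less_trans by blast
  have 1: "PiD (osuc q) 0 (\<lambda>B s b. bf A r B s (\<beta> []) [] [])"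
  proof -
    obtain p1 where p1: "p1 < q" "PiD p1 0 (\<lambda>B s b. bf A r B s (\<beta> []) [] b)" using p[of "[]"] by auto
    have "p1 \<le> osuc q" using less_trans[OF p1(1) less_osuc] by (rule less_imp_le)
    then have "PiD (osuc q) 0 (\<lambda>B s b. bf A r B s (\<beta> []) [] b)"
      using p1(2) by (rule PiD_mono)
    then show ?thesis by (rule PiD_cong) auto
  qed
  have 2: "PiD (osuc q) 0 (\<lambda>B s b. \<forall>a. set a \<subseteq> A \<longrightarrow> (\<forall>b. set b \<subseteq> B \<and> length b = length a \<longrightarrow> bf A r B s (\<beta> a) a b \<longrightarrow>
    (\<forall>c\<in>A. \<exists>d\<in>B. bf A r B s (\<beta> (a @ [c])) (a @ [c]) (b @ [d]))))"
  proof (rule PiD_forth[OF pos])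
    fix a c assume a: "set a \<subseteq> A" "c \<in> A"
    obtain p1 where p1: "p1 < q" "PiD p1 (length a) (\<lambda>B s b. bf A r B s (\<beta> a) a b)" using p[OF a(1)] by blast
    obtain p2 where p2: "p2 < q" "PiD p2 (Suc (length a)) (\<lambda>B s b. bf A r B s (\<beta> (a @ [c])) (a @ [c]) b)"
      using p[of "a @ [c]"] a by auto
    show "\<exists>\<delta><osuc q. SigD \<delta> (length a)
        (\<lambda>B s b. \<not> bf A r B s (\<beta> a) a b \<or> (\<exists>d\<in>B. bf A r B s (\<beta> (a @ [c])) (a @ [c]) (b @ [d])))"
      by (intro exI[of _ q] conjI less_osuc SigD_forth[OF p1(2) p2(2)] less_imp_le[OF p1(1)] p2(1))
  qed
  have 3: "PiD (osuc q) 0 (\<lambda>B s b. \<forall>i\<in>{a. set a \<subseteq> A}. \<forall>b. set b \<subseteq> B \<and> length b = length i \<longrightarrow> bf A r B s (\<beta> i) i b \<longrightarrow>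
    (\<forall>d\<in>B. \<exists>c\<in>A. bf A r B s (\<beta> (i @ [c])) (i @ [c]) (b @ [d])))"
  proof (rule PiD_back[OF pos])
    fix a assume a: "a \<in> {a. set a \<subseteq> A}"
    obtain p1 where p1: "p1 < q" "PiD p1 (length a) (\<lambda>B s b. bf A r B s (\<beta> a) a b)" using p a by blast
    have "SigD q (length a + 1) (\<lambda>B s b. \<not> bf A r B s (\<beta> a) a (take (length a) b))"
      by (rule SigD_mono[OF less_imp_le[OF p1(1)]]) (use PiD_weaken[OF p1(2), of 1] in \<open>simp add: PiD_iff\<close>)
    moreover have "SigD q (length a + 1) (\<lambda>B s b. \<exists>c\<in>A. bf A r B s (\<beta> (a @ [c])) (a @ [c]) b)"
    proof (rule SigD_Union[OF q])
      fix c assume "c \<in> A"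
      then obtain p2 where "p2 < q" "PiD p2 (length (a @ [c])) (\<lambda>B s b. bf A r B s (\<beta> (a @ [c])) (a @ [c]) b)"
        using p[of "a @ [c]"] a by auto
      then show "SigD q (length a + 1) (\<lambda>B s b. bf A r B s (\<beta> (a @ [c])) (a @ [c]) b)"
        by (simp add: SigD_of_PiD)
    qed simp
    ultimately show "\<exists>\<delta><osuc q. SigD \<delta> (length a + 1) (\<lambda>B s b. \<not> bf A r B s (\<beta> a) a (take (length a) b) \<or>
        (\<exists>c\<in>A. bf A r B s (\<beta> (a @ [c])) (a @ [c]) b))"
      using SigD_or[OF q] less_osuc by blast
  qed auto
  show "PiD (osuc q) 0 (\<lambda>B s b. bf_described A r \<beta> B s)"
    by (rule PiD_cong[OF PiD_and[OF pos 1 PiD_and[OF pos 2 3]]])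
      (auto simp: bf_described_def bf_extends_def)
qed

section \<open>Scott sentences at \<open>lam\<close> and its next two successors\<close>

context maximal_order
begin

lemma bf_definable:
  "\<beta> < lam \<Longrightarrow> set a \<subseteq> A \<Longrightarrow> PiD (hh \<beta>) (length a) (\<lambda>B s b. bf A r B s \<beta> a b)"
proof (induction \<beta> arbitrary: a rule: less_induct)
  case (less \<beta>)
  show ?case
  proof (rule PiD_bf_step[OF hh_pos[OF less.prems(1)], where g = hh])
    fix \<gamma> c assume "\<gamma> < \<beta>" "set c \<subseteq> A"
    then show "PiD (hh \<gamma>) (length a + length c) (\<lambda>B s b. bf A r B s \<gamma> (a @ c) b)"
      using less.IH[of \<gamma> "a @ c"] less.prems less_trans[of \<gamma> \<beta> lam] by simp
  qed (use hh_mono less.prems in blast)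
qed

text \<open>\<open>lam\<close> is closed under \<open>hh\<close> and under successor, so the
  supremum of the levels for smaller ranks does not exceed it.\<close>

lemma bf_definable_lam: "set a \<subseteq> A \<Longrightarrow> PiD lam (length a) (\<lambda>B s b. bf A r B s lam a b)"
proof (rule PiD_bf_step[OF lam_pos, where g = hh])
  assume a: "set a \<subseteq> A"
  fix \<gamma> c assume "\<gamma> < lam" "set c \<subseteq> A"
  then show "PiD (hh \<gamma>) (length a + length c) (\<lambda>B s b. bf A r B s \<gamma> (a @ c) b)"
    using bf_definable[of \<gamma> "a @ c"] a by simp
qed (use hh_less lam_limit in blast)

theorem scott_sentence_Pi_lam_2:
  assumes "structure_on A r"
    and "\<And>a b. set a \<subseteq> A \<Longrightarrow> set b \<subseteq> A \<Longrightarrow> bf A r A r lam a b \<Longrightarrow> bf_extends A r (\<lambda>_. lam) A r a b"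
  shows "has_scott_sentence_in A r (PiC (osuc (osuc lam)))"
  using assms bf_definable_lam less_osuc[of lam] lam_pos
  by (intro scott_sentence_Pi_Suc[where \<beta> = "\<lambda>_. lam"]) (blast intro: less_trans)+

theorem scott_sentence_Pi_lam_1:
  assumes "structure_on A r" "\<And>a. set a \<subseteq> A \<Longrightarrow> \<beta> a < lam"
    and "\<And>a b. set a \<subseteq> A \<Longrightarrow> set b \<subseteq> A \<Longrightarrow> bf A r A r (\<beta> a) a b \<Longrightarrow> bf_extends A r \<beta> A r a b"
  shows "has_scott_sentence_in A r (PiC (osuc lam))"
  using assms bf_definable hh_less lam_pos
  by (intro scott_sentence_Pi_Suc[where \<beta> = \<beta>]) blast+

lemma c3_less: "c3 < lam"
  using rho_ge rho_less ex_std le_less_trans by blast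

text \<open>Here the rank of a tuple is determined by its \<open>c3\<close>-type; so the back condition splits into one
  statement of bounded complexity for each \<open>c3\<close>-type of the extended tuple.\<close>

theorem scott_sentence_Pi_lam:
  assumes A: "structure_on A r" and \<beta>: "\<And>a. set a \<subseteq> A \<Longrightarrow> \<beta> a < lam" "\<And>a. set a \<subseteq> A \<Longrightarrow> c3 \<le> \<beta> a"
    and type: "\<And>a b. set a \<subseteq> A \<Longrightarrow> set b \<subseteq> A \<Longrightarrow> bf A r A r c3 a b \<Longrightarrow> \<beta> a = \<beta> b"
    and ext: "\<And>a b. set a \<subseteq> A \<Longrightarrow> set b \<subseteq> A \<Longrightarrow> bf A r A r (\<beta> a) a b \<Longrightarrow> bf_extends A r \<beta> A r a b"
  shows "has_scott_sentence_in A r (PiC lam)"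
proof -
  define forth where "forth B s \<longleftrightarrow> (\<forall>a. set a \<subseteq> A \<longrightarrow> (\<forall>b. set b \<subseteq> B \<and> length b = length a \<longrightarrow> bf A r B s (\<beta> a) a b \<longrightarrow>
    (\<forall>c\<in>A. \<exists>d\<in>B. bf A r B s (\<beta> (a @ [c])) (a @ [c]) (b @ [d]))))" for B s
  define back1 where "back1 B s \<longleftrightarrow> (\<forall>i\<in>{a. set a \<subseteq> A}. \<forall>b. set b \<subseteq> B \<and> length b = length i \<longrightarrow> bf A r B s (\<beta> i) i b \<longrightarrow>
    (\<forall>d\<in>B. \<exists>c\<in>A. bf A r B s c3 (i @ [c]) (b @ [d])))" for B s
  \<comment> \<open>The extended tuples have the same \<open>c3\<close>-type for all members of
    \<open>C i\<close>, hence the same rank; this keeps their disjunction at a single level below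
    \<open>lam\<close>.\<close>
  define C where "C i = {c \<in> A. bf A r A r c3 (fst i @ [snd i]) (fst i @ [c])}" for i
  define back2 where "back2 B s \<longleftrightarrow> (\<forall>i\<in>{a. set a \<subseteq> A} \<times> A. \<forall>b. set b \<subseteq> B \<and> length b = length (fst i) \<longrightarrow>
    bf A r B s (\<beta> (fst i)) (fst i) b \<longrightarrow> (\<forall>d\<in>B. \<not> bf A r B s c3 (fst i @ [snd i]) (b @ [d]) \<or>
      (\<exists>c\<in>C i. bf A r B s (\<beta> (fst i @ [c])) (fst i @ [c]) (b @ [d]))))" for B s
  define T where "T B s \<longleftrightarrow> bf A r B s (\<beta> []) [] [] \<and> forth B s \<and> back1 B s \<and> back2 B s" for B s
  show ?thesis
  proof (rule Scott_sentenceI[where T = T, OF _ A])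
    have e: "bf_extends A r \<beta> A r a b" if "set a \<subseteq> A" "set b \<subseteq> A" "bf A r A r (\<beta> a) a b" for a b
      using ext that by blast
    have "back1 A r"
      unfolding back1_def
    proof (intro ballI allI impI)
      fix a b d assume "a \<in> {a. set a \<subseteq> A}" "set b \<subseteq> A \<and> length b = length a" "bf A r A r (\<beta> a) a b" "d \<in> A"
      then obtain c where "c \<in> A" "bf A r A r (\<beta> (a @ [c])) (a @ [c]) (b @ [d])"
        using e unfolding bf_extends_def by blast
      moreover have "c3 \<le> \<beta> (a @ [c])" using \<beta>(2) \<open>a \<in> _\<close> \<open>c \<in> A\<close> by simp
      ultimately show "\<exists>c\<in>A. bf A r A r c3 (a @ [c]) (b @ [d])" using bf_mono by blast
    qed
    moreover have "back2 A r"
      unfolding back2_def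
    proof (intro ballI allI impI)
      fix i b d assume i: "i \<in> {a. set a \<subseteq> A} \<times> A" and b: "set b \<subseteq> A \<and> length b = length (fst i)"
        "bf A r A r (\<beta> (fst i)) (fst i) b" "d \<in> A"
      have "bf_extends A r \<beta> A r (fst i) b" by (rule e) (use i b in auto)
      then obtain c where c: "c \<in> A" "bf A r A r (\<beta> (fst i @ [c])) (fst i @ [c]) (b @ [d])"
        using b(3) unfolding bf_extends_def by blast
      have "c3 \<le> \<beta> (fst i @ [c])" using \<beta>(2) i c(1) by auto
      then have "bf A r A r c3 (b @ [d]) (fst i @ [c])" using bf_sym[OF bf_mono[OF c(2)]] by blast
      then have "c \<in> C i" if "bf A r A r c3 (fst i @ [snd i]) (b @ [d])"
        using bf_trans[OF that] c(1) by (auto simp: C_def)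
      with c show "\<not> bf A r A r c3 (fst i @ [snd i]) (b @ [d]) \<or>
          (\<exists>c\<in>C i. bf A r A r (\<beta> (fst i @ [c])) (fst i @ [c]) (b @ [d]))" by blast
    qed
    moreover have "forth A r" unfolding forth_def using e by (auto simp: bf_extends_def)
    ultimately show "T A r" using bf_refl[of "[]" A r] by (simp add: T_def)
  next
    fix B s assume T: "T B s"
    have "bf_described A r \<beta> B s"
      unfolding bf_described_def bf_extends_def
    proof (intro conjI allI impI ballI)
      show "bf A r B s (\<beta> []) [] []" using T by (simp add: T_def)
      fix a b assume a: "set a \<subseteq> A" and b: "set b \<subseteq> B \<and> length b = length a" "bf A r B s (\<beta> a) a b"
      show "\<exists>d\<in>B. bf A r B s (\<beta> (a @ [c])) (a @ [c]) (b @ [d])" if "c \<in> A" for c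
        using T a b that unfolding T_def forth_def by blast
      fix d assume d: "d \<in> B"
      have "back1 B s" "back2 B s" using T by (simp_all add: T_def)
      then obtain c0 where c0: "c0 \<in> A" "bf A r B s c3 (a @ [c0]) (b @ [d])"
        using a b d unfolding back1_def by blast
      have "(a, c0) \<in> {a. set a \<subseteq> A} \<times> A" using a c0 by simp
      from bspec[OF \<open>back2 B s\<close>[unfolded back2_def] this] b d c0(2)
      have "\<exists>c\<in>C (a, c0). bf A r B s (\<beta> (a @ [c])) (a @ [c]) (b @ [d])" by auto
      then show "\<exists>c\<in>A. bf A r B s (\<beta> (a @ [c])) (a @ [c]) (b @ [d])" by (auto simp: C_def)
    qed
    then show "isomorphic A r B s" by (rule bf_described_isomorphic)
  next
    have h: "osuc (max (hh \<gamma>) (hh \<delta>)) < lam" if "\<gamma> < lam" "\<delta> < lam" for \<gamma> \<delta>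
      using that hh_less lam_limit by (simp add: max_def)
    have m: "hh \<gamma> \<le> osuc (max (hh \<gamma>) (hh \<delta>))" "hh \<delta> < osuc (max (hh \<gamma>) (hh \<delta>))"
      "hh \<gamma> < osuc (max (hh \<gamma>) (hh \<delta>))" for \<gamma> \<delta>
      using less_osuc[of "max (hh \<gamma>) (hh \<delta>)"] by (auto simp: less_osuc_iff intro: less_imp_le)
    have pos: "0 < osuc \<gamma>" for \<gamma> using cord_0_le less_osuc le_less_trans by blast
    have neg: "SigD (osuc (max (hh (\<beta> a)) \<delta>)) (length a + 1) (\<lambda>B s b. \<not> bf A r B s (\<beta> a) a (take (length a) b))"
      if "set a \<subseteq> A" for a \<delta>
    proof (rule SigD_mono)
      show "hh (\<beta> a) \<le> osuc (max (hh (\<beta> a)) \<delta>)" using less_osuc[of "max (hh (\<beta> a)) \<delta>"] by (simp add: less_imp_le)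
      show "SigD (hh (\<beta> a)) (length a + 1) (\<lambda>B s b. \<not> bf A r B s (\<beta> a) a (take (length a) b))"
        using PiD_weaken[OF bf_definable[OF \<beta>(1)[OF that] that], of 1] by (simp add: PiD_iff)
    qed
    have 1: "PiD lam 0 (\<lambda>B s b. bf A r B s (\<beta> []) [] [])"
    proof -
      have h0: "\<beta> [] < lam" using \<beta>(1)[of "[]"] by simp
      have "PiD lam 0 (\<lambda>B s b. bf A r B s (\<beta> []) [] b)"
        using PiD_mono[OF less_imp_le[OF hh_less[OF h0]] bf_definable[OF h0, of "[]" A r]] by simp
      then show ?thesis by (rule PiD_cong) auto
    qed
    have 2: "PiD lam 0 (\<lambda>B s b. forth B s)"
      unfolding forth_def
    proof (rule PiD_forth[OF lam_pos])
      fix a c assume a: "set a \<subseteq> A" "c \<in> A"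
      show "\<exists>\<delta><lam. SigD \<delta> (length a)
        (\<lambda>B s b. \<not> bf A r B s (\<beta> a) a b \<or> (\<exists>d\<in>B. bf A r B s (\<beta> (a @ [c])) (a @ [c]) (b @ [d])))"
      proof (intro exI conjI)
        have ac: "set (a @ [c]) \<subseteq> A" using a by simp
        let ?\<delta> = "osuc (max (hh (\<beta> a)) (hh (\<beta> (a @ [c]))))"
        show "?\<delta> < lam" by (rule h[OF \<beta>(1)[OF a(1)] \<beta>(1)[OF ac]])
        show "SigD ?\<delta> (length a)
          (\<lambda>B s b. \<not> bf A r B s (\<beta> a) a b \<or> (\<exists>d\<in>B. bf A r B s (\<beta> (a @ [c])) (a @ [c]) (b @ [d])))"
          using bf_definable[OF \<beta>(1)[OF ac] ac, of r]
          by (intro SigD_forth[OF bf_definable[OF \<beta>(1)[OF a(1)] a(1)] _ m(1,2)]) simp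
      qed
    qed
    have 3: "PiD lam 0 (\<lambda>B s b. back1 B s)"
      unfolding back1_def
    proof (rule PiD_back[OF lam_pos])
      fix a assume "a \<in> {a. set a \<subseteq> A}"
      then have a: "set a \<subseteq> A" by simp
      let ?\<delta> = "osuc (max (hh (\<beta> a)) (hh c3))"
      have "SigD ?\<delta> (length a + 1) (\<lambda>B s b. \<exists>c\<in>A. bf A r B s c3 (a @ [c]) b)"
      proof (rule SigD_Union[OF pos])
        fix c assume "c \<in> A"
        then show "SigD ?\<delta> (length a + 1) (\<lambda>B s b. bf A r B s c3 (a @ [c]) b)"
          using SigD_of_PiD[OF m(2) bf_definable[OF c3_less, of "a @ [c]" A r]] a by simp
      qed simp
      then show "\<exists>\<delta><lam. SigD \<delta> (length a + 1) (\<lambda>B s b. \<not> bf A r B s (\<beta> a) a (take (length a) b) \<or>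
          (\<exists>c\<in>A. bf A r B s c3 (a @ [c]) b))"
        using SigD_or[OF pos neg[OF a]] h[OF \<beta>(1)[OF a] c3_less] by blast
    qed auto
    have 4: "PiD lam 0 (\<lambda>B s b. back2 B s)"
      unfolding back2_def
    proof (rule PiD_back[OF lam_pos])
      fix i assume i: "i \<in> {a. set a \<subseteq> A} \<times> A"
      define a c where "a = fst i" and "c = snd i"
      have a: "set a \<subseteq> A" "c \<in> A" "set (a @ [c]) \<subseteq> A" using i by (auto simp: a_def c_def)
      let ?\<mu> = "max (hh c3) (hh (\<beta> (a @ [c])))"
      let ?\<delta> = "osuc (max (hh (\<beta> a)) ?\<mu>)"
      have \<delta>: "?\<delta> < lam"
        using hh_less[OF c3_less] hh_less[OF \<beta>(1)[OF a(3)]] hh_less[OF \<beta>(1)[OF a(1)]] lam_limit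
        by (simp add: max_def)
      have \<mu>: "hh c3 < ?\<delta>" "hh (\<beta> (a @ [c])) < ?\<delta>"
        by (auto simp: less_osuc_iff max_def)
      have "SigD ?\<delta> (length a + 1) (\<lambda>B s b. \<not> bf A r B s c3 (a @ [c]) b)"
        by (rule SigD_mono[OF less_imp_le[OF \<mu>(1)]])
          (use bf_definable[OF c3_less a(3), of r] in \<open>simp add: PiD_iff\<close>)
      moreover have "SigD ?\<delta> (length a + 1) (\<lambda>B s b. \<exists>c\<in>C i. bf A r B s (\<beta> (a @ [c])) (a @ [c]) b)"
      proof (rule SigD_Union[OF pos])
        show "countable (C i)" by simp
        fix c' assume c': "c' \<in> C i"
        then have "\<beta> (a @ [c]) = \<beta> (a @ [c'])" "set (a @ [c']) \<subseteq> A"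
          using type[of "a @ [c]" "a @ [c']"] a by (auto simp: C_def a_def c_def)
        then show "SigD ?\<delta> (length a + 1) (\<lambda>B s b. bf A r B s (\<beta> (a @ [c'])) (a @ [c']) b)"
          using SigD_of_PiD[OF \<mu>(2)] bf_definable[OF \<beta>(1), of "a @ [c']" "a @ [c']" A r] by simp
      qed
      ultimately have "SigD ?\<delta> (length a + 1) (\<lambda>B s b. \<not> bf A r B s (\<beta> a) a (take (length a) b) \<or>
          (\<not> bf A r B s c3 (a @ [c]) b \<or> (\<exists>c\<in>C i. bf A r B s (\<beta> (a @ [c])) (a @ [c]) b)))"
        by (intro SigD_or[OF pos] neg[OF a(1)])
      with \<delta> show "\<exists>\<delta><lam. SigD \<delta> (length (fst i) + 1) (\<lambda>B s b. \<not> bf A r B s (\<beta> (fst i)) (fst i) (take (length (fst i)) b) \<or>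
          (\<not> bf A r B s c3 (fst i @ [snd i]) b \<or> (\<exists>c\<in>C i. bf A r B s (\<beta> (fst i @ [c])) (fst i @ [c]) b)))"
        unfolding a_def c_def by blast
    qed auto
    show "PiD lam 0 (\<lambda>B s b. T B s)"
      unfolding T_def by (intro PiD_and[OF lam_pos] 1 2 3 4)
  qed
qed

end

subsection \<open>Lower bounds\<close>

declare bot_cset.rep_eq [simp] cinsert.rep_eq [simp]

text \<open>The classes are syntactic: a positive \<Pi> level requires an outermost conjunction, so
  a quantifier-free formula has to be wrapped.\<close>

lemma Pi_lift:
  assumes "Pi_in \<beta> \<phi>" "\<beta> \<le> \<delta>" "0 < \<delta>"
  shows "\<exists>\<psi>. Pi_in \<delta> \<psi> \<and> fv \<psi> = fv \<phi> \<and> (\<forall>A r e. sat A r \<psi> e \<longleftrightarrow> sat A r \<phi> e)"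
  using zero_or_pos[of \<beta>]
proof
  assume "\<beta> = 0"
  then have "Sigma_in 0 \<phi>"
    using assms(1) by (auto elim!: Pi_in.cases intro: Sigma_in_Pi_in.Sigma_0)
  then have "Pi_in \<delta> (And (csingle \<phi>))"
    using assms(3) by (intro Sigma_in_Pi_in.Pi_step) (auto intro!: exI[of _ "[]"])
  then show ?thesis by (intro exI[of _ "And (csingle \<phi>)"]) auto
qed (use assms Pi_in_mono in blast)

text \<open>The parameters \<open>a\<close> absorb the witnesses of an outermost existential block.
  So the comparison structures exclude not only \<Pi> below \<alpha>, but also \<Sigma> up to
  \<alpha> and d-\<Sigma> below \<alpha>. Every class that remains contains \<Pi> at
  \<alpha>.\<close>

theorem scott_complexity_PiI:
  assumes A: "structure_on A r" and \<alpha>: "0 < \<alpha>" and "has_scott_sentence_in A r (PiC \<alpha>)"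
    and lower: "\<And>\<beta> a. \<beta> < \<alpha> \<Longrightarrow> set a \<subseteq> A \<Longrightarrow> \<exists>B s b. structure_on B s \<and> \<not> isomorphic A r B s \<and>
      set b \<subseteq> B \<and> length b = length a \<and>
      (\<forall>\<phi> e e'. Pi_in \<beta> \<phi> \<longrightarrow> along (fv \<phi>) a b e e' \<longrightarrow> sat A r \<phi> e \<longrightarrow> sat B s \<phi> e')"
  shows "scott_sentence_complexity A r (PiC \<alpha>)"
proof -
  have self: "models A r \<phi>" if "scott_sentence A r \<phi>" for \<phi>
    using that A unfolding scott_sentence_def isomorphic_def
    by (metis bij_betw_id id_apply)
  obtain x where "x \<in> A" using A by (auto simp: structure_on_def)
  define e0 where "e0 = (\<lambda>_::nat. x)"
  have e0: "range e0 \<subseteq> A" using \<open>x \<in> A\<close> by (auto simp: e0_def)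
  have not_Pi: "\<not> (Pi_in \<delta> \<phi> \<and> scott_sentence A r \<phi>)" if \<delta>: "\<delta> < \<alpha>" for \<delta> \<phi>
  proof
    assume \<phi>: "Pi_in \<delta> \<phi> \<and> scott_sentence A r \<phi>"
    obtain B s b where B: "structure_on B s" "\<not> isomorphic A r B s"
      "\<forall>\<phi> e e'. Pi_in \<delta> \<phi> \<longrightarrow> along (fv \<phi>) [] b e e' \<longrightarrow> sat A r \<phi> e \<longrightarrow> sat B s \<phi> e'"
      using lower[OF \<delta>, of "[]"] by auto
    have "sat A r \<phi> e0" using self \<phi> e0 by (auto simp: models_def)
    then have "models B s \<phi>"
      using B(3) \<phi> unfolding models_def by (auto simp: scott_sentence_def sentence_def)
    with B \<phi> show False by (auto simp: scott_sentence_def)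
  qed
  text \<open>A witness for the true disjunct of the \<open>\<Sigma>\<close> part is kept as a tuple of parameters.\<close>
  have not_conj: False
    if \<sigma>: "Sigma_in \<gamma> \<sigma>" "0 < \<gamma>" "fv \<sigma> = {}" and \<pi>: "Pi_in \<delta> \<pi>" "fv \<pi> = {}" "0 < \<alpha>"
      and \<gamma>\<delta>: "\<And>\<beta>. \<beta> < \<gamma> \<Longrightarrow> \<exists>\<epsilon><\<alpha>. \<beta> \<le> \<epsilon> \<and> \<delta> \<le> \<epsilon> \<and> (\<epsilon> = 0 \<longrightarrow> \<beta> = 0 \<and> \<delta> = 0)"
      and \<phi>: "scott_sentence A r \<phi>" "\<And>B s e. sat B s \<phi> e \<longleftrightarrow> sat B s \<sigma> e \<and> sat B s \<pi> e"
    for \<gamma> \<sigma> \<delta> \<pi> \<phi>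
  proof -
    have s: "sat A r \<sigma> e0" "sat A r \<pi> e0" using self[OF \<phi>(1)] e0 \<phi>(2) by (auto simp: models_def)
    obtain F where F: "\<sigma> = Or F" "\<forall>\<phi> \<in> rcset F. \<exists>xs \<psi> \<beta>. \<phi> = foldr Ex xs \<psi> \<and> \<beta> < \<gamma> \<and> Pi_in \<beta> \<psi>"
      using Sigma_in_pos[OF \<sigma>(2,1)] by blast
    obtain \<chi> where \<chi>: "\<chi> \<in> rcset F" "sat A r \<chi> e0" using s(1) unfolding F(1) sat_Or by blast
    then obtain xs \<psi> \<beta> where x: "\<chi> = foldr Ex xs \<psi>" "\<beta> < \<gamma>" "Pi_in \<beta> \<psi>" using F(2) by blast
    obtain e2 where e2: "\<forall>v. v \<notin> set xs \<longrightarrow> e2 v = e0 v" "\<forall>v\<in>set xs. e2 v \<in> A" "sat A r \<psi> e2"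
      using \<chi>(2) unfolding x(1) sat_foldr_Ex by blast
    have "fv \<chi> \<subseteq> fv \<sigma>" using \<chi>(1) by (auto simp: F(1) cimage.rep_eq)
    then have fv: "fv \<psi> - set xs = {}" using \<sigma>(3) x(1) by (simp add: fv_foldr_Ex)
    \<comment> \<open>A common level for the witnessed disjunct and the \<Pi> part; zero is treated
      separately since \<open>Pi_lift\<close> needs a positive target.\<close>
    obtain \<epsilon> where \<epsilon>: "\<epsilon> < \<alpha>" "\<beta> \<le> \<epsilon>" "\<delta> \<le> \<epsilon>" "\<epsilon> = 0 \<longrightarrow> \<beta> = 0 \<and> \<delta> = 0" using \<gamma>\<delta>[OF x(2)] by blast
    have lift: "\<exists>\<psi>'. Pi_in \<epsilon> \<psi>' \<and> fv \<psi>' = fv \<psi> \<and> (\<forall>A r e. sat A r \<psi>' e \<longleftrightarrow> sat A r \<psi> e)"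
      if "Pi_in \<eta> \<psi>" "\<eta> \<le> \<epsilon>" "\<epsilon> = 0 \<longrightarrow> \<eta> = 0" for \<psi> \<eta>
      using that Pi_lift[of \<eta> \<psi> \<epsilon>] zero_or_pos[of \<epsilon>] by auto
    obtain \<psi>' where \<psi>': "Pi_in \<epsilon> \<psi>'" "fv \<psi>' = fv \<psi>" "\<forall>A r e. sat A r \<psi>' e \<longleftrightarrow> sat A r \<psi> e"
      using lift[OF x(3) \<epsilon>(2)] \<epsilon>(4) by blast
    obtain \<pi>' where \<pi>': "Pi_in \<epsilon> \<pi>'" "fv \<pi>' = fv \<pi>" "\<forall>A r e. sat A r \<pi>' e \<longleftrightarrow> sat A r \<pi> e"
      using lift[OF \<pi>(1) \<epsilon>(3)] \<epsilon>(4) by blast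
    have "set (map e2 xs) \<subseteq> A" using e2(2) by auto
    from lower[OF \<epsilon>(1) this] obtain B s b where B: "structure_on B s" "\<not> isomorphic A r B s"
      "set b \<subseteq> B" "length b = length (map e2 xs)"
      "\<forall>\<phi> e e'. Pi_in \<epsilon> \<phi> \<longrightarrow> along (fv \<phi>) (map e2 xs) b e e' \<longrightarrow> sat A r \<phi> e \<longrightarrow> sat B s \<phi> e'"
      by (elim exE conjE) (rule that)
    have "models B s \<phi>"
      unfolding models_def
    proof (intro allI impI)
      fix e' :: "nat \<Rightarrow> nat" assume "range e' \<subseteq> B"
      have al: "along (fv \<psi> - set xs) [] [] e0 e'" using fv by blast
      obtain e2' where e2': "\<forall>v. v \<notin> set xs \<longrightarrow> e2' v = e' v" "\<forall>v\<in>set xs. e2' v \<in> B"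
        "along (fv \<psi>) ([] @ map e2 xs) ([] @ b) e2 e2'"
        using along_extend[OF al e2(1) B(4)[unfolded length_map] refl B(3)] by (elim exE conjE) (rule that)
      have "sat B s \<psi>' e2'" using B(5) \<psi>' e2'(3) e2(3) by (metis append_Nil)
      then have "sat B s \<chi> e'"
        unfolding x(1) sat_foldr_Ex using e2'(1,2) \<psi>'(3) by blast
      then have "sat B s \<sigma> e'" unfolding F(1) sat_Or using \<chi>(1) by blast
      moreover have "sat B s \<pi> e'" using B(5) \<pi>' \<pi>(2) s(2) by blast
      ultimately show "sat B s \<phi> e'" by (simp add: \<phi>(2))
    qed
    with B(1,2) \<phi>(1) show False by (simp add: scott_sentence_def)
  qed
  \<comment> \<open>The empty conjunction turns a single \<Sigma> or \<Pi> sentence into a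
    conjunction of both kinds.\<close>
  have true_qf: "finitary_qf (And cempty)" by (rule finitary_qf.intros) auto
  have not_Sigma: "\<not> (Sigma_in \<delta> \<phi> \<and> scott_sentence A r \<phi>)" if \<delta>: "\<delta> \<le> \<alpha>" "0 < \<delta>" for \<delta> \<phi>
  proof
    assume \<phi>: "Sigma_in \<delta> \<phi> \<and> scott_sentence A r \<phi>"
    then have "fv \<phi> = {}" by (simp add: scott_sentence_def sentence_def)
    moreover have "\<exists>\<epsilon><\<alpha>. \<beta> \<le> \<epsilon> \<and> 0 \<le> \<epsilon> \<and> (\<epsilon> = 0 \<longrightarrow> \<beta> = 0 \<and> (0::cord) = 0)" if "\<beta> < \<delta>" for \<beta>
      using that \<delta> cord_0_le by (intro exI[of _ \<beta>]) auto
    ultimately show False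
      using not_conj[of \<delta> \<phi> 0 "And cempty" \<phi>] \<phi> \<delta> \<alpha> true_qf Sigma_in_Pi_in.Pi_0[OF true_qf]
      by (auto simp: cimage.rep_eq)
  qed
  have not_dSigma: "\<not> (d_Sigma_in \<delta> \<phi> \<and> scott_sentence A r \<phi>)" if \<delta>: "\<delta> < \<alpha>" "0 < \<delta>" for \<delta> \<phi>
  proof
    assume \<phi>: "d_Sigma_in \<delta> \<phi> \<and> scott_sentence A r \<phi>"
    then obtain \<sigma> \<pi> where d: "Sigma_in \<delta> \<sigma>" "Pi_in \<delta> \<pi>" "\<phi> = And (cinsert \<sigma> (csingle \<pi>))"
      by (auto simp: d_Sigma_in_def)
    have fv: "fv \<sigma> = {}" "fv \<pi> = {}"
      using \<phi> by (auto simp: d(3) scott_sentence_def sentence_def cimage.rep_eq)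
    have "\<exists>\<epsilon><\<alpha>. \<beta> \<le> \<epsilon> \<and> \<delta> \<le> \<epsilon> \<and> (\<epsilon> = 0 \<longrightarrow> \<beta> = 0 \<and> \<delta> = 0)" if "\<beta> < \<delta>" for \<beta>
      using that \<delta> by (intro exI[of _ \<delta>]) auto
    moreover have "sat B s \<phi> e \<longleftrightarrow> sat B s \<sigma> e \<and> sat B s \<pi> e" for B s e
      unfolding d(3) sat_And by auto
    ultimately show False
      using not_conj[OF d(1) \<delta>(2) fv(1) d(2) fv(2) \<alpha>] \<phi> by blast
  qed
  have le: "class_le (PiC \<alpha>) \<Delta>"
    if "\<And>\<phi>. Pi_in \<alpha> \<phi> \<Longrightarrow> fv \<phi> = {} \<Longrightarrow> \<exists>\<psi>. fv \<psi> = {} \<and> in_class \<Delta> \<psi> \<and> (\<forall>B s e. sat B s \<psi> e \<longleftrightarrow> sat B s \<phi> e)" for \<Delta>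
    using that unfolding class_le_def sentence_def equivalent_def models_def by (simp, metis)
  have "class_le (PiC \<alpha>) \<Delta>" if \<Delta>: "0 < level \<Delta>" "has_scott_sentence_in A r \<Delta>" for \<Delta>
  proof (cases \<Delta>)
    case (PiC \<delta>)
    then have "\<alpha> \<le> \<delta>" using not_Pi[of \<delta>] \<Delta> by (auto simp: has_scott_sentence_in_def not_less[symmetric])
    then show ?thesis using Pi_in_mono[OF \<alpha>] PiC by (intro le) auto
  next
    case (SigmaC \<delta>)
    then have "\<alpha> < \<delta>" using not_Sigma[of \<delta>] \<Delta> by (auto simp: has_scott_sentence_in_def not_le[symmetric])
    show ?thesis
    proof (rule le)
      fix \<phi> assume \<phi>: "Pi_in \<alpha> \<phi>" "fv \<phi> = {}"
      have "Sigma_in \<delta> (Or (csingle \<phi>))"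
        using \<phi> \<open>\<alpha> < \<delta>\<close> \<Delta>(1) SigmaC by (intro Sigma_in_Pi_in.Sigma_step) (auto intro!: exI[of _ "[]"])
      then show "\<exists>\<psi>. fv \<psi> = {} \<and> in_class \<Delta> \<psi> \<and> (\<forall>B s e. sat B s \<psi> e \<longleftrightarrow> sat B s \<phi> e)"
        using \<phi>(2) SigmaC by (intro exI[of _ "Or (csingle \<phi>)"]) auto
    qed
  next
    case (DSigmaC \<delta>)
    then have "\<alpha> \<le> \<delta>" using not_dSigma[of \<delta>] \<Delta> by (auto simp: has_scott_sentence_in_def not_less[symmetric])
    show ?thesis
    proof (rule le)
      fix \<phi> assume \<phi>: "Pi_in \<alpha> \<phi>" "fv \<phi> = {}"
      let ?\<sigma> = "Or (csingle (And cempty))"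
      have "Sigma_in \<delta> ?\<sigma>"
        using \<Delta>(1) DSigmaC Sigma_in_Pi_in.Pi_0[OF true_qf]
        by (intro Sigma_in_Pi_in.Sigma_step) (auto intro!: exI[of _ "[]"] exI[of _ "0::cord"])
      moreover have "Pi_in \<delta> \<phi>" using Pi_in_mono[OF \<alpha> \<open>\<alpha> \<le> \<delta>\<close>] \<phi>(1) by blast
      ultimately have "d_Sigma_in \<delta> (And (cinsert ?\<sigma> (csingle \<phi>)))"
        unfolding d_Sigma_in_def by blast
      then show "\<exists>\<psi>. fv \<psi> = {} \<and> in_class \<Delta> \<psi> \<and> (\<forall>B s e. sat B s \<psi> e \<longleftrightarrow> sat B s \<phi> e)"
        using \<phi>(2) DSigmaC by (intro exI[of _ "And (cinsert ?\<sigma> (csingle \<phi>))"]) (auto simp: cimage.rep_eq)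
    qed
  qed
  with assms show ?thesis by (simp add: scott_sentence_complexity_def)
qed

section \<open>A dense coloured order\<close>

text \<open>The number \<open>pair j i\<close> stands for the dyadic rational \<open>(2 i + 1) / 2 ^ j\<close>, with colour \<open>p1 j\<close>.\<close>

definition numer :: "nat \<Rightarrow> nat" where "numer q = 2 * p2 q + 1"

definition ql :: "nat \<Rightarrow> nat \<Rightarrow> bool" where
  "ql a b \<longleftrightarrow> numer a * 2 ^ p1 b < numer b * 2 ^ p1 a"

definition cl :: "nat \<Rightarrow> nat" where "cl q = p1 (p1 q)"

text \<open>A dyadic fraction with odd numerator is reduced, so different codes are different
  rationals; this is what totality of \<open>ql\<close> requires.\<close>

lemma odd_power2_eq:
  assumes "(2 * i + 1) * 2 ^ m = (2 * i' + 1) * (2::nat) ^ n"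
  shows "m = n \<and> i = i'"
proof -
  have *: "n \<le> m" if "(2 * i + 1) * 2 ^ m = (2 * i' + 1) * (2::nat) ^ n" for i i' m n
  proof (rule ccontr)
    assume "\<not> n \<le> m"
    then obtain k where "n = m + Suc k" using less_imp_Suc_add not_le by (metis add_Suc_right)
    then have n2: "(2::nat) ^ n = 2 * 2 ^ k * 2 ^ m" by (simp add: power_add)
    have "(2 * i' + 1) * (2 * 2 ^ k * 2 ^ m) = (2 * ((2 * i' + 1) * 2 ^ k)) * (2::nat) ^ m"
      by (simp only: mult_ac)
    then have "(2 * i + 1) * 2 ^ m = (2 * ((2 * i' + 1) * 2 ^ k)) * (2::nat) ^ m"
      using that n2 by metis
    then have "2 * i + 1 = 2 * ((2 * i' + 1) * 2 ^ k)" unfolding mult_cancel2 by simp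
    then show False by presburger
  qed
  have "m = n" using *[OF assms] *[OF assms[symmetric]] by simp
  with assms show ?thesis by simp
qed

lemma slo_ql: "slo ql"
  unfolding slo_def
proof (intro conjI allI impI)
  show "\<not> ql x x" for x by (simp add: ql_def)
  show "ql x z" if "ql x y" "ql y z" for x y z
  proof -
    have "(numer x * 2 ^ p1 z) * 2 ^ p1 y = (numer x * 2 ^ p1 y) * 2 ^ p1 z" by (simp only: mult_ac)
    also have "\<dots> < (numer y * 2 ^ p1 x) * 2 ^ p1 z" using that(1) by (simp add: ql_def)
    also have "\<dots> = (numer y * 2 ^ p1 z) * 2 ^ p1 x" by (simp only: mult_ac)
    also have "\<dots> < (numer z * 2 ^ p1 y) * 2 ^ p1 x" using that(2) by (simp add: ql_def)
    also have "\<dots> = (numer z * 2 ^ p1 x) * 2 ^ p1 y" by (simp only: mult_ac)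
    finally show ?thesis by (simp add: ql_def)
  qed
  show "x = y \<or> ql x y \<or> ql y x" for x y
  proof (cases "numer x * 2 ^ p1 y = numer y * 2 ^ p1 x")
    case True
    then have "p1 x = p1 y \<and> p2 x = p2 y" using odd_power2_eq unfolding numer_def by metis
    then show ?thesis by (metis pair_p1_p2)
  qed (auto simp: ql_def)
qed

lemmas ql_irrefl [simp] = slo_irrefl[OF slo_ql]
lemmas ql_trans = slo_trans[OF slo_ql]
lemmas ql_total = slo_total[OF slo_ql]
lemmas ql_asym = slo_asym[OF slo_ql]

lemma le_pair2: "k \<le> pair x k"
  by (rule le_prod_encode_2)

lemma numer_pair: "numer (pair j i) = 2 * i + 1"
  by (simp add: numer_def)

lemma numer_pos: "0 < numer q"
  by (simp add: numer_def)

lemma ql_above: "\<exists>q. cl q = x \<and> ql a q"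
proof -
  define i where "i = numer a * 2 ^ pair x 0"
  have "i < (2 * i + 1) * 1" by simp
  also have "\<dots> \<le> (2 * i + 1) * 2 ^ p1 a" by (intro mult_le_mono2) simp
  finally have "ql a (pair (pair x 0) i)" by (simp add: ql_def numer_pair i_def)
  then show ?thesis by (intro exI[of _ "pair (pair x 0) i"]) (simp add: cl_def)
qed

lemma ql_below: "\<exists>q. cl q = x \<and> ql q a"
proof -
  \<comment> \<open>The fraction \<open>1 / 2 ^ ?j\<close> lies below \<open>a\<close> as soon as
    \<open>?j\<close> exceeds the exponent of \<open>a\<close>; the second component of
    \<open>?j\<close> can be enlarged without changing the colour.\<close>
  let ?j = "pair x (Suc (p1 a))"
  have "Suc (p1 a) \<le> ?j" by (rule le_pair2)
  then have "(2::nat) ^ p1 a < 2 ^ ?j" by (intro power_strict_increasing) auto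
  also have "\<dots> \<le> numer a * 2 ^ ?j" using numer_pos[of a] by simp
  finally show ?thesis by (intro exI[of _ "pair ?j 0"]) (simp add: ql_def cl_def numer_pair)
qed

lemma power2_split: "m < j \<Longrightarrow> n * 2 ^ (j - m - 1) * 2 * 2 ^ m = n * (2::nat) ^ j"
proof -
  assume "m < j"
  then have "j = (j - m - 1) + 1 + m" by simp
  then have "(2::nat) ^ j = 2 ^ (j - m - 1) * 2 * 2 ^ m" by (metis power_add power_one_right)
  then show ?thesis by (simp only: mult.assoc)
qed

lemma ql_dense: "ql a b \<Longrightarrow> \<exists>q. cl q = x \<and> ql a q \<and> ql q b"
proof -
  assume ab: "ql a b"
  \<comment> \<open>With this large exponent \<open>a\<close> and \<open>b\<close> have the even
    numerators \<open>2 * A\<close> and \<open>2 * B\<close>, so the odd numerator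
    \<open>2 * A + 1\<close> lies strictly between them.\<close>
  define j where "j = pair x (p1 a + p1 b + 1)"
  have j: "p1 a + p1 b + 1 \<le> j" unfolding j_def by (rule le_pair2)
  define A where "A = numer a * 2 ^ (j - p1 a - 1)"
  define B where "B = numer b * 2 ^ (j - p1 b - 1)"
  have A: "A * 2 * 2 ^ p1 a = numer a * 2 ^ j" using j unfolding A_def by (intro power2_split) simp
  have B: "B * 2 * 2 ^ p1 b = numer b * 2 ^ j" using j unfolding B_def by (intro power2_split) simp
  have "(A * 2) * (2 ^ p1 a * 2 ^ p1 b) = (A * 2 * 2 ^ p1 a) * 2 ^ p1 b" by (simp only: mult_ac)
  also have "\<dots> = (numer a * 2 ^ p1 b) * 2 ^ j" unfolding A by (simp only: mult_ac)
  also have "\<dots> < (numer b * 2 ^ p1 a) * 2 ^ j" using ab by (simp add: ql_def)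
  also have "\<dots> = (B * 2 * 2 ^ p1 b) * 2 ^ p1 a" unfolding B by (simp only: mult_ac)
  also have "\<dots> = (B * 2) * (2 ^ p1 a * 2 ^ p1 b)" by (simp only: mult_ac)
  finally have "A * 2 < B * 2" by (simp only: mult_less_cancel2)
  then have AB: "2 * A + 1 < B * 2" by simp
  have "A * 2 * 2 ^ p1 a < (2 * A + 1) * 2 ^ p1 a" by (intro mult_strict_right_mono) auto
  then have 1: "ql a (pair j A)" unfolding A by (simp only: ql_def numer_pair p1_pair)
  have "(2 * A + 1) * 2 ^ p1 b < B * 2 * 2 ^ p1 b" using AB by (intro mult_strict_right_mono) auto
  then have 2: "ql (pair j A) b" unfolding B by (simp only: ql_def numer_pair p1_pair)
  from 1 2 show ?thesis by (intro exI[of _ "pair j A"]) (simp add: cl_def j_def)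
qed

lemma ql_max: "finite S \<Longrightarrow> S \<noteq> {} \<Longrightarrow> \<exists>m\<in>S. \<forall>x\<in>S. x = m \<or> ql x m"
proof (induction S rule: finite_ne_induct)
  case (insert a S)
  then obtain m where "m \<in> S" "\<forall>x\<in>S. x = m \<or> ql x m" by blast
  then show ?case using ql_total[of a m] ql_trans by (metis insert_iff)
qed auto

lemma ql_min: "finite S \<Longrightarrow> S \<noteq> {} \<Longrightarrow> \<exists>m\<in>S. \<forall>x\<in>S. m = x \<or> ql m x"
proof (induction S rule: finite_ne_induct)
  case (insert a S)
  then obtain m where "m \<in> S" "\<forall>x\<in>S. m = x \<or> ql m x" by blast
  then show ?case using ql_total[of a m] ql_trans by (metis insert_iff)
qed auto

text \<open>Every colour is dense and unbounded in both directions. In this form density enters the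
  extension of positions in the games.\<close>

lemma ql_gap:
  assumes "finite S" "finite T" "\<And>s t. s \<in> S \<Longrightarrow> t \<in> T \<Longrightarrow> ql s t"
  shows "\<exists>q. cl q = x \<and> (\<forall>s\<in>S. ql s q) \<and> (\<forall>t\<in>T. ql q t)"
proof -
  have S: "(\<forall>s\<in>S. ql s q) \<longleftrightarrow> ql m q" if "m \<in> S" "\<forall>x\<in>S. x = m \<or> ql x m" for m q
    using that ql_trans by metis
  have T: "(\<forall>t\<in>T. ql q t) \<longleftrightarrow> ql q m" if "m \<in> T" "\<forall>x\<in>T. m = x \<or> ql m x" for m q
    using that ql_trans by metis
  show ?thesis
  proof (cases "S = {}")
    case True
    show ?thesis
    proof (cases "T = {}")
      case False
      then obtain m where "m \<in> T" "\<forall>x\<in>T. m = x \<or> ql m x" using ql_min assms(2) by blast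
      then show ?thesis using T ql_below[of x m] True by auto
    qed (use True ql_below in auto)
  next
    case False
    then obtain m where m: "m \<in> S" "\<forall>x\<in>S. x = m \<or> ql x m" using ql_max assms(1) by blast
    show ?thesis
    proof (cases "T = {}")
      case True
      then show ?thesis using S[OF m] ql_above[of x m] by auto
    next
      case False
      then obtain n where n: "n \<in> T" "\<forall>x\<in>T. n = x \<or> ql n x" using ql_min assms(2) by blast
      then show ?thesis using S[OF m] T[OF n] ql_dense[OF assms(3)[OF m(1) n(1)], of x] by auto
    qed
  qed
qed

section \<open>Linear orders coding trees\<close>

text \<open>Prefixes come first: the block of a node is followed by its subtree, and sibling
  subtrees are ordered like the siblings.\<close>

definition sless :: "nat list \<Rightarrow> nat list \<Rightarrow> bool" where
  "sless s t \<longleftrightarrow> (s, t) \<in> lexord {(a, b). ql a b}"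

lemma sless_irrefl [simp]: "\<not> sless s s"
  unfolding sless_def by (rule lexord_irreflexive) simp

lemma sless_trans: "sless s t \<Longrightarrow> sless t u \<Longrightarrow> sless s u"
  unfolding sless_def by (rule lexord_trans) (auto simp: trans_def intro: ql_trans)

lemma sless_total: "s = t \<or> sless s t \<or> sless t s"
proof -
  have "total (lexord {(a, b). ql a b})" by (rule total_lexord) (use ql_total in \<open>auto simp: total_on_def\<close>)
  then show ?thesis unfolding sless_def total_on_def by blast
qed

lemma sless_iff:
  "sless s t \<longleftrightarrow> (\<exists>q u. t = s @ q # u) \<or> (\<exists>w a x b y. s = w @ a # x \<and> t = w @ b # y \<and> ql a b)"
  unfolding sless_def lexord_def by (simp, rule iffI; elim disjE exE conjE; blast)

lemma sless_asym: "sless s t \<Longrightarrow> \<not> sless t s"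
  using sless_trans sless_irrefl by blast

lemma sless_append [simp]: "sless s (s @ q # u)"
  unfolding sless_iff by blast

lemma sless_diff: "ql a b \<Longrightarrow> sless (w @ a # x) (w @ b # y)"
  unfolding sless_iff by blast

lemma sless_sibling [simp]: "sless (w @ [a]) (w @ [b]) \<longleftrightarrow> ql a b"
  by (simp add: sless_def lexord_same_pref_iff)

definition el :: "nat list \<Rightarrow> nat \<Rightarrow> nat" where "el s j = pair (list_encode s) j"
definition nd :: "nat \<Rightarrow> nat list" where "nd x = list_decode (p1 x)"

lemma nd_el [simp]: "nd (el s j) = s" and p2_el [simp]: "p2 (el s j) = j"
  by (simp_all add: nd_def el_def)

lemma el_nd [simp]: "el (nd x) (p2 x) = x"
  by (simp add: nd_def el_def)

lemma el_eq [simp]: "el s j = el t i \<longleftrightarrow> s = t \<and> j = i"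
  by (metis nd_el p2_el)

lemma el_eqI: "nd x = s \<Longrightarrow> p2 x = j \<Longrightarrow> x = el s j"
  by auto

text \<open>Each type \<open>x\<close> has a set \<open>ch x\<close> of types of children and a colour; \<open>lab\<close> enumerates all types.
  In the order with root type \<open>\<rho>\<close>, the children of each node are densely ordered, with each possible
  type occurring densely, and each node is represented by a finite block whose size tells the level
  and the colour. The root itself has no block.\<close>

locale tree_order =
  fixes lab :: "nat \<Rightarrow> 'x" and ch :: "'x \<Rightarrow> 'x set" and colr :: "'x \<Rightarrow> nat"
  assumes surj_lab: "surj lab"
begin

definition tp :: "'x \<Rightarrow> nat list \<Rightarrow> 'x" where
  "tp \<rho> s = (if s = [] then \<rho> else lab (cl (last s)))"

definition node :: "'x \<Rightarrow> nat list \<Rightarrow> bool" where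
  "node \<rho> s \<longleftrightarrow> (\<forall>i<length s. lab (cl (s ! i)) \<in> ch (tp \<rho> (take i s)))"

text \<open>\<open>Suc\<close> keeps blocks non-empty, and \<open>pair\<close> makes the size
  determine level and colour.\<close>

definition bs :: "'x \<Rightarrow> nat list \<Rightarrow> nat" where
  "bs \<rho> s = Suc (pair (length s) (colr (tp \<rho> s)))"

definition dm :: "'x \<Rightarrow> nat set" where
  "dm \<rho> = {x. nd x \<noteq> [] \<and> node \<rho> (nd x) \<and> p2 x < bs \<rho> (nd x)}"

definition od :: "'x \<Rightarrow> nat rel" where
  "od \<rho> = {(x, y). x \<in> dm \<rho> \<and> y \<in> dm \<rho> \<and> (sless (nd x) (nd y) \<or> nd x = nd y \<and> p2 x \<le> p2 y)}"

lemma tp_snoc [simp]: "tp \<rho> (s @ [q]) = lab (cl q)" and tp_nil [simp]: "tp \<rho> [] = \<rho>"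
  by (simp_all add: tp_def)

lemma node_nil [simp]: "node \<rho> []"
  by (simp add: node_def)

lemma node_snoc [simp]: "node \<rho> (s @ [q]) \<longleftrightarrow> node \<rho> s \<and> lab (cl q) \<in> ch (tp \<rho> s)"
  by (auto simp: node_def nth_append less_Suc_eq)

lemma node_append: "node \<rho> (s @ u) \<Longrightarrow> node \<rho> s"
  by (induction u rule: rev_induct) (auto simp flip: append_assoc)

lemma node_take: "node \<rho> s \<Longrightarrow> node \<rho> (take k s)"
  using node_append[of \<rho> "take k s" "drop k s"] by simp

lemma node_replace: "node \<rho> (w @ b # y) \<Longrightarrow> cl q = cl b \<Longrightarrow> node \<rho> (w @ [q])"
  using node_append[of \<rho> "w @ [b]" y] by simp

lemma bs_pos [simp]: "0 < bs \<rho> s"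
  by (simp add: bs_def)

lemma el_dm [simp]: "el s j \<in> dm \<rho> \<longleftrightarrow> s \<noteq> [] \<and> node \<rho> s \<and> j < bs \<rho> s"
  by (simp add: dm_def)

lemma linear_order_od: "linear_order_on (dm \<rho>) (od \<rho>)"
  unfolding order_on_defs
proof (intro conjI)
  show "trans (od \<rho>)" by (rule transI) (auto simp: od_def intro: sless_trans)
  show "antisym (od \<rho>)"
  proof (rule antisymI)
    fix x y assume "(x, y) \<in> od \<rho>" "(y, x) \<in> od \<rho>"
    then have "nd x = nd y \<and> p2 x = p2 y" using sless_trans sless_irrefl by (fastforce simp: od_def)
    then show "x = y" by (metis el_nd)
  qed
  show "total_on (dm \<rho>) (od \<rho>)"
    unfolding total_on_def od_def using sless_total by fastforce
qed (auto simp: od_def refl_on_def)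

definition below :: "'x \<Rightarrow> nat \<Rightarrow> nat \<Rightarrow> bool" where
  "below \<rho> x y \<longleftrightarrow> (x, y) \<in> od \<rho> \<and> x \<noteq> y"

lemma below_iff: "below \<rho> x y \<longleftrightarrow> x \<in> dm \<rho> \<and> y \<in> dm \<rho> \<and> (sless (nd x) (nd y) \<or> nd x = nd y \<and> p2 x < p2 y)"
proof -
  have "x = y \<longleftrightarrow> nd x = nd y \<and> p2 x = p2 y" by (metis el_nd)
  then show ?thesis by (auto simp: below_def od_def)
qed

text \<open>A node and its proper extension are separated by a child further to the left; two
  diverging nodes by a sibling between the two branches.\<close>

lemma dense_nodes:
  assumes "below \<rho> x y" "nd x \<noteq> nd y"
  shows "\<exists>z. below \<rho> x z \<and> below \<rho> z y"
proof -
  have xy: "x \<in> dm \<rho>" "y \<in> dm \<rho>" "sless (nd x) (nd y)" using assms by (auto simp: below_iff)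
  have n: "node \<rho> (nd y)" using xy(2) by (simp add: dm_def)
  have between: ?thesis if "node \<rho> u" "u \<noteq> []" "sless (nd x) u" "sless u (nd y)" for u
    using that xy by (intro exI[of _ "el u 0"]) (simp add: below_iff)
  from xy(3) consider q u where "nd y = nd x @ q # u"
    | w a s b t where "nd x = w @ a # s" "nd y = w @ b # t" "ql a b"
    unfolding sless_iff by blast
  then show ?thesis
  proof cases
    case 1
    obtain q' where q': "cl q' = cl q" "ql q' q" using ql_below by blast
    show ?thesis
      by (rule between[of "nd x @ [q']"]) (use 1 n q' node_replace in \<open>auto intro: sless_diff\<close>)
  next
    case 2
    obtain q where q: "cl q = cl b" "ql a q" "ql q b" using ql_dense[OF 2(3)] by blast
    show ?thesis
      by (rule between[of "w @ [q]"]) (use 2 n q node_replace in \<open>auto intro: sless_diff\<close>)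
  qed
qed

text \<open>Density between nodes leaves adjacency only inside blocks. As non-adjacency is witnessed
  by one element, adjacency is respected at every positive rank.\<close>

lemma adjacent_iff:
  assumes "x \<in> dm \<rho>" "y \<in> dm \<rho>"
  shows "below \<rho> x y \<and> \<not> (\<exists>z. below \<rho> x z \<and> below \<rho> z y) \<longleftrightarrow> nd x = nd y \<and> p2 y = Suc (p2 x)"
proof
  assume *: "below \<rho> x y \<and> \<not> (\<exists>z. below \<rho> x z \<and> below \<rho> z y)"
  then have nd: "nd x = nd y" using dense_nodes by blast
  then have "p2 x < p2 y" using * by (auto simp: below_iff)
  moreover have "\<not> Suc (p2 x) < p2 y"
  proof
    assume "Suc (p2 x) < p2 y"
    then have "below \<rho> x (el (nd x) (Suc (p2 x)))" "below \<rho> (el (nd x) (Suc (p2 x))) y"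
      using nd assms by (auto simp: below_iff dm_def)
    with * show False by blast
  qed
  ultimately show "nd x = nd y \<and> p2 y = Suc (p2 x)" using nd by simp
next
  assume nd: "nd x = nd y \<and> p2 y = Suc (p2 x)"
  have "\<not> (below \<rho> x z \<and> below \<rho> z y)" for z
    using nd sless_asym[of "nd y" "nd z"] by (cases "nd z = nd y") (simp_all add: below_iff)
  moreover have "below \<rho> x y" using nd assms by (simp add: below_iff)
  ultimately show "below \<rho> x y \<and> \<not> (\<exists>z. below \<rho> x z \<and> below \<rho> z y)" by blast
qed

section \<open>What small back-and-forth ranks see of the coded tree\<close>

abbreviation bt :: "'x \<Rightarrow> 'x \<Rightarrow> cord \<Rightarrow> nat list \<Rightarrow> nat list \<Rightarrow> bool" where
  "bt \<rho> \<rho>' \<equiv> bf (dm \<rho>) (od \<rho>) (dm \<rho>') (od \<rho>')"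

lemma bt_below:
  "bt \<rho> \<rho>' \<beta> a b \<Longrightarrow> i < length a \<Longrightarrow> j < length a \<Longrightarrow> below \<rho> (a ! i) (a ! j) \<longleftrightarrow> below \<rho>' (b ! i) (b ! j)"
  using bf_patom[of "dm \<rho>" "od \<rho>" "dm \<rho>'" "od \<rho>'" \<beta> a b] by (auto simp: patom_def below_def)

lemma bt_eq:
  "bt \<rho> \<rho>' \<beta> a b \<Longrightarrow> i < length a \<Longrightarrow> j < length a \<Longrightarrow> a ! i = a ! j \<longleftrightarrow> b ! i = b ! j"
  using bf_patom[of "dm \<rho>" "od \<rho>" "dm \<rho>'" "od \<rho>'" \<beta> a b] by (auto simp: patom_def)

lemma bt_adjacent:
  assumes bt: "bt \<rho> \<rho>' \<beta> a b" "0 < \<beta>" and sub: "set a \<subseteq> dm \<rho>" "set b \<subseteq> dm \<rho>'"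
    and ij: "i < length a" "j < length a" and adj: "nd (a ! i) = nd (a ! j)" "p2 (a ! j) = Suc (p2 (a ! i))"
  shows "nd (b ! i) = nd (b ! j) \<and> p2 (b ! j) = Suc (p2 (b ! i))"
proof -
  have len: "length a = length b" using bf_length[OF bt(1)] .
  have in_dm: "a ! i \<in> dm \<rho>" "a ! j \<in> dm \<rho>" "b ! i \<in> dm \<rho>'" "b ! j \<in> dm \<rho>'"
    using sub ij len nth_mem by (metis subsetD)+
  have 1: "below \<rho> (a ! i) (a ! j) \<and> \<not> (\<exists>z. below \<rho> (a ! i) z \<and> below \<rho> z (a ! j))"
    using adjacent_iff[OF in_dm(1,2)] adj by simp
  have "\<not> (below \<rho>' (b ! i) z \<and> below \<rho>' z (b ! j))" for z
  proof
    assume z: "below \<rho>' (b ! i) z \<and> below \<rho>' z (b ! j)"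
    then have "set [z] \<subseteq> dm \<rho>'" by (simp add: below_iff)
    from bf_back[OF bt(1,2) this] obtain c where c: "length c = length [z]" "bt \<rho> \<rho>' 0 (a @ c) (b @ [z])" by blast
    then obtain y where y: "c = [y]" by (auto simp: length_Suc_conv)
    have "below \<rho> (a ! i) y" "below \<rho> y (a ! j)"
      using bt_below[OF c(2), of i "length a"] bt_below[OF c(2), of "length a" j] z ij len y
      by (simp_all add: nth_append)
    with 1 show False by blast
  qed
  moreover have "below \<rho>' (b ! i) (b ! j)" using 1 bt_below[OF bt(1) ij] by simp
  ultimately show ?thesis using adjacent_iff[OF in_dm(3,4)] by blast
qed

text \<open>One move names the whole block, and a rank of \<open>osuc 0\<close> is left to preserve
  adjacency. The image is a run of consecutive elements of one block, shifted by some
  \<open>k\<close>.\<close>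

lemma bt_block:
  assumes bt: "bt \<rho> \<rho>' \<beta> a b" "osuc 0 < \<beta>" and sub: "set a \<subseteq> dm \<rho>" "set b \<subseteq> dm \<rho>'"
    and s: "s \<noteq> []" "node \<rho> s"
  shows "\<exists>t k. k + bs \<rho> s \<le> bs \<rho>' t \<and> (\<forall>i<length a. nd (a ! i) = s \<longrightarrow> nd (b ! i) = t \<and> p2 (b ! i) = k + p2 (a ! i))"
proof -
  let ?N = "bs \<rho> s"
  define c where "c = map (el s) [0..<?N]"
  have c: "set c \<subseteq> dm \<rho>" using s by (auto simp: c_def)
  obtain d where d: "set d \<subseteq> dm \<rho>'" "length d = length c" "bt \<rho> \<rho>' (osuc 0) (a @ c) (b @ d)"
    using bf_forth[OF bt c] by blast
  have len: "length a = length b" using bf_length[OF bt(1)] .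
  have N: "length d = ?N" using d(2) by (simp add: c_def)
  have sub': "set (a @ c) \<subseteq> dm \<rho>" "set (b @ d) \<subseteq> dm \<rho>'" using sub c d by auto
  have cn: "(a @ c) ! (length a + m) = el s m" if "m < ?N" for m using that by (simp add: c_def)
  have dn: "(b @ d) ! (length a + m) = d ! m" if "m < ?N" for m using that len by (simp add: nth_append)
  have chain: "nd (d ! m) = nd (d ! 0) \<and> p2 (d ! m) = p2 (d ! 0) + m" if "m < ?N" for m
    using that
  proof (induction m)
    case (Suc m)
    have m: "length a + m < length (a @ c)" "length a + Suc m < length (a @ c)"
      using Suc.prems by (auto simp: c_def)
    have "nd (d ! m) = nd (d ! Suc m) \<and> p2 (d ! Suc m) = Suc (p2 (d ! m))"
      using bt_adjacent[OF d(3) less_osuc sub' m] Suc.prems cn[of m] cn[of "Suc m"] dn[of m] dn[of "Suc m"]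
      by simp
    with Suc show ?case by simp
  qed simp
  let ?t = "nd (d ! 0)" and ?k = "p2 (d ! 0)"
  have "d ! (?N - 1) \<in> dm \<rho>'" using d(1) N by (metis bs_pos diff_less less_numeral_extra(1) nth_mem subsetD)
  then have "?k + ?N \<le> bs \<rho>' ?t" using chain[of "?N - 1"] by (auto simp: dm_def bs_def)
  moreover have "nd (b ! i) = ?t \<and> p2 (b ! i) = ?k + p2 (a ! i)" if i: "i < length a" "nd (a ! i) = s" for i
  proof -
    have "a ! i \<in> dm \<rho>" using sub i by auto
    then have p: "p2 (a ! i) < ?N" using i(2) by (simp add: dm_def)
    have "(a @ c) ! i = (a @ c) ! (length a + p2 (a ! i))"
      unfolding cn[OF p] using i by (simp add: nth_append el_eqI)
    then have "(b @ d) ! i = (b @ d) ! (length a + p2 (a ! i))"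
      using bt_eq[OF d(3), of i "length a + p2 (a ! i)"] i p by (simp add: c_def)
    then have "b ! i = d ! p2 (a ! i)" using i len dn[OF p] by (simp add: nth_append)
    then show ?thesis using chain[OF p] by simp
  qed
  ultimately show ?thesis by blast
qed

lemma bt_sym: "bt \<rho> \<rho>' \<beta> a b \<Longrightarrow> bt \<rho>' \<rho> \<beta> b a"
  by (rule bf_sym)

lemma bt_same_node:
  assumes "bt \<rho> \<rho>' \<beta> a b" "osuc 0 < \<beta>" "set a \<subseteq> dm \<rho>" "set b \<subseteq> dm \<rho>'"
    and "i < length a" "j < length a" "nd (a ! i) = nd (a ! j)"
  shows "nd (b ! i) = nd (b ! j)"
proof -
  have "a ! i \<in> dm \<rho>" using assms by auto
  then have "nd (a ! i) \<noteq> []" "node \<rho> (nd (a ! i))" by (simp_all add: dm_def)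
  from bt_block[OF assms(1-4) this] show ?thesis using assms(5-7) by metis
qed

text \<open>By symmetry each block fits into the other, so both shifts vanish and the sizes agree; a
  size determines level and colour.\<close>

lemma bt_index:
  assumes bt: "bt \<rho> \<rho>' \<beta> a b" "osuc 0 < \<beta>" and sub: "set a \<subseteq> dm \<rho>" "set b \<subseteq> dm \<rho>'" and i: "i < length a"
  shows "p2 (b ! i) = p2 (a ! i)" "length (nd (b ! i)) = length (nd (a ! i))"
    "colr (tp \<rho>' (nd (b ! i))) = colr (tp \<rho> (nd (a ! i)))"
proof -
  have len: "length a = length b" using bf_length[OF bt(1)] .
  have "a ! i \<in> dm \<rho>" "b ! i \<in> dm \<rho>'" using sub i len by auto
  then have n: "nd (a ! i) \<noteq> []" "node \<rho> (nd (a ! i))" "nd (b ! i) \<noteq> []" "node \<rho>' (nd (b ! i))"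
    by (simp_all add: dm_def)
  obtain k where "k + bs \<rho> (nd (a ! i)) \<le> bs \<rho>' (nd (b ! i))" "p2 (b ! i) = k + p2 (a ! i)"
    using bt_block[OF bt sub n(1,2)] i by blast
  moreover obtain k' where "k' + bs \<rho>' (nd (b ! i)) \<le> bs \<rho> (nd (a ! i))" "p2 (a ! i) = k' + p2 (b ! i)"
    using bt_block[OF bt_sym[OF bt(1)] bt(2) sub(2,1) n(3,4)] i len by auto
  ultimately have "p2 (b ! i) = p2 (a ! i)" "bs \<rho> (nd (a ! i)) = bs \<rho>' (nd (b ! i))" by auto
  then show "p2 (b ! i) = p2 (a ! i)" "length (nd (b ! i)) = length (nd (a ! i))"
    "colr (tp \<rho>' (nd (b ! i))) = colr (tp \<rho> (nd (a ! i)))"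
    by (auto simp: bs_def)
qed

text \<open>To leave the subtree of \<open>s\<close> upwards in the order is to meet a node of level
  at most that of \<open>s\<close>. So extension is tested by order and block sizes alone.\<close>

lemma proper_prefix_iff:
  assumes s: "s \<noteq> []" "node \<rho> s" and s': "s' \<noteq> []" "node \<rho> s'"
  shows "(\<exists>q u. s' = s @ q # u) \<longleftrightarrow> below \<rho> (el s 0) (el s' 0) \<and> length s < length s' \<and>
    \<not> (\<exists>u. el u 0 \<in> dm \<rho> \<and> length u \<le> length s \<and> below \<rho> (el s 0) (el u 0) \<and>
      (u = s' \<or> below \<rho> (el u 0) (el s' 0)))"
    (is "?L \<longleftrightarrow> ?R")
proof
  assume ?L
  then obtain q v where v: "s' = s @ q # v" by blast
  have False if u: "length u \<le> length s" "sless s u" "u = s' \<or> sless u s'" for u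
  proof -
    have us: "sless u s'" using u(1,3) v by auto
    from u(2) consider p w where "u = s @ p # w" | w a x b y where "s = w @ a # x" "u = w @ b # y" "ql a b"
      unfolding sless_iff by blast
    then show False
    proof cases
      case 2
      then have "sless s' u" using v by (auto intro: sless_diff)
      then show False using us sless_trans sless_irrefl by blast
    qed (use u(1) in simp)
  qed
  then show ?R using v s s' by (auto simp: below_iff)
next
  assume R: ?R
  then have "sless s s'" by (auto simp: below_iff)
  then consider q u where "s' = s @ q # u" | w a x b y where "s = w @ a # x" "s' = w @ b # y" "ql a b"
    unfolding sless_iff by blast
  then show ?L
  proof cases
    case 2
    let ?u = "w @ [b]"
    have "node \<rho> ?u" using node_replace[of \<rho> w b y b] s' 2 by simp
    moreover have "?u = s' \<or> sless ?u s'" using 2 sless_append[of ?u] by (cases y) auto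
    moreover have "sless s ?u" using 2 by (auto intro: sless_diff)
    ultimately show ?thesis using R s s' 2 by (auto simp: below_iff dest!: spec[of _ ?u])
  qed blast
qed

text \<open>One move introduces a node that would violate \<open>proper_prefix_iff\<close>; the rank
  that remains exceeds \<open>osuc 0\<close>, which is enough to compare its level.\<close>

lemma bt_prefix:
  assumes bt: "bt \<rho> \<rho>' \<beta> a b" "c3' < \<beta>" "osuc 0 < c3'" and sub: "set a \<subseteq> dm \<rho>" "set b \<subseteq> dm \<rho>'"
    and i: "i < length a" "a ! i = el s 0" "b ! i = el t 0" and j: "j < length a" "a ! j = el s' 0" "b ! j = el t' 0"
    and prefix: "\<exists>q u. s' = s @ q # u"
  shows "\<exists>q u. t' = t @ q # u"
proof -
  have len: "length a = length b" using bf_length[OF bt(1)] .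
  have \<beta>: "osuc 0 < \<beta>" using bt(2,3) by (rule less_trans[rotated])
  have in_dm: "el s 0 \<in> dm \<rho>" "el s' 0 \<in> dm \<rho>" "el t 0 \<in> dm \<rho>'" "el t' 0 \<in> dm \<rho>'"
    using sub i j len nth_mem by (metis subsetD)+
  then have n: "s \<noteq> []" "node \<rho> s" "s' \<noteq> []" "node \<rho> s'" "t \<noteq> []" "node \<rho>' t" "t' \<noteq> []" "node \<rho>' t'"
    by simp_all
  have lens: "length t = length s" "length t' = length s'"
    using bt_index(2)[OF bt(1) \<beta> sub i(1)] bt_index(2)[OF bt(1) \<beta> sub j(1)] i j by simp_all
  note R = proper_prefix_iff[OF n(1-4), THEN iffD1, OF prefix]
  have "\<not> (el u 0 \<in> dm \<rho>' \<and> length u \<le> length t \<and> below \<rho>' (el t 0) (el u 0) \<and>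
      (u = t' \<or> below \<rho>' (el u 0) (el t' 0)))" for u
  proof
    assume u: "el u 0 \<in> dm \<rho>' \<and> length u \<le> length t \<and> below \<rho>' (el t 0) (el u 0) \<and>
      (u = t' \<or> below \<rho>' (el u 0) (el t' 0))"
    then have us: "set [el u 0] \<subseteq> dm \<rho>'" by simp
    from bf_back[OF bt(1,2) this] obtain c where
      c: "set c \<subseteq> dm \<rho>" "length c = length [el u 0]" "bt \<rho> \<rho>' c3' (a @ c) (b @ [el u 0])" by blast
    then obtain y where y: "c = [y]" by (auto simp: length_Suc_conv)
    have sub': "set (a @ c) \<subseteq> dm \<rho>" "set (b @ [el u 0]) \<subseteq> dm \<rho>'" using sub c us by auto
    have k: "length a < length (a @ c)" "i < length (a @ c)" "j < length (a @ c)" using y i j by auto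
    have "p2 y = 0" "length (nd y) = length u"
      using bt_index(1,2)[OF c(3) bt(3) sub' k(1)] y len by (simp_all add: nth_append)
    then have y_el: "y = el (nd y) 0" "length (nd y) \<le> length s" using u lens el_eqI by auto
    have 1: "below \<rho> (el s 0) y"
      using bt_below[OF c(3) k(2,1)] u i len y by (simp add: nth_append)
    have 2: "nd y = s' \<or> below \<rho> y (el s' 0)"
    proof (cases "u = t'")
      case True
      then have "y = el s' 0"
        using bt_eq[OF c(3) k(1,3)] j len y by (simp add: nth_append)
      then show ?thesis by simp
    next
      case False
      then show ?thesis using bt_below[OF c(3) k(1,3)] u j len y by (simp add: nth_append)
    qed
    have "y \<in> dm \<rho>" using c(1) y by simp
    then show False using R y_el 1 2 by metis
  qed
  moreover have "below \<rho>' (el t 0) (el t' 0)" using R bt_below[OF bt(1) i(1) j(1)] i j by simp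
  moreover have "length t < length t'" using R lens by simp
  ultimately show ?thesis using proper_prefix_iff[OF n(5-8)] by blast
qed

end

context tree_order
begin

section \<open>Games on trees\<close>

text \<open>A finite partial isomorphism of trees. Functionality and injectivity follow from the
  last clause, because distinct siblings are comparable.\<close>

definition pos :: "'x \<Rightarrow> 'x \<Rightarrow> (nat list \<times> nat list) set \<Rightarrow> bool" where
  "pos \<rho> \<rho>' F \<longleftrightarrow> finite F \<and> ([], []) \<in> F \<and>
    (\<forall>s t. (s, t) \<in> F \<longrightarrow> node \<rho> s \<and> node \<rho>' t \<and> length s = length t) \<and>
    (\<forall>s q t p. (s @ [q], t @ [p]) \<in> F \<longrightarrow> (s, t) \<in> F) \<and>
    (\<forall>s q t p q' p'. (s @ [q], t @ [p]) \<in> F \<longrightarrow> (s @ [q'], t @ [p']) \<in> F \<longrightarrow> ql q q' = ql p p')"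

lemma pos_finite: "pos \<rho> \<rho>' F \<Longrightarrow> finite F" and pos_nil: "pos \<rho> \<rho>' F \<Longrightarrow> ([], []) \<in> F"
  by (simp_all add: pos_def)

lemma pos_node: "pos \<rho> \<rho>' F \<Longrightarrow> (s, t) \<in> F \<Longrightarrow> node \<rho> s \<and> node \<rho>' t"
  by (simp add: pos_def)

lemma pos_length: "pos \<rho> \<rho>' F \<Longrightarrow> (s, t) \<in> F \<Longrightarrow> length s = length t"
  by (simp add: pos_def)

lemma pos_butlast: "pos \<rho> \<rho>' F \<Longrightarrow> (s @ [q], t @ [p]) \<in> F \<Longrightarrow> (s, t) \<in> F"
  unfolding pos_def by metis

lemma pos_sibling: "pos \<rho> \<rho>' F \<Longrightarrow> (s @ [q], t @ [p]) \<in> F \<Longrightarrow> (s @ [q'], t @ [p']) \<in> F \<Longrightarrow> ql q q' = ql p p'"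
  unfolding pos_def by metis

lemma pos_sym: "pos \<rho> \<rho>' F \<Longrightarrow> pos \<rho>' \<rho> (F\<inverse>)"
  unfolding pos_def finite_converse converse_iff by metis

lemma pos_prefix: "pos \<rho> \<rho>' F \<Longrightarrow> (s @ u, t @ v) \<in> F \<Longrightarrow> length u = length v \<Longrightarrow> (s, t) \<in> F"
proof (induction u arbitrary: v rule: rev_induct)
  case (snoc q u)
  then obtain v' p where v: "v = v' @ [p]" by (cases v rule: rev_cases) auto
  have "((s @ u) @ [q], (t @ v') @ [p]) \<in> F" using snoc.prems(2) v by simp
  then have "(s @ u, t @ v') \<in> F" by (rule pos_butlast[OF snoc.prems(1)])
  then show ?case using snoc v by simp
qed simp

lemma pos_prefix':
  assumes F: "pos \<rho> \<rho>' F" and st: "(s @ u, t') \<in> F"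
  obtains t v where "t' = t @ v" "length v = length u" "length t = length s" "(s, t) \<in> F"
proof -
  let ?t = "take (length s) t'" and ?v = "drop (length s) t'"
  have len: "length t' = length s + length u" using pos_length[OF F st] by simp
  have "(s, ?t) \<in> F" by (rule pos_prefix[OF F, of _ u _ ?v]) (use st len in simp_all)
  then show ?thesis using that[of ?t ?v] len by simp
qed

lemma pos_snoc:
  assumes F: "pos \<rho> \<rho>' F" and st: "(s @ [q], t') \<in> F"
  obtains t p where "t' = t @ [p]" "(s, t) \<in> F"
proof -
  from pos_prefix'[OF F st] obtain t v where tv: "t' = t @ v" "length v = length [q]" "(s, t) \<in> F" by metis
  then obtain p where "v = [p]" by (cases v) auto
  then show ?thesis using that tv by simp
qed

lemma pos_fun: "pos \<rho> \<rho>' F \<Longrightarrow> (s, t) \<in> F \<Longrightarrow> (s, t') \<in> F \<Longrightarrow> t = t'"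
proof (induction s arbitrary: t t' rule: rev_induct)
  case Nil
  then show ?case using pos_length by (metis length_0_conv)
next
  case (snoc q s)
  obtain v p where v: "t = v @ [p]" "(s, v) \<in> F" using pos_snoc[OF snoc.prems(1,2)] by metis
  obtain v' p' where v': "t' = v' @ [p']" "(s, v') \<in> F" using pos_snoc[OF snoc.prems(1,3)] by metis
  have vv: "v = v'" using snoc.IH[OF snoc.prems(1) v(2) v'(2)] .
  have "\<not> ql p p'" "\<not> ql p' p"
    using pos_sibling[OF snoc.prems(1), of s q v p q p'] pos_sibling[OF snoc.prems(1), of s q v p' q p]
      snoc.prems(2,3) v v' vv by auto
  then show ?case using ql_total[of p p'] v v' vv by auto
qed

lemma pos_inj: "pos \<rho> \<rho>' F \<Longrightarrow> (s, t) \<in> F \<Longrightarrow> (s', t) \<in> F \<Longrightarrow> s = s'"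
  using pos_fun[OF pos_sym] by (metis converse_iff)

lemma pos_sless_imp:
  assumes F: "pos \<rho> \<rho>' F" and st: "(s, t) \<in> F" "(s', t') \<in> F" and less: "sless s s'"
  shows "sless t t'"
proof -
  from less consider q u where "s' = s @ q # u" | w a x b y where "s = w @ a # x" "s' = w @ b # y" "ql a b"
    unfolding sless_iff by blast
  then show ?thesis
  proof cases
    case 1
    then have st': "(s @ (q # u), t') \<in> F" using st(2) by simp
    from pos_prefix'[OF F st'] obtain t0 v where t0: "t' = t0 @ v" "length v = length (q # u)" "(s, t0) \<in> F" by metis
    then have "t' = t @ v" using pos_fun[OF F st(1)] by blast
    with t0(2) show ?thesis by (cases v) auto
  next
    case 2
    have 3: "((w @ [a]) @ x, t) \<in> F" "((w @ [b]) @ y, t') \<in> F" using st 2 by simp_all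
    from pos_prefix'[OF F 3(1)] obtain v0 r where v0: "t = v0 @ r" "(w @ [a], v0) \<in> F" by metis
    from pos_prefix'[OF F 3(2)] obtain v1 r' where v1: "t' = v1 @ r'" "(w @ [b], v1) \<in> F" by metis
    from pos_snoc[OF F v0(2)] obtain v p where v: "v0 = v @ [p]" "(w, v) \<in> F" by metis
    from pos_snoc[OF F v1(2)] obtain v' p' where v': "v1 = v' @ [p']" "(w, v') \<in> F" by metis
    have "v = v'" by (rule pos_fun[OF F v(2) v'(2)])
    then have "ql p p'" using pos_sibling[OF F, of w a v p b p'] v0 v1 v v' 2(3) by simp
    then show ?thesis using v0 v1 v v' \<open>v = v'\<close> by (auto intro: sless_diff)
  qed
qed

lemma pos_sless: "pos \<rho> \<rho>' F \<Longrightarrow> (s, t) \<in> F \<Longrightarrow> (s', t') \<in> F \<Longrightarrow> sless s s' \<longleftrightarrow> sless t t'"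
  using pos_sless_imp[of \<rho> \<rho>' F s t s' t'] pos_sless_imp[OF pos_sym, of \<rho> \<rho>' F t s t' s'] by auto

section \<open>Answering moves by extending positions\<close>

definition related :: "'x \<Rightarrow> 'x \<Rightarrow> (nat list \<times> nat list) set \<Rightarrow> nat \<Rightarrow> nat \<Rightarrow> bool" where
  "related \<rho> \<rho>' F x y \<longleftrightarrow> x \<in> dm \<rho> \<and> y \<in> dm \<rho>' \<and> p2 x = p2 y \<and> (nd x, nd y) \<in> F"

abbreviation rell where "rell \<rho> \<rho>' F \<equiv> list_all2 (related \<rho> \<rho>' F)"

lemma rell_dm: "rell \<rho> \<rho>' F a b \<Longrightarrow> set a \<subseteq> dm \<rho> \<and> set b \<subseteq> dm \<rho>'"
  by (induction rule: list_all2_induct) (auto simp: related_def)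

lemma rell_mono: "rell \<rho> \<rho>' F a b \<Longrightarrow> F \<subseteq> F' \<Longrightarrow> rell \<rho> \<rho>' F' a b"
  by (erule list_all2_mono) (auto simp: related_def)

lemma rell_sym: "rell \<rho> \<rho>' F a b \<Longrightarrow> rell \<rho>' \<rho> (F\<inverse>) b a"
  unfolding list_all2_conv_all_nth related_def by auto

lemma rell_patom:
  assumes F: "pos \<rho> \<rho>' F" and ab: "rell \<rho> \<rho>' F a b"
  shows "patom (od \<rho>) (od \<rho>') a b"
  unfolding patom_def
proof (intro conjI allI impI)
  show "length a = length b" using ab by (rule list_all2_lengthD)
  fix i j assume ij: "i < length a" "j < length a"
  have i: "related \<rho> \<rho>' F (a ! i) (b ! i)" and j: "related \<rho> \<rho>' F (a ! j) (b ! j)"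
    using ab ij by (auto simp: list_all2_conv_all_nth)
  have nd: "nd (a ! i) = nd (a ! j) \<longleftrightarrow> nd (b ! i) = nd (b ! j)"
    using pos_fun[OF F] pos_inj[OF F] i j unfolding related_def by metis
  have eq: "x = y \<longleftrightarrow> nd x = nd y \<and> p2 x = p2 y" for x y by (metis el_nd)
  show "a ! i = a ! j \<longleftrightarrow> b ! i = b ! j" 
    unfolding eq[of "a ! i" "a ! j"] eq[of "b ! i" "b ! j"] using nd i j by (simp add: related_def)
  show "(a ! i, a ! j) \<in> od \<rho> \<longleftrightarrow> (b ! i, b ! j) \<in> od \<rho>'"
    using pos_sless[OF F, of "nd (a ! i)" "nd (b ! i)" "nd (a ! j)" "nd (b ! j)"] nd i j
    by (simp add: od_def related_def)
qed

abbreviation typed :: "'x \<Rightarrow> 'x \<Rightarrow> (nat \<Rightarrow> 'x \<Rightarrow> 'x \<Rightarrow> bool) \<Rightarrow> (nat list \<times> nat list) set \<Rightarrow> bool" where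
  "typed \<rho> \<rho>' E F \<equiv> \<forall>s t. (s, t) \<in> F \<longrightarrow> E (length s) (tp \<rho> s) (tp \<rho>' t)"

text \<open>The new child goes into the cut determined by the siblings already matched, in a colour
  that gives the wanted type.\<close>

lemma pos_insert:
  assumes F: "pos \<rho> \<rho>' F" and uv: "(u, v) \<in> F" and new: "\<And>t. (u @ [q], t) \<notin> F"
    and q: "lab (cl q) \<in> ch (tp \<rho> u)" and y: "y \<in> ch (tp \<rho>' v)"
  obtains p where "lab (cl p) = y" "pos \<rho> \<rho>' (insert (u @ [q], v @ [p]) F)"
proof -
  obtain c where c: "lab c = y" using surj_lab by (metis surjD)
  define S where "S = {p. \<exists>q'. (u @ [q'], v @ [p]) \<in> F \<and> ql q' q}"
  define T where "T = {p. \<exists>q'. (u @ [q'], v @ [p]) \<in> F \<and> ql q q'}"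
  have "S \<union> T \<subseteq> (\<lambda>(s, t). last t) ` F" unfolding S_def T_def by force
  then have fin: "finite S" "finite T" using pos_finite[OF F] finite_subset by (metis finite_Un finite_imageI)+
  have "ql s t" if "s \<in> S" "t \<in> T" for s t
    using that pos_sibling[OF F] ql_trans unfolding S_def T_def by blast
  then obtain p where p: "cl p = c" "\<forall>s\<in>S. ql s p" "\<forall>t\<in>T. ql p t" using ql_gap[OF fin] by metis
  have sib: "ql q' q = ql p' p \<and> ql q q' = ql p p'" if "(u @ [q'], v @ [p']) \<in> F" for q' p'
  proof -
    have "q' \<noteq> q" using new that by auto
    then consider "ql q' q" | "ql q q'" using ql_total by blast
    then show ?thesis
    proof cases
      case 1
      then have "p' \<in> S" using that by (auto simp: S_def)
      then show ?thesis using 1 p(2) ql_asym by metis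
    next
      case 2
      then have "p' \<in> T" using that by (auto simp: T_def)
      then show ?thesis using 2 p(3) ql_asym by metis
    qed
  qed
  have "pos \<rho> \<rho>' (insert (u @ [q], v @ [p]) F)"
    unfolding pos_def
  proof (intro conjI allI impI)
    show "finite (insert (u @ [q], v @ [p]) F)" using pos_finite[OF F] by simp
    show "([], []) \<in> insert (u @ [q], v @ [p]) F" using pos_nil[OF F] by simp
    fix s t assume st: "(s, t) \<in> insert (u @ [q], v @ [p]) F"
    have uv': "node \<rho> u" "node \<rho>' v" "length u = length v" using pos_node[OF F uv] pos_length[OF F uv] by auto
    have yp: "lab (cl p) \<in> ch (tp \<rho>' v)" using y c p by simp
    show "node \<rho> s" "node \<rho>' t" "length s = length t"
      using st uv' q yp pos_node[OF F] pos_length[OF F] by auto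
  next
    fix s q' t p' assume "(s @ [q'], t @ [p']) \<in> insert (u @ [q], v @ [p]) F"
    then show "(s, t) \<in> insert (u @ [q], v @ [p]) F" using uv pos_butlast[OF F] by auto
  next
    fix s q1 t p1 q2 p2
    assume 1: "(s @ [q1], t @ [p1]) \<in> insert (u @ [q], v @ [p]) F"
      and 2: "(s @ [q2], t @ [p2]) \<in> insert (u @ [q], v @ [p]) F"
    from 1 consider "s = u" "q1 = q" "t = v" "p1 = p" | "(s @ [q1], t @ [p1]) \<in> F" by auto
    then show "ql q1 q2 = ql p1 p2"
    proof cases
      case a: 1
      from 2 consider "q2 = q" "p2 = p" | "(s @ [q2], t @ [p2]) \<in> F" by auto
      then show ?thesis using a sib by cases auto
    next
      case a: 2
      from 2 consider "s = u" "q2 = q" "t = v" "p2 = p" | "(s @ [q2], t @ [p2]) \<in> F" by auto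
      then show ?thesis using a sib pos_sibling[OF F] by cases auto
    qed
  qed
  then show ?thesis using that p(1) c by blast
qed

lemma extend_node:
  assumes F: "pos \<rho> \<rho>' F" "typed \<rho> \<rho>' E F" and s: "node \<rho> s" "length s \<le> N"
    and zig: "\<And>l x y x'. l < N \<Longrightarrow> E l x y \<Longrightarrow> x' \<in> ch x \<Longrightarrow> \<exists>y'\<in>ch y. E (Suc l) x' y'"
  shows "\<exists>F' t. F \<subseteq> F' \<and> pos \<rho> \<rho>' F' \<and> typed \<rho> \<rho>' E F' \<and> (s, t) \<in> F'"
  using s
proof (induction s rule: rev_induct)
  case Nil
  then show ?case using F pos_nil[OF F(1)] by blast
next
  case (snoc q u)
  then obtain F' v where F': "F \<subseteq> F'" "pos \<rho> \<rho>' F'" "typed \<rho> \<rho>' E F'" "(u, v) \<in> F'" by auto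
  show ?case
  proof (cases "\<exists>t. (u @ [q], t) \<in> F'")
    case True
    then show ?thesis using F' by blast
  next
    case False
    have q: "lab (cl q) \<in> ch (tp \<rho> u)" using snoc.prems by simp
    have "E (length u) (tp \<rho> u) (tp \<rho>' v)" using F' by blast
    from zig[OF _ this q] snoc.prems obtain y where y: "y \<in> ch (tp \<rho>' v)" "E (Suc (length u)) (lab (cl q)) y"
      by (auto simp: Suc_le_eq)
    obtain p where p: "lab (cl p) = y" "pos \<rho> \<rho>' (insert (u @ [q], v @ [p]) F')"
      by (rule pos_insert[OF F'(2,4) _ q y(1)]) (use False in blast)
    have "typed \<rho> \<rho>' E (insert (u @ [q], v @ [p]) F')" using F'(3) y(2) p(1) by auto
    then show ?thesis using F'(1) p(2) by (intro exI[of _ "insert (u @ [q], v @ [p]) F'"] exI[of _ "v @ [p]"]) auto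
  qed
qed

lemma extend_list:
  assumes F: "pos \<rho> \<rho>' F" "typed \<rho> \<rho>' E F" and c: "set c \<subseteq> dm \<rho>" "\<forall>x\<in>set c. length (nd x) \<le> N"
    and zig: "\<And>l x y x'. l < N \<Longrightarrow> E l x y \<Longrightarrow> x' \<in> ch x \<Longrightarrow> \<exists>y'\<in>ch y. E (Suc l) x' y'"
    and col: "\<And>l x y. E l x y \<Longrightarrow> colr x = colr y"
  shows "\<exists>F' d. F \<subseteq> F' \<and> pos \<rho> \<rho>' F' \<and> typed \<rho> \<rho>' E F' \<and> rell \<rho> \<rho>' F' c d"
  using c
proof (induction c)
  case Nil
  then show ?case using F by (metis list_all2_Nil subset_refl)
next
  case (Cons x c)
  then obtain F' d where F': "F \<subseteq> F'" "pos \<rho> \<rho>' F'" "typed \<rho> \<rho>' E F'" "rell \<rho> \<rho>' F' c d" by auto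
  have x: "nd x \<noteq> []" "node \<rho> (nd x)" "p2 x < bs \<rho> (nd x)" "length (nd x) \<le> N" using Cons.prems by (auto simp: dm_def)
  have "\<exists>F'' t. F' \<subseteq> F'' \<and> pos \<rho> \<rho>' F'' \<and> typed \<rho> \<rho>' E F'' \<and> (nd x, t) \<in> F''"
    by (rule extend_node[OF F'(2,3) x(2,4)]) (rule zig)
  then obtain F'' t where
    F'': "F' \<subseteq> F''" "pos \<rho> \<rho>' F''" "typed \<rho> \<rho>' E F''" "(nd x, t) \<in> F''"
    by - (elim exE conjE, rule that)
  have "colr (tp \<rho> (nd x)) = colr (tp \<rho>' t)" by (rule col) (use F'' in blast)
  moreover have len: "length (nd x) = length t" using pos_length[OF F''(2,4)] .
  ultimately have "bs \<rho>' t = bs \<rho> (nd x)" by (simp add: bs_def)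
  then have "related \<rho> \<rho>' F'' x (el t (p2 x))"
    using x len pos_node[OF F''(2,4)] F''(4) Cons.prems by (auto simp: related_def)
  then have "rell \<rho> \<rho>' F'' (x # c) (el t (p2 x) # d)" using rell_mono[OF F'(4) F''(1)] by simp
  then show ?case using F' F'' by blast
qed

lemma ex_length_bound: "\<exists>N. \<forall>x\<in>set c. length (nd x) \<le> N"
proof (induction c)
  case (Cons x c)
  then obtain N where "\<forall>x\<in>set c. length (nd x) \<le> N" by blast
  then show ?case by (intro exI[of _ "max (length (nd x)) N"]) (auto simp: le_max_iff_disj)
qed simp

text \<open>\<open>E \<gamma> n\<close> relates types which cannot be distinguished in \<open>n\<close> steps down the tree, when after
  that there remain fewer than \<open>\<gamma>\<close> moves of the game.\<close>

lemma game:
  assumes mono: "\<And>\<delta> \<gamma> n x y. \<delta> < \<gamma> \<Longrightarrow> \<gamma> < \<Gamma> \<Longrightarrow> E \<gamma> 0 x y \<Longrightarrow> E \<delta> n x y"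
    and mono1: "\<And>\<gamma> n x y. \<gamma> < \<Gamma> \<Longrightarrow> E \<gamma> (Suc n) x y \<Longrightarrow> E \<gamma> n x y"
    and zig: "\<And>\<gamma> n x y x'. \<gamma> < \<Gamma> \<Longrightarrow> E \<gamma> (Suc n) x y \<Longrightarrow> x' \<in> ch x \<Longrightarrow> \<exists>y'\<in>ch y. E \<gamma> n x' y'"
    and zag: "\<And>\<gamma> n x y y'. \<gamma> < \<Gamma> \<Longrightarrow> E \<gamma> (Suc n) x y \<Longrightarrow> y' \<in> ch y \<Longrightarrow> \<exists>x'\<in>ch x. E \<gamma> n x' y'"
    and col: "\<And>\<gamma> n x y. \<gamma> < \<Gamma> \<Longrightarrow> E \<gamma> n x y \<Longrightarrow> colr x = colr y"
  shows "\<gamma> \<le> \<Gamma> \<Longrightarrow> pos \<rho> \<rho>' F \<Longrightarrow> (\<And>\<delta> n. \<delta> < \<gamma> \<Longrightarrow> typed \<rho> \<rho>' (\<lambda>_. E \<delta> n) F) \<Longrightarrow> rell \<rho> \<rho>' F a b \<Longrightarrow>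
    bt \<rho> \<rho>' \<gamma> a b"
proof (induction \<gamma> arbitrary: F a b rule: less_induct)
  case (less \<gamma>)
  have down: "E \<delta> 0 x y" if "\<delta> < \<Gamma>" "E \<delta> n x y" for \<delta> n x y
    using that(2) by (induction n) (use mono1[OF that(1)] in auto)
  have step: "bt \<rho> \<rho>' \<delta> (a @ c) (b @ d)"
    if \<delta>: "\<delta> < \<gamma>" and F': "F \<subseteq> F'" "pos \<rho> \<rho>' F'" "rell \<rho> \<rho>' F' c d" and E: "typed \<rho> \<rho>' (\<lambda>l. E \<delta> (N - l)) F'" for \<delta> F' c d N
  proof (rule less.IH[OF \<delta> _ F'(2)])
    have \<Gamma>: "\<delta> < \<Gamma>" using \<delta> less.prems(1) by (rule less_le_trans)
    then show "\<delta> \<le> \<Gamma>" by simp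
    show "typed \<rho> \<rho>' (\<lambda>_. E \<delta>' n) F'" if "\<delta>' < \<delta>" for \<delta>' n
      using mono[OF that \<Gamma>] down[OF \<Gamma>] E by blast
    show "rell \<rho> \<rho>' F' (a @ c) (b @ d)"
      using rell_mono[OF less.prems(4) F'(1)] F'(3) by (rule list_all2_appendI)
  qed
  \<comment> \<open>A move with nodes of depth at most \<open>N\<close> starts with
    \<open>n = N\<close> and loses one per level. At its end \<open>E \<delta> 0\<close> is left,
    which by \<open>mono\<close> provides any number of steps at smaller ranks.\<close>
  have start: "typed \<rho> \<rho>' (\<lambda>l. E \<delta> (N - l)) F" if "\<delta> < \<gamma>" for \<delta> N
    using less.prems(3)[OF that] by blast
  show ?case
  proof (rule bfI)
    show "patom (od \<rho>) (od \<rho>') a b" by (rule rell_patom[OF less.prems(2,4)])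
    show "\<forall>\<delta><\<gamma>. \<forall>c. set c \<subseteq> dm \<rho> \<longrightarrow> (\<exists>d. set d \<subseteq> dm \<rho>' \<and> length d = length c \<and> bt \<rho> \<rho>' \<delta> (a @ c) (b @ d))"
    proof (intro allI impI)
      fix \<delta> c assume \<delta>: "\<delta> < \<gamma>" and c: "set c \<subseteq> dm \<rho>"
      have \<Gamma>: "\<delta> < \<Gamma>" using \<delta> less.prems(1) by (rule less_le_trans)
      obtain N where N: "\<forall>x\<in>set c. length (nd x) \<le> N" using ex_length_bound by blast
      have zig': "\<exists>y'\<in>ch y. E \<delta> (N - Suc l) x' y'" if "l < N" "E \<delta> (N - l) x y" "x' \<in> ch x" for l x y x'
        using zig[OF \<Gamma> _ that(3), of "N - Suc l" y] that(1,2) by (simp add: Suc_diff_Suc)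
      have "\<exists>F' d. F \<subseteq> F' \<and> pos \<rho> \<rho>' F' \<and> typed \<rho> \<rho>' (\<lambda>l. E \<delta> (N - l)) F' \<and> rell \<rho> \<rho>' F' c d"
        by (rule extend_list[OF less.prems(2) start[OF \<delta>] c N]) (use zig' col[OF \<Gamma>] in metis)+
      then obtain F' d where F': "F \<subseteq> F'" "pos \<rho> \<rho>' F'" "typed \<rho> \<rho>' (\<lambda>l. E \<delta> (N - l)) F'" "rell \<rho> \<rho>' F' c d"
        by - (elim exE conjE, rule that)
      then show "\<exists>d. set d \<subseteq> dm \<rho>' \<and> length d = length c \<and> bt \<rho> \<rho>' \<delta> (a @ c) (b @ d)"
        using step[OF \<delta> F'(1,2,4,3)] rell_dm[OF F'(4)] list_all2_lengthD[OF F'(4)] by metis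
    qed
    show "\<forall>\<delta><\<gamma>. \<forall>d. set d \<subseteq> dm \<rho>' \<longrightarrow> (\<exists>c. set c \<subseteq> dm \<rho> \<and> length d = length c \<and> bt \<rho> \<rho>' \<delta> (a @ c) (b @ d))"
    proof (intro allI impI)
      fix \<delta> d assume \<delta>: "\<delta> < \<gamma>" and d: "set d \<subseteq> dm \<rho>'"
      have \<Gamma>: "\<delta> < \<Gamma>" using \<delta> less.prems(1) by (rule less_le_trans)
      obtain N where N: "\<forall>x\<in>set d. length (nd x) \<le> N" using ex_length_bound by blast
      have zag': "\<exists>x'\<in>ch x. E \<delta> (N - Suc l) x' y'" if "l < N" "E \<delta> (N - l) x y" "y' \<in> ch y" for l x y y'
        using zag[OF \<Gamma> _ that(3), of "N - Suc l" x] that(1,2) by (simp add: Suc_diff_Suc)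
      have start': "typed \<rho>' \<rho> (\<lambda>l y x. E \<delta> (N - l) x y) (F\<inverse>)"
        using start[OF \<delta>] pos_length[OF less.prems(2)] by (metis converse_iff)
      have "\<exists>F' c. F\<inverse> \<subseteq> F' \<and> pos \<rho>' \<rho> F' \<and> typed \<rho>' \<rho> (\<lambda>l y x. E \<delta> (N - l) x y) F' \<and> rell \<rho>' \<rho> F' d c"
        by (rule extend_list[OF pos_sym[OF less.prems(2)] start' d N]) (use zag' col[OF \<Gamma>] in metis)+
      then obtain F' c where F': "F\<inverse> \<subseteq> F'" "pos \<rho>' \<rho> F'" "rell \<rho>' \<rho> F' d c"
        "typed \<rho>' \<rho> (\<lambda>l y x. E \<delta> (N - l) x y) F'" by blast
      have "F \<subseteq> F'\<inverse>" using F'(1) by auto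
      moreover have "typed \<rho> \<rho>' (\<lambda>l. E \<delta> (N - l)) (F'\<inverse>)"
        using F'(4) pos_length[OF F'(2)] by (metis converse_iff)
      ultimately have "bt \<rho> \<rho>' \<delta> (a @ c) (b @ d)"
        using step[OF \<delta> _ pos_sym[OF F'(2)] rell_sym[OF F'(3)]] by blast
      then show "\<exists>c. set c \<subseteq> dm \<rho> \<and> length d = length c \<and> bt \<rho> \<rho>' \<delta> (a @ c) (b @ d)"
        using rell_dm[OF F'(3)] list_all2_lengthD[OF F'(3)] by metis
    qed
  qed
qed

lemma pos_root: "pos \<rho> \<rho>' {([], [])}"
  by (simp add: pos_def)

text \<open>\<open>W\<close> is a bisimulation of types, so it can serve as \<open>E\<close> for all
  ranks and all numbers of steps.\<close>

lemma zigzag_extend: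
  assumes W: "\<And>x y x'. W x y \<Longrightarrow> x' \<in> ch x \<Longrightarrow> \<exists>y'\<in>ch y. W x' y'" "\<And>x y y'. W x y \<Longrightarrow> y' \<in> ch y \<Longrightarrow> \<exists>x'\<in>ch x. W x' y'"
      "\<And>x y. W x y \<Longrightarrow> colr x = colr y"
    and F: "pos \<rho> \<rho>' F" "typed \<rho> \<rho>' (\<lambda>_. W) F" "rell \<rho> \<rho>' F a b" and c: "c \<in> dm \<rho>"
  shows "\<exists>d\<in>dm \<rho>'. bt \<rho> \<rho>' \<gamma> (a @ [c]) (b @ [d])"
proof -
  have c': "set [c] \<subseteq> dm \<rho>" "\<forall>x\<in>set [c]. length (nd x) \<le> length (nd c)" using c by auto
  have "\<exists>F' d. F \<subseteq> F' \<and> pos \<rho> \<rho>' F' \<and> typed \<rho> \<rho>' (\<lambda>_. W) F' \<and> rell \<rho> \<rho>' F' [c] d"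
    by (rule extend_list[OF F(1,2) c']) (use W in blast)+
  then obtain F' d where F': "F \<subseteq> F'" "pos \<rho> \<rho>' F'" "typed \<rho> \<rho>' (\<lambda>_. W) F'" "rell \<rho> \<rho>' F' [c] d" by blast
  from F'(4) obtain y where y: "d = [y]" by (auto simp: list_all2_Cons1)
  have "rell \<rho> \<rho>' F' (a @ [c]) (b @ d)" using rell_mono[OF F(3) F'(1)] F'(4) by (rule list_all2_appendI)
  then have "bt \<rho> \<rho>' \<gamma> (a @ [c]) (b @ d)"
    by (intro game[where \<Gamma> = \<gamma> and E = "\<lambda>_ _. W" and F = F']) (use W F' in blast)+
  then show ?thesis using y rell_dm[OF F'(4)] by auto
qed

section \<open>Distinguishing types\<close>

abbreviation c2 :: cord where "c2 \<equiv> osuc (osuc 0)"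

text \<open>Winning strategies for the player who wants to tell two types apart, played on the types
  alone. All ranks stay above \<open>c2\<close>, where \<open>bt_child\<close> still forces children
  to be answered by children.\<close>

inductive dist :: "cord \<Rightarrow> 'x \<Rightarrow> 'x \<Rightarrow> bool" where
  dist_colr: "colr x \<noteq> colr y \<Longrightarrow> c2 < \<gamma> \<Longrightarrow> dist \<gamma> x y"
| dist_forth: "c2 < \<delta> \<Longrightarrow> \<delta> < \<gamma> \<Longrightarrow> x' \<in> ch x \<Longrightarrow> (\<And>y'. y' \<in> ch y \<Longrightarrow> dist \<delta> x' y') \<Longrightarrow> dist \<gamma> x y"
| dist_back: "c2 < \<delta> \<Longrightarrow> \<delta> < \<gamma> \<Longrightarrow> y' \<in> ch y \<Longrightarrow> (\<And>x'. x' \<in> ch x \<Longrightarrow> dist \<delta> x' y') \<Longrightarrow> dist \<gamma> x y"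

lemma dist_sym: "dist \<gamma> x y \<Longrightarrow> dist \<gamma> y x"
  by (induction rule: dist.induct) (metis dist.intros)+

lemma dist_mono: "dist \<gamma> x y \<Longrightarrow> \<gamma> \<le> \<gamma>' \<Longrightarrow> dist \<gamma>' x y"
  by (induction rule: dist.induct) (meson dist.intros less_le_trans)+

lemma dist_gt: "dist \<gamma> x y \<Longrightarrow> c2 < \<gamma>"
  by (induction rule: dist.induct) (meson less_trans)+

text \<open>The root has no block and cannot be an entry of a tuple, so the two roots count as
  matched from the start.\<close>

definition at :: "nat list \<Rightarrow> nat list \<Rightarrow> nat list \<Rightarrow> nat list \<Rightarrow> bool" where
  "at s t a b \<longleftrightarrow> s = [] \<and> t = [] \<or> (\<exists>i<length a. a ! i = el s 0 \<and> b ! i = el t 0)"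

lemma at_sym: "length a = length b \<Longrightarrow> at s t a b \<Longrightarrow> at t s b a"
  unfolding at_def by metis

text \<open>Level and prefix relation survive above \<open>c2\<close>, so a child of
  \<open>s\<close> is answered by a child of \<open>t\<close>; below the roots the level alone
  decides.\<close>

lemma bt_child:
  assumes bt: "bt \<rho> \<rho>' \<gamma> a b" "\<delta> < \<gamma>" "c2 < \<delta>" and sub: "set a \<subseteq> dm \<rho>" "set b \<subseteq> dm \<rho>'"
    and st: "at s t a b" "node \<rho> s" "x' \<in> ch (tp \<rho> s)"
  shows "\<exists>q p c d. lab (cl q) = x' \<and> lab (cl p) \<in> ch (tp \<rho>' t) \<and> set (a @ [c]) \<subseteq> dm \<rho> \<and> set (b @ [d]) \<subseteq> dm \<rho>' \<and>
    bt \<rho> \<rho>' \<delta> (a @ [c]) (b @ [d]) \<and> at (s @ [q]) (t @ [p]) (a @ [c]) (b @ [d]) \<and>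
    node \<rho> (s @ [q]) \<and> node \<rho>' (t @ [p])"
proof -
  obtain e where e: "lab e = x'" using surj_lab by (metis surjD)
  obtain q where q: "cl q = e" using ql_above by blast
  have n: "node \<rho> (s @ [q])" using st e q by simp
  then have c: "set [el (s @ [q]) 0] \<subseteq> dm \<rho>" by simp
  have len: "length a = length b" using bf_length[OF bt(1)] .
  obtain d where d: "set d \<subseteq> dm \<rho>'" "length d = length [el (s @ [q]) 0]" "bt \<rho> \<rho>' \<delta> (a @ [el (s @ [q]) 0]) (b @ d)"
    using bf_forth[OF bt(1,2) c] by blast
  then obtain y where y: "d = [y]" by (auto simp: length_Suc_conv)
  have sub': "set (a @ [el (s @ [q]) 0]) \<subseteq> dm \<rho>" "set (b @ d) \<subseteq> dm \<rho>'" using sub c d by auto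
  have \<delta>: "osuc 0 < \<delta>" using bt(3) less_osuc by (metis less_trans)
  have k: "length a < length (a @ [el (s @ [q]) 0])" by simp
  have "p2 y = 0" "length (nd y) = Suc (length s)"
    using bt_index(1,2)[OF d(3) \<delta> sub' k] y len by (simp_all add: nth_append)
  then obtain t' where t': "y = el t' 0" "length t' = Suc (length s)" by (metis el_eqI)
  have n': "node \<rho>' t'" using d(1) y t' by simp
  have "\<exists>p. t' = t @ [p]"
  proof (cases "s = [] \<and> t = []")
    case True
    then show ?thesis using t'(2) by (auto simp: length_Suc_conv)
  next
    case False
    then obtain i where i: "i < length a" "a ! i = el s 0" "b ! i = el t 0" using st(1) by (auto simp: at_def)
    have "\<exists>q u. t' = t @ q # u"
      by (rule bt_prefix[OF d(3) bt(3) less_osuc sub', where i = i and j = "length a"])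
        (use i y t' len in \<open>auto simp: nth_append\<close>)
    moreover have "length t = length s"
      using bt_index(2)[OF bt(1) less_trans[OF \<delta> bt(2)] sub i(1)] i by simp
    ultimately show ?thesis using t'(2) by auto
  qed
  then obtain p where p: "t' = t @ [p]" by blast
  have "at (s @ [q]) (t @ [p]) (a @ [el (s @ [q]) 0]) (b @ [y])"
    unfolding at_def using t' p len by (intro disjI2 exI[of _ "length a"]) (simp add: nth_append)
  moreover have "lab (cl p) \<in> ch (tp \<rho>' t)" using n' p by simp
  ultimately show ?thesis using e q n n' p d(3) sub' y by blast
qed

text \<open>The strategy is carried out with the first elements of the blocks. The colours of the
  roots are compared by hypothesis, as no block shows them.\<close>

lemma dist_bt:
  "dist \<gamma> x y \<Longrightarrow> x = tp \<rho> s \<Longrightarrow> y = tp \<rho>' t \<Longrightarrow> bt \<rho> \<rho>' \<gamma> a b \<Longrightarrow> set a \<subseteq> dm \<rho> \<Longrightarrow> set b \<subseteq> dm \<rho>' \<Longrightarrow>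
    at s t a b \<Longrightarrow> node \<rho> s \<Longrightarrow> node \<rho>' t \<Longrightarrow> colr \<rho> = colr \<rho>' \<Longrightarrow> False"
proof (induction arbitrary: s t a b rule: dist.induct)
  case (dist_colr x y \<gamma>)
  have \<gamma>: "osuc 0 < \<gamma>" using dist_colr.hyps less_osuc by (metis less_trans)
  from dist_colr.prems(6) consider "s = []" "t = []" | i where "i < length a" "a ! i = el s 0" "b ! i = el t 0"
    by (auto simp: at_def)
  then show ?case
  proof cases
    case 2
    then show ?thesis using bt_index(3)[OF dist_colr.prems(3) \<gamma> dist_colr.prems(4,5) 2(1)] dist_colr by simp
  qed (use dist_colr in simp)
next
  case (dist_forth \<delta> \<gamma> x' x y)
  have "x' \<in> ch (tp \<rho> s)" using dist_forth by simp
  from bt_child[OF dist_forth.prems(3) dist_forth.hyps(2,1) dist_forth.prems(4,5,6,7) this]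
  obtain q p c d where *: "lab (cl q) = x'" "lab (cl p) \<in> ch (tp \<rho>' t)" "set (a @ [c]) \<subseteq> dm \<rho>" "set (b @ [d]) \<subseteq> dm \<rho>'"
    "bt \<rho> \<rho>' \<delta> (a @ [c]) (b @ [d])" "at (s @ [q]) (t @ [p]) (a @ [c]) (b @ [d])" "node \<rho> (s @ [q])" "node \<rho>' (t @ [p])"
    by - (elim exE conjE, rule that)
  have "lab (cl p) \<in> ch y" using *(2) dist_forth.prems(2) by simp
  from dist_forth.IH[OF this _ _ *(5,3,4,6,7,8) dist_forth.prems(9)] show ?case using *(1) by simp
next
  case (dist_back \<delta> \<gamma> y' y x)
  have y': "y' \<in> ch (tp \<rho>' t)" using dist_back by simp
  have len: "length a = length b" using bf_length[OF dist_back.prems(3)] .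
  from bt_child[OF bt_sym[OF dist_back.prems(3)] dist_back.hyps(2,1) dist_back.prems(5,4) at_sym[OF len dist_back.prems(6)] dist_back.prems(8) y']
  obtain q p c d where *: "lab (cl q) = y'" "lab (cl p) \<in> ch (tp \<rho> s)" "set (b @ [c]) \<subseteq> dm \<rho>'" "set (a @ [d]) \<subseteq> dm \<rho>"
    "bt \<rho>' \<rho> \<delta> (b @ [c]) (a @ [d])" "at (t @ [q]) (s @ [p]) (b @ [c]) (a @ [d])" "node \<rho>' (t @ [q])" "node \<rho> (s @ [p])"
    by - (elim exE conjE, rule that)
  have at: "at (s @ [p]) (t @ [q]) (a @ [d]) (b @ [c])" by (rule at_sym[OF _ *(6)]) (simp add: len)
  have "lab (cl p) \<in> ch x" using *(2) dist_back.prems(1) by simp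
  from dist_back.IH[OF this _ _ bt_sym[OF *(5)] *(4,3) at *(8,7) dist_back.prems(9)] show ?case using *(1) by simp
qed

lemma dist_not_isomorphic:
  assumes "dist \<gamma> \<rho> \<rho>'" "colr \<rho> = colr \<rho>'"
  shows "\<not> isomorphic (dm \<rho>) (od \<rho>) (dm \<rho>') (od \<rho>')"
proof
  assume "isomorphic (dm \<rho>) (od \<rho>) (dm \<rho>') (od \<rho>')"
  then have "bt \<rho> \<rho>' \<gamma> [] []" by (rule isomorphic_bf)
  then show False using dist_bt[OF assms(1), of \<rho> "[]" \<rho>' "[]" "[]" "[]"] assms(2) by (simp add: at_def)
qed

section \<open>Recovering positions\<close>

lemma bt_prefix_node:
  assumes bt: "bt \<rho> \<rho>' \<gamma> a b" "c2 < \<gamma>" and sub: "set a \<subseteq> dm \<rho>" "set b \<subseteq> dm \<rho>'"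
    and ijk: "i < length a" "j < length a" "k < length a"
    and a: "nd (a ! i) = u @ w" "a ! j = el u 0" "a ! k = el (u @ w) 0"
  shows "b ! j = el (take (length u) (nd (b ! i))) 0"
proof -
  have \<gamma>: "osuc 0 < \<gamma>" using bt(2) less_osuc by (metis less_trans)
  have ix: "p2 (b ! l) = p2 (a ! l)" "length (nd (b ! l)) = length (nd (a ! l))" if "l < length a" for l
    using bt_index(1,2)[OF bt(1) \<gamma> sub that] by auto
  have j: "p2 (b ! j) = 0" "length (nd (b ! j)) = length u" using ix[OF ijk(2)] a by simp_all
  have ik: "nd (b ! k) = nd (b ! i)"
    by (rule bt_same_node[OF bt(1) \<gamma> sub ijk(3,1)]) (simp add: a)
  have "nd (b ! j) = take (length u) (nd (b ! i))"
  proof (cases w)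
    case Nil
    then have "nd (b ! j) = nd (b ! i)"
      by (intro bt_same_node[OF bt(1) \<gamma> sub ijk(2,1)]) (simp add: a)
    then show ?thesis using j by simp
  next
    case (Cons q v)
    have f: "b ! j = el (nd (b ! j)) 0" "b ! k = el (nd (b ! k)) 0" using ix[OF ijk(3)] j a by (simp_all add: el_eqI)
    have "\<exists>q v. nd (b ! k) = nd (b ! j) @ q # v"
      by (rule bt_prefix[OF bt less_osuc sub ijk(2) a(2) f(1) ijk(3) a(3) f(2)]) (simp add: Cons)
    then show ?thesis using ik j by auto
  qed
  then show ?thesis using j by (simp add: el_eqI)
qed

definition paths :: "nat list \<Rightarrow> nat list \<Rightarrow> (nat list \<times> nat list) set" where
  "paths a b = insert ([], []) {(take k (nd (a ! i)), take k (nd (b ! i))) |i k. i < length a \<and> k \<le> length (nd (a ! i))}"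

text \<open>The tuples name elements at the ends of branches only. A further move names the two
  diverging children; \<open>bt_prefix_node\<close> forces their images to be the corresponding
  prefixes, and the order compares these.\<close>

lemma paths_ql:
  assumes bt: "bt \<rho> \<rho>' \<gamma> a b" "c2 < \<delta>" "\<delta> < \<gamma>" and sub: "set a \<subseteq> dm \<rho>" "set b \<subseteq> dm \<rho>'"
    and ij: "i < length a" "j < length a" and a: "nd (a ! i) = w @ q # x" "nd (a ! j) = w @ q' # x'"
    and b: "nd (b ! i) = v @ p # y" "nd (b ! j) = v @ p' # y'" "length w = length v"
    and q: "ql q q'"
  shows "ql p p'"
proof -
  have in_dm: "a ! i \<in> dm \<rho>" "a ! j \<in> dm \<rho>" using sub ij by auto
  then have n: "node \<rho> (w @ q # x)" "node \<rho> (w @ q' # x')" using a by (auto simp: dm_def)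
  have n': "node \<rho> (w @ [q])" "node \<rho> (w @ [q'])" using node_replace[OF n(1)] node_replace[OF n(2)] by auto
  let ?c = "[el (w @ [q]) 0, el (w @ [q']) 0, el (w @ q # x) 0, el (w @ q' # x') 0]"
  have c: "set ?c \<subseteq> dm \<rho>" using n n' by simp
  obtain d where d: "set d \<subseteq> dm \<rho>'" "length d = length ?c" "bt \<rho> \<rho>' \<delta> (a @ ?c) (b @ d)"
    using bf_forth[OF bt(1,3) c] by blast
  have len: "length a = length b" using bf_length[OF bt(1)] .
  have sub': "set (a @ ?c) \<subseteq> dm \<rho>" "set (b @ d) \<subseteq> dm \<rho>'" using sub c d by auto
  let ?L = "length a"
  have "(b @ d) ! ?L = el (take (length (w @ [q])) (nd ((b @ d) ! i))) 0"
    by (rule bt_prefix_node[OF d(3) bt(2) sub', where k = "?L + 2" and w = x])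
      (use ij a in \<open>simp_all add: nth_append\<close>)
  then have 1: "(b @ d) ! ?L = el (v @ [p]) 0" using b ij len by (simp add: nth_append)
  have "(b @ d) ! (?L + 1) = el (take (length (w @ [q'])) (nd ((b @ d) ! j))) 0"
    by (rule bt_prefix_node[OF d(3) bt(2) sub', where k = "?L + 3" and w = x'])
      (use ij a in \<open>simp_all add: nth_append\<close>)
  then have 2: "(b @ d) ! (?L + 1) = el (v @ [p']) 0" using b ij len by (simp add: nth_append)
  have "below \<rho> ((a @ ?c) ! ?L) ((a @ ?c) ! (?L + 1))" using q n' by (simp add: nth_append below_iff)
  then have "below \<rho>' (el (v @ [p]) 0) (el (v @ [p']) 0)"
    using bt_below[OF d(3), of ?L "?L + 1"] 1 2 by simp
  then show ?thesis by (simp add: below_iff)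
qed

lemma paths_pos:
  assumes bt: "bt \<rho> \<rho>' \<gamma> a b" "c2 < \<delta>" "\<delta> < \<gamma>" and sub: "set a \<subseteq> dm \<rho>" "set b \<subseteq> dm \<rho>'"
  shows "pos \<rho> \<rho>' (paths a b)" "rell \<rho> \<rho>' (paths a b) a b"
proof -
  have len: "length a = length b" using bf_length[OF bt(1)] .
  have \<gamma>: "osuc 0 < \<gamma>" using bt(2,3) less_osuc by (metis less_trans)
  have ix: "p2 (b ! l) = p2 (a ! l)" "length (nd (b ! l)) = length (nd (a ! l))" if "l < length a" for l
    using bt_index(1,2)[OF bt(1) \<gamma> sub that] by auto
  have in_dm: "a ! i \<in> dm \<rho>" "b ! i \<in> dm \<rho>'" if "i < length a" for i using sub that len by auto
  have snoc: "\<exists>i<length a. \<exists>x y. nd (a ! i) = s @ q # x \<and> nd (b ! i) = t @ p # y \<and> length s = length t"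
    if st: "(s @ [q], t @ [p]) \<in> paths a b" for s q t p
  proof -
    from st obtain i k where ik: "i < length a" "k \<le> length (nd (a ! i))" "s @ [q] = take k (nd (a ! i))" "t @ [p] = take k (nd (b ! i))"
      by (auto simp: paths_def)
    have "nd (a ! i) = (s @ [q]) @ drop k (nd (a ! i))" "nd (b ! i) = (t @ [p]) @ drop k (nd (b ! i))"
      unfolding ik(3,4) by simp_all
    moreover have "length (s @ [q]) = length (t @ [p])" unfolding ik(3,4) using ix(2)[OF ik(1)] by simp
    ultimately show ?thesis using ik(1) by (metis append.assoc append_Cons append_Nil length_append_singleton nat.inject)
  qed
  have "paths a b \<subseteq> insert ([], []) (\<Union>i<length a. (\<lambda>k. (take k (nd (a ! i)), take k (nd (b ! i)))) ` {..length (nd (a ! i))})"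
    by (auto simp: paths_def)
  then have f1: "finite (paths a b)" by (rule finite_subset) auto
  have f0: "([], []) \<in> paths a b" by (simp add: paths_def)
  have f2: "node \<rho> s \<and> node \<rho>' t \<and> length s = length t" if "(s, t) \<in> paths a b" for s t
    using that in_dm ix by (auto simp: paths_def dm_def intro: node_take)
  have f3: "(s, t) \<in> paths a b" if st: "(s @ [q], t @ [p]) \<in> paths a b" for s q t p
  proof -
    obtain i x y where i: "i < length a" "nd (a ! i) = s @ q # x" "nd (b ! i) = t @ p # y" "length s = length t"
      using snoc[OF st] by blast
    then have "s = take (length s) (nd (a ! i))" "t = take (length s) (nd (b ! i))" "length s \<le> length (nd (a ! i))" by simp_all
    then show ?thesis using i(1) unfolding paths_def by blast
  qed
  have f4: "ql q q' = ql p p'"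
    if st: "(s @ [q], t @ [p]) \<in> paths a b" and st': "(s @ [q'], t @ [p']) \<in> paths a b" for s q t p q' p'
  proof -
    obtain i x y where i: "i < length a" "nd (a ! i) = s @ q # x" "nd (b ! i) = t @ p # y" "length s = length t"
      using snoc[OF st] by blast
    obtain j x' y' where j: "j < length a" "nd (a ! j) = s @ q' # x'" "nd (b ! j) = t @ p' # y'"
      using snoc[OF st'] by blast
    show ?thesis
    proof
      show "ql q q' \<Longrightarrow> ql p p'" by (rule paths_ql[OF bt sub i(1) j(1) i(2) j(2) i(3) j(3) i(4)])
      show "ql p p' \<Longrightarrow> ql q q'"
        by (rule paths_ql[OF bt_sym[OF bt(1)] bt(2,3) sub(2,1) _ _ i(3) j(3) i(2) j(2) i(4)[symmetric]]) (use i j len in auto)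
    qed
  qed
  show "pos \<rho> \<rho>' (paths a b)"
    unfolding pos_def by (intro conjI allI impI f0 f1) (erule f3 | erule (1) f4 | drule f2, simp)+
  have "(nd (a ! i), nd (b ! i)) \<in> paths a b" if "i < length a" for i
  proof -
    have "(nd (a ! i), nd (b ! i)) = (take (length (nd (a ! i))) (nd (a ! i)), take (length (nd (a ! i))) (nd (b ! i)))"
      using ix(2)[OF that] by simp
    then show ?thesis using that unfolding paths_def by blast
  qed
  then show "rell \<rho> \<rho>' (paths a b) a b"
    using len ix in_dm by (simp add: list_all2_conv_all_nth related_def)
qed

lemma paths_dist:
  assumes bt: "bt \<rho> \<rho>' \<gamma> a b" "dist \<delta> (tp \<rho> s) (tp \<rho>' t)" "\<delta> < \<gamma>" and sub: "set a \<subseteq> dm \<rho>" "set b \<subseteq> dm \<rho>'"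
    and st: "(s, t) \<in> paths a b" "s \<noteq> []" "colr \<rho> = colr \<rho>'"
  shows False
proof -
  have \<delta>: "c2 < \<delta>" using bt(2) by (rule dist_gt)
  obtain i k where ik: "i < length a" "s = take k (nd (a ! i))" "t = take k (nd (b ! i))" "k \<le> length (nd (a ! i))"
    using st by (auto simp: paths_def)
  have "a ! i \<in> dm \<rho>" using sub ik by auto
  then have n: "node \<rho> (nd (a ! i))" by (simp add: dm_def)
  let ?c = "[el s 0, el (nd (a ! i)) 0]"
  have nd_ne: "nd (a ! i) \<noteq> []" using ik st(2) by auto
  have c: "set ?c \<subseteq> dm \<rho>" using n st(2) ik node_take nd_ne by auto
  obtain d where d: "set d \<subseteq> dm \<rho>'" "length d = length ?c" "bt \<rho> \<rho>' \<delta> (a @ ?c) (b @ d)"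
    using bf_forth[OF bt(1,3) c] by blast
  have len: "length a = length b" using bf_length[OF bt(1)] .
  have sub': "set (a @ ?c) \<subseteq> dm \<rho>" "set (b @ d) \<subseteq> dm \<rho>'" using sub c d by auto
  have "(b @ d) ! length a = el (take (length s) (nd ((b @ d) ! i))) 0"
    by (rule bt_prefix_node[OF d(3) \<delta> sub', where k = "length a + 1" and w = "drop k (nd (a ! i))"])
      (use ik(1) in \<open>simp_all add: nth_append ik(2)\<close>)
  moreover have "take (length s) (nd ((b @ d) ! i)) = t" using ik len by (simp add: nth_append)
  ultimately have "at s t (a @ ?c) (b @ d)"
    unfolding at_def by (intro disjI2 exI[of _ "length a"]) (simp add: nth_append)
  moreover have "node \<rho> s" "node \<rho>' t"
    using pos_node[OF paths_pos(1)[OF bt(1) \<delta> bt(3) sub] st(1)] by auto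
  ultimately show False using dist_bt[OF bt(2) refl refl d(3) sub'] st(3) by blast
qed

end

section \<open>The trees\<close>

datatype ty = TRoot | TW "nat list" | TF nat nat nat | TG nat nat | TW' | TRoot2 | TOm | TRoot3

fun lab :: "nat \<Rightarrow> ty" where
  "lab c = (let k = p1 c; e = p2 c in
    if k = 0 then TW (list_decode e) else if k = 1 then TF (p1 e) (p1 (p2 e)) (p2 (p2 e))
    else if k = 2 then TG (p1 e) (p2 e) else if k = 3 then TW' else if k = 4 then TRoot2
    else if k = 5 then TOm else if k = 6 then TRoot3 else TRoot)"

declare lab.simps [simp del]

lemma surj_lab: "surj lab"
proof (rule surjI)
  fix x :: ty
  show "lab (case x of TW s \<Rightarrow> pair 0 (list_encode s) | TF i n y \<Rightarrow> pair 1 (pair i (pair n y)) | TG i n \<Rightarrow> pair 2 (pair i n)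
      | TW' \<Rightarrow> pair 3 0 | TRoot2 \<Rightarrow> pair 4 0 | TOm \<Rightarrow> pair 5 0 | TRoot3 \<Rightarrow> pair 6 0 | TRoot \<Rightarrow> pair 7 0) = x"
    by (cases x) (simp_all add: lab.simps Let_def)
qed

text \<open>Comparison types get the colour of what they imitate: \<open>TG\<close>,
  \<open>TOm\<close> and \<open>TRoot3\<close> that of \<open>TF 0\<close>, and \<open>TW'\<close>
  and \<open>TRoot2\<close> that of \<open>TW\<close> and \<open>TRoot\<close>.\<close>

primrec colr :: "ty \<Rightarrow> nat" where
  "colr TRoot = 0" | "colr (TW s) = 0" | "colr (TF i n x) = Suc i" | "colr (TG N m) = 1"
| "colr TW' = 0" | "colr TRoot2 = 0" | "colr TOm = 1" | "colr TRoot3 = 1"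

definition ext :: "nat list \<Rightarrow> nat \<Rightarrow> nat" where
  "ext s i = (if i < length s then s ! i else s ! (length s - 1))"

text \<open>The sets \<open>{x. Q n x}\<close> exhaust the labels. The type \<open>TF i n x\<close> is a label \<open>x\<close> at level \<open>n\<close>,
  whose children are the labels below \<open>x\<close> at the next level. A type \<open>TW s\<close> codes the eventually
  constant sequence \<open>ext s\<close> of labels; the other types occur only in structures to be
  compared with those of root types \<open>TF 0 0 0\<close> and \<open>TRoot\<close>.\<close>

locale labelled = maximal_order +
  fixes Q :: "nat \<Rightarrow> nat \<Rightarrow> bool" and ys :: "nat \<Rightarrow> nat"
  assumes Q_mono: "Q n x \<Longrightarrow> n \<le> m \<Longrightarrow> Q m x" and Q_top [simp]: "Q n 0" and ex_Q: "\<exists>n. Q n x"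
    and Q_cofinal: "Q n x \<Longrightarrow> z \<prec> x \<Longrightarrow> \<exists>y. Q (Suc n) y \<and> z \<preceq> y \<and> y \<prec> x"
    and dec_Q: "dec (\<lambda>z. Q (p1 z) (p2 z))"
begin

definition okl :: "nat list \<Rightarrow> bool" where
  "okl s \<longleftrightarrow> s \<noteq> [] \<and> (\<forall>i<length s. Q i (s ! i)) \<and> (\<forall>i. Suc i < length s \<longrightarrow> s ! i \<preceq> s ! Suc i)"

text \<open>The colour of \<open>TF i i (ext s i)\<close> names the index \<open>i\<close>, so
  \<open>TW s\<close> determines its sequence up to orbits of labels. \<open>TG N m\<close> has a
  child of its own kind, like a non-standard label, but only down to level \<open>N - 1\<close>,
  where all children are standard. \<open>TW'\<close> codes \<open>ys\<close>, and
  \<open>TOm\<close> behaves like a cut between the standard and the non-standard labels.\<close>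

fun ch :: "ty \<Rightarrow> ty set" where
  "ch TRoot = {TW s | s. okl s}"
| "ch (TW s) = {TF i i (ext s i) | i. True}"
| "ch (TF i n x) = {TF i (Suc n) y | y. Q (Suc n) y \<and> y \<prec> x}"
| "ch (TG N m) = {TF 0 (Suc m) y | y. stdL y \<and> Q (Suc m) y} \<union> {y. y = TG N (Suc m) \<and> Suc m < N}"
| "ch TW' = {TF i i (ys i) | i. True}"
| "ch TRoot2 = insert TW' {TW s | s. okl s}"
| "ch TOm = {TF 0 2 z | z. stdL z}"
| "ch TRoot3 = insert TOm {TF 0 1 y | y. Q 1 y \<and> y \<prec> 0}"

sublocale tree_order lab ch colr
  by unfold_locales (rule surj_lab)

lemma okl_ext: "okl s \<Longrightarrow> Q i (ext s i)"
  unfolding okl_def ext_def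
  by (cases "i < length s") (auto intro: Q_mono[of "length s - 1"])

lemma okl_ext_Suc: "okl s \<Longrightarrow> ext s i \<preceq> ext s (Suc i)"
proof -
  assume s: "okl s"
  consider "Suc i < length s" | "Suc i = length s" | "length s \<le> i" by linarith
  then show ?thesis
  proof cases
    case 2
    then have "i = length s - 1" by simp
    then show ?thesis using 2 by (simp add: ext_def)
  qed (use s in \<open>auto simp: okl_def ext_def\<close>)
qed

lemma okl_ext_mono: "okl s \<Longrightarrow> i \<le> j \<Longrightarrow> ext s i \<preceq> ext s j"
proof (induction j)
  case (Suc j)
  then show ?case using okl_ext_Suc[of s j] le_trans' le_Suc_eq by metis
qed simp

primrec good :: "ty \<Rightarrow> bool" where
  "good TRoot = True" | "good (TW s) = okl s" | "good (TF i n x) = Q n x" | "good (TG N m) = False"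
| "good TW' = False" | "good TRoot2 = False" | "good TOm = False" | "good TRoot3 = False"

lemma good_ch: "good x \<Longrightarrow> y \<in> ch x \<Longrightarrow> good y"
  by (cases x) (auto intro: okl_ext)

lemma good_tp: "good \<rho> \<Longrightarrow> node \<rho> s \<Longrightarrow> good (tp \<rho> s)"
  by (induction s rule: rev_induct) (auto intro: good_ch)

section \<open>Types in the same orbit\<close>

definition lsim :: "nat \<Rightarrow> nat \<Rightarrow> bool" where
  "lsim x y \<longleftrightarrow> x = y \<or> \<not> stdL x \<and> \<not> stdL y"

lemma lsim_sym: "lsim x y \<Longrightarrow> lsim y x"
  by (auto simp: lsim_def)

inductive sim :: "ty \<Rightarrow> ty \<Rightarrow> bool" where
  sim_root: "sim TRoot TRoot"
| sim_W: "okl s \<Longrightarrow> okl s' \<Longrightarrow> (\<And>i. lsim (ext s i) (ext s' i)) \<Longrightarrow> sim (TW s) (TW s')"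
| sim_F: "Q n x \<Longrightarrow> Q n y \<Longrightarrow> lsim x y \<Longrightarrow> sim (TF i n x) (TF i n y)"

lemma sim_sym: "sim x y \<Longrightarrow> sim y x"
  by (induction rule: sim.induct) (auto intro: sim.intros lsim_sym)

lemma sim_colr: "sim x y \<Longrightarrow> colr x = colr y"
  by (induction rule: sim.induct) auto

text \<open>A family member may have a least non-standard label, but the next one has smaller ones:
  there is no least non-standard label, and \<open>Q_cofinal\<close> makes a smaller one
  admissible.\<close>

lemma sim_zig: "sim x y \<Longrightarrow> x' \<in> ch x \<Longrightarrow> \<exists>y'\<in>ch y. sim x' y'"
proof (induction rule: sim.induct)
  case sim_root
  then show ?case by (auto intro!: sim_W simp: lsim_def)
next
  case (sim_W s s')
  then show ?case by (auto intro!: sim_F intro: okl_ext)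
next
  case (sim_F n x y i)
  from sim_F(4) obtain z where z: "x' = TF i (Suc n) z" "Q (Suc n) z" "z \<prec> x" by auto
  have "\<exists>w. Q (Suc n) w \<and> w \<prec> y \<and> lsim z w"
  proof (cases "x = y \<or> stdL z")
    case True
    then have "z \<prec> y" using sim_F(3) z std_lt_nonstd by (auto simp: lsim_def)
    then show ?thesis using z by (auto simp: lsim_def)
  next
    case False
    then have "\<not> stdL y" using sim_F(3) by (auto simp: lsim_def)
    then obtain u where u: "u \<prec> y" "\<not> stdL u" using nonstd_below by blast
    obtain w where w: "Q (Suc n) w" "u \<preceq> w" "w \<prec> y" using Q_cofinal[OF sim_F(2) u(1)] by blast
    have "\<not> stdL w" using u w std_down by blast
    then show ?thesis using w False by (auto simp: lsim_def)
  qed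
  then show ?case using z by (auto intro: sim.sim_F)
qed

text \<open>The larger label has the child \<open>z\<close>, while all children \<open>w\<close> of
  \<open>z\<close> are smaller than \<open>z\<close>; by induction these are separated from
  \<open>z\<close> at \<open>osuc (rho w)\<close>, which is at most \<open>rho z\<close>.\<close>

lemma dist_label_lt: "stdL z \<Longrightarrow> z \<prec> y \<Longrightarrow> Q n z \<Longrightarrow> dist (osuc (rho z)) (TF i n z) (TF i n y)"
proof (induction z arbitrary: y n rule: accp_induct_rule)
  case (1 z)
  have std: "stdL z" using 1(1) .
  have "c2 < rho z" using rho_ge[OF std] less_osuc less_le_trans by blast
  then show ?case
  proof (rule dist_back[OF _ less_osuc])
    show "TF i (Suc n) z \<in> ch (TF i n y)" using 1(3,4) Q_mono[of n z "Suc n"] by simp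
    fix x' assume "x' \<in> ch (TF i n z)"
    then obtain w where w: "x' = TF i (Suc n) w" "Q (Suc n) w" "w \<prec> z" by auto
    have "dist (osuc (rho w)) x' (TF i (Suc n) z)" unfolding w(1) by (rule 1(2)[OF w(3,3,2)])
    then show "dist (rho z) x' (TF i (Suc n) z)"
      by (rule dist_mono) (rule osuc_le[OF rho_mono[OF std w(3)]])
  qed
qed

lemma dist_label:
  assumes z: "stdL z" "z \<noteq> y" "Q n z" "Q n y"
  shows "dist (osuc (rho z)) (TF i n z) (TF i n y)"
proof (cases "z \<prec> y")
  case False
  then have y: "y \<prec> z" using z(2) not_lt by metis
  have "dist (osuc (rho y)) (TF i n y) (TF i n z)"
    by (rule dist_label_lt[OF std_down[OF z(1) y] y z(4)])
  then show ?thesis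
    by (rule dist_mono[OF dist_sym]) (meson less_osuc osuc_le rho_mono[OF z(1) y] less_trans)
qed (rule dist_label_lt[OF z(1) _ z(3)])

lemma dist_label':
  assumes "\<not> lsim x y" "Q n x" "Q n y"
  shows "\<exists>z. stdL z \<and> Q n z \<and> dist (osuc (rho z)) (TF i n x) (TF i n y)"
proof (cases "stdL x")
  case True
  then show ?thesis using dist_label[of x y n i] assms by (auto simp: lsim_def)
next
  case False
  then show ?thesis using dist_sym[OF dist_label[of y x n i]] assms by (auto simp: lsim_def)
qed

lemma dist_colour_F: "i \<noteq> j \<Longrightarrow> stdL z \<Longrightarrow> dist (osuc (rho z)) (TF i n x) (TF j m y)"
  by (rule dist_colr, simp) (meson rho_ge less_osuc less_le_trans less_trans)

lemma dist_W:
  assumes z: "stdL z" and d: "dist (osuc (rho z)) (TF i i (ext s i)) (TF i i (f i))"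
    and ch: "ch y = {TF i i (f i) | i. True}"
  shows "dist (osuc (osuc (rho z))) (TW s) y"
proof (rule dist_forth[OF dist_gt[OF d] less_osuc])
  show "TF i i (ext s i) \<in> ch (TW s)" by auto
  fix y' assume "y' \<in> ch y"
  then obtain j where "y' = TF j j (f j)" unfolding ch by blast
  then show "dist (osuc (rho z)) (TF i i (ext s i)) y'"
    using d dist_colour_F[OF _ z] by (cases "i = j") auto
qed

text \<open>The bound may depend on \<open>s\<close> only. If the difference lies beyond
  \<open>s\<close> and the constant tail of \<open>s\<close> is standard, this tail is the witness.
  If the tail is non-standard, \<open>s'\<close> is standard there, so by monotonicity it is
  standard already at the last position of \<open>s\<close>, where the sequences differ as
  well.\<close>

lemma dist_W_W:
  assumes s: "okl s" "okl s'" and n: "\<not> (\<forall>i. lsim (ext s i) (ext s' i))"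
  shows "\<exists>z. stdL z \<and> Q (length s) z \<and> dist (osuc (osuc (rho z))) (TW s) (TW s')"
proof -
  obtain i where i: "\<not> lsim (ext s i) (ext s' i)" using n by blast
  define l where "l = length s - 1"
  have l: "Suc l = length s" using s(1) by (simp add: l_def okl_def)
  have const: "ext s j = ext s l" if "l \<le> j" for j
  proof (cases "j < length s")
    case True
    then have "j = l" using that l by simp
    then show ?thesis by simp
  qed (use l in \<open>simp add: ext_def l_def\<close>)
  have "\<exists>j z. stdL z \<and> Q (length s) z \<and> dist (osuc (rho z)) (TF j j (ext s j)) (TF j j (ext s' j))"
  proof (cases "i \<le> l")
    case True
    obtain z where z: "stdL z" "Q i z" "dist (osuc (rho z)) (TF i i (ext s i)) (TF i i (ext s' i))"
      using dist_label'[OF i okl_ext[OF s(1)] okl_ext[OF s(2)]] by blast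
    then have "Q (length s) z" using Q_mono[of i z] True l by simp
    then show ?thesis using z by blast
  next
    case False
    then have c: "ext s i = ext s l" using const[of i] by simp
    show ?thesis
    proof (cases "stdL (ext s i)")
      case True
      have "Q (length s) (ext s i)" using okl_ext[OF s(1), of l] Q_mono l c by (metis lessI less_imp_le)
      then show ?thesis
        using dist_label[OF True _ okl_ext[OF s(1)] okl_ext[OF s(2)]] i True by (metis lsim_def)
    next
      case f: False
      then have "stdL (ext s' i)" using i by (auto simp: lsim_def)
      then have st: "stdL (ext s' l)" using okl_ext_mono[OF s(2), of l i] False std_down by auto
      have "\<not> stdL (ext s l)" using f c by simp
      then have "ext s' l \<noteq> ext s l" using st by metis
      then have "dist (osuc (rho (ext s' l))) (TF l l (ext s l)) (TF l l (ext s' l))"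
        by (intro dist_sym[OF dist_label] st okl_ext s)
      moreover have "Q (length s) (ext s' l)" using okl_ext[OF s(2), of l] Q_mono l by (metis lessI less_imp_le)
      ultimately show ?thesis using st by blast
    qed
  qed
  then obtain j z where z: "stdL z" "Q (length s) z" "dist (osuc (rho z)) (TF j j (ext s j)) (TF j j (ext s' j))"
    by blast
  have "dist (osuc (osuc (rho z))) (TW s) (TW s')" by (rule dist_W[where f = "ext s'", OF z(1,3)]) simp
  then show ?thesis using z by blast
qed

text \<open>The index of a family member containing a label that separates the type from a sibling
  outside its orbit, as \<open>sim_child\<close> shows.\<close>

primrec lev :: "ty \<Rightarrow> nat" where
  "lev TRoot = 0" | "lev (TW s) = length s" | "lev (TF i n x) = n" | "lev (TG N m) = 0"
| "lev TW' = 0" | "lev TRoot2 = 0" | "lev TOm = 0" | "lev TRoot3 = 0"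

lemma sim_child:
  assumes xy: "sim x y" and x': "x' \<in> ch x" and y': "y' \<in> ch y" and col: "colr x' = colr y'" and n: "\<not> sim x' y'"
  shows "\<exists>z. stdL z \<and> Q (lev x') z \<and> dist (osuc (osuc (rho z))) x' y'"
  using xy
proof cases
  case sim_root
  then obtain s s' where s: "x' = TW s" "y' = TW s'" "okl s" "okl s'" using x' y' by auto
  then have "\<not> (\<forall>i. lsim (ext s i) (ext s' i))" using n by (auto intro: sim_W)
  from dist_W_W[OF s(3,4) this] show ?thesis using s by simp
next
  case (sim_W s s')
  then have False using x' y' col n by (auto intro!: sim_F intro: okl_ext)
  then show ?thesis ..
next
  case (sim_F n u v i)
  then obtain u' v' where u: "x' = TF i (Suc n) u'" "y' = TF i (Suc n) v'" "Q (Suc n) u'" "Q (Suc n) v'"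
    using x' y' by auto
  then have "\<not> lsim u' v'" using n by (auto intro: sim.sim_F)
  from dist_label'[OF this u(3,4), of i] obtain z where
    "stdL z" "Q (Suc n) z" "dist (osuc (rho z)) x' y'" using u by blast
  then show ?thesis using u dist_mono[OF _ less_imp_le[OF less_osuc]] by (intro exI[of _ z]) simp
qed

lemma good_sim: "good x \<Longrightarrow> sim x x"
  by (cases x) (auto intro: sim.intros simp: lsim_def)

text \<open>Induction along branches: matched children of similar parents are similar or separated
  at a rank that \<open>bound\<close> keeps below \<gamma>, and \<open>paths_dist\<close> excludes
  the latter.\<close>

lemma paths_sim:
  assumes \<rho>: "good \<rho>" and sub: "set a \<subseteq> dm \<rho>" "set b \<subseteq> dm \<rho>" and bt: "bt \<rho> \<rho> \<gamma> a b" "c3 < \<gamma>"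
    and bound: "\<And>x k z. x \<in> set a \<Longrightarrow> k \<le> length (nd x) \<Longrightarrow> stdL z \<Longrightarrow> Q (lev (tp \<rho> (take k (nd x)))) z \<Longrightarrow> osuc (osuc (rho z)) < \<gamma>"
  shows "typed \<rho> \<rho> (\<lambda>_. sim) (paths a b)"
proof -
  note pos = paths_pos(1)[OF bt(1) less_osuc bt(2) sub]
  have "sim (tp \<rho> s) (tp \<rho> u)" if "(s, u) \<in> paths a b" for s u
    using that
  proof (induction s arbitrary: u rule: rev_induct)
    case Nil
    then have "u = []" using pos_length[OF pos] by fastforce
    then show ?case using good_sim[OF \<rho>] by simp
  next
    case (snoc q s)
    from pos_snoc[OF pos snoc.prems] obtain v p where v: "u = v @ [p]" "(s, v) \<in> paths a b" by metis
    have parent: "sim (tp \<rho> s) (tp \<rho> v)" using snoc.IH v(2) .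
    have ch: "tp \<rho> (s @ [q]) \<in> ch (tp \<rho> s)" "tp \<rho> (v @ [p]) \<in> ch (tp \<rho> v)"
      using pos_node[OF pos snoc.prems] v(1) by auto
    have no: "\<not> dist \<delta> (tp \<rho> (s @ [q])) (tp \<rho> (v @ [p]))" if "\<delta> < \<gamma>" for \<delta>
      using paths_dist[OF bt(1) _ that sub] snoc.prems v(1) by blast
    have col: "colr (tp \<rho> (s @ [q])) = colr (tp \<rho> (v @ [p]))"
      using no[OF bt(2)] dist_colr[OF _ less_osuc] by blast
    show ?case
    proof (rule ccontr)
      assume "\<not> sim (tp \<rho> (s @ [q])) (tp \<rho> u)"
      then obtain z where z: "stdL z" "Q (lev (tp \<rho> (s @ [q]))) z" "dist (osuc (osuc (rho z))) (tp \<rho> (s @ [q])) (tp \<rho> (v @ [p]))"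
        using sim_child[OF parent ch col] v(1) by blast
      obtain i k where ik: "i < length a" "k \<le> length (nd (a ! i))" "s @ [q] = take k (nd (a ! i))"
        using snoc.prems by (auto simp: paths_def)
      have "osuc (osuc (rho z)) < \<gamma>"
        by (rule bound[of "a ! i" k]) (use ik z(1,2) in auto)
      then show False using no z(3) by blast
    qed
  qed
  then show ?thesis by blast
qed

text \<open>Once the position is typed by the bisimulation \<open>sim\<close>, the next element can
  be matched at every rank; hence \<beta> is arbitrary in the conclusion.\<close>

lemma bt_bf_extends:
  assumes \<rho>: "good \<rho>" and sub: "set a \<subseteq> dm \<rho>" "set b \<subseteq> dm \<rho>" and bt: "bt \<rho> \<rho> \<gamma> a b" "c3 < \<gamma>"
    and bound: "\<And>x k z. x \<in> set a \<Longrightarrow> k \<le> length (nd x) \<Longrightarrow> stdL z \<Longrightarrow> Q (lev (tp \<rho> (take k (nd x)))) z \<Longrightarrow> osuc (osuc (rho z)) < \<gamma>"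
  shows "bf_extends (dm \<rho>) (od \<rho>) \<beta> (dm \<rho>) (od \<rho>) a b"
proof -
  note pos = paths_pos[OF bt(1) less_osuc bt(2) sub]
  have typed: "typed \<rho> \<rho> (\<lambda>_. sim) (paths a b)" by (rule paths_sim[OF \<rho> sub bt bound])
  have zag: "\<exists>x'\<in>ch x. sim x' y'" if "sim x y" "y' \<in> ch y" for x y y'
    using sim_zig[OF sim_sym[OF that(1)] that(2)] sim_sym by blast
  have 1: "\<exists>d\<in>dm \<rho>. bt \<rho> \<rho> (\<beta> (a @ [c])) (a @ [c]) (b @ [d])" if "c \<in> dm \<rho>" for c
    by (rule zigzag_extend[OF sim_zig zag sim_colr pos(1) typed pos(2) that])
  have typed': "typed \<rho> \<rho> (\<lambda>_. sim) ((paths a b)\<inverse>)" using typed sim_sym by blast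
  have "\<exists>c\<in>dm \<rho>. bt \<rho> \<rho> (\<beta> (a @ [c])) (a @ [c]) (b @ [d])" if d: "d \<in> dm \<rho>" for d
  proof -
    have "\<exists>F' e. (paths a b)\<inverse> \<subseteq> F' \<and> pos \<rho> \<rho> F' \<and> typed \<rho> \<rho> (\<lambda>_. sim) F' \<and> rell \<rho> \<rho> F' [d] e"
      by (rule extend_list[OF pos_sym[OF pos(1)] typed', where N = "length (nd d)"]) (use d sim_zig sim_colr in auto)
    then obtain F' e where F': "(paths a b)\<inverse> \<subseteq> F'" "pos \<rho> \<rho> F'" "typed \<rho> \<rho> (\<lambda>_. sim) F'" "rell \<rho> \<rho> F' [d] e" by blast
    from F'(4) obtain c where c: "e = [c]" by (auto simp: list_all2_Cons1)
    have "rell \<rho> \<rho> F' (b @ [d]) (a @ [c])"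
      using rell_mono[OF rell_sym[OF pos(2)] F'(1)] F'(4) c by (intro list_all2_appendI) auto
    then have "bt \<rho> \<rho> (\<beta> (a @ [c])) (b @ [d]) (a @ [c])"
      by (intro game[where \<Gamma> = "\<beta> (a @ [c])" and E = "\<lambda>_ _. sim" and F = F']) (use sim_zig zag sim_colr F' in blast)+
    then have "bt \<rho> \<rho> (\<beta> (a @ [c])) (a @ [c]) (b @ [d])" by (rule bt_sym)
    moreover have "c \<in> dm \<rho>" using rell_dm[OF F'(4)] c by simp
    ultimately show ?thesis by blast
  qed
  with 1 show ?thesis by (simp add: bf_extends_def)
qed

section \<open>Types that are close\<close>

definition near :: "nat \<Rightarrow> nat \<Rightarrow> nat \<Rightarrow> bool" where
  "near c x y \<longleftrightarrow> x = y \<or> c \<preceq> x \<and> c \<preceq> y"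

lemma near_sym: "near c x y \<Longrightarrow> near c y x"
  by (auto simp: near_def)

lemma near_refl [simp]: "near c x x"
  by (simp add: near_def)

lemma near_down: "near c x y \<Longrightarrow> c' \<prec> c \<Longrightarrow> near c' x y"
  unfolding near_def using lt_le_trans by blast

definition ys_ok :: bool where
  "ys_ok \<longleftrightarrow> (\<forall>i. Q i (ys i) \<and> stdL (ys i)) \<and> (\<forall>i j. i \<le> j \<longrightarrow> ys i \<preceq> ys j) \<and> (\<forall>c. stdL c \<longrightarrow> (\<exists>i. c \<prec> ys i))"

definition full :: bool where "full \<longleftrightarrow> (\<forall>n x. Q n x)"

text \<open>\<open>c\<close> is the resolution: labels at or above it are not told apart, and each
  step down the tree lowers it. In \<open>close_G\<close> the standard label \<open>d\<close>
  replaces, at level \<open>N\<close>, the non-standard children that are missing there.\<close>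

inductive close :: "nat \<Rightarrow> ty \<Rightarrow> ty \<Rightarrow> bool" for c where
  close_F: "Q n x \<Longrightarrow> Q n y \<Longrightarrow> near c x y \<Longrightarrow> close c (TF i n x) (TF i n y)"
| close_G: "Q m x \<Longrightarrow> \<not> stdL x \<Longrightarrow> m < N \<Longrightarrow> stdL d \<Longrightarrow> c \<preceq> d \<Longrightarrow> Q N d \<Longrightarrow> close c (TF 0 m x) (TG N m)"
| close_root: "close c TRoot TRoot"
| close_W: "okl s \<Longrightarrow> okl s' \<Longrightarrow> (\<And>i. near c (ext s i) (ext s' i)) \<Longrightarrow> close c (TW s) (TW s')"
| close_W': "okl s \<Longrightarrow> ys_ok \<Longrightarrow> (\<And>i. near c (ext s i) (ys i)) \<Longrightarrow> close c (TW s) TW'"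
| close_root2: "ys_ok \<Longrightarrow> close c TRoot TRoot2"
| close_Om: "full \<Longrightarrow> c \<preceq> x \<Longrightarrow> close c (TF 0 1 x) TOm"
| close_root3: "full \<Longrightarrow> close c (TF 0 0 0) TRoot3"

lemma close_colr: "close c x y \<Longrightarrow> colr x = colr y"
  by (induction rule: close.induct) auto

lemma close_down: "close c x y \<Longrightarrow> c' \<prec> c \<Longrightarrow> close c' x y"
proof (induction rule: close.induct)
  case (close_G m x N d)
  then have "c' \<preceq> d" using lt_le_trans by blast
  then show ?case using close_G by (intro close.close_G) auto
next
  case (close_Om x)
  then have "c' \<preceq> x" using lt_le_trans by blast
  then show ?case using close_Om by (intro close.close_Om) auto
qed (auto intro: close.intros near_down)

lemma good_close: "good x \<Longrightarrow> close c x x"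
  by (cases x) (auto intro: close.intros)

lemma close_same: "x' \<in> ch x \<Longrightarrow> x' \<in> ch y \<Longrightarrow> good x \<Longrightarrow> \<exists>y'\<in>ch y. close c' x' y'"
  and close_same': "x' \<in> ch x \<Longrightarrow> x' \<in> ch y \<Longrightarrow> good y \<Longrightarrow> \<exists>y'\<in>ch y. close c' y' x'"
  using good_ch good_close by blast+

text \<open>Unless the labels are equal, both exceed \<open>c'\<close>. So children below
  \<open>c'\<close> are kept, and any other child is answered by an admissible label between
  \<open>c'\<close> and \<open>y\<close>, supplied by \<open>Q_cofinal\<close>.\<close>

lemma near_zig:
  assumes near: "near c x y" and y: "Q n y" and z: "Q (Suc n) z" "z \<prec> x" and c': "c' \<prec> c"
  shows "\<exists>w. Q (Suc n) w \<and> w \<prec> y \<and> near c' z w"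
proof (cases "x = y")
  case True
  then show ?thesis using z by (auto simp: near_def)
next
  case False
  then have cy: "c \<preceq> y" using near by (auto simp: near_def)
  show ?thesis
  proof (cases "z \<prec> c'")
    case True
    then have "z \<prec> y" using c' cy lt_trans lt_le_trans by blast
    then show ?thesis using z by auto
  next
    case False
    then have "c' \<preceq> z" using not_lt by blast
    moreover obtain w where "Q (Suc n) w" "c' \<preceq> w" "w \<prec> y" using Q_cofinal[OF y lt_le_trans[OF c' cy]] by blast
    ultimately show ?thesis by (auto simp: near_def)
  qed
qed

lemma close_zig:
  assumes "close c x y" and x': "x' \<in> ch x" and c: "stdL c" and c': "c' \<prec> c"
  shows "\<exists>y'\<in>ch y. close c' x' y'"
  using assms(1)
proof cases
  case (close_F n u v i)
  obtain z where z: "x' = TF i (Suc n) z" "Q (Suc n) z" "z \<prec> u" using x' close_F by auto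
  obtain w where "Q (Suc n) w" "w \<prec> v" "near c' z w" using near_zig[OF close_F(5,4) z(2,3) c'] by blast
  then show ?thesis using z close_F by (auto intro: close.close_F)
next
  case (close_G m u N d)
  obtain z where z: "x' = TF 0 (Suc m) z" "Q (Suc m) z" "z \<prec> u" using x' close_G by auto
  have c'd: "c' \<preceq> d" using c' close_G(7) lt_le_trans by blast
  show ?thesis
  proof (cases "stdL z")
    case True
    then show ?thesis using z close_G by (intro close_same[OF x']) auto
  next
    case False
    show ?thesis
    proof (cases "Suc m < N")
      case True
      then have "close c' x' (TG N (Suc m))" using z False close_G c'd by (auto intro: close.close_G)
      then show ?thesis using True close_G by auto
    next
      case Nm: False
      \<comment> \<open>The last level of the imitation: \<open>TG\<close> has no child of its own
        kind here, so the non-standard \<open>z\<close> is answered by \<open>d\<close>.\<close>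
      then have N: "N = Suc m" using close_G by simp
      have "c' \<prec> z" using False std_lt_nonstd std_down[OF c c'] by blast
      then have "near c' z d" using c'd by (auto simp: near_def)
      then have "close c' x' (TF 0 (Suc m) d)" unfolding z(1) using z(2) close_G N by (intro close.close_F) auto
      then show ?thesis using close_G N by auto
    qed
  qed
next
  case close_root
  then show ?thesis using x' by (intro close_same[OF x']) auto
next
  case (close_W s s')
  then obtain i where i: "x' = TF i i (ext s i)" using x' by auto
  have "close c' x' (TF i i (ext s' i))"
    unfolding i by (intro close.close_F okl_ext close_W near_down[OF _ c'])
  then show ?thesis using close_W by auto
next
  case (close_W' s)
  then obtain i where i: "x' = TF i i (ext s i)" using x' by auto
  have "Q i (ys i)" using close_W' by (simp add: ys_ok_def)
  then have "close c' x' (TF i i (ys i))"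
    unfolding i by (intro close.close_F okl_ext close_W' near_down[OF _ c'])
  then show ?thesis using close_W' by auto
next
  case close_root2
  then show ?thesis using x' by (intro close_same[OF x']) auto
next
  case (close_Om u)
  obtain z where z: "x' = TF 0 2 z" "z \<prec> u" using x' close_Om by (auto simp: numeral_2_eq_2)
  have q: "Q 2 w" for w using close_Om by (simp add: full_def)
  show ?thesis
  proof (cases "stdL z")
    case True
    moreover have "Q 1 u" using close_Om by (simp add: full_def)
    ultimately show ?thesis using z close_Om q by (intro close_same[OF x']) auto
  next
    case False
    \<comment> \<open>A non-standard child is answered by the standard label \<open>c'\<close>
      itself.\<close>
    have s': "stdL c'" using std_down[OF c c'] .
    then have "near c' z c'" using False std_lt_nonstd by (auto simp: near_def)
    then have "close c' x' (TF 0 2 c')" unfolding z(1) by (intro close.close_F q)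
    then show ?thesis using s' close_Om by auto
  qed
next
  case close_root3
  then show ?thesis using x' by (intro close_same[OF x']) auto
qed

lemma close_zag:
  assumes "close c x y" and y': "y' \<in> ch y" and c: "stdL c" and c': "c' \<prec> c"
  shows "\<exists>x'\<in>ch x. close c' x' y'"
  using assms(1)
proof cases
  case (close_F n u v i)
  obtain z where z: "y' = TF i (Suc n) z" "Q (Suc n) z" "z \<prec> v" using y' close_F by auto
  obtain w where "Q (Suc n) w" "w \<prec> u" "near c' z w" using near_zig[OF near_sym[OF close_F(5)] close_F(3) z(2,3) c'] by blast
  then show ?thesis using z close_F by (auto intro: close.close_F near_sym)
next
  case (close_G m u N d)
  from y' consider z where "y' = TF 0 (Suc m) z" "stdL z" "Q (Suc m) z" | "y' = TG N (Suc m)" "Suc m < N"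
    using close_G by auto
  then show ?thesis
  proof cases
    case 1
    then have "z \<prec> u" using std_lt_nonstd close_G by blast
    then show ?thesis using 1 close_G by (intro close_same'[OF y']) auto
  next
    case 2
    obtain w where w: "w \<prec> u" "\<not> stdL w" using nonstd_below close_G by blast
    obtain z where z: "Q (Suc m) z" "w \<preceq> z" "z \<prec> u" using Q_cofinal[OF close_G(3) w(1)] by blast
    have "\<not> stdL z" using w z std_down by blast
    moreover have "c' \<preceq> d" using c' close_G(7) lt_le_trans by blast
    ultimately have "close c' (TF 0 (Suc m) z) y'" unfolding 2(1) using z 2(2) close_G by (intro close.close_G) auto
    then show ?thesis using z close_G by auto
  qed
next
  case close_root
  then show ?thesis using y' by (intro close_same'[OF y']) auto
next
  case (close_W s s')
  then obtain i where i: "y' = TF i i (ext s' i)" using y' by auto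
  have "close c' (TF i i (ext s i)) y'"
    unfolding i by (intro close.close_F okl_ext close_W near_down[OF _ c'])
  then show ?thesis using close_W by auto
next
  case (close_W' s)
  then obtain i where i: "y' = TF i i (ys i)" using y' by auto
  have "Q i (ys i)" using close_W' by (simp add: ys_ok_def)
  then have "close c' (TF i i (ext s i)) y'"
    unfolding i by (intro close.close_F okl_ext close_W' near_down[OF _ c'])
  then show ?thesis using close_W' by auto
next
  case close_root2
  show ?thesis
  proof (cases "y' = TW'")
    case True
    obtain m where m: "c' \<prec> ys m" using close_root2 std_down[OF c c'] by (auto simp: ys_ok_def)
    \<comment> \<open>The sequence \<open>ys\<close> is frozen once it has passed \<open>c'\<close>;
      the later values of both sequences are above the resolution.\<close>
    let ?s = "map ys [0..<Suc m]"
    have e: "ext ?s i = (if i \<le> m then ys i else ys m)" for i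
      by (auto simp: ext_def nth_append simp del: upt_Suc)
    have ok: "okl ?s" using close_root2 by (auto simp: okl_def ys_ok_def simp del: upt_Suc)
    have "near c' (ext ?s i) (ys i)" for i
    proof (cases "i \<le> m")
      case False
      then have "ys m \<preceq> ys i" using close_root2 by (simp add: ys_ok_def)
      then have "c' \<prec> ys i" using m lt_le_trans by blast
      then show ?thesis using m False by (simp add: e near_def del: upt_Suc)
    qed (simp add: e del: upt_Suc)
    then have "close c' (TW ?s) y'" unfolding True using ok close_root2 by (intro close.close_W') auto
    then show ?thesis using ok close_root2 by auto
  next
    case False
    then show ?thesis using y' close_root2 by (intro close_same'[OF y']) auto
  qed
next
  case (close_Om u)
  obtain z where z: "y' = TF 0 2 z" "stdL z" using y' close_Om by auto
  have q: "Q n w" for n w using close_Om by (simp add: full_def)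
  show ?thesis
  proof (cases "z \<prec> u")
    case True
    then show ?thesis using z close_Om q by (intro close_same'[OF y']) (auto simp: numeral_2_eq_2)
  next
    case False
    then have "c' \<prec> z" using c' close_Om(4) not_lt le_trans' lt_le_trans by metis
    then have "near c' c' z" by (simp add: near_def)
    then have "close c' (TF 0 2 c') y'" unfolding z(1) by (intro close.close_F q)
    moreover have "c' \<prec> u" using c' close_Om(4) lt_le_trans by blast
    ultimately show ?thesis using close_Om q by (auto simp: numeral_2_eq_2)
  qed
next
  case close_root3
  show ?thesis
  proof (cases "y' = TOm")
    case True
    have "c' \<noteq> 0" using std_down[OF c c'] nonstd_0 by metis
    then obtain w where "Q 1 w" "c' \<preceq> w" "w \<prec> 0" using Q_cofinal[OF Q_top, of c' 0] lt_0 by auto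
    moreover from this have "close c' (TF 0 1 w) y'" unfolding True using close_root3 by (intro close.close_Om) auto
    ultimately show ?thesis using close_root3 by (intro bexI[of _ "TF 0 1 w"]) auto
  next
    case False
    then show ?thesis using y' close_root3 by (intro close_same'[OF y']) auto
  qed
qed

text \<open>The resolution \<open>t \<gamma> n\<close> pays for moves with \<gamma> and for steps
  down the tree with \<open>n\<close>. All these labels are standard, so rank \<open>lam\<close> is
  reached.\<close>

lemma close_game:
  assumes "\<gamma> \<le> lam" "pos \<rho> \<rho>' F" "\<And>\<delta> n. \<delta> < \<gamma> \<Longrightarrow> typed \<rho> \<rho>' (\<lambda>_. close (t \<delta> n)) F" "rell \<rho> \<rho>' F a b"
  shows "bt \<rho> \<rho>' \<gamma> a b"
proof (rule game[where \<Gamma> = lam and E = "\<lambda>\<gamma> n. close (t \<gamma> n)", OF _ _ _ _ _ assms])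
  show "\<delta> < \<gamma> \<Longrightarrow> \<gamma> < lam \<Longrightarrow> close (t \<gamma> 0) x y \<Longrightarrow> close (t \<delta> n) x y" for \<delta> \<gamma> n x y
    using close_down t_mono by blast
  show "close (t \<gamma> (Suc n)) x y \<Longrightarrow> close (t \<gamma> n) x y" for \<gamma> n x y
    using close_down t_mono2 by blast
  show "\<gamma> < lam \<Longrightarrow> close (t \<gamma> (Suc n)) x y \<Longrightarrow> x' \<in> ch x \<Longrightarrow> \<exists>y'\<in>ch y. close (t \<gamma> n) x' y'" for \<gamma> n x y x'
    using close_zig std_t t_mono2 by blast
  show "\<gamma> < lam \<Longrightarrow> close (t \<gamma> (Suc n)) x y \<Longrightarrow> y' \<in> ch y \<Longrightarrow> \<exists>x'\<in>ch x. close (t \<gamma> n) x' y'" for \<gamma> n x y y'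
    using close_zag std_t t_mono2 by blast
  show "close (t \<gamma> n) x y \<Longrightarrow> colr x = colr y" for \<gamma> n x y
    by (rule close_colr)
qed

section \<open>Non-isomorphic structures\<close>

lemma c2_less_lam: "c2 < lam"
  using c3_less less_osuc less_trans by blast

lemma lam_osuc_rho: "stdL z \<Longrightarrow> osuc (rho z) < lam"
  using lam_limit rho_less by blast

lemma ex_nonstd_Q: "Q m x \<Longrightarrow> \<not> stdL x \<Longrightarrow> \<exists>y. Q (Suc m) y \<and> y \<prec> x \<and> \<not> stdL y"
proof -
  assume x: "Q m x" "\<not> stdL x"
  obtain w where w: "w \<prec> x" "\<not> stdL w" using nonstd_below x by blast
  obtain z where z: "Q (Suc m) z" "w \<preceq> z" "z \<prec> x" using Q_cofinal[OF x(1) w(1)] by blast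
  then show ?thesis using w std_down by blast
qed

lemma dist_nonstd: "stdL z \<Longrightarrow> \<not> stdL x \<Longrightarrow> Q n z \<Longrightarrow> Q n x \<Longrightarrow> dist lam (TF i n x) (TF i n z)"
  using dist_sym[OF dist_mono[OF dist_label[of z x n i]]] lam_osuc_rho[of z] by (metis less_imp_le)

text \<open>A non-standard label has non-standard children at every level, and \<open>TG\<close>
  imitates this only down to level \<open>N - 1\<close>; the induction is on the distance to that
  level.\<close>

lemma dist_G: "Q m x \<Longrightarrow> \<not> stdL x \<Longrightarrow> m < N \<Longrightarrow> \<exists>\<gamma>. dist \<gamma> (TF 0 m x) (TG N m)"
proof (induction "N - Suc m" arbitrary: m x)
  case 0
  obtain y where y: "Q (Suc m) y" "y \<prec> x" "\<not> stdL y" using ex_nonstd_Q 0 by blast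
  have "dist (osuc lam) (TF 0 m x) (TG N m)"
    by (rule dist_forth[OF c2_less_lam less_osuc, of "TF 0 (Suc m) y"]) (use y 0 dist_nonstd in auto)
  then show ?case by blast
next
  case (Suc k)
  obtain y where y: "Q (Suc m) y" "y \<prec> x" "\<not> stdL y" using ex_nonstd_Q Suc by blast
  have k: "k = N - Suc (Suc m)" "Suc m < N" using Suc(2) by auto
  obtain \<gamma> where \<gamma>: "dist \<gamma> (TF 0 (Suc m) y) (TG N (Suc m))" using Suc(1)[OF k(1) y(1,3) k(2)] by blast
  let ?\<gamma> = "max lam \<gamma>"
  have "dist (osuc ?\<gamma>) (TF 0 m x) (TG N m)"
  proof (rule dist_forth[OF _ less_osuc])
    show "c2 < ?\<gamma>" using c2_less_lam by (simp add: less_max_iff_disj)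
    show "TF 0 (Suc m) y \<in> ch (TF 0 m x)" using y by simp
    fix y' assume "y' \<in> ch (TG N m)"
    then show "dist ?\<gamma> (TF 0 (Suc m) y) y'"
      using y dist_mono[OF \<gamma>, of ?\<gamma>] dist_mono[OF dist_nonstd, of _ y "Suc m" ?\<gamma> 0] by auto
  qed
  then show ?case by blast
qed

text \<open>\<open>ys\<close> overtakes every standard tail, while a sequence with non-standard tail
  differs from it at the last position, since all values of \<open>ys\<close> are standard.\<close>

lemma dist_root2: "ys_ok \<Longrightarrow> dist (osuc lam) TRoot TRoot2"
proof (rule dist_back[OF c2_less_lam less_osuc])
  assume ys: "ys_ok"
  show "TW' \<in> ch TRoot2" by simp
  fix x' assume "x' \<in> ch TRoot"
  then obtain s where s: "x' = TW s" "okl s" by auto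
  have Qy: "Q i (ys i)" "stdL (ys i)" for i using ys by (auto simp: ys_ok_def)
  define l where "l = length s - 1"
  have "\<exists>i. \<not> lsim (ext s i) (ys i)"
  proof (cases "stdL (ext s l)")
    case True
    then obtain i where i: "ext s l \<prec> ys i" using ys by (auto simp: ys_ok_def)
    have "ys i \<preceq> ys (max i (length s))" using ys by (simp add: ys_ok_def)
    then have "ext s l \<prec> ys (max i (length s))" using i lt_le_trans by blast
    moreover have "ext s (max i (length s)) = ext s l" using s by (simp add: ext_def l_def okl_def)
    ultimately show ?thesis using Qy by (intro exI[of _ "max i (length s)"]) (auto simp: lsim_def)
  next
    case False
    then show ?thesis using Qy by (intro exI[of _ l]) (auto simp: lsim_def)
  qed
  then obtain i where "\<not> lsim (ext s i) (ys i)" by blast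
  from dist_label'[OF this okl_ext[OF s(2)] Qy(1)] obtain z where
    z: "stdL z" "dist (osuc (rho z)) (TF i i (ext s i)) (TF i i (ys i))" by blast
  have "dist (osuc (osuc (rho z))) x' TW'" unfolding s(1) by (rule dist_W[where f = ys, OF z]) simp
  then show "dist lam x' TW'" by (rule dist_mono) (rule less_imp_le[OF lam_limit[OF lam_osuc_rho[OF z(1)]]])
qed

text \<open>A standard \<open>x\<close> is a label of a child of \<open>TOm\<close> but not of a
  child of \<open>x\<close>; a non-standard \<open>x\<close> has a non-standard child, and
  \<open>TOm\<close> has none.\<close>

lemma dist_Om:
  assumes full: full
  shows "dist (osuc lam) (TF 0 1 x) TOm"
proof (cases "stdL x")
  case True
  have q: "Q n y" for n y using full by (simp add: full_def)
  have "dist lam (TF 0 1 x) TOm"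
  proof (rule dist_back[of "osuc (rho x)"])
    show "c2 < osuc (rho x)" using rho_ge[OF True] less_osuc less_le_trans less_trans by metis
    show "osuc (rho x) < lam" by (rule lam_osuc_rho[OF True])
    show "TF 0 2 x \<in> ch TOm" using True by simp
    fix x' assume "x' \<in> ch (TF 0 1 x)"
    then obtain w where w: "x' = TF 0 2 w" "w \<prec> x" by (auto simp: numeral_2_eq_2)
    then have "x \<noteq> w" by auto
    then show "dist (osuc (rho x)) x' (TF 0 2 x)" unfolding w(1) by (intro dist_sym[OF dist_label] True q)
  qed
  then show ?thesis by (rule dist_mono) (rule less_imp_le[OF less_osuc])
next
  case False
  have q: "Q n y" for n y using full by (simp add: full_def)
  obtain y where y: "y \<prec> x" "\<not> stdL y" using nonstd_below False by blast
  show ?thesis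
  proof (rule dist_forth[OF c2_less_lam less_osuc])
    show "TF 0 2 y \<in> ch (TF 0 1 x)" using y q by (simp add: numeral_2_eq_2)
    fix y' assume "y' \<in> ch TOm"
    then show "dist lam (TF 0 2 y) y'" using dist_nonstd[OF _ y(2) q q] by auto
  qed
qed

lemma dist_root3: "full \<Longrightarrow> dist (osuc (osuc lam)) (TF 0 0 0) TRoot3"
proof (rule dist_back[OF _ less_osuc])
  assume full
  show "c2 < osuc lam" using c2_less_lam less_osuc by (rule less_trans)
  show "TOm \<in> ch TRoot3" by simp
  fix x' assume "x' \<in> ch (TF 0 0 0)"
  then obtain x where "x' = TF 0 1 x" by auto
  then show "dist (osuc lam) x' TOm" using dist_Om[OF \<open>full\<close>] by simp
qed

end

section \<open>Computability\<close>

lemma dec_ql [cmp_intro]: "cmp f \<Longrightarrow> cmp g \<Longrightarrow> dec (\<lambda>x. ql (f x) (g x))"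
  unfolding ql_def numer_def by (intro cmp_intro)

lemma cmp_cl [cmp_intro]: "cmp f \<Longrightarrow> cmp (\<lambda>x. cl (f x))"
  unfolding cl_def by (intro cmp_intro)

lemma sless_nth:
  "sless s u \<longleftrightarrow> (length s < length u \<and> (\<forall>i<length s. s ! i = u ! i)) \<or>
    (\<exists>k<length s. k < length u \<and> (\<forall>i<k. s ! i = u ! i) \<and> ql (s ! k) (u ! k))"
proof -
  have take: "take k s = take k u \<longleftrightarrow> (\<forall>i<k. s ! i = u ! i)" if "k \<le> length s" "k \<le> length u" for k
    using that by (auto simp: list_eq_iff_nth_eq)
  have "length s < length u \<and> take (length s) u = s \<longleftrightarrow> length s < length u \<and> (\<forall>i<length s. s ! i = u ! i)"
    using take[of "length s"] by auto
  then show ?thesis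
    unfolding sless_def lexord_take_index_conv using take by (auto simp: less_imp_le)
qed

definition sless_code :: "nat \<Rightarrow> nat \<Rightarrow> bool" where
  "sless_code m n \<longleftrightarrow> (len m < len n \<and> (\<forall>i<len m. sel m i = sel n i)) \<or>
    (\<exists>k<len m. k < len n \<and> (\<forall>i<k. sel m i = sel n i) \<and> ql (sel m k) (sel n k))"

lemma sless_code: "sless_code m n \<longleftrightarrow> sless (list_decode m) (list_decode n)"
  unfolding sless_code_def sless_nth len_def by (auto simp: sel_decode)

lemma dec_sless_code [cmp_intro]: "cmp f \<Longrightarrow> cmp g \<Longrightarrow> dec (\<lambda>x. sless_code (f x) (g x))"
proof -
  assume fg: "cmp f" "cmp g"
  have "dec (\<lambda>z. sless_code (p1 z) (p2 z))" unfolding sless_code_def by (intro cmp_intro)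
  then show ?thesis using fg by (rule dec_comp2[where P = sless_code])
qed

lemma pairs_snoc:
  "(\<forall>i. Suc i < length (s @ [q]) \<longrightarrow> P ((s @ [q]) ! i) ((s @ [q]) ! Suc i)) \<longleftrightarrow>
    (\<forall>i. Suc i < length s \<longrightarrow> P (s ! i) (s ! Suc i)) \<and> (s \<noteq> [] \<longrightarrow> P (last s) q)"
proof (cases s rule: rev_cases)
  case (snoc u p)
  then show ?thesis by (auto simp: nth_append less_Suc_eq)
qed simp

context labelled
begin

lemma dec_Q' [cmp_intro]: "cmp f \<Longrightarrow> cmp g \<Longrightarrow> dec (\<lambda>x. Q (f x) (g x))"
  by (rule dec_comp2[where P = Q, OF dec_Q])

definition okl_code :: "nat \<Rightarrow> bool" where
  "okl_code e \<longleftrightarrow> 0 < len e \<and> (\<forall>i<len e. Q i (sel e i)) \<and>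
    (\<forall>i<len e. Suc i < len e \<longrightarrow> sel e i = sel e (Suc i) \<or> sel e i \<prec> sel e (Suc i))"

lemma okl_code: "okl_code e \<longleftrightarrow> okl (list_decode e)"
proof -
  have *: "(\<forall>i<n. Suc i < n \<longrightarrow> P i) \<longleftrightarrow> (\<forall>i. Suc i < n \<longrightarrow> P i)" for P and n :: nat
    using Suc_lessD by blast
  show ?thesis unfolding okl_code_def okl_def len_def * by (auto simp: sel_decode Suc_lessD)
qed

lemma dec_okl_code: "dec okl_code"
  unfolding okl_code_def by (intro cmp_intro)

definition ext_code :: "nat \<Rightarrow> nat \<Rightarrow> nat" where
  "ext_code e i = (if i < len e then sel e i else sel e (len e - 1))"

lemma ext_code: "okl (list_decode e) \<Longrightarrow> ext_code e i = ext (list_decode e) i"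
  unfolding ext_code_def ext_def len_def okl_def by (simp add: sel_decode)

lemma cmp_ext_code [cmp_intro]: "cmp f \<Longrightarrow> cmp g \<Longrightarrow> cmp (\<lambda>x. ext_code (f x) (g x))"
  unfolding ext_code_def by (intro cmp_intro)

text \<open>The tags 0 and 1 are those of \<open>TW\<close> and \<open>TF\<close> in
  \<open>lab\<close>; by \<open>good_code\<close> these are the only types that occur below a good
  root.\<close>

definition child_code :: "nat \<Rightarrow> nat \<Rightarrow> bool" where
  "child_code c c' \<longleftrightarrow> p1 c' = 1 \<and>
    (p1 c = 0 \<and> p1 (p2 c') = p1 (p2 (p2 c')) \<and> p2 (p2 (p2 c')) = ext_code (p2 c) (p1 (p2 c')) \<or>
     p1 c = 1 \<and> p1 (p2 c') = p1 (p2 c) \<and> p1 (p2 (p2 c')) = Suc (p1 (p2 (p2 c))) \<and>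
      Q (p1 (p2 (p2 c'))) (p2 (p2 (p2 c'))) \<and> p2 (p2 (p2 c')) \<prec> p2 (p2 (p2 c)))"

lemma dec_child_code [cmp_intro]: "cmp f \<Longrightarrow> cmp g \<Longrightarrow> dec (\<lambda>x. child_code (f x) (g x))"
  unfolding child_code_def by (intro cmp_intro)

lemma lab_0: "p1 c = 0 \<Longrightarrow> lab c = TW (list_decode (p2 c))"
  and lab_1: "p1 c = 1 \<Longrightarrow> lab c = TF (p1 (p2 c)) (p1 (p2 (p2 c))) (p2 (p2 (p2 c)))"
  by (simp_all add: lab.simps Let_def)

lemma lab_TW: "lab c = TW s \<longleftrightarrow> p1 c = 0 \<and> list_decode (p2 c) = s"
  by (auto simp: lab.simps Let_def split: if_splits)

lemma lab_TF: "lab c = TF i n x \<longleftrightarrow> p1 c = 1 \<and> p1 (p2 c) = i \<and> p1 (p2 (p2 c)) = n \<and> p2 (p2 (p2 c)) = x"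
  by (auto simp: lab.simps Let_def split: if_splits)

lemma child_code:
  assumes "good (lab c)" "p1 c \<le> 1"
  shows "child_code c c' \<longleftrightarrow> lab c' \<in> ch (lab c)"
proof -
  consider "p1 c = 0" | "p1 c = 1" using assms(2) by linarith
  then show ?thesis
  proof cases
    case 1
    then have "okl (list_decode (p2 c))" using assms(1) lab_0[OF 1] by simp
    then show ?thesis using 1 by (auto simp: lab_0 child_code_def lab_TF ext_code)
  next
    case 2
    then show ?thesis by (auto simp: lab_1 child_code_def lab_TF)
  qed
qed

lemma good_code: "good x \<Longrightarrow> lab c \<in> ch x \<Longrightarrow> good (lab c) \<and> p1 c \<le> 1"
  by (cases x) (auto simp: lab_TW lab_TF lab_0 lab_1 intro: okl_ext)

lemma good_last: "good \<rho> \<Longrightarrow> node \<rho> s \<Longrightarrow> s \<noteq> [] \<Longrightarrow> good (lab (cl (last s))) \<and> p1 (cl (last s)) \<le> 1"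
proof (cases s rule: rev_cases)
  case (snoc u q)
  assume "good \<rho>" "node \<rho> s"
  then show ?thesis using snoc good_code[OF good_tp, of \<rho> u "cl q"] by simp
qed simp

lemma node_iff:
  assumes \<rho>: "good \<rho>" and P: "\<And>c. P c \<longleftrightarrow> lab c \<in> ch \<rho>"
  shows "node \<rho> s \<longleftrightarrow> (0 < length s \<longrightarrow> P (cl (s ! 0))) \<and>
    (\<forall>i. Suc i < length s \<longrightarrow> child_code (cl (s ! i)) (cl (s ! Suc i)))"
proof (induction s rule: rev_induct)
  case (snoc q s)
  show ?case
  proof (cases "s = []")
    case False
    have tp: "tp \<rho> s = lab (cl (last s))" using False by (simp add: tp_def)
    have "lab (cl q) \<in> ch (tp \<rho> s) \<longleftrightarrow> child_code (cl (last s)) (cl q)" if "node \<rho> s"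
      using child_code good_last[OF \<rho> that False] tp by simp
    then have "node \<rho> (s @ [q]) \<longleftrightarrow> node \<rho> s \<and> child_code (cl (last s)) (cl q)" by auto
    then show ?thesis
      unfolding pairs_snoc[where P = "\<lambda>a b. child_code (cl a) (cl b)"] snoc using False
      by (auto simp: nth_append)
  qed (use P node_snoc[of \<rho> "[]" q] in simp)
qed simp

definition node_code :: "(nat \<Rightarrow> bool) \<Rightarrow> nat \<Rightarrow> bool" where
  "node_code P n \<longleftrightarrow> P (cl (sel n 0)) \<and> (\<forall>i<len n. Suc i < len n \<longrightarrow> child_code (cl (sel n i)) (cl (sel n (Suc i))))"

definition dm_code :: "(nat \<Rightarrow> bool) \<Rightarrow> nat \<Rightarrow> bool" where
  "dm_code P x \<longleftrightarrow> 0 < len (p1 x) \<and> node_code P (p1 x) \<and>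
    p2 x < Suc (pair (len (p1 x)) (let c = cl (sel (p1 x) (len (p1 x) - 1)) in if p1 c = 1 then Suc (p1 (p2 c)) else 0))"

lemma dec_dm_code: "dec P \<Longrightarrow> cmp f \<Longrightarrow> dec (\<lambda>x. dm_code P (f x))"
proof (rule dec_comp[where P = "dm_code P"])
  assume P: "dec P"
  have "dec (\<lambda>n. P (cl (sel n 0)))" by (rule dec_comp[OF P]) (intro cmp_intro)
  then have node: "dec (\<lambda>n. node_code P n)" unfolding node_code_def by (intro cmp_intro)
  have "dec (\<lambda>x. node_code P (p1 x))" by (rule dec_comp[OF node]) (intro cmp_intro)
  then show "dec (dm_code P)" unfolding dm_code_def Let_def by (intro cmp_intro)
qed

lemma dm_code:
  assumes \<rho>: "good \<rho>" and P: "\<And>c. P c \<longleftrightarrow> lab c \<in> ch \<rho>"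
  shows "dm_code P x \<longleftrightarrow> x \<in> dm \<rho>"
proof (cases "nd x = []")
  case True
  then show ?thesis by (simp add: dm_code_def dm_def len_def nd_def)
next
  case False
  have len: "len (p1 x) = length (nd x)" by (simp add: len_def nd_def)
  have sel: "sel (p1 x) i = nd x ! i" if "i < length (nd x)" for i using that by (simp add: nd_def sel_decode)
  have node: "node_code P (p1 x) \<longleftrightarrow> node \<rho> (nd x)"
    unfolding node_iff[OF \<rho> P] node_code_def len using False by (auto simp: sel)
  have last: "sel (p1 x) (length (nd x) - 1) = last (nd x)" using False by (simp add: sel last_conv_nth)
  have "colr (tp \<rho> (nd x)) = (let c = cl (last (nd x)) in if p1 c = 1 then Suc (p1 (p2 c)) else 0)" if n: "node \<rho> (nd x)"
  proof -
    have "p1 (cl (last (nd x))) \<le> 1" using good_last[OF \<rho> n False] by simp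
    then consider "p1 (cl (last (nd x))) = 0" | "p1 (cl (last (nd x))) = 1" by linarith
    then show ?thesis using False by cases (simp_all add: tp_def lab_0 lab_1)
  qed
  then show ?thesis unfolding dm_code_def len last node using False by (auto simp: dm_def bs_def)
qed

lemma computable_linear_order_tree:
  assumes \<rho>: "good \<rho>" and P: "dec P" "\<And>c. P c \<longleftrightarrow> lab c \<in> ch \<rho>"
  shows "computable_linear_order (dm \<rho>) (od \<rho>)"
  unfolding computable_linear_order_def
proof (intro conjI linear_order_od computable_setI computable_relI)
  note dm = dm_code[OF \<rho> P(2)]
  show "dec (\<lambda>x. x \<in> dm \<rho>)" unfolding dm[symmetric] by (rule dec_dm_code[OF P(1)]) (intro cmp_intro)
  have nd: "nd x = nd y \<longleftrightarrow> p1 x = p1 y" for x y unfolding nd_def by (metis list_decode_inverse)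
  have "dec (\<lambda>z. dm_code P (p1 z) \<and> dm_code P (p2 z) \<and>
      (sless_code (p1 (p1 z)) (p1 (p2 z)) \<or> p1 (p1 z) = p1 (p2 z) \<and> p2 (p1 z) \<le> p2 (p2 z)))"
    by (intro cmp_intro dec_dm_code P(1))
  then show "dec (\<lambda>z. (p1 z, p2 z) \<in> od \<rho>)"
    unfolding dm sless_code nd_def[symmetric] nd[symmetric] by (rule dec_eqI) (auto simp: od_def)
qed

lemma computable_TF: "computable_linear_order (dm (TF 0 0 0)) (od (TF 0 0 0))"
proof (rule computable_linear_order_tree)
  let ?P = "\<lambda>c. p1 c = 1 \<and> p1 (p2 c) = 0 \<and> p1 (p2 (p2 c)) = 1 \<and> Q 1 (p2 (p2 (p2 c))) \<and> p2 (p2 (p2 c)) \<prec> 0"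
  show "dec ?P" by (intro cmp_intro)
  show "?P c \<longleftrightarrow> lab c \<in> ch (TF 0 0 0)" for c by (auto simp: lab_TF)
qed simp

lemma computable_TRoot: "computable_linear_order (dm TRoot) (od TRoot)"
proof (rule computable_linear_order_tree)
  let ?P = "\<lambda>c. p1 c = 0 \<and> okl_code (p2 c)"
  show "dec ?P" by (intro cmp_intro dec_comp[OF dec_okl_code])
  show "?P c \<longleftrightarrow> lab c \<in> ch TRoot" for c by (auto simp: lab_TW okl_code)
qed simp

section \<open>Scott sentence complexity\<close>

lemma structure_dm: "ch \<rho> \<noteq> {} \<Longrightarrow> structure_on (dm \<rho>) (od \<rho>)"
proof -
  assume "ch \<rho> \<noteq> {}"
  then obtain c where c: "lab c \<in> ch \<rho>" using surj_lab by (metis ex_in_conv surjD)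
  obtain q where "cl q = c" using ql_above by blast
  then have "el [q] 0 \<in> dm \<rho>" using c node_snoc[of \<rho> "[]" q] by simp
  then show ?thesis unfolding structure_on_def by (intro conjI) (blast, auto simp: od_def)
qed

lemma ch_TF: "ch (TF 0 0 0) \<noteq> {}"
proof -
  obtain z where "stdL z" using ex_std by blast
  then have "z \<prec> 0" using std_lt_nonstd nonstd_0 by blast
  then obtain y where "Q 1 y" "y \<prec> 0" using Q_cofinal[OF Q_top, of z 0] by auto
  then show ?thesis by auto
qed

lemma ch_TRoot: "ch TRoot \<noteq> {}"
proof -
  have "okl [0]" by (simp add: okl_def)
  then show ?thesis by auto
qed

lemma dm_mono: "ch \<rho> \<subseteq> ch \<rho>' \<Longrightarrow> dm \<rho> \<subseteq> dm \<rho>'" and node_mono: "ch \<rho> \<subseteq> ch \<rho>' \<Longrightarrow> node \<rho> s \<Longrightarrow> node \<rho>' s"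
proof -
  show n: "ch \<rho> \<subseteq> ch \<rho>' \<Longrightarrow> node \<rho> s \<Longrightarrow> node \<rho>' s" for s
  proof (induction s rule: rev_induct)
    case (snoc q s)
    then show ?case
      using node_snoc[of \<rho> "[]" q] node_snoc[of \<rho>' "[]" q] by (cases "s = []") (auto simp: tp_def)
  qed simp
  then show "ch \<rho> \<subseteq> ch \<rho>' \<Longrightarrow> dm \<rho> \<subseteq> dm \<rho>'" by (auto simp: dm_def bs_def tp_def)
qed

lemma paths_diagonal: "(s, u) \<in> paths a a \<Longrightarrow> s = u"
  by (auto simp: paths_def)

text \<open>Enlarging the set of children of the root leaves all old nodes in place, so the identity
  on the branches through \<open>a\<close> is a position.\<close>

lemma pos_diagonal:
  assumes sub: "ch \<rho> \<subseteq> ch \<rho>'" and a: "set a \<subseteq> dm \<rho>"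
  shows "pos \<rho> \<rho>' (paths a a)" "rell \<rho> \<rho>' (paths a a) a a"
proof -
  have bt: "bt \<rho> \<rho> (osuc (osuc c2)) a a" by (rule bf_refl[OF a])
  note pos = paths_pos[OF bt less_osuc less_osuc a a]
  show "pos \<rho> \<rho>' (paths a a)" using pos(1) node_mono[OF sub] unfolding pos_def by blast
  show "rell \<rho> \<rho>' (paths a a) a a"
    using pos(2) dm_mono[OF sub] by (auto simp: related_def elim!: list_all2_mono)
qed

lemma rho_bound: "stdL x \<Longrightarrow> z \<prec> x \<Longrightarrow> osuc (osuc (rho z)) < osuc (osuc (rho x))"
proof -
  assume "stdL x" "z \<prec> x"
  then have "osuc (rho z) \<le> rho x" by (intro osuc_le rho_mono)
  then have "osuc (osuc (rho z)) \<le> osuc (rho x)" by (intro osuc_le) (simp add: less_osuc_iff)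
  then show ?thesis using less_osuc by (rule le_less_trans)
qed

section \<open>Upper and lower bounds for the three orders\<close>

lemma thin_bound:
  assumes thin: "\<And>n. \<exists>\<delta>. stdL \<delta> \<and> (\<forall>x. Q n x \<and> stdL x \<longrightarrow> x \<prec> \<delta>)"
  obtains bnd where "\<And>n. bnd n < lam" "\<And>n. c3 < bnd n" "\<And>n z. stdL z \<Longrightarrow> Q n z \<Longrightarrow> osuc (osuc (rho z)) < bnd n"
proof -
  obtain D where D: "\<And>n. stdL (D n)" "\<And>n x. Q n x \<Longrightarrow> stdL x \<Longrightarrow> x \<prec> D n" using thin by metis
  show ?thesis
  proof (rule that[of "\<lambda>n. osuc (osuc (rho (D n)))"])
    show "osuc (osuc (rho (D n))) < lam" for n by (intro lam_limit rho_less D)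
    have "c3 < osuc (rho (D n))" for n using rho_ge[OF D(1)] less_osuc by (rule le_less_trans)
    then show "c3 < osuc (osuc (rho (D n)))" for n using less_osuc less_trans by blast
    show "osuc (osuc (rho z)) < osuc (osuc (rho (D n)))" if "stdL z" "Q n z" for n z
      by (intro rho_bound D that)
  qed
qed

lemma thin_extends:
  assumes \<rho>: "good \<rho>" and f: "\<And>x k. x \<in> dm \<rho> \<Longrightarrow> k \<le> length (nd x) \<Longrightarrow> lev (tp \<rho> (take k (nd x))) \<le> f x"
    and bnd: "\<And>n. c3 < bnd n" "\<And>n z. stdL z \<Longrightarrow> Q n z \<Longrightarrow> osuc (osuc (rho z)) < bnd n"
    and sub: "set a \<subseteq> dm \<rho>" "set b \<subseteq> dm \<rho>" and bt: "bt \<rho> \<rho> (bnd (Max (insert 0 (f ` set a)))) a b"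
  shows "bf_extends (dm \<rho>) (od \<rho>) \<beta> (dm \<rho>) (od \<rho>) a b"
proof (rule bt_bf_extends[OF \<rho> sub bt bnd(1)])
  fix x k z assume x: "x \<in> set a" "k \<le> length (nd x)" and z: "stdL z" "Q (lev (tp \<rho> (take k (nd x)))) z"
  have "lev (tp \<rho> (take k (nd x))) \<le> f x" using f x sub by blast
  also have "\<dots> \<le> Max (insert 0 (f ` set a))" using x by (intro Max_ge) auto
  finally show "osuc (osuc (rho z)) < bnd (Max (insert 0 (f ` set a)))" using z Q_mono by (intro bnd) auto
qed

lemma tp_TF: "node (TF 0 0 0) s \<Longrightarrow> lev (tp (TF 0 0 0) s) = length s \<and> (\<exists>x. tp (TF 0 0 0) s = TF 0 (length s) x)"
proof (induction s rule: rev_induct)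
  case (snoc q s)
  then obtain x where "tp (TF 0 0 0) s = TF 0 (length s) x" by auto
  then show ?case using snoc.prems by auto
qed simp

text \<open>The level of a type is the depth of its node, which the \<open>c3\<close>-type of a
  tuple determines through block sizes. So the rank depends on the \<open>c3\<close>-type only, and
  the Scott sentence stays at \<open>lam\<close>.\<close>

theorem complexity_lam:
  assumes thin: "\<And>n. \<exists>\<delta>. stdL \<delta> \<and> (\<forall>x. Q n x \<and> stdL x \<longrightarrow> x \<prec> \<delta>)"
  shows "scott_sentence_complexity (dm (TF 0 0 0)) (od (TF 0 0 0)) (PiC lam)"
proof -
  let ?\<rho> = "TF 0 0 0"
  note A = structure_dm[OF ch_TF]
  obtain bnd where bnd: "\<And>n. bnd n < lam" "\<And>n. c3 < bnd n"
    "\<And>n z. stdL z \<Longrightarrow> Q n z \<Longrightarrow> osuc (osuc (rho z)) < bnd n" using thin_bound[OF thin] by metis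
  let ?f = "\<lambda>x. length (nd x)"
  have f: "lev (tp ?\<rho> (take k (nd x))) \<le> ?f x" if "x \<in> dm ?\<rho>" "k \<le> length (nd x)" for x k
  proof -
    have "node ?\<rho> (take k (nd x))" using that node_take by (simp add: dm_def)
    then show ?thesis using tp_TF that by simp
  qed
  have "has_scott_sentence_in (dm ?\<rho>) (od ?\<rho>) (PiC lam)"
  proof (rule scott_sentence_Pi_lam[OF A, where \<beta> = "\<lambda>a. bnd (Max (insert 0 (?f ` set a)))"])
    fix a b assume sub: "set a \<subseteq> dm ?\<rho>" "set b \<subseteq> dm ?\<rho>"
    show "bf_extends (dm ?\<rho>) (od ?\<rho>) (\<lambda>a. bnd (Max (insert 0 (?f ` set a)))) (dm ?\<rho>) (od ?\<rho>) a b"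
      if "bt ?\<rho> ?\<rho> (bnd (Max (insert 0 (?f ` set a)))) a b"
      by (rule thin_extends[where f = ?f and bnd = bnd, OF _ f bnd(2,3) sub that]) simp_all
    assume bt: "bt ?\<rho> ?\<rho> c3 a b"
    have "osuc 0 < c3" using less_osuc less_trans by blast
    then have "map ?f a = map ?f b"
      using bf_length[OF bt] bt_index(2)[OF bt _ sub] by (intro nth_equalityI) auto
    then have "?f ` set a = ?f ` set b" by (metis set_map)
    then show "bnd (Max (insert 0 (?f ` set a))) = bnd (Max (insert 0 (?f ` set b)))" by simp
  qed (use bnd in \<open>auto intro: less_imp_le\<close>)
  then show ?thesis
  proof (rule scott_complexity_PiI[OF A lam_pos])
    fix \<beta> a assume \<beta>: "\<beta> < lam" and a: "set a \<subseteq> dm ?\<rho>"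
    \<comment> \<open>One rank more than \<beta>, to be spent on the move that copies
      \<open>a\<close> into the comparison structure.\<close>
    let ?c = "t (osuc \<beta>) 0"
    have \<beta>': "osuc \<beta> < lam" by (rule lam_limit[OF \<beta>])
    obtain n where n: "Q n ?c" using ex_Q by blast
    let ?N = "n + 2"
    have typed: "typed ?\<rho> (TG ?N 0) (\<lambda>_. close (t \<delta> k)) {([], [])}" if "\<delta> < osuc \<beta>" for \<delta> k
    proof -
      have "close (t \<delta> k) ?\<rho> (TG ?N 0)"
        using t_mono[OF that \<beta>'] Q_mono[OF n, of ?N] std_t[OF \<beta>'] by (intro close_G[where d = ?c]) auto
      then show ?thesis by simp
    qed
    have "bt ?\<rho> (TG ?N 0) (osuc \<beta>) [] []"
      by (rule close_game[OF less_imp_le[OF \<beta>'] pos_root typed]) simp_all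
    from bf_forth[OF this less_osuc a] obtain b where
      b: "set b \<subseteq> dm (TG ?N 0)" "length b = length a" "bt ?\<rho> (TG ?N 0) \<beta> a b" by auto
    have "\<exists>\<gamma>. dist \<gamma> ?\<rho> (TG ?N 0)" by (rule dist_G) simp_all
    then have "\<not> isomorphic (dm ?\<rho>) (od ?\<rho>) (dm (TG ?N 0)) (od (TG ?N 0))"
      using dist_not_isomorphic by force
    moreover have "structure_on (dm (TG ?N 0)) (od (TG ?N 0))" by (rule structure_dm) auto
    moreover have "sat (dm (TG ?N 0)) (od (TG ?N 0)) \<phi> e'"
      if "Pi_in \<beta> \<phi>" "along (fv \<phi>) a b e e'" "sat (dm ?\<rho>) (od ?\<rho>) \<phi> e" for \<phi> e e'
      by (rule bf_preserves(2)[OF that(1) b(3) that(2,3)])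
    ultimately show "\<exists>B s b. structure_on B s \<and> \<not> isomorphic (dm ?\<rho>) (od ?\<rho>) B s \<and> set b \<subseteq> B \<and> length b = length a \<and>
        (\<forall>\<phi> e e'. Pi_in \<beta> \<phi> \<longrightarrow> along (fv \<phi>) a b e e' \<longrightarrow> sat (dm ?\<rho>) (od ?\<rho>) \<phi> e \<longrightarrow> sat B s \<phi> e')"
      using b(1,2) by (intro exI[of _ "dm (TG ?N 0)"] exI[of _ "od (TG ?N 0)"] exI[of _ b]) blast
  qed
qed

text \<open>The level of \<open>TW s\<close> is the length of \<open>s\<close>. Each tuple has a
  rank below \<open>lam\<close>, but the ranks of possible new entries vary, so the back condition
  is a disjunction of level \<open>lam\<close>. For the lower bound the identity on \<open>a\<close>
  keeps rank \<open>lam\<close> when \<open>TW'\<close> is added.\<close>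

theorem complexity_lam_1:
  assumes thin: "\<And>n. \<exists>\<delta>. stdL \<delta> \<and> (\<forall>x. Q n x \<and> stdL x \<longrightarrow> x \<prec> \<delta>)" and ys: ys_ok
  shows "scott_sentence_complexity (dm TRoot) (od TRoot) (PiC (osuc lam))"
proof -
  note A = structure_dm[OF ch_TRoot]
  obtain bnd where bnd: "\<And>n. bnd n < lam" "\<And>n. c3 < bnd n"
    "\<And>n z. stdL z \<Longrightarrow> Q n z \<Longrightarrow> osuc (osuc (rho z)) < bnd n" using thin_bound[OF thin] by metis
  let ?f = "\<lambda>x. Max ((\<lambda>k. lev (tp TRoot (take k (nd x)))) ` {..length (nd x)})"
  have f: "lev (tp TRoot (take k (nd x))) \<le> ?f x" if "x \<in> dm TRoot" "k \<le> length (nd x)" for x k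
    using that by (intro Max_ge) auto
  have "has_scott_sentence_in (dm TRoot) (od TRoot) (PiC (osuc lam))"
  proof (rule scott_sentence_Pi_lam_1[OF A, where \<beta> = "\<lambda>a. bnd (Max (insert 0 (?f ` set a)))"])
    show "bnd (Max (insert 0 (?f ` set a))) < lam" for a by (rule bnd)
    fix a b assume sub: "set a \<subseteq> dm TRoot" "set b \<subseteq> dm TRoot" and bt: "bt TRoot TRoot (bnd (Max (insert 0 (?f ` set a)))) a b"
    show "bf_extends (dm TRoot) (od TRoot) (\<lambda>a. bnd (Max (insert 0 (?f ` set a)))) (dm TRoot) (od TRoot) a b"
      by (rule thin_extends[where f = ?f and bnd = bnd, OF _ f bnd(2,3) sub bt]) simp_all
  qed
  then show ?thesis
  proof (rule scott_complexity_PiI[OF A less_trans[OF lam_pos less_osuc]])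
    fix \<beta> a assume "\<beta> < osuc lam" and a: "set a \<subseteq> dm TRoot"
    then have \<beta>: "\<beta> \<le> lam" by (simp add: less_osuc_iff)
    have sub: "ch TRoot \<subseteq> ch TRoot2" by auto
    note pos = pos_diagonal[OF sub a]
    have typed: "typed TRoot TRoot2 (\<lambda>_. close (t \<delta> n)) (paths a a)" for \<delta> n
    proof (intro allI impI)
      fix s u assume su: "(s, u) \<in> paths a a"
      then have u: "u = s" using paths_diagonal by blast
      have "node TRoot s" using su pos_node[OF pos_diagonal(1)[OF subset_refl a]] by blast
      then have g: "good (tp TRoot s)" by (intro good_tp) simp
      show "close (t \<delta> n) (tp TRoot s) (tp TRoot2 u)"
        unfolding u using good_close[OF g] close_root2[OF ys] by (cases "s = []") (simp_all add: tp_def)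
    qed
    have "bt TRoot TRoot2 lam a a" by (rule close_game[OF order_refl pos(1) typed pos(2)])
    then have bt: "bt TRoot TRoot2 \<beta> a a" using \<beta> by (rule bf_mono)
    have "\<not> isomorphic (dm TRoot) (od TRoot) (dm TRoot2) (od TRoot2)"
      by (rule dist_not_isomorphic[OF dist_root2[OF ys]]) simp
    moreover have "structure_on (dm TRoot2) (od TRoot2)" by (rule structure_dm) auto
    moreover have "sat (dm TRoot2) (od TRoot2) \<phi> e'"
      if "Pi_in \<beta> \<phi>" "along (fv \<phi>) a a e e'" "sat (dm TRoot) (od TRoot) \<phi> e" for \<phi> e e'
      by (rule bf_preserves(2)[OF that(1) bt that(2,3)])
    ultimately show "\<exists>B s b. structure_on B s \<and> \<not> isomorphic (dm TRoot) (od TRoot) B s \<and> set b \<subseteq> B \<and> length b = length a \<and>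
        (\<forall>\<phi> e e'. Pi_in \<beta> \<phi> \<longrightarrow> along (fv \<phi>) a b e e' \<longrightarrow> sat (dm TRoot) (od TRoot) \<phi> e \<longrightarrow> sat B s \<phi> e')"
      using a dm_mono[OF sub] by (intro exI[of _ "dm TRoot2"] exI[of _ "od TRoot2"] exI[of _ a]) blast
  qed
qed

text \<open>The answer to a first move in \<open>TRoot3\<close>: \<open>TOm\<close> is replaced by a
  non-standard label, whose children include all standard ones. The copying goes in one direction
  only, as \<open>TOm\<close> has no non-standard children.\<close>

definition copy :: "ty \<Rightarrow> ty \<Rightarrow> bool" where
  "copy y x \<longleftrightarrow> y = x \<and> good x \<or> y = TRoot3 \<and> x = TF 0 0 0 \<or> (\<exists>u. y = TOm \<and> x = TF 0 1 u \<and> \<not> stdL u)"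

lemma copy_colr: "copy y x \<Longrightarrow> colr y = colr x"
  by (auto simp: copy_def)

lemma copy_zig:
  assumes full: full and yx: "copy y x" and y': "y' \<in> ch y"
  shows "\<exists>x'\<in>ch x. copy y' x'"
proof -
  have q: "Q n w" for n w using full by (simp add: full_def)
  from yx consider "y = x" "good x" | "y = TRoot3" "x = TF 0 0 0" | u where "y = TOm" "x = TF 0 1 u" "\<not> stdL u"
    by (auto simp: copy_def)
  then show ?thesis
  proof cases
    case 1
    then show ?thesis using y' good_ch by (auto simp: copy_def)
  next
    case 2
    show ?thesis
    proof (cases "y' = TOm")
      case True
      obtain u where "u \<prec> 0" "\<not> stdL u" using nonstd_below nonstd_0 by blast
      then show ?thesis using 2 True q by (intro bexI[of _ "TF 0 1 u"]) (auto simp: copy_def)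
    next
      case False
      then show ?thesis using 2 y' by (intro bexI[of _ y']) (auto simp: copy_def)
    qed
  next
    case 3
    then obtain z where z: "y' = TF 0 2 z" "stdL z" using y' by auto
    then have "z \<prec> u" using std_lt_nonstd 3 by blast
    then show ?thesis using 3 z q by (intro bexI[of _ y']) (auto simp: copy_def numeral_2_eq_2)
  qed
qed

lemma copy_close: "full \<Longrightarrow> copy y x \<Longrightarrow> stdL c \<Longrightarrow> close c x y"
  unfolding copy_def using good_close close_root3 close_Om std_lt_nonstd by blast

text \<open>A tuple of \<open>TRoot3\<close> is copied by \<open>copy\<close>, and the copy is close
  at every standard resolution, so rank \<open>lam\<close> remains after this move. By
  \<open>Pi_transfer\<close> this one-sided answer covers \<Pi> formulas up to
  \<open>osuc lam\<close>.\<close>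

theorem complexity_lam_2:
  assumes full: full
  shows "scott_sentence_complexity (dm (TF 0 0 0)) (od (TF 0 0 0)) (PiC (osuc (osuc lam)))"
proof -
  let ?\<rho> = "TF 0 0 0"
  note A = structure_dm[OF ch_TF]
  have "has_scott_sentence_in (dm ?\<rho>) (od ?\<rho>) (PiC (osuc (osuc lam)))"
  proof (rule scott_sentence_Pi_lam_2[OF A])
    fix a b assume sub: "set a \<subseteq> dm ?\<rho>" "set b \<subseteq> dm ?\<rho>" and bt: "bt ?\<rho> ?\<rho> lam a b"
    show "bf_extends (dm ?\<rho>) (od ?\<rho>) (\<lambda>_. lam) (dm ?\<rho>) (od ?\<rho>) a b"
      by (rule bt_bf_extends[OF _ sub bt c3_less]) (simp_all add: lam_limit lam_osuc_rho)
  qed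
  then show ?thesis
  proof (rule scott_complexity_PiI[OF A less_trans[OF less_trans[OF lam_pos less_osuc] less_osuc]])
    fix \<beta> a assume "\<beta> < osuc (osuc lam)" and a: "set a \<subseteq> dm ?\<rho>"
    then have \<beta>: "\<beta> \<le> osuc lam" by (simp add: less_osuc_iff)
    have sub: "ch ?\<rho> \<subseteq> ch TRoot3" by auto
    note pos = pos_diagonal[OF sub a]
    have typed: "typed TRoot3 ?\<rho> (\<lambda>_. copy) ((paths a a)\<inverse>)"
    proof (intro allI impI)
      fix s u assume "(s, u) \<in> (paths a a)\<inverse>"
      then have su: "(s, u) \<in> paths a a" and u: "u = s" using paths_diagonal by blast+
      have "node ?\<rho> s" using su pos_node[OF pos_diagonal(1)[OF subset_refl a]] by blast
      then have g: "good (tp ?\<rho> s)" by (intro good_tp) simp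
      show "copy (tp TRoot3 s) (tp ?\<rho> u)"
        unfolding u using g by (cases "s = []") (simp_all add: tp_def copy_def)
    qed
    have ext: "\<exists>c. set c \<subseteq> dm ?\<rho> \<and> length c = length d \<and> bt ?\<rho> TRoot3 \<delta> (a @ c) (a @ d)"
      if \<delta>: "\<delta> < osuc lam" and d: "set d \<subseteq> dm TRoot3" for \<delta> d
    proof -
      obtain N where N: "\<forall>x\<in>set d. length (nd x) \<le> N" using ex_length_bound by blast
      have "\<exists>F c. (paths a a)\<inverse> \<subseteq> F \<and> pos TRoot3 ?\<rho> F \<and> typed TRoot3 ?\<rho> (\<lambda>_. copy) F \<and> rell TRoot3 ?\<rho> F d c"
        by (rule extend_list[OF pos_sym[OF pos(1)] typed d N]) (use copy_zig[OF full] copy_colr in blast)+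
      then obtain F c where F: "(paths a a)\<inverse> \<subseteq> F" "pos TRoot3 ?\<rho> F" "typed TRoot3 ?\<rho> (\<lambda>_. copy) F" "rell TRoot3 ?\<rho> F d c"
        by blast
      have "rell TRoot3 ?\<rho> F (a @ d) (a @ c)"
        using rell_mono[OF rell_sym[OF pos(2)] F(1)] F(4) by (rule list_all2_appendI)
      then have rell: "rell ?\<rho> TRoot3 (F\<inverse>) (a @ c) (a @ d)" by (rule rell_sym)
      have close: "typed ?\<rho> TRoot3 (\<lambda>_. close (t \<delta>' n)) (F\<inverse>)" if "\<delta>' < lam" for \<delta>' n
        using F(3) copy_close[OF full _ std_t[OF that]] by blast
      have "bt ?\<rho> TRoot3 lam (a @ c) (a @ d)"
        by (rule close_game[OF order_refl pos_sym[OF F(2)] close rell])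
      then have "bt ?\<rho> TRoot3 \<delta> (a @ c) (a @ d)" by (rule bf_mono) (use \<delta> in \<open>simp add: less_osuc_iff\<close>)
      then show ?thesis using rell_dm[OF F(4)] list_all2_lengthD[OF F(4)] by metis
    qed
    have "\<not> isomorphic (dm ?\<rho>) (od ?\<rho>) (dm TRoot3) (od TRoot3)"
      by (rule dist_not_isomorphic[OF dist_root3[OF full]]) simp
    moreover have "structure_on (dm TRoot3) (od TRoot3)" by (rule structure_dm) auto
    moreover have "sat (dm TRoot3) (od TRoot3) \<phi> e'"
      if "Pi_in \<beta> \<phi>" "along (fv \<phi>) a a e e'" "sat (dm ?\<rho>) (od ?\<rho>) \<phi> e" for \<phi> e e'
      by (rule Pi_transfer[OF that(1) rell_patom[OF pos] ext[OF less_le_trans[OF _ \<beta>]] that(2,3)])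
    ultimately show "\<exists>B s b. structure_on B s \<and> \<not> isomorphic (dm ?\<rho>) (od ?\<rho>) B s \<and> set b \<subseteq> B \<and> length b = length a \<and>
        (\<forall>\<phi> e e'. Pi_in \<beta> \<phi> \<longrightarrow> along (fv \<phi>) a b e e' \<longrightarrow> sat (dm ?\<rho>) (od ?\<rho>) \<phi> e \<longrightarrow> sat B s \<phi> e')"
      using a dm_mono[OF sub] by (intro exI[of _ "dm TRoot3"] exI[of _ "od TRoot3"] exI[of _ a]) blast
  qed
qed

end

section \<open>The thin and the full families of labels\<close>

context maximal_order
begin

lemma finite_max: "finite S \<Longrightarrow> S \<noteq> {} \<Longrightarrow> \<exists>m\<in>S. \<forall>x\<in>S. x \<preceq> m"
proof (induction S rule: finite_ne_induct)
  case (insert a S)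
  then obtain m where m: "m \<in> S" "\<forall>x\<in>S. x \<preceq> m" by blast
  show ?case
  proof (cases "a \<preceq> m")
    case False
    then have "m \<prec> a" using not_lt by blast
    then show ?thesis using m le_trans' by (intro bexI[of _ a]) blast+
  qed (use m in blast)
qed auto

lemma ex_cofinal_sequence:
  assumes Q: "\<And>n m x. Q n x \<Longrightarrow> n \<le> m \<Longrightarrow> Q m x" "\<And>x. \<exists>n. Q n x" and y0: "stdL y0" "Q (0::nat) y0"
  shows "\<exists>ys. (\<forall>i. Q i (ys i) \<and> stdL (ys i)) \<and> (\<forall>i j. i \<le> j \<longrightarrow> ys i \<preceq> ys j) \<and> (\<forall>c. stdL c \<longrightarrow> (\<exists>i. c \<prec> ys i))"
proof -
  \<comment> \<open>Bounding the numbers makes the sets finite and increasing in \<open>i\<close>,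
    so their maxima form a monotone sequence; \<open>y0\<close> keeps all of them non-empty.\<close>
  define S where "S i = {x. x \<le> i + y0 \<and> stdL x \<and> Q i x}" for i
  have "finite (S i)" for i unfolding S_def by (rule finite_subset[of _ "{..i + y0}"]) auto
  moreover have "y0 \<in> S i" for i using y0 Q(1)[of 0 y0 i] by (simp add: S_def)
  ultimately have "\<exists>m\<in>S i. \<forall>x\<in>S i. x \<preceq> m" for i by (intro finite_max) auto
  then obtain ys where ys: "\<And>i. ys i \<in> S i" "\<And>i x. x \<in> S i \<Longrightarrow> x \<preceq> ys i" by metis
  have "ys i \<preceq> ys j" if "i \<le> j" for i j
  proof -
    have "ys i \<in> S j" using ys(1)[of i] that Q(1) by (auto simp: S_def)
    then show ?thesis by (rule ys(2))
  qed
  moreover have "\<exists>i. c \<prec> ys i" if "stdL c" for c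
  proof -
    obtain \<gamma> where \<gamma>: "\<gamma> < lam" "c \<prec> t \<gamma> 0" using t_cofinal[OF \<open>stdL c\<close>] by blast
    obtain n where n: "Q n (t \<gamma> 0)" using Q(2) by blast
    have "t \<gamma> 0 \<in> S (max n (t \<gamma> 0))" using Q(1)[OF n] std_t[OF \<gamma>(1)] by (simp add: S_def)
    then show ?thesis using ys(2) \<gamma>(2) lt_le_trans by blast
  qed
  ultimately show ?thesis using ys(1) by (intro exI[of _ ys]) (simp add: S_def)
qed

lemma labelled_R: "labelled K (\<lambda>n. R (k + n))"
proof unfold_locales
  show "R (k + n) x \<Longrightarrow> n \<le> m \<Longrightarrow> R (k + m) x" for n m x by (erule R_mono) simp
  show "\<exists>n. R (k + n) x" for x
  proof -
    obtain n where "R n x" using ex_R by blast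
    then have "R (k + n) x" by (rule R_mono) simp
    then show ?thesis by blast
  qed
  show "R (k + n) x \<Longrightarrow> z \<prec> x \<Longrightarrow> \<exists>y. R (k + Suc n) y \<and> z \<preceq> y \<and> y \<prec> x" for n x z
    using R_cofinal[of "k + n" x z] by simp
  show "dec (\<lambda>z. R (k + p1 z) (p2 z))" by (intro cmp_intro)
qed simp

lemma labelled_full: "labelled K (\<lambda>_ _. True)"
  by unfold_locales (auto intro: cmp_intro)

theorem complexities:
  "(\<exists>A r. computable_linear_order A r \<and> scott_sentence_complexity A r (PiC omega1CK)) \<and>
   (\<exists>A r. computable_linear_order A r \<and> scott_sentence_complexity A r (PiC (osuc omega1CK))) \<and>
   (\<exists>A r. computable_linear_order A r \<and> scott_sentence_complexity A r (PiC (osuc (osuc omega1CK))))"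
proof (intro conjI)
  have thin: "\<exists>\<delta>. stdL \<delta> \<and> (\<forall>x. R (k + n) x \<and> stdL x \<longrightarrow> x \<prec> \<delta>)" for k n by (rule R_thin)
  interpret L: labelled K "\<lambda>n. R (0 + n)" "\<lambda>_. 0" by (rule labelled_R)
  show "\<exists>A r. computable_linear_order A r \<and> scott_sentence_complexity A r (PiC omega1CK)"
    using L.computable_TF L.complexity_lam[OF thin] by blast
next
  have thin: "\<exists>\<delta>. stdL \<delta> \<and> (\<forall>x. R (k + n) x \<and> stdL x \<longrightarrow> x \<prec> \<delta>)" for k n by (rule R_thin)
  obtain y0 where y0: "stdL y0" using ex_std by blast
  \<comment> \<open>The family is shifted by \<open>k\<close> because \<open>ys_ok\<close> asks for
    a standard label already at index 0, whereas \<open>R 0\<close> contains only the top.\<close>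
  obtain k where k: "R k y0" using ex_R by blast
  interpret L0: labelled K "\<lambda>n. R (k + n)" "\<lambda>_. 0" by (rule labelled_R)
  have "R (k + 0) y0" using k by simp
  from ex_cofinal_sequence[of "\<lambda>n. R (k + n)", OF _ L0.ex_Q y0 this] L0.Q_mono
  obtain ys where ys: "\<forall>i. R (k + i) (ys i) \<and> stdL (ys i)" "\<forall>i j. i \<le> j \<longrightarrow> ys i \<preceq> ys j" "\<forall>c. stdL c \<longrightarrow> (\<exists>i. c \<prec> ys i)"
    by (metis (no_types))
  interpret L: labelled K "\<lambda>n. R (k + n)" ys by (rule labelled_R)
  have "L.ys_ok" unfolding L.ys_ok_def using ys by blast
  then show "\<exists>A r. computable_linear_order A r \<and> scott_sentence_complexity A r (PiC (osuc omega1CK))"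
    using L.computable_TRoot L.complexity_lam_1[OF thin] by blast
next
  interpret L: labelled K "\<lambda>_ _. True" "\<lambda>_. 0" by (rule labelled_full)
  have "L.full" by (simp add: L.full_def)
  then show "\<exists>A r. computable_linear_order A r \<and> scott_sentence_complexity A r (PiC (osuc (osuc omega1CK)))"
    using L.computable_TF L.complexity_lam_2 by blast
qed

end

theorem mainTheorem20:
  shows "(\<exists>A r. computable_linear_order A r \<and>
            scott_sentence_complexity A r (PiC omega1CK)) \<and>
         (\<exists>A r. computable_linear_order A r \<and>
            scott_sentence_complexity A r (PiC (osuc omega1CK))) \<and>
         (\<exists>A r. computable_linear_order A r \<and>
            scott_sentence_complexity A r (PiC (osuc (osuc omega1CK))))"
proof -
  obtain K where "slo K" "dec (\<lambda>z. K (p1 z) (p2 z))" "\<exists>z. \<not> std K z"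
    "\<And>\<beta>. computable_ordinal \<beta> \<Longrightarrow> \<exists>x. std K x \<and> rk K x = \<beta>"
    using ex_order_with_maximal_std_part by blast
  then interpret maximal_order K by unfold_locales
  show ?thesis by (rule complexities)
qed

end
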